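(* Let $f$ be a bounded function on $\mathcal{X}$. Assume there is a family $\{\tau_\varepsilon\}_{\varepsilon>0}$ of non-negative measurable functions on $\mathcal{X}$ and a constant $C$ such that $\int_\mathcal{X}\tau_\varepsilon\,d\mu_\mathcal{X}\le C\varepsilon$, and such that for all sufficiently small $\varepsilon>0$ and all $g$ in the $\varepsilon$-neighbourhood of the identity in $G$, $|f(g\Lambda)-f(\Lambda)|\le\tau_\varepsilon(\Lambda)$ for all $\Lambda\in\mathcal{X}$. Then for any probability measure $\mu$ on $\mathrm{M}_{m\times n}(\mathbb{R})$ satisfying condition (EMEI): (i) for any $\varepsilon>0$ and $\mu$-almost every $\theta$, $\sum_{s=0}^{N-1}f(a_su(\theta)\Gamma)=N\gamma+o(N^{1/2}\log^{\frac32+\varepsilon}N)$, where $\gamma=\mu_\mathcal{X}(f)$; (ii) setting $F_N(\Lambda)=\frac{1}{\sqrt N}\sum_{i=0}^{N-1}\big(f(a_i\Lambda)-\gamma\big)$, for every $x\in\mathbb{R}$, $\mu(\{\theta:F_N(u(\theta)\Gamma)<x\})\to\mathrm{Norm}_\sigma(x)$ as $N\to\infty$, where $$\sigma^2=\sum_{s\in\mathbb{Z}}\left(\int_\mathcal{X}f(a_s\Lambda)f(\Lambda)\,d\mu_\mathcal{X}(\Lambda)-\mu_\mathcal{X}(f)^2\right)<\infty.$$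
   Context: $G=\mathrm{SL}_{m+n}(\mathbb{R})$, $\Gamma=\mathrm{SL}_{m+n}(\mathbb{Z})$, $\mathcal{X}=G/\Gamma$ with $G$-invariant probability $\mu_\mathcal{X}$; neighbourhoods of the identity are balls for a fixed right-invariant distance on $G$. $u(\theta)=\begin{pmatrix}I_m&\theta\\0&I_n\end{pmatrix}$, $a_t=\mathrm{diag}(e^{\frac nmt}I_m,e^{-t}I_n)$. $\mathrm{Norm}_\sigma(x)=\frac{1}{\sigma\sqrt{2\pi}}\int_{-\infty}^xe^{-\frac12(y/\sigma)^2}dy$. Condition (EMEI) on a probability measure $\mu$ on $\mathrm{M}_{m\times n}(\mathbb{R})$: $\mu$ is compactly supported and there exist $\delta>0$, an integer $k\ge1$ such that for all $r\ge1$, $F_0\in C^\infty(\mathrm{M}_{m\times n}(\mathbb{R}))$, $F_1,\dots,F_r\in C_c^\infty(\mathcal{X})$, $t_1,\dots,t_r>0$: $\int F_0(\theta)\prod_iF_i(a_{t_i}u(\theta)\Gamma)d\mu(\theta)=\mu(F_0)\prod_i\mu_\mathcal{X}(F_i)+O_r(e^{-\delta D(t_1,\dots,t_r)}\|F_0\|_{C^k}\prod_i\|F_i\|_{C^k})$, with $D(t_1,\dots,t_r)=\min\{t_i,|t_i-t_j|:i\ne j\}$ and $C^k$ norms on $\mathcal{X}$ defined via derivatives along a fixed basis of the Lie algebra of $G$.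
   Formalization: f is assumed Borel measurable; the right-invariant distance is assumed to induce the topology of G and be locally comparable to the matrix norm at the identity (as Riemannian ones are); if σ=0, Norm_σ is read as the distribution function of the point mass at 0, and (ii) is claimed for x≠0. *)

theory Defs
  imports "HOL-Probability.Probability" "HOL-Library.Landau_Symbols"
begin

subsection \<open>The space of lattices\<close>

text \<open>
  \<open>'a\<close> indexes the rows and columns, so the group is \<open>SL\<^sub>d(\<real>)\<close> with \<open>d = CARD('a)\<close>; below
  \<open>'a\<close> is the sum type \<open>'m + 'n\<close>, which gives the block structure.
\<close>

definition SL :: "(real^'a^'a) set" where
  "SL = {A. det A = 1}"

definition SLZ :: "(real^'a^'a) set" where
  "SLZ = {A \<in> SL. \<forall>i j. A $ i $ j \<in> \<int>}"

definition lcoset :: "real^'a^'a \<Rightarrow> (real^'a^'a) set" where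
  "lcoset g = (\<lambda>\<gamma>. g ** \<gamma>) ` SLZ"

definition lattices :: "(real^'a^'a) set set" where
  "lattices = lcoset ` SL"

definition act :: "real^'a^'a \<Rightarrow> (real^'a^'a) set \<Rightarrow> (real^'a^'a) set" where
  "act g \<Lambda> = (\<lambda>h. g ** h) ` \<Lambda>"

definition lattice_topology :: "(real^'a^'a) set topology" where
  "lattice_topology = topology (\<lambda>U. U \<subseteq> lattices \<and>
     openin (top_of_set SL) {g \<in> SL. lcoset g \<in> U})"

lemma openin_lattice_topology:
  "openin lattice_topology U \<longleftrightarrow>
     U \<subseteq> lattices \<and> openin (top_of_set SL) {g \<in> SL. lcoset g \<in> U}"
proof -
  have "istopology (\<lambda>U. U \<subseteq> lattices \<and>
      openin (top_of_set SL) {g \<in> SL :: (real^'a^'a) set. lcoset g \<in> U})"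
    unfolding istopology_def
  proof (intro conjI allI impI; (elim conjE)?)
    fix S T :: "(real^'a^'a) set set"
    assume "openin (top_of_set SL) {g \<in> SL. lcoset g \<in> S}"
      and "openin (top_of_set SL) {g \<in> SL. lcoset g \<in> T}"
    then have "openin (top_of_set SL) ({g \<in> SL. lcoset g \<in> S} \<inter> {g \<in> SL. lcoset g \<in> T})"
      by (rule openin_Int)
    also have "{g \<in> SL. lcoset g \<in> S} \<inter> {g \<in> SL. lcoset g \<in> T} = {g \<in> SL. lcoset g \<in> S \<inter> T}"
      by auto
    finally show "openin (top_of_set SL) {g \<in> SL. lcoset g \<in> S \<inter> T}" .
  next
    fix \<K> :: "(real^'a^'a) set set set"
    assume *: "\<forall>K\<in>\<K>. K \<subseteq> lattices \<and> openin (top_of_set SL) {g \<in> SL. lcoset g \<in> K}"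
    then have "openin (top_of_set SL) (\<Union>K\<in>\<K>. {g \<in> SL. lcoset g \<in> K})"
      by (intro openin_Union) auto
    also have "(\<Union>K\<in>\<K>. {g \<in> SL. lcoset g \<in> K}) = {g \<in> SL. lcoset g \<in> \<Union>\<K>}"
      by auto
    finally show "openin (top_of_set SL) {g \<in> SL. lcoset g \<in> \<Union>\<K>}" .
  qed auto
  then show ?thesis
    by (simp add: lattice_topology_def topology_inverse')
qed

lemma topspace_lattice_topology: "topspace lattice_topology = lattices"
proof
  show "topspace lattice_topology \<subseteq> lattices"
    by (metis openin_lattice_topology openin_topspace)
  have "{g \<in> SL :: (real^'a^'a) set. lcoset g \<in> lattices} = SL"
    by (auto simp: lattices_def)
  then have "openin lattice_topology (lattices :: (real^'a^'a) set set)"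
    unfolding openin_lattice_topology by (metis openin_subtopology_self order_refl)
  then show "(lattices :: (real^'a^'a) set set) \<subseteq> topspace lattice_topology"
    by (rule openin_subset)
qed

definition invariant_probability :: "(real^'a^'a) set measure \<Rightarrow> bool" where
  "invariant_probability M \<longleftrightarrow>
     prob_space M \<and>
     space M = lattices \<and>
     sets M = sigma_sets lattices {U. openin lattice_topology U} \<and>
     (\<forall>g\<in>SL. \<forall>A\<in>sets M. emeasure M (act g ` A) = emeasure M A)"

text \<open>
  The last clause holds for every right-invariant Riemannian distance.  Some such regularity at the
  identity is implicit in speaking of \<open>\<epsilon>\<close>-neighbourhoods with a bound linear in \<open>\<epsilon>\<close>: without
  it, any concave rescaling of \<open>d\<close>, such as the reciprocal of \<open>ln (1 + 1 / d)\<close>, would be allowed.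
\<close>

definition right_invariant_distance :: "(real^'a^'a \<Rightarrow> real^'a^'a \<Rightarrow> real) \<Rightarrow> bool" where
  "right_invariant_distance d \<longleftrightarrow>
     Metric_space SL d \<and>
     Metric_space.mtopology SL d = top_of_set SL \<and>
     (\<forall>g\<in>SL. \<forall>h\<in>SL. \<forall>k\<in>SL. d (g ** k) (h ** k) = d g h) \<and>
     (\<exists>K>0. \<exists>r>0. \<forall>g\<in>SL. norm (g - mat 1) < r \<longrightarrow>
        norm (g - mat 1) / K \<le> d g (mat 1) \<and> d g (mat 1) \<le> K * norm (g - mat 1))"


subsection \<open>Smooth functions and \<open>C\<^sup>k\<close> norms\<close>

text \<open>The library's power and \<^const>\<open>exp\<close> are not available for the matrix product.\<close>

definition mexp :: "real^'a^'a \<Rightarrow> real^'a^'a" where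
  "mexp A = (\<Sum>k. (1 / fact k) *\<^sub>R (((**) A ^^ k) (mat 1)))"

definition sl :: "(real^'a^'a) set" where
  "sl = {A. trace A = 0}"

definition basis_of_sl :: "(real^'a^'a) set \<Rightarrow> bool" where
  "basis_of_sl B \<longleftrightarrow> independent B \<and> span B = sl"

definition lie_deriv ::
    "real^'a^'a \<Rightarrow> ((real^'a^'a) set \<Rightarrow> real) \<Rightarrow> (real^'a^'a) set \<Rightarrow> real" where
  "lie_deriv Y \<phi> \<Lambda> = deriv (\<lambda>t. \<phi> (act (mexp (t *\<^sub>R Y)) \<Lambda>)) 0"

primrec lie_derivs ::
    "(real^'a^'a) list \<Rightarrow> ((real^'a^'a) set \<Rightarrow> real) \<Rightarrow> (real^'a^'a) set \<Rightarrow> real" where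
  "lie_derivs [] \<phi> = \<phi>"
| "lie_derivs (Y # Ys) \<phi> = lie_deriv Y (lie_derivs Ys \<phi>)"

definition smooth_on_lattices :: "((real^'a^'a) set \<Rightarrow> real) \<Rightarrow> bool" where
  "smooth_on_lattices \<phi> \<longleftrightarrow>
     (\<forall>Ys. set Ys \<subseteq> sl \<longrightarrow>
        continuous_map lattice_topology euclideanreal (lie_derivs Ys \<phi>) \<and>
        (\<forall>Y\<in>sl. \<forall>\<Lambda>\<in>lattices.
           (\<lambda>t. lie_derivs Ys \<phi> (act (mexp (t *\<^sub>R Y)) \<Lambda>)) differentiable (at 0)))"

definition compactly_supported_on_lattices :: "((real^'a^'a) set \<Rightarrow> real) \<Rightarrow> bool" where
  "compactly_supported_on_lattices \<phi> \<longleftrightarrow>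
     compactin lattice_topology (lattice_topology closure_of {\<Lambda> \<in> lattices. \<phi> \<Lambda> \<noteq> 0})"

definition Ck_norm_lattices ::
    "(real^'a^'a) set \<Rightarrow> nat \<Rightarrow> ((real^'a^'a) set \<Rightarrow> real) \<Rightarrow> ennreal" where
  "Ck_norm_lattices B k \<phi> =
     (SUP Ys \<in> {Ys. set Ys \<subseteq> B \<and> length Ys \<le> k}. SUP \<Lambda> \<in> lattices. ennreal \<bar>lie_derivs Ys \<phi> \<Lambda>\<bar>)"

definition dir_deriv :: "'v::euclidean_space \<Rightarrow> ('v \<Rightarrow> real) \<Rightarrow> 'v \<Rightarrow> real" where
  "dir_deriv v \<phi> x = deriv (\<lambda>t. \<phi> (x + t *\<^sub>R v)) 0"

primrec dir_derivs :: "'v::euclidean_space list \<Rightarrow> ('v \<Rightarrow> real) \<Rightarrow> 'v \<Rightarrow> real" where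
  "dir_derivs [] \<phi> = \<phi>"
| "dir_derivs (v # vs) \<phi> = dir_deriv v (dir_derivs vs \<phi>)"

definition smooth :: "('v::euclidean_space \<Rightarrow> real) \<Rightarrow> bool" where
  "smooth \<phi> \<longleftrightarrow>
     (\<forall>vs. set vs \<subseteq> Basis \<longrightarrow>
        continuous_on UNIV (dir_derivs vs \<phi>) \<and>
        (\<forall>v\<in>Basis. \<forall>x. (\<lambda>t. dir_derivs vs \<phi> (x + t *\<^sub>R v)) differentiable (at 0)))"

text \<open>
  Smooth functions on the vector space need not be bounded, so this norm may be infinite; hence
  its type.
\<close>

definition Ck_norm :: "nat \<Rightarrow> ('v::euclidean_space \<Rightarrow> real) \<Rightarrow> ennreal" where
  "Ck_norm k \<phi> =
     (SUP vs \<in> {vs. set vs \<subseteq> Basis \<and> length vs \<le> k}. SUP x. ennreal \<bar>dir_derivs vs \<phi> x\<bar>)"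


subsection \<open>The flow and condition (EMEI)\<close>

definition unip :: "real^'n^'m \<Rightarrow> real^('m + 'n)^('m + 'n)" where
  "unip \<theta> = (\<chi> i j. case (i, j) of
      (Inl p, Inl q) \<Rightarrow> if p = q then 1 else 0
    | (Inl p, Inr q) \<Rightarrow> \<theta> $ p $ q
    | (Inr p, Inl q) \<Rightarrow> 0
    | (Inr p, Inr q) \<Rightarrow> if p = q then 1 else 0)"

definition diag_flow :: "real \<Rightarrow> real^('m::finite + 'n::finite)^('m + 'n)" where
  "diag_flow t = (\<chi> i j. if i \<noteq> j then 0 else
     (case i of
        Inl _ \<Rightarrow> exp (real CARD('n) / real CARD('m) * t)
      | Inr _ \<Rightarrow> exp (- t)))"

definition gap :: "nat \<Rightarrow> (nat \<Rightarrow> real) \<Rightarrow> real" where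
  "gap r t = Min ({t i | i. i < r} \<union> {\<bar>t i - t j\<bar> | i j. i < r \<and> j < r \<and> i \<noteq> j})"

text \<open>The tuples are indexed from \<open>0\<close> to \<open>r - 1\<close>; the constant \<open>C\<close> may depend on \<open>r\<close> only.\<close>

definition EMEI ::
    "(real^('m::finite + 'n::finite)^('m + 'n)) set \<Rightarrow> (real^('m + 'n)^('m + 'n)) set measure \<Rightarrow>
     (real^'n^'m) measure \<Rightarrow> bool" where
  "EMEI B muX mu \<longleftrightarrow>
     (\<exists>K. compact K \<and> emeasure mu (- K) = 0) \<and>
     (\<exists>\<delta>>0. \<exists>k\<ge>1. \<forall>r\<ge>1. \<exists>C\<ge>0. \<forall>F0 F t.
        smooth F0 \<longrightarrow>
        (\<forall>i<r. smooth_on_lattices (F i) \<and> compactly_supported_on_lattices (F i)) \<longrightarrow>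
        (\<forall>i<r. t i > 0) \<longrightarrow>
        ennreal \<bar>(\<integral>\<theta>. F0 \<theta> * (\<Prod>i<r. F i (act (diag_flow (t i)) (lcoset (unip \<theta>)))) \<partial>mu)
                  - (\<integral>\<theta>. F0 \<theta> \<partial>mu) * (\<Prod>i<r. \<integral>\<Lambda>. F i \<Lambda> \<partial>muX)\<bar>
          \<le> ennreal (C * exp (- \<delta> * gap r t)) * Ck_norm k F0 * (\<Prod>i<r. Ck_norm_lattices B k (F i)))"


subsection \<open>The normal law\<close>

text \<open>
  The formula makes no sense for \<open>\<sigma> = 0\<close>; the law is then the point mass at \<open>0\<close>.
\<close>

definition Norm :: "real \<Rightarrow> real \<Rightarrow> real" where
  "Norm \<sigma> x =
     (if \<sigma> = 0 then (if 0 < x then 1 else 0)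
      else 1 / (\<sigma> * sqrt (2 * pi)) * (LBINT y:{..x}. exp (- (1/2) * (y / \<sigma>)\<^sup>2)))"

end

theory Submission imports Defs "HOL-Real_Asymp.Real_Asymp" begin

text \<open>
  Convolving with a bump function of width \<open>\<epsilon>\<close> on the group turns \<open>f\<close> into a smooth compactly
  supported function, up to an error \<open>O(\<epsilon>)\<close> in mean and at the price of \<open>C\<^sup>k\<close> norms polynomial in
  \<open>1 / \<epsilon>\<close>.  Choosing \<open>\<epsilon>\<close> exponentially small in the gap of the times carries (EMEI) over from
  smooth functions to \<open>f\<close>, and even to correlations whose times form clusters that are far apart
  compared with their diameters.  In particular partial sums have linear second moments, and the
  strong law follows from a dyadic chaining argument and Borel--Cantelli.

  For the central limit theorem, sum over long blocks separated by short gaps.  In each fixed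
  moment the sums may be replaced by sums of independent blocks distributed according to
  \<open>\<mu>\<^sub>\<X>\<close>: any \<open>r\<close> times can be grouped at a scale at which they form clusters, and a
  cluster never meets two blocks.  The independent model has uniformly bounded exponential moments,
  so finitely many moments determine the characteristic function up to a prescribed error, and for
  independent blocks the limit is Gaussian by the usual second order expansion.
\<close>

subsection \<open>Matrices and the special linear group\<close>

text \<open>The hypothesis on \<open>f\<close> controls oscillation only in mean, so a smooth
  approximation is not uniformly close to \<open>f\<close>, and a small mean error over
  \<open>X\<close> says nothing by itself about the orbits seen by \<open>mu\<close>. The error is
  therefore dominated pointwise by \<open>1 + e\<close> with \<open>e\<close> itself smooth of
  compact support, and (EMEI) at a single time compares the two means of \<open>e\<close>. The times
  in a moment may be close together, where (EMEI) gives no decay. A cluster of times is then treated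
  as one observable: its regularity constant grows like \<open>exp (\<xi> * D1)\<close> with the
  diameter \<open>D1\<close>, while mixing gains \<open>exp (- \<delta> * D2)\<close> with the
  distance \<open>D2\<close> to the other clusters. Hence \<open>D2\<close> must exceed a fixed
  multiple of \<open>D1\<close>. After smoothing, \<delta> depends on the number \<open>r\<close> of
  times, and so does that multiple; no bound uniform in \<open>r\<close> is available on the side of
  \<open>mu\<close>. This is why exponential moments are taken only in the independent model, and
  why the number of moments is fixed before \<open>N\<close> tends to infinity.\<close>

lemma bounded_bilinear_matrix_mult:
  "bounded_bilinear ((**) :: real^'b::finite^'a::finite \<Rightarrow> real^'c::finite^'b \<Rightarrow> real^'c^'a)"
proof -
  have "bilinear ((**) :: real^'b^'a \<Rightarrow> real^'c^'b \<Rightarrow> real^'c^'a)"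
    unfolding bilinear_def
    by (auto intro!: linearI simp: matrix_add_ldistrib matrix_matrix_mult_def vec_eq_iff
        algebra_simps sum.distrib sum_distrib_left)
  then show ?thesis
    by (simp add: bilinear_conv_bounded_bilinear)
qed

interpretation matmul: bounded_bilinear "(**) :: real^'b::finite^'a::finite \<Rightarrow> real^'c::finite^'b \<Rightarrow> real^'c^'a"
  by (rule bounded_bilinear_matrix_mult)

lemma mat_nth: "mat c $ i $ j = (if i = j then c else 0)"
  by (simp add: mat_def)

lemma SL_mat_1 [simp]: "mat 1 \<in> SL"
  by (simp add: SL_def)

lemma SL_mult: "g \<in> SL \<Longrightarrow> h \<in> SL \<Longrightarrow> g ** h \<in> SL"
  by (simp add: SL_def det_mul)

lemma invertible_SL: "g \<in> SL \<Longrightarrow> invertible g"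
  by (simp add: SL_def invertible_det_nz)

lemma matrix_inv_SL:
  assumes "g \<in> SL"
  shows "g ** matrix_inv g = mat 1" "matrix_inv g ** g = mat 1" "matrix_inv g \<in> SL"
proof -
  obtain h where h: "g ** h = mat 1" "h ** g = mat 1"
    using invertible_SL[OF assms] by (auto simp: invertible_def)
  then have "g ** matrix_inv g = mat 1 \<and> matrix_inv g ** g = mat 1"
    unfolding matrix_inv_def by (rule_tac someI_ex) auto
  then show *: "g ** matrix_inv g = mat 1" "matrix_inv g ** g = mat 1" by auto
  have "det g * det (matrix_inv g) = 1"
    by (metis *(1) det_I det_mul)
  then show "matrix_inv g \<in> SL"
    using assms by (simp add: SL_def)
qed

lemma continuous_on_det: "continuous_on S (det :: real^'a::finite^'a \<Rightarrow> real)"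
  unfolding det_def by (intro continuous_intros)

lemma continuous_on_det' [continuous_intros]:
  "continuous_on S f \<Longrightarrow> continuous_on S (\<lambda>x. det (f x :: real^'a::finite^'a))"
  by (rule continuous_on_compose2[OF continuous_on_det[of UNIV]]) auto

lemma borel_measurable_det [measurable]: "(det :: real^'a::finite^'a \<Rightarrow> real) \<in> borel_measurable borel"
  by (intro borel_measurable_continuous_onI continuous_on_det)

lemma continuous_on_matmul [continuous_intros]:
  fixes f :: "'x::topological_space \<Rightarrow> real^'b::finite^'a::finite"
    and g :: "'x::topological_space \<Rightarrow> real^'c::finite^'b::finite"
  shows "continuous_on S f \<Longrightarrow> continuous_on S g \<Longrightarrow> continuous_on S (\<lambda>x. f x ** g x)"
  by (rule matmul.continuous_on)

lemma det_scaleR: "det (c *\<^sub>R (A :: real^'a::finite^'a)) = c ^ CARD('a) * det A"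
proof -
  have "det (c *\<^sub>R A) = det ((\<chi> i. c *s row i A) :: real^'a^'a)"
    by (rule arg_cong[where f=det]) (simp add: vec_eq_iff row_def)
  also have "\<dots> = (\<Prod>i\<in>(UNIV::'a set). c) * det (\<chi> i. row i A)"
    by (rule det_rows_mul[of "\<lambda>_. c" "\<lambda>i. row i A"])
  also have "(\<chi> i. row i A) = A" by (simp add: vec_eq_iff row_def)
  finally show ?thesis by simp
qed

text \<open>Continuity of the inverse comes from Cramer's rule.\<close>

lemma matrix_inv_SL_cramer:
  assumes "g \<in> (SL :: (real^'a::finite^'a) set)"
  shows "matrix_inv g = (\<chi> k j. det ((\<chi> i l. if l = k then (if i = j then 1 else 0) else g$i$l) :: real^'a^'a) / det g)"
proof -
  have "column j (matrix_inv g) = (\<chi> k. det ((\<chi> i l. if l = k then axis j 1 $ i else g$i$l) :: real^'a^'a) / det g)" for j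
  proof -
    have "g *v column j (matrix_inv g) = column j (g ** matrix_inv g)"
      by (simp add: vec_eq_iff column_def matrix_vector_mult_def matrix_matrix_mult_def)
    then have "g *v column j (matrix_inv g) = axis j 1"
      by (simp add: matrix_inv_SL[OF assms] vec_eq_iff column_def axis_def mat_def)
    then show ?thesis
      by (subst (asm) cramer) (use assms in \<open>auto simp: SL_def\<close>)
  qed
  then show ?thesis
    by (simp add: vec_eq_iff column_def axis_def cong: if_cong)
qed

lemma continuous_on_matrix_inv: "continuous_on (SL :: (real^'a::finite^'a) set) matrix_inv"
proof -
  have "continuous_on SL (\<lambda>g::real^'a^'a. if l = k then c else g$i$l)" for l k i :: 'a and c
    by (cases "l = k") (auto intro!: continuous_intros)
  then have "continuous_on SL (\<lambda>g::real^'a^'a. (\<chi> k j. det ((\<chi> i l. if l = k then (if i = j then 1 else 0) else g$i$l) :: real^'a^'a) / det g) :: real^'a^'a)"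
    by (intro continuous_on_vec_lambda continuous_on_divide continuous_on_det') (auto simp: SL_def intro!: continuous_intros)
  then show ?thesis
    by (rule continuous_on_eq) (simp add: matrix_inv_SL_cramer)
qed

section \<open>The matrix exponential\<close>

definition mpow :: "real^'a::finite^'a \<Rightarrow> nat \<Rightarrow> real^'a^'a" where
  "mpow Y k = ((**) Y ^^ k) (mat 1)"

lemma mpow_simps [simp]: "mpow Y 0 = mat 1" "mpow Y (Suc k) = Y ** mpow Y k"
  by (simp_all add: mpow_def)

lemma mpow_scaleR: "mpow (c *\<^sub>R (Y :: real^'a::finite^'a)) k = c ^ k *\<^sub>R mpow Y k"
  by (induction k) (simp_all add: matmul.scaleR_left matmul.scaleR_right)

lemma mpow_commute: "Y ** mpow Y k = mpow Y k ** (Y :: real^'a::finite^'a)"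
proof (induction k)
  case (Suc k)
  then show ?case by (metis matrix_mul_assoc mpow_simps(2))
qed simp

text \<open>Only boundedness of the matrix product is used, so the geometric rate carries its
  constant; the factorials of the exponential series absorb this growth.\<close>

lemma norm_mpow:
  fixes Y :: "real^'a::finite^'a"
  shows "\<exists>K>0. \<forall>k. norm (mpow Y k) \<le> K ^ k * norm (mat 1 :: real^'a^'a)"
proof -
  obtain C where C: "C > 0" "\<And>(A::real^'a^'a) (B::real^'a^'a). norm (A ** B) \<le> norm A * norm B * C"
    using matmul.pos_bounded by blast
  define K where "K = norm Y * C + 1"
  have "K > 0" unfolding K_def using C by (simp add: add_nonneg_pos)
  moreover have "norm (mpow Y k) \<le> K ^ k * norm (mat 1 :: real^'a^'a)" for k
  proof (induction k)
    case (Suc k)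
    have "norm (mpow Y (Suc k)) \<le> (norm Y * C) * norm (mpow Y k)"
      using C(2)[of Y "mpow Y k"] by (simp add: mult_ac)
    also have "\<dots> \<le> K * (K ^ k * norm (mat 1 :: real^'a^'a))"
      using Suc C by (intro mult_mono) (auto simp: K_def)
    finally show ?case by simp
  qed simp
  ultimately show ?thesis by blast
qed

text \<open>Entry by entry the exponential is a scalar power series in \<open>t\<close>; in this
  form the theorem on termwise differentiation applies to it.\<close>

lemma summable_mexp_nth: "summable (\<lambda>k. (mpow (Y::real^'a::finite^'a) k $ i $ j / fact k) * t ^ k)"
proof -
  obtain K where K: "K > 0" "\<And>k. norm (mpow Y k) \<le> K ^ k * norm (mat 1 :: real^'a^'a)"
    using norm_mpow by blast
  have "norm ((mpow Y k $ i $ j / fact k) * t ^ k) \<le> norm (mat 1 :: real^'a^'a) * (inverse (fact k) * (K * \<bar>t\<bar>) ^ k)" for k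
  proof -
    have "\<bar>mpow Y k $ i $ j\<bar> \<le> norm (mpow Y k)"
      using Finite_Cartesian_Product.norm_nth_le[of "mpow Y k $ i" j] Finite_Cartesian_Product.norm_nth_le[of "mpow Y k" i] by auto
    with K(2)[of k] have "\<bar>mpow Y k $ i $ j\<bar> \<le> K ^ k * norm (mat 1 :: real^'a^'a)" by linarith
    then have "\<bar>mpow Y k $ i $ j\<bar> * (\<bar>t\<bar> ^ k / fact k) \<le> K ^ k * norm (mat 1 :: real^'a^'a) * (\<bar>t\<bar> ^ k / fact k)"
      by (intro mult_right_mono) auto
    then show ?thesis by (simp add: abs_mult power_abs power_mult_distrib field_simps)
  qed
  moreover have "summable (\<lambda>k. norm (mat 1 :: real^'a^'a) * (inverse (fact k) * (K * \<bar>t\<bar>) ^ k))"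
    by (intro summable_mult summable_exp)
  ultimately show ?thesis by (rule summable_comparison_test'[rotated])
qed

lemma mexp_nth: "mexp (t *\<^sub>R Y) $ i $ j = (\<Sum>k. (mpow (Y::real^'a::finite^'a) k $ i $ j / fact k) * t ^ k)"
proof -
  have s: "(\<lambda>k. (1 / fact k) *\<^sub>R mpow (t *\<^sub>R Y) k) sums (\<chi> i j. \<Sum>k. (mpow Y k $ i $ j / fact k) * t ^ k)"
    unfolding sums_def
  proof (intro vec_tendstoI)
    fix i j
    have "(\<lambda>n. \<Sum>k<n. (mpow Y k $ i $ j / fact k) * t ^ k) \<longlonglongrightarrow> (\<Sum>k. (mpow Y k $ i $ j / fact k) * t ^ k)"
      by (rule summable_LIMSEQ[OF summable_mexp_nth])
    then show "(\<lambda>n. (\<Sum>k<n. (1 / fact k) *\<^sub>R mpow (t *\<^sub>R Y) k) $ i $ j) \<longlonglongrightarrow>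
      (\<chi> i j. \<Sum>k. (mpow Y k $ i $ j / fact k) * t ^ k) $ i $ j"
      by (simp add: mpow_scaleR mult_ac)
  qed
  then show ?thesis
    unfolding mexp_def mpow_def[symmetric] by (simp add: sums_iff)
qed

text \<open>Termwise differentiation is done on the entries, where \<open>diffs\<close> shifts the
  series by one index and thereby produces the factor \<open>Y\<close>. The last part reassembles
  the entrywise derivatives into that of the matrix-valued curve.\<close>

lemma has_vector_derivative_mexp:
  "((\<lambda>t. mexp (t *\<^sub>R Y)) has_vector_derivative (Y ** mexp (t *\<^sub>R Y))) (at t)" for Y :: "real^'a::finite^'a"
proof -
  have "((\<lambda>t. mexp (t *\<^sub>R Y) $ i $ j) has_real_derivative (Y ** mexp (t *\<^sub>R Y)) $ i $ j) (at t)" for i j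
  proof -
    let ?c = "\<lambda>k. mpow Y k $ i $ j / fact k"
    have "((\<lambda>t. \<Sum>k. ?c k * t ^ k) has_real_derivative (\<Sum>k. diffs ?c k * t ^ k)) (at t)"
      by (rule termdiffs_strong_converges_everywhere) (rule summable_mexp_nth)
    moreover have "(\<Sum>k. diffs ?c k * t ^ k) = (Y ** mexp (t *\<^sub>R Y)) $ i $ j"
    proof -
      have "diffs ?c k * t ^ k = (\<Sum>l\<in>UNIV. Y $ i $ l * ((mpow Y k $ l $ j / fact k) * t ^ k))" for k
        unfolding diffs_def by (simp add: matrix_matrix_mult_def sum_distrib_right sum_divide_distrib field_simps sum_distrib_left del: of_nat_Suc)
      then have "(\<Sum>k. diffs ?c k * t ^ k) = (\<Sum>k. \<Sum>l\<in>UNIV. Y $ i $ l * ((mpow Y k $ l $ j / fact k) * t ^ k))" by simp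
      also have "\<dots> = (\<Sum>l\<in>UNIV. \<Sum>k. Y $ i $ l * ((mpow Y k $ l $ j / fact k) * t ^ k))"
        by (rule suminf_sum) (intro summable_mult summable_mexp_nth)
      also have "\<dots> = (\<Sum>l\<in>UNIV. Y $ i $ l * (mexp (t *\<^sub>R Y) $ l $ j))"
        unfolding mexp_nth by (intro sum.cong refl suminf_mult summable_mexp_nth)
      finally show ?thesis by (simp add: matrix_matrix_mult_def)
    qed
    ultimately show ?thesis by (simp add: mexp_nth)
  qed
  then have *: "((\<lambda>t. mexp (t *\<^sub>R Y) $ i $ j) has_derivative (\<lambda>h. h * (Y ** mexp (t *\<^sub>R Y)) $ i $ j)) (at t)" for i j
    by (simp add: has_field_derivative_def mult_commute_abs)
  show ?thesis
    unfolding has_vector_derivative_def has_derivative_at'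
  proof safe
    show "bounded_linear (\<lambda>x. x *\<^sub>R (Y ** mexp (t *\<^sub>R Y)))" by (rule bounded_linear_scaleR_left)
  next
    fix e :: real assume "e > 0"
    have "((\<lambda>s. (mexp (s *\<^sub>R Y) - mexp (t *\<^sub>R Y) - (s - t) *\<^sub>R (Y ** mexp (t *\<^sub>R Y))) /\<^sub>R norm (s - t)) \<longlongrightarrow> 0) (at t)"
    proof (intro vec_tendstoI)
      fix i j
      show "((\<lambda>s. ((mexp (s *\<^sub>R Y) - mexp (t *\<^sub>R Y) - (s - t) *\<^sub>R (Y ** mexp (t *\<^sub>R Y))) /\<^sub>R norm (s - t)) $ i $ j) \<longlongrightarrow> 0 $ i $ j) (at t)"
        using *[of i j] by (simp add: has_derivative_at_within)
    qed
    then have "\<forall>\<^sub>F s in at t. norm ((mexp (s *\<^sub>R Y) - mexp (t *\<^sub>R Y) - (s - t) *\<^sub>R (Y ** mexp (t *\<^sub>R Y))) /\<^sub>R norm (s - t)) < e"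
      using \<open>e > 0\<close> by (auto dest!: tendstoD simp: dist_norm)
    then obtain d where d: "d > 0" "\<And>s. s \<noteq> t \<Longrightarrow> dist s t < d \<Longrightarrow> norm ((mexp (s *\<^sub>R Y) - mexp (t *\<^sub>R Y) - (s - t) *\<^sub>R (Y ** mexp (t *\<^sub>R Y))) /\<^sub>R norm (s - t)) < e"
      unfolding eventually_at by auto
    then show "\<exists>d>0. \<forall>s. 0 < norm (s - t) \<and> norm (s - t) < d \<longrightarrow>
        norm (mexp (s *\<^sub>R Y) - mexp (t *\<^sub>R Y) - (s - t) *\<^sub>R (Y ** mexp (t *\<^sub>R Y))) / norm (s - t) < e"
      by (intro exI[of _ d]) (auto simp: dist_norm divide_inverse mult.commute)
  qed
qed

lemma mexp_0 [simp]: "mexp 0 = (mat 1 :: real^'a::finite^'a)"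
proof -
  have "mexp (0 *\<^sub>R 0) $ i $ j = (mat 1 :: real^'a^'a) $ i $ j" for i j
    by (subst mexp_nth, subst powser_zero) simp
  then show ?thesis by (simp add: vec_eq_iff)
qed

lemma mexp_commute: "Y ** mexp (t *\<^sub>R Y) = mexp (t *\<^sub>R Y) ** (Y::real^'a::finite^'a)"
proof -
  have "(Y ** mexp (t *\<^sub>R Y)) $ i $ j = (mexp (t *\<^sub>R Y) ** Y) $ i $ j" for i j
  proof -
    have "(Y ** mexp (t *\<^sub>R Y)) $ i $ j = (\<Sum>k. \<Sum>l\<in>UNIV. Y $ i $ l * ((mpow Y k $ l $ j / fact k) * t ^ k))"
      by (subst suminf_sum, intro summable_mult summable_mexp_nth)
         (simp only: mexp_nth matrix_matrix_mult_def vec_lambda_beta suminf_mult[OF summable_mexp_nth])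
    also have "\<dots> = (\<Sum>k. (Y ** mpow Y k) $ i $ j / fact k * t ^ k)"
      unfolding matrix_matrix_mult_def vec_lambda_beta sum_distrib_right sum_divide_distrib
      by (simp add: field_simps)
    also have "\<dots> = (\<Sum>k. (mpow Y k ** Y) $ i $ j / fact k * t ^ k)"
      by (simp add: mpow_commute)
    also have "\<dots> = (\<Sum>k. \<Sum>l\<in>UNIV. ((mpow Y k $ i $ l / fact k) * t ^ k) * Y $ l $ j)"
      unfolding matrix_matrix_mult_def vec_lambda_beta sum_distrib_right sum_divide_distrib
      by (simp add: field_simps)
    also have "\<dots> = (mexp (t *\<^sub>R Y) ** Y) $ i $ j"
      by (subst suminf_sum, intro summable_mult2 summable_mexp_nth)
         (simp only: mexp_nth matrix_matrix_mult_def vec_lambda_beta suminf_mult2[OF summable_mexp_nth, symmetric])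
    finally show ?thesis .
  qed
  then show ?thesis by (simp add: vec_eq_iff)
qed

text \<open>The product of the exponentials at \<open>- t\<close> and \<open>t + s\<close> has zero
  derivative in \<open>t\<close>, because \<open>Y\<close> commutes with its exponential; its value
  at \<open>t = 0\<close> then gives the group law. The case \<open>s = 0\<close> shows that
  exponentials at opposite times are inverse to each other.\<close>

lemma mexp_add: "mexp ((s + t) *\<^sub>R Y) = mexp (s *\<^sub>R Y) ** mexp (t *\<^sub>R (Y::real^'a::finite^'a))"
proof -
  have *: "mexp ((- t) *\<^sub>R Y) ** mexp ((t + s) *\<^sub>R Y) = mexp (s *\<^sub>R Y)" for s t
  proof -
    let ?H = "\<lambda>t. mexp ((- t) *\<^sub>R Y) ** mexp ((t + s) *\<^sub>R Y)"
    have "(?H has_vector_derivative 0) (at t)" for t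
    proof -
      have 1: "((\<lambda>t. mexp ((- t) *\<^sub>R Y)) has_vector_derivative ((- 1) *\<^sub>R (Y ** mexp ((- t) *\<^sub>R Y)))) (at t)"
        by (rule vector_diff_chain_at[OF _ has_vector_derivative_mexp, of uminus, unfolded o_def])
           (auto intro!: derivative_eq_intros)
      have 2: "((\<lambda>t. mexp ((t + s) *\<^sub>R Y)) has_vector_derivative (1 *\<^sub>R (Y ** mexp ((t + s) *\<^sub>R Y)))) (at t)"
        by (rule vector_diff_chain_at[OF _ has_vector_derivative_mexp, of "\<lambda>t. t + s", unfolded o_def])
           (auto intro!: derivative_eq_intros)
      show ?thesis
        using matmul.has_vector_derivative[OF 1 2]
        by (simp add: mexp_commute[of Y "-t"] matmul.minus_left matmul.minus_right matrix_mul_assoc[symmetric] del: scaleR_minus_left)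
    qed
    then obtain c where "\<And>x. x \<in> UNIV \<Longrightarrow> ?H x = c"
      using has_vector_derivative_zero_constant[of UNIV ?H] convex_UNIV by blast
    then have "?H t = ?H 0" by (metis UNIV_I)
    then show ?thesis by simp
  qed
  have "mexp ((- s) *\<^sub>R Y) ** mexp ((s + t) *\<^sub>R Y) = mexp (t *\<^sub>R Y)" using *[of s t] .
  then have "mexp (s *\<^sub>R Y) ** mexp ((- s) *\<^sub>R Y) ** mexp ((s + t) *\<^sub>R Y) = mexp (s *\<^sub>R Y) ** mexp (t *\<^sub>R Y)"
    by (simp add: matrix_mul_assoc[symmetric])
  moreover have "mexp (s *\<^sub>R Y) ** mexp ((- s) *\<^sub>R Y) = mat 1"
    using *[of "-s" 0] by simp
  ultimately show ?thesis by simp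
qed

lemma mexp_minus: "mexp (s *\<^sub>R Y) ** mexp ((- s) *\<^sub>R Y) = mat 1" for Y :: "real^'a::finite^'a"
  using mexp_add[of s "-s" Y] by simp

text \<open>At the identity only the trivial permutation contributes to the differentiated Leibniz
  formula: any other one moves at least two indices, so after one factor has been differentiated a
  vanishing off-diagonal entry remains.\<close>

lemma det_derivative_at_1:
  fixes E :: "real \<Rightarrow> real^'a::finite^'a"
  assumes E: "\<And>i j. ((\<lambda>t. E t $ i $ j) has_real_derivative Y $ i $ j) (at 0)" and "E 0 = mat 1"
  shows "((\<lambda>t. det (E t)) has_real_derivative trace Y) (at 0)"
proof -
  have "((\<lambda>t. det (E t)) has_real_derivative
     (\<Sum>p\<in>{p. p permutes UNIV}. of_int (sign p) * (\<Sum>i\<in>UNIV. Y $ i $ p i * (\<Prod>j\<in>UNIV - {i}. E 0 $ j $ p j)))) (at 0)"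
    unfolding det_def by (intro DERIV_sum DERIV_cmult has_field_derivative_prod E)
  moreover have "(\<Sum>i\<in>UNIV. Y $ i $ p i * (\<Prod>j\<in>UNIV - {i}. E 0 $ j $ p j)) = (if p = id then trace Y else 0)"
    if p: "p permutes UNIV" for p
  proof (cases "p = id")
    case True
    then show ?thesis by (simp add: assms(2) mat_def trace_def)
  next
    case False
    have "(\<Prod>j\<in>UNIV - {i}. E 0 $ j $ p j) = 0" for i
    proof -
      obtain a where a: "p a \<noteq> a" using False by (auto simp: fun_eq_iff)
      have "p (p a) \<noteq> p a" using permutes_inj[OF p] a by (auto dest: injD)
      then obtain b where "b \<noteq> i" "p b \<noteq> b"
        using a by metis
      then show ?thesis
        by (intro prod_zero) (auto simp: assms(2) mat_def intro!: bexI[of _ b])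
    qed
    then show ?thesis using False by (simp del: prod_zero_iff)
  qed
  ultimately have "((\<lambda>t. det (E t)) has_real_derivative
     (\<Sum>p\<in>{p. p permutes (UNIV::'a set)}. of_int (sign p) * (if p = id then trace Y else 0))) (at 0)"
    by simp
  moreover have "(\<Sum>p\<in>{p. p permutes (UNIV::'a set)}. of_int (sign p) * (if p = id then trace Y else 0))
     = (\<Sum>p\<in>{id::'a\<Rightarrow>'a}. of_int (sign p) * (if p = id then trace Y else 0))"
    by (rule sum.mono_neutral_right) (auto simp: finite_permutations permutes_id)
  ultimately show ?thesis by simp
qed

lemma mexp_nth_deriv: "((\<lambda>t. mexp (t *\<^sub>R Y) $ i $ j) has_real_derivative (Y ** mexp (t *\<^sub>R Y)) $ i $ j) (at t)"
  for Y :: "real^'a::finite^'a"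
proof -
  have "bounded_linear (\<lambda>A::real^'a^'a. A $ i $ j)"
    by (intro bounded_linear_compose[OF bounded_linear_vec_nth] bounded_linear_vec_nth)
  then have "((\<lambda>t. mexp (t *\<^sub>R Y) $ i $ j) has_vector_derivative (Y ** mexp (t *\<^sub>R Y)) $ i $ j) (at t)"
    by (rule bounded_linear.has_vector_derivative) (rule has_vector_derivative_mexp)
  then show ?thesis by (simp add: has_real_derivative_iff_has_vector_derivative)
qed

text \<open>The derivative of the determinant vanishes at \<open>0\<close> because the trace does;
  multiplicativity carries this to every \<open>t\<close>, so the determinant is constant.\<close>

lemma mexp_in_SL:
  fixes Y :: "real^'a::finite^'a"
  assumes "Y \<in> sl"
  shows "mexp (t *\<^sub>R Y) \<in> SL"
proof -
  let ?D = "\<lambda>t. det (mexp (t *\<^sub>R Y))"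
  have d0: "(?D has_real_derivative 0) (at 0)"
    using det_derivative_at_1[of "\<lambda>t. mexp (t *\<^sub>R Y)" Y] mexp_nth_deriv[of Y _ _ 0] assms
    by (simp add: sl_def)
  have "(?D has_real_derivative 0) (at t)" for t
  proof -
    have "((\<lambda>h. ?D h * ?D t) has_real_derivative 0 * ?D t) (at 0)"
      by (intro DERIV_cmult_right d0)
    moreover have "?D h * ?D t = ?D (h + t)" for h
      by (simp add: mexp_add det_mul)
    ultimately have "((\<lambda>h. ?D (h + t)) has_real_derivative 0) (at 0)" by simp
    then have "(?D has_real_derivative 0) (at (0 + t))"
      by (subst DERIV_shift)
    then show ?thesis by simp
  qed
  then have "?D t = ?D 0" using DERIV_isconst_all by blast
  then show ?thesis by (simp add: SL_def)
qed

subsection \<open>Lebesgue measure on matrices under right multiplication\<close>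

text \<open>Fubini with the coordinate along \<open>b\<close> integrated first: once the other
  coordinates, among them that along \<open>a\<close>, are fixed, the shear is a translation of the
  line.\<close>

lemma nn_integral_lborel_shear:
  fixes a b :: "'e::euclidean_space" and F :: "'e \<Rightarrow> ennreal"
  assumes a: "a \<in> Basis" "b \<in> Basis" "a \<noteq> b" and F [measurable]: "F \<in> borel_measurable borel"
  shows "(\<integral>\<^sup>+x. F (x + (c * (x \<bullet> a)) *\<^sub>R b) \<partial>lborel) = (\<integral>\<^sup>+x. F x \<partial>lborel)"
proof -
  interpret product_sigma_finite "\<lambda>_::'e. lborel :: real measure" by standard
  define B where "B = Basis - {b}"
  have B: "finite B" "b \<notin> B" "Basis = insert b B" "a \<in> B"
    using a by (auto simp: B_def)
  have eq: "(\<integral>\<^sup>+x. G x \<partial>lborel) =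
     (\<integral>\<^sup>+x. (\<integral>\<^sup>+y. G ((\<Sum>i\<in>B. x i *\<^sub>R i) + y *\<^sub>R b) \<partial>lborel) \<partial>(\<Pi>\<^sub>M b\<in>B. lborel))"
    if [measurable]: "G \<in> borel_measurable borel" for G :: "'e \<Rightarrow> ennreal"
  proof -
    have "(\<integral>\<^sup>+x. G x \<partial>lborel) = (\<integral>\<^sup>+f. G (\<Sum>b\<in>Basis. f b *\<^sub>R b) \<partial>(\<Pi>\<^sub>M b\<in>Basis. lborel))"
      by (subst lborel_eq) (simp add: nn_integral_distr)
    also have "\<dots> = (\<integral>\<^sup>+f. G (\<Sum>b\<in>Basis. f b *\<^sub>R b) \<partial>(\<Pi>\<^sub>M b\<in>insert b B. lborel))"
      using B by simp
    finally have "(\<integral>\<^sup>+x. G x \<partial>lborel) = (\<integral>\<^sup>+f. G (\<Sum>b\<in>Basis. f b *\<^sub>R b) \<partial>(\<Pi>\<^sub>M b\<in>insert b B. lborel))" .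
    also have "\<dots> = (\<integral>\<^sup>+x. (\<integral>\<^sup>+y. G (\<Sum>i\<in>Basis. (x(b := y)) i *\<^sub>R i) \<partial>lborel) \<partial>(\<Pi>\<^sub>M b\<in>B. lborel))"
      using B by (subst product_nn_integral_insert) (auto simp del: fun_upd_apply)
    finally have "(\<integral>\<^sup>+x. G x \<partial>lborel) = (\<integral>\<^sup>+x. (\<integral>\<^sup>+y. G (\<Sum>i\<in>Basis. (x(b := y)) i *\<^sub>R i) \<partial>lborel) \<partial>(\<Pi>\<^sub>M b\<in>B. lborel))" .
    moreover have "(\<Sum>i\<in>Basis. (x(b := y)) i *\<^sub>R i) = (\<Sum>i\<in>B. x i *\<^sub>R i) + y *\<^sub>R b" for x :: "'e \<Rightarrow> real" and y
    proof -
      have "(\<Sum>i\<in>B. (x(b := y)) i *\<^sub>R i) = (\<Sum>i\<in>B. x i *\<^sub>R i)"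
        using B by (intro sum.cong) auto
      then show ?thesis by (simp add: B(3) B(1,2) add.commute fun_upd_same del: fun_upd_apply)
    qed
    ultimately show ?thesis by (simp del: fun_upd_apply)
  qed
  have inner: "((\<Sum>i\<in>B. x i *\<^sub>R i) + y *\<^sub>R b) \<bullet> a = x a" for x :: "'e \<Rightarrow> real" and y
  proof -
    have "(\<Sum>i\<in>B. x i *\<^sub>R i) \<bullet> a = (\<Sum>i\<in>B. if i = a then x a else 0)"
      unfolding inner_sum_left using B a by (intro sum.cong) (auto simp: inner_Basis)
    then show ?thesis using B a by (simp add: inner_add_left inner_Basis)
  qed
  have "(\<integral>\<^sup>+x. F (x + (c * (x \<bullet> a)) *\<^sub>R b) \<partial>lborel)
    = (\<integral>\<^sup>+x. (\<integral>\<^sup>+y. F ((\<Sum>i\<in>B. x i *\<^sub>R i) + (c * x a + 1 * y) *\<^sub>R b) \<partial>lborel) \<partial>(\<Pi>\<^sub>M b\<in>B. lborel))"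
    by (subst eq, measurable, simp only: inner) (simp add: scaleR_add_left add_ac)
  moreover have "(\<integral>\<^sup>+y. F ((\<Sum>i\<in>B. x i *\<^sub>R i) + (c * x a + 1 * y) *\<^sub>R b) \<partial>lborel)
     = (\<integral>\<^sup>+y. F ((\<Sum>i\<in>B. x i *\<^sub>R i) + y *\<^sub>R b) \<partial>lborel)" for x
    using nn_integral_real_affine[where c=1 and t="c * x a" and f="\<lambda>y. F ((\<Sum>i\<in>B. x i *\<^sub>R i) + y *\<^sub>R b)"] by simp
  ultimately show ?thesis by (simp add: eq del: mult_1)
qed

text \<open>\<open>K\<close> is the factor by which right multiplication by \<open>h\<close> scales
  volume. It multiplies the integral of the substituted function, so that factors compose without
  division in \<open>ennreal\<close>.\<close>

definition right_scale :: "ennreal \<Rightarrow> real^'a::finite^'a \<Rightarrow> bool" where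
  "right_scale K h \<longleftrightarrow> (\<forall>F\<in>borel_measurable borel. (\<integral>\<^sup>+A. F ((A::real^'a^'a) ** h) \<partial>lborel) * K = (\<integral>\<^sup>+A. F A \<partial>lborel))"

lemma borel_measurable_matmul_right [measurable]: "(\<lambda>A. A ** h) \<in> borel_measurable (borel :: (real^'b::finite^'a::finite) measure)"
  for h :: "real^'c::finite^'b"
  by (intro borel_measurable_continuous_onI linear_continuous_on matmul.bounded_linear_left)

lemma right_scale_mult:
  assumes "right_scale K g" "right_scale L h"
  shows "right_scale (K * L) (g ** h)"
  unfolding right_scale_def
proof
  fix F :: "real^'a^'a \<Rightarrow> ennreal" assume F [measurable]: "F \<in> borel_measurable borel"
  have "(\<integral>\<^sup>+A. F (A ** (g ** h)) \<partial>lborel) * (K * L) = (\<integral>\<^sup>+A. F ((A ** g) ** h) \<partial>lborel) * K * L"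
    by (simp add: matrix_mul_assoc mult_ac)
  also have "(\<integral>\<^sup>+A. F ((A ** g) ** h) \<partial>lborel) * K = (\<integral>\<^sup>+A. F (A ** h) \<partial>lborel)"
    using assms(1) unfolding right_scale_def by (rule bspec) measurable
  also have "\<dots> * L = (\<integral>\<^sup>+A. F A \<partial>lborel)"
    using assms(2) unfolding right_scale_def by (rule bspec) measurable
  finally show "(\<integral>\<^sup>+A. F (A ** (g ** h)) \<partial>lborel) * (K * L) = (\<integral>\<^sup>+A. F A \<partial>lborel)" .
qed

lemma Basis_vec2: "(Basis :: (real^'a::finite^'a) set) = (\<lambda>(i,j). axis i (axis j 1)) ` UNIV"
  by (auto simp: Basis_vec_def image_iff)

lemma axis2_nth: "(axis k (axis l 1) :: real^'a::finite^'a) $ i $ j = (if k = i \<and> l = j then 1 else 0)"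
  by (auto simp: axis_def)

text \<open>Right multiplication by this matrix adds \<open>c\<close> times column \<open>m\<close>
  to column \<open>n\<close>, which is one shear in every row. The partial map \<open>T S\<close>
  performs the shears of the rows in \<open>S\<close>, so that rows can be treated one at a time; no
  shear alters column \<open>m\<close>.\<close>

lemma right_scale_transvection:
  fixes m n :: "'a::finite"
  assumes "m \<noteq> n"
  shows "right_scale 1 (\<chi> i j. if i = m \<and> j = n then c else of_bool (i = j))"
  unfolding right_scale_def
proof
  fix F :: "real^'a^'a \<Rightarrow> ennreal" assume F [measurable]: "F \<in> borel_measurable borel"
  let ?h = "(\<chi> i j. if i = m \<and> j = n then c else of_bool (i = j)) :: real^'a^'a"
  define T where "T S A = (A + (\<Sum>i\<in>S. (c * A $ i $ m) *\<^sub>R axis i (axis n 1)) :: real^'a^'a)" for S A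
  have T_meas [measurable]: "T S \<in> borel_measurable borel" for S
    unfolding T_def by (intro borel_measurable_continuous_onI continuous_intros)
  have T_eq: "A ** ?h = T UNIV A" for A
  proof -
    have "(A ** ?h) $ i $ j = T UNIV A $ i $ j" for i j
    proof -
      have "(A ** ?h) $ i $ j = (\<Sum>k\<in>UNIV. (if k = j then A $ i $ j else 0) + (if k = m then (if j = n then c * A $ i $ m else 0) else 0))"
        unfolding matrix_matrix_mult_def using assms by (auto intro!: sum.cong)
      also have "\<dots> = A $ i $ j + (if j = n then c * A $ i $ m else 0)"
        unfolding sum.distrib by simp
      also have "(if j = n then c * A $ i $ m else 0) = (\<Sum>k\<in>UNIV. if k = i then (if j = n then c * A $ i $ m else 0) else 0)"
        by simp
      also have "\<dots> = (\<Sum>k\<in>UNIV. ((c * A $ k $ m) *\<^sub>R axis k (axis n 1)) $ i $ j)"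
        by (intro sum.cong) (auto simp: axis_def)
      finally show ?thesis by (simp add: T_def)
    qed
    then show ?thesis by (simp add: vec_eq_iff)
  qed
  have "(\<integral>\<^sup>+A. F (T S A) \<partial>lborel) = (\<integral>\<^sup>+A. F A \<partial>lborel)" if "finite S" for S
    using that F
  proof (induction S arbitrary: F)
    case (insert i S)
    note [measurable] = insert.prems
    have eq: "T (insert i S) A = T S (A + (c * (A \<bullet> axis i (axis m 1))) *\<^sub>R axis i (axis n 1))" for A
    proof -
      define A' where "A' = A + (c * (A \<bullet> axis i (axis m 1))) *\<^sub>R axis i (axis n 1)"
      have "A' $ k $ m = A $ k $ m" for k
        using assms by (simp add: A'_def axis_def)
      then have "T S A' = A' + (\<Sum>i\<in>S. (c * A $ i $ m) *\<^sub>R axis i (axis n 1))"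
        by (simp add: T_def)
      then show ?thesis
        using insert.hyps by (simp add: A'_def T_def inner_axis add_ac)
    qed
    have "(\<integral>\<^sup>+A. F (T (insert i S) A) \<partial>lborel) = (\<integral>\<^sup>+A. F (T S A) \<partial>lborel)"
      unfolding eq using assms
      by (intro nn_integral_lborel_shear[where F="\<lambda>A. F (T S A)"]) (auto simp: Basis_vec2 axis_eq_axis)
    then show ?case using insert by simp
  qed (simp add: T_def)
  then show "(\<integral>\<^sup>+A. F (A ** ?h) \<partial>lborel) * 1 = (\<integral>\<^sup>+A. F A \<partial>lborel)"
    by (simp add: T_eq)
qed

text \<open>Column \<open>j\<close> is scaled by \<open>D $ j $ j\<close>, and this factor occurs
  once for each row; hence the determinant enters with the power \<open>CARD('a)\<close>. The
  function \<open>c\<close> expresses the factor in terms of the matrix unit, since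
  \<open>lborel_affine_euclidean\<close> is indexed by \<open>Basis\<close>.\<close>

lemma right_scale_diagonal:
  fixes D :: "real^'a::finite^'a"
  assumes D: "\<And>i j. i \<noteq> j \<Longrightarrow> D $ i $ j = 0" and "det D \<noteq> 0"
  shows "right_scale (ennreal (\<bar>det D\<bar> ^ CARD('a))) D"
  unfolding right_scale_def
proof
  fix F :: "real^'a^'a \<Rightarrow> ennreal" assume F [measurable]: "F \<in> borel_measurable borel"
  have det: "det D = (\<Prod>i\<in>UNIV. D $ i $ i)" by (rule det_diagonal) (use D in auto)
  with assms have nz: "D $ i $ i \<noteq> 0" for i by auto
  define c where "c b = (\<Sum>j\<in>UNIV. D $ j $ j * (\<Sum>i\<in>UNIV. b $ i $ j))" for b :: "real^'a^'a"
  have c_axis: "c (axis i (axis j 1)) = D $ j $ j" for i j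
  proof -
    have "(\<Sum>k\<in>UNIV. (axis i (axis j 1) :: real^'a^'a) $ k $ l) = (\<Sum>k\<in>UNIV. if k = i then (if l = j then 1 else 0) else 0)" for l
      by (intro sum.cong) (auto simp: axis_def)
    then have "(\<Sum>k\<in>UNIV. (axis i (axis j 1) :: real^'a^'a) $ k $ l) = (if l = j then 1 else 0)" for l by simp
    then show ?thesis by (simp add: c_def if_distrib[of "\<lambda>x. _ * x"] cong: if_cong)
  qed
  define T where "T x = 0 + (\<Sum>j\<in>Basis. (c j * (x \<bullet> j)) *\<^sub>R j)" for x :: "real^'a^'a"
  have inj: "inj (\<lambda>(i,j). axis i (axis j 1) :: real^'a^'a)"
    by (auto simp: inj_on_def axis_eq_axis)
  have T_eq: "A ** D = T A" for A
  proof -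
    have "(A ** D) $ i $ j = T A $ i $ j" for i j
    proof -
      have "(A ** D) $ i $ j = (\<Sum>k\<in>UNIV. if k = j then A $ i $ j * D $ j $ j else 0)"
        unfolding matrix_matrix_mult_def vec_lambda_beta by (intro sum.cong refl) (use D in auto)
      moreover have "T A $ i $ j = (\<Sum>(k,l)\<in>UNIV. (D $ l $ l * A $ k $ l) * (axis k (axis l 1) :: real^'a^'a) $ i $ j)"
        unfolding T_def Basis_vec2 by (subst sum.reindex[OF inj]) (simp add: case_prod_unfold c_axis inner_axis)
      moreover have "\<dots> = (\<Sum>p\<in>UNIV. if p = (i,j) then D $ j $ j * A $ i $ j else 0)"
        by (intro sum.cong) (auto simp: axis2_nth split: if_splits)
      ultimately show ?thesis by (simp add: mult.commute)
    qed
    then show ?thesis by (simp add: vec_eq_iff)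
  qed
  have "(\<Prod>j\<in>Basis. \<bar>c j\<bar>) = (\<Prod>(k,l)\<in>(UNIV::('a\<times>'a) set). \<bar>D $ l $ l\<bar>)"
    unfolding Basis_vec2 by (subst prod.reindex[OF inj]) (simp add: case_prod_unfold c_axis)
  also have "\<dots> = (\<Prod>k\<in>(UNIV::'a set). \<Prod>l\<in>UNIV. \<bar>D $ l $ l\<bar>)"
    by (subst UNIV_Times_UNIV[symmetric], subst prod.cartesian_product) simp
  also have "\<dots> = \<bar>det D\<bar> ^ CARD('a)" by (simp add: det abs_prod)
  finally have pr: "(\<Prod>j\<in>Basis. \<bar>c j\<bar>) = \<bar>det D\<bar> ^ CARD('a)" .
  have [measurable]: "T \<in> borel_measurable borel"
    unfolding T_def by (intro borel_measurable_continuous_onI continuous_intros)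
  have "(\<integral>\<^sup>+A. F A \<partial>lborel) = (\<integral>\<^sup>+A. F A \<partial>density (distr lborel borel T) (\<lambda>_. ennreal (\<Prod>j\<in>Basis. \<bar>c j\<bar>)))"
    unfolding T_def by (subst lborel_affine_euclidean[of c 0]) (auto simp: Basis_vec2 c_axis nz)
  also have "\<dots> = (\<integral>\<^sup>+A. F (A ** D) \<partial>lborel) * ennreal (\<bar>det D\<bar> ^ CARD('a))"
    by (simp add: nn_integral_density nn_integral_distr pr T_eq nn_integral_cmult nn_integral_multc mult.commute)
  finally show "(\<integral>\<^sup>+A. F (A ** D) \<partial>lborel) * ennreal (\<bar>det D\<bar> ^ CARD('a)) = (\<integral>\<^sup>+A. F A \<partial>lborel)" ..
qed

text \<open>Exchanging two columns permutes the coordinates, so it carries boxes to boxes of equal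
  volume, and boxes determine Lebesgue measure.\<close>

lemma right_scale_swap:
  fixes m n :: "'a::finite"
  assumes "m \<noteq> n"
  shows "right_scale 1 (\<chi> i j. mat 1 $ i $ Transposition.transpose m n j)"
  unfolding right_scale_def
proof
  fix F :: "real^'a^'a \<Rightarrow> ennreal" assume F [measurable]: "F \<in> borel_measurable borel"
  let ?h = "(\<chi> i j. mat 1 $ i $ Transposition.transpose m n j) :: real^'a^'a"
  let ?t = "Transposition.transpose m n"
  have T: "A ** ?h = (\<chi> i j. A $ i $ ?t j)" for A
    by (simp add: vec_eq_iff matrix_matrix_mult_def mat_def if_distrib[of "\<lambda>x. _ * x"] cong: if_cong)
  have "distr lborel borel (\<lambda>A. A ** ?h) = (lborel :: (real^'a^'a) measure)"
  proof (rule lborel_eqI[symmetric])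
    fix l u :: "real^'a^'a" assume lu: "\<And>b. b \<in> Basis \<Longrightarrow> l \<bullet> b \<le> u \<bullet> b"
    have lu': "l $ i $ j \<le> u $ i $ j" for i j
      using lu[of "axis i (axis j 1)"] rangeI[of "\<lambda>(i,j). axis i (axis j 1) :: real^'a^'a" "(i,j)"]
      by (simp add: Basis_vec2 inner_axis)
    have inj: "inj (\<lambda>(i,j). axis i (axis j 1) :: real^'a^'a)"
      by (auto simp: inj_on_def axis_eq_axis)
    have mem: "x \<in> box l u \<longleftrightarrow> (\<forall>i j. l $ i $ j < x $ i $ j \<and> x $ i $ j < u $ i $ j)" for x l u :: "real^'a^'a"
      by (auto simp: mem_box Basis_vec2 inner_axis)
    have "(\<lambda>A. A ** ?h) -` box l u = box (l ** ?h) (u ** ?h)"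
      unfolding T by (auto simp: mem) (metis transpose_involutory)+
    then have "emeasure (distr lborel borel (\<lambda>A. A ** ?h)) (box l u) = emeasure lborel (box (l ** ?h) (u ** ?h))"
      by (subst emeasure_distr) auto
    also have "\<dots> = ennreal (\<Prod>b\<in>Basis. (u ** ?h - l ** ?h) \<bullet> b)"
      by (subst emeasure_lborel_box) (auto simp: Basis_vec2 inner_axis T lu')
    also have "(\<Prod>b\<in>Basis. (u ** ?h - l ** ?h) \<bullet> b) = (\<Prod>b\<in>Basis. (u - l) \<bullet> b)"
    proof -
      have "(\<Prod>b\<in>Basis. (u ** ?h - l ** ?h) \<bullet> b) = (\<Prod>(i,j)\<in>UNIV. u $ i $ ?t j - l $ i $ ?t j)"
        unfolding Basis_vec2 by (subst prod.reindex[OF inj]) (simp add: case_prod_unfold inner_axis T)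
      also have "\<dots> = (\<Prod>i\<in>UNIV. \<Prod>j\<in>UNIV. u $ i $ ?t j - l $ i $ ?t j)"
        by (subst UNIV_Times_UNIV[symmetric], subst prod.cartesian_product) simp
      also have "\<dots> = (\<Prod>i\<in>UNIV. \<Prod>j\<in>UNIV. u $ i $ j - l $ i $ j)"
        by (intro prod.cong refl prod.permute[OF permutes_swap_id, unfolded o_def, symmetric]) auto
      also have "\<dots> = (\<Prod>(i,j)\<in>UNIV. u $ i $ j - l $ i $ j)"
        by (subst UNIV_Times_UNIV[symmetric], subst prod.cartesian_product) simp
      also have "\<dots> = (\<Prod>b\<in>Basis. (u - l) \<bullet> b)"
        unfolding Basis_vec2 by (subst prod.reindex[OF inj]) (simp add: case_prod_unfold inner_axis)
      finally show ?thesis .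
    qed
    finally show "emeasure (distr lborel borel (\<lambda>A. A ** ?h)) (box l u) = (\<Prod>b\<in>Basis. (u - l) \<bullet> b)" .
  qed simp
  then have "(\<integral>\<^sup>+A. F A \<partial>lborel) = (\<integral>\<^sup>+A. F A \<partial>distr lborel borel (\<lambda>A. A ** ?h))" by simp
  also have "\<dots> = (\<integral>\<^sup>+A. F (A ** ?h) \<partial>lborel)" by (subst nn_integral_distr) auto
  finally show "(\<integral>\<^sup>+A. F (A ** ?h) \<partial>lborel) * 1 = (\<integral>\<^sup>+A. F A \<partial>lborel)" by simp
qed

lemma det_transvection:
  fixes m n :: "'a::finite"
  assumes "m \<noteq> n"
  shows "det ((\<chi> i j. if i = m \<and> j = n then c else of_bool (i = j)) :: real^'a^'a) = 1"
proof -
  have "(\<chi> k. if k = m then row m (mat 1) + c *s row n (mat 1) else row k (mat 1)) =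
      ((\<chi> i j. if i = m \<and> j = n then c else of_bool (i = j)) :: real^'a^'a)"
    using assms by (auto simp: vec_eq_iff row_def mat_def)
  then show ?thesis
    using det_row_operation[OF assms, where c=c and A="mat 1 :: real^'a^'a"] by (simp add: det_I)
qed

text \<open>Induction over elementary factorisations. The condition on the determinant stands inside
  the formula, where a product passes it on to both factors and a matrix with a zero row satisfies
  the claim vacuously.\<close>

lemma right_scale_det:
  fixes h :: "real^'a::finite^'a"
  shows "det h \<noteq> 0 \<longrightarrow> right_scale (ennreal (\<bar>det h\<bar> ^ CARD('a))) h"
proof (induction h rule: induct_matrix_elementary)
  case (1 A B)
  then show ?case
    using right_scale_mult[of _ A _ B] by (auto simp: det_mul abs_mult power_mult_distrib ennreal_mult)
next
  case (2 A i)
  then show ?case by (simp add: det_zero_row)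
next
  case (3 A)
  then show ?case using right_scale_diagonal by blast
next
  case (4 m n)
  have "\<bar>det ((\<chi> i j. mat 1 $ i $ Transposition.transpose m n j) :: real^'a^'a)\<bar> = 1"
    using det_permute_columns[OF permutes_swap_id[of m UNIV n], of "mat 1 :: real^'a^'a"] 4
    by (simp add: det_I abs_mult sign_swap_id)
  then show ?case using right_scale_swap[OF 4] by simp
next
  case (5 m n c)
  then show ?case using right_scale_transvection[OF 5] det_transvection[OF 5] by simp
qed

text \<open>The scaling factor is a power of the absolute determinant, hence \<open>1\<close>. This
  invariance is what lets a translation of the lattice be moved into the smoothing kernel.\<close>

lemma lborel_right_mult_SL:
  fixes h :: "real^'a::finite^'a"
  assumes "h \<in> SL"
  shows "distr lborel borel (\<lambda>A::real^'a^'a. A ** h) = lborel"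
proof (rule measure_eqI)
  fix X assume "X \<in> sets (distr lborel borel (\<lambda>A::real^'a^'a. A ** h))"
  then have [measurable]: "X \<in> sets borel" by simp
  have "right_scale 1 h"
    using right_scale_det[of h] assms by (simp add: SL_def)
  then have "(\<integral>\<^sup>+A. indicator X (A ** h) \<partial>lborel) * 1 = (\<integral>\<^sup>+A. indicator X A \<partial>lborel)"
    unfolding right_scale_def by (rule bspec) measurable
  moreover have "(\<integral>\<^sup>+A. indicator X (A ** h) \<partial>lborel) = (\<integral>\<^sup>+A. indicator X A \<partial>distr lborel borel (\<lambda>A. A ** h))"
    by (subst nn_integral_distr) auto
  ultimately show "emeasure (distr lborel borel (\<lambda>A. A ** h)) X = emeasure lborel X" by simp
qed simp

lemma integral_lborel_right_mult_SL:
  fixes F :: "real^'a::finite^'a \<Rightarrow> real"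
  assumes "h \<in> SL" "F \<in> borel_measurable borel"
  shows "(\<integral>A. F (A ** h) \<partial>lborel) = (\<integral>A. F A \<partial>lborel)"
proof -
  have "(\<integral>A. F A \<partial>lborel) = (\<integral>A. F A \<partial>distr lborel borel (\<lambda>A. A ** h))"
    using assms by (simp add: lborel_right_mult_SL)
  also have "\<dots> = (\<integral>A. F (A ** h) \<partial>lborel)"
    using assms by (subst integral_distr) auto
  finally show ?thesis ..
qed

subsection \<open>Smooth bump functions on matrices\<close>

text \<open>The powers of \<open>x\<close> in the denominator make the family closed under
  differentiation up to linear combinations; \<open>n = 0\<close> is the usual smooth function that
  is flat at the origin.\<close>

definition flat_exp :: "nat \<Rightarrow> real \<Rightarrow> real" where
  "flat_exp n x = (if x > 0 then exp (- 1 / x) / x ^ n else 0)"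

lemma flat_nonneg: "0 \<le> flat_exp n x"
  by (simp add: flat_exp_def)

text \<open>With \<open>y = 1 / x\<close> the claim says that the single term
  \<open>y ^ n / fact n\<close> is at most the whole exponential series.\<close>

lemma flat_le_fact: "flat_exp n x \<le> fact n"
proof (cases "x > 0")
  case True
  define y where "y = 1 / x"
  have y: "y > 0" using True by (simp add: y_def)
  have "(\<Sum>k\<in>{n}. inverse (fact k) *\<^sub>R y ^ k) \<le> (\<Sum>k. inverse (fact k) *\<^sub>R y ^ k)"
    by (rule sum_le_suminf) (use y summable_exp_generic[of y] in auto)
  then have "y ^ n / fact n \<le> exp y"
    by (simp add: exp_def divide_inverse mult.commute)
  then have "y ^ n \<le> fact n * exp y" by (simp add: field_simps)
  then have "y ^ n * exp (- y) \<le> fact n * exp y * exp (- y)" by (intro mult_right_mono) auto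
  also have "\<dots> = fact n" by (simp add: exp_minus)
  finally show ?thesis using True by (simp add: flat_exp_def y_def power_divide)
qed (simp add: flat_exp_def)

lemma flat_eq_mult_Suc: "flat_exp n x = x * flat_exp (Suc n) x"
  by (simp add: flat_exp_def)

lemma DERIV_flat: "(flat_exp n has_real_derivative (flat_exp (Suc (Suc n)) x - real n * flat_exp (Suc n) x)) (at x)"
proof -
  consider "x > 0" | "x < 0" | "x = 0" by linarith
  then show ?thesis
  proof cases
    case 1
    have e: "((\<lambda>x. exp (- 1 / x)) has_real_derivative exp (- 1 / x) / x\<^sup>2) (at x)"
      using 1 by (auto intro!: derivative_eq_intros simp: power2_eq_square)
    have p: "((\<lambda>x. inverse x ^ n) has_real_derivative - real n * inverse x ^ Suc n) (at x)"
    proof (cases n)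
      case (Suc m)
      have i: "(inverse has_real_derivative - (inverse x)\<^sup>2) (at x)"
        using 1 DERIV_inverse[of x UNIV] by (simp add: power2_eq_square)
      show ?thesis unfolding Suc
        by (rule DERIV_cong[OF DERIV_power_Suc[OF i, of m]]) (simp add: power2_eq_square algebra_simps)
    qed simp
    have "((\<lambda>x. exp (- 1 / x) * inverse x ^ n) has_real_derivative (flat_exp (Suc (Suc n)) x - real n * flat_exp (Suc n) x)) (at x)"
      by (rule DERIV_cong[OF DERIV_mult[OF e p]]) (use 1 in \<open>simp add: flat_exp_def field_simps power2_eq_square\<close>)
    then show ?thesis
      by (rule has_field_derivative_transform_within_open[where S="{0<..}"]) (use 1 in \<open>auto simp: flat_exp_def divide_inverse power_inverse\<close>)
  next
    case 2
    have "((\<lambda>x. 0) has_real_derivative (flat_exp (Suc (Suc n)) x - real n * flat_exp (Suc n) x)) (at x)"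
      using 2 by (simp add: flat_exp_def)
    then show ?thesis
      by (rule has_field_derivative_transform_within_open[where S="{..<0}"]) (use 2 in \<open>auto simp: flat_exp_def\<close>)
  next
    case 3
    \<comment> \<open>The difference quotient equals \<open>h\<close> times the member of the family
      of index \<open>n + 2\<close>, which is bounded.\<close>
    have "(\<lambda>h. flat_exp n h / h) \<midarrow>0\<rightarrow> 0"
    proof (rule Lim_null_comparison)
      show "\<forall>\<^sub>F h in at 0. norm (flat_exp n h / h) \<le> \<bar>h\<bar> * fact (Suc (Suc n))"
        unfolding eventually_at_filter
      proof (intro always_eventually allI impI)
        fix h :: real assume "h \<noteq> 0"
        have "flat_exp n h / h = h * flat_exp (Suc (Suc n)) h"
          using \<open>h \<noteq> 0\<close> by (simp add: flat_eq_mult_Suc[of n] flat_eq_mult_Suc[of "Suc n"])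
        then show "norm (flat_exp n h / h) \<le> \<bar>h\<bar> * fact (Suc (Suc n))"
          using flat_nonneg[of "Suc (Suc n)" h] flat_le_fact[of "Suc (Suc n)" h]
          by (auto simp: abs_mult simp del: fact_Suc intro!: mult_left_mono)
      qed
      show "((\<lambda>h. \<bar>h\<bar> * fact (Suc (Suc n))) \<longlongrightarrow> 0) (at (0::real))"
        by (auto intro!: tendsto_eq_intros)
    qed
    then show ?thesis using 3 by (simp add: DERIV_def flat_exp_def)
  qed
qed

text \<open>
  The families \<open>\<epsilon> \<mapsto> \<psi> \<epsilon>\<close> below are stable under differentiation in the matrix variable, and
  each of them is bounded by a power of \<open>1 / \<epsilon>\<close>; this is all that is used about \<open>C\<^sup>k\<close> norms.
\<close>

inductive test_family :: "(real \<Rightarrow> real^'a::finite^'a \<Rightarrow> real) \<Rightarrow> bool" where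
  const: "test_family (\<lambda>_ _. c)"
| scale: "test_family (\<lambda>\<epsilon> _. 1 / \<epsilon>)"
| coord: "test_family (\<lambda>_ A. A $ i $ j)"
| bump: "test_family (\<lambda>\<epsilon> A. flat_exp n (1 - (norm (A - mat 1) / \<epsilon>)\<^sup>2))"
| add: "test_family \<psi> \<Longrightarrow> test_family \<eta> \<Longrightarrow> test_family (\<lambda>\<epsilon> A. \<psi> \<epsilon> A + \<eta> \<epsilon> A)"
| mult: "test_family \<psi> \<Longrightarrow> test_family \<eta> \<Longrightarrow> test_family (\<lambda>\<epsilon> A. \<psi> \<epsilon> A * \<eta> \<epsilon> A)"

lemma test_family_sum:
  "finite S \<Longrightarrow> (\<And>i. i \<in> S \<Longrightarrow> test_family (\<psi> i)) \<Longrightarrow> test_family (\<lambda>\<epsilon> A. \<Sum>i\<in>S. \<psi> i \<epsilon> A)"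
  by (induction S rule: finite_induct) (auto intro: test_family.const test_family.add)

text \<open>The induction produces the whole matrix of partial derivatives at once, with each entry
  again in the class. Differentiating a bump brings out two factors \<open>1 / \<epsilon>\<close>,
  which is why \<open>scale\<close> is among the generators.\<close>

lemma test_family_derivative:
  fixes \<psi> :: "real \<Rightarrow> real^'a::finite^'a \<Rightarrow> real"
  assumes "test_family \<psi>"
  shows "\<exists>D. (\<forall>i j. test_family (D i j)) \<and>
    (\<forall>\<epsilon>>0. \<forall>A. (\<psi> \<epsilon> has_derivative (\<lambda>H. \<Sum>i\<in>UNIV. \<Sum>j\<in>UNIV. D i j \<epsilon> A * H $ i $ j)) (at A))"
  using assms
proof induction
  case (const c)
  show ?case
    by (rule exI[of _ "\<lambda>_ _ _ _. 0"]) (auto intro: test_family.const)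
next
  case scale
  show ?case
    by (rule exI[of _ "\<lambda>_ _ _ _. 0"]) (auto intro: test_family.const)
next
  case (coord i j)
  have "((\<lambda>A::real^'a^'a. A $ i $ j) has_derivative (\<lambda>H. \<Sum>k\<in>UNIV. \<Sum>l\<in>UNIV. (if k = i then if l = j then 1 else 0 else 0) * H $ k $ l)) (at A)" for A
  proof -
    have "bounded_linear (\<lambda>A::real^'a^'a. A $ i $ j)"
      by (intro bounded_linear_compose[OF bounded_linear_vec_nth] bounded_linear_vec_nth)
    then have "((\<lambda>A::real^'a^'a. A $ i $ j) has_derivative (\<lambda>H. H $ i $ j)) (at A)"
      by (rule bounded_linear_imp_has_derivative)
    moreover have "(\<Sum>k\<in>UNIV. \<Sum>l\<in>UNIV. (if k = i then if l = j then 1 else 0 else 0) * H $ k $ l) = H $ i $ j" for H :: "real^'a^'a"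
    proof -
      have "(\<Sum>k\<in>UNIV. \<Sum>l\<in>UNIV. (if k = i then if l = j then 1 else 0 else 0) * H $ k $ l)
        = (\<Sum>k\<in>UNIV. if k = i then (\<Sum>l\<in>UNIV. if l = j then H $ i $ j else 0) else 0)"
        by (intro sum.cong refl) (simp add: if_distrib[of "\<lambda>x. x * _"] cong: if_cong)
      then show ?thesis by simp
    qed
    ultimately show ?thesis by simp
  qed
  then show ?case
    by (intro exI[of _ "\<lambda>k l _ _. if k = i then if l = j then 1 else 0 else 0"]) (auto intro: test_family.const)
next
  case (bump n)
  define q where "q \<epsilon> A = 1 - (norm (A - mat 1) / \<epsilon>)\<^sup>2" for \<epsilon> and A :: "real^'a^'a"
  define D where "D i j \<epsilon> A = (flat_exp (Suc (Suc n)) (1 - (norm (A - mat 1) / \<epsilon>)\<^sup>2) + (- real n) * flat_exp (Suc n) (1 - (norm (A - mat 1) / \<epsilon>)\<^sup>2))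
      * ((- 2) * ((1 / \<epsilon>) * (1 / \<epsilon>)) * (A $ i $ j + - (mat 1 $ i $ j)))" for i j \<epsilon> and A :: "real^'a^'a"
  have "test_family (D i j)" for i j
    unfolding D_def by (intro test_family.intros)
  moreover have "((\<lambda>A. flat_exp n (q \<epsilon> A)) has_derivative (\<lambda>H. \<Sum>i\<in>UNIV. \<Sum>j\<in>UNIV. D i j \<epsilon> A * H $ i $ j)) (at A)"
    if "\<epsilon> > 0" for \<epsilon> A
  proof -
    have q_eq: "q \<epsilon> = (\<lambda>A. 1 - ((A - mat 1) \<bullet> (A - mat 1)) * (1 / \<epsilon>)\<^sup>2)"
      by (simp add: q_def fun_eq_iff power_divide power2_norm_eq_inner)
    have dq: "(q \<epsilon> has_derivative (\<lambda>H. - (2 * ((A - mat 1) \<bullet> H) * (1 / \<epsilon>)\<^sup>2))) (at A)"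
      unfolding q_eq by (auto intro!: derivative_eq_intros simp: inner_commute)
    have "((\<lambda>A. flat_exp n (q \<epsilon> A)) has_derivative (\<lambda>H. - (2 * ((A - mat 1) \<bullet> H) * (1 / \<epsilon>)\<^sup>2) * (flat_exp (Suc (Suc n)) (q \<epsilon> A) - real n * flat_exp (Suc n) (q \<epsilon> A)))) (at A)"
      by (rule has_derivative_eq_rhs[OF has_derivative_compose[OF dq DERIV_flat[unfolded has_field_derivative_def]]])
         (simp add: fun_eq_iff mult.commute)
    moreover have "(\<Sum>i\<in>UNIV. \<Sum>j\<in>UNIV. D i j \<epsilon> A * H $ i $ j) = - (2 * ((A - mat 1) \<bullet> H) * (1 / \<epsilon>)\<^sup>2) * (flat_exp (Suc (Suc n)) (q \<epsilon> A) - real n * flat_exp (Suc n) (q \<epsilon> A))" for H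
    proof -
      define K where "K = - (2 * (1 / \<epsilon>)\<^sup>2) * (flat_exp (Suc (Suc n)) (q \<epsilon> A) - real n * flat_exp (Suc n) (q \<epsilon> A))"
      have alg: "(a + (- r) * b) * ((- 2) * (e * e) * (x + - y)) = - (2 * e\<^sup>2) * (a - r * b) * (x - y)"
        for a b r e x y :: real
        by (simp add: power2_eq_square algebra_simps)
      have "D i j \<epsilon> A = K * (A - mat 1) $ i $ j" for i j
        unfolding D_def K_def q_def[symmetric] vector_minus_component by (rule alg)
      then have "(\<Sum>i\<in>UNIV. \<Sum>j\<in>UNIV. D i j \<epsilon> A * H $ i $ j) = K * ((A - mat 1) \<bullet> H)"
        by (simp add: inner_vec_def sum_distrib_left mult.assoc)
      then show ?thesis by (simp add: K_def)
    qed
    ultimately show ?thesis by simp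
  qed
  ultimately show ?case
    by (intro exI[of _ D] conjI allI impI) (simp_all only: q_def)
next
  case (add \<psi> \<eta>)
  obtain D where D1: "(\<forall>i j. test_family (D i j)) \<and>
    (\<forall>\<epsilon>>0. \<forall>A. (\<psi> \<epsilon> has_derivative (\<lambda>H. \<Sum>i\<in>UNIV. \<Sum>j\<in>UNIV. D i j \<epsilon> A * H $ i $ j)) (at A))"
    using add.IH(1) by (elim exE) (rule that)
  obtain E where E1: "(\<forall>i j. test_family (E i j)) \<and>
    (\<forall>\<epsilon>>0. \<forall>A. (\<eta> \<epsilon> has_derivative (\<lambda>H. \<Sum>i\<in>UNIV. \<Sum>j\<in>UNIV. E i j \<epsilon> A * H $ i $ j)) (at A))"
    using add.IH(2) by (elim exE) (rule that)
  have D: "test_family (D i j)" "test_family (E i j)" for i j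
    using D1 E1 by simp_all
  have d: "(\<psi> \<epsilon> has_derivative (\<lambda>H. \<Sum>i\<in>UNIV. \<Sum>j\<in>UNIV. D i j \<epsilon> A * H $ i $ j)) (at A)"
      "(\<eta> \<epsilon> has_derivative (\<lambda>H. \<Sum>i\<in>UNIV. \<Sum>j\<in>UNIV. E i j \<epsilon> A * H $ i $ j)) (at A)" if "\<epsilon> > 0" for \<epsilon> A
    using D1 E1 that by simp_all
  have "((\<lambda>A. \<psi> \<epsilon> A + \<eta> \<epsilon> A) has_derivative (\<lambda>H. \<Sum>i\<in>UNIV. \<Sum>j\<in>UNIV. (D i j \<epsilon> A + E i j \<epsilon> A) * H $ i $ j)) (at A)" if "\<epsilon> > 0" for \<epsilon> A
    using has_derivative_add[OF d(1)[OF that, of A] d(2)[OF that, of A]] by (simp add: sum.distrib distrib_right)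
  then show ?case
    using D by (intro exI[of _ "\<lambda>i j \<epsilon> A. D i j \<epsilon> A + E i j \<epsilon> A"] conjI allI impI test_family.add)
next
  case (mult \<psi> \<eta>)
  obtain D where D1: "(\<forall>i j. test_family (D i j)) \<and>
    (\<forall>\<epsilon>>0. \<forall>A. (\<psi> \<epsilon> has_derivative (\<lambda>H. \<Sum>i\<in>UNIV. \<Sum>j\<in>UNIV. D i j \<epsilon> A * H $ i $ j)) (at A))"
    using mult.IH(1) by (elim exE) (rule that)
  obtain E where E1: "(\<forall>i j. test_family (E i j)) \<and>
    (\<forall>\<epsilon>>0. \<forall>A. (\<eta> \<epsilon> has_derivative (\<lambda>H. \<Sum>i\<in>UNIV. \<Sum>j\<in>UNIV. E i j \<epsilon> A * H $ i $ j)) (at A))"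
    using mult.IH(2) by (elim exE) (rule that)
  have D: "test_family (D i j)" "test_family (E i j)" for i j
    using D1 E1 by simp_all
  have d: "(\<psi> \<epsilon> has_derivative (\<lambda>H. \<Sum>i\<in>UNIV. \<Sum>j\<in>UNIV. D i j \<epsilon> A * H $ i $ j)) (at A)"
      "(\<eta> \<epsilon> has_derivative (\<lambda>H. \<Sum>i\<in>UNIV. \<Sum>j\<in>UNIV. E i j \<epsilon> A * H $ i $ j)) (at A)" if "\<epsilon> > 0" for \<epsilon> A
    using D1 E1 that by simp_all
  have "((\<lambda>A. \<psi> \<epsilon> A * \<eta> \<epsilon> A) has_derivative (\<lambda>H. \<Sum>i\<in>UNIV. \<Sum>j\<in>UNIV. (\<psi> \<epsilon> A * E i j \<epsilon> A + D i j \<epsilon> A * \<eta> \<epsilon> A) * H $ i $ j)) (at A)" if "\<epsilon> > 0" for \<epsilon> A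
    using has_derivative_mult[OF d(1)[OF that, of A] d(2)[OF that, of A]]
    by (simp add: sum.distrib algebra_simps sum_distrib_left sum_distrib_right)
  then show ?case
    using D mult.hyps by (intro exI[of _ "\<lambda>i j \<epsilon> A. \<psi> \<epsilon> A * E i j \<epsilon> A + D i j \<epsilon> A * \<eta> \<epsilon> A"] conjI allI impI test_family.add test_family.mult)
qed

lemma test_family_continuous:
  assumes "test_family \<psi>" "\<epsilon> > 0"
  shows "continuous_on S (\<psi> \<epsilon>)"
proof -
  obtain D where "\<forall>A. (\<psi> \<epsilon> has_derivative (\<lambda>H. \<Sum>i\<in>UNIV. \<Sum>j\<in>UNIV. D i j \<epsilon> A * H $ i $ j)) (at A)"
    using test_family_derivative[OF assms(1)] assms(2) by blast
  then have "isCont (\<psi> \<epsilon>) A" for A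
    using has_derivative_continuous by blast
  then show ?thesis by (simp add: continuous_at_imp_continuous_on)
qed

lemma abs_nth2_le_norm: "\<bar>A $ i $ j\<bar> \<le> norm (A :: real^'b::finite^'a::finite)"
  using Finite_Cartesian_Product.norm_nth_le[of "A $ i" j] Finite_Cartesian_Product.norm_nth_le[of A i] by auto

text \<open>Coordinates are unbounded, hence the restriction to the unit ball around the identity.
  Since \<open>1 / \<epsilon> \<ge> 1\<close>, bounds of this form survive sums as well as products
  once the exponents are added.\<close>

lemma test_family_bound:
  fixes \<psi> :: "real \<Rightarrow> real^'a::finite^'a \<Rightarrow> real"
  assumes "test_family \<psi>"
  shows "\<exists>C\<ge>0. \<exists>L. \<forall>\<epsilon> A. 0 < \<epsilon> \<longrightarrow> \<epsilon> \<le> 1 \<longrightarrow> norm (A - mat 1) \<le> 1 \<longrightarrow> \<bar>\<psi> \<epsilon> A\<bar> \<le> C * (1 / \<epsilon>) ^ L"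
  using assms
proof induction
  case (const c)
  show ?case by (intro exI[of _ "\<bar>c\<bar>"] conjI exI[of _ "0::nat"]) auto
next
  case scale
  show ?case by (intro exI[of _ "1::real"] conjI exI[of _ "1::nat"]) auto
next
  case (coord i j)
  have "\<bar>A $ i $ j\<bar> \<le> 1 + norm (mat 1 :: real^'a^'a)" if "norm (A - mat 1) \<le> 1" for A :: "real^'a^'a"
    using abs_nth2_le_norm[of A i j] norm_triangle_ineq[of "A - mat 1" "mat 1"] that by simp
  then show ?case
    by (intro exI[of _ "1 + norm (mat 1 :: real^'a^'a)"] conjI exI[of _ "0::nat"]) auto
next
  case (bump n)
  show ?case
    by (intro exI[of _ "fact n"] conjI exI[of _ "0::nat"]) (auto simp: flat_nonneg flat_le_fact)
next
  case (add \<psi> \<eta>)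
  then obtain C K C' K' where C: "C \<ge> 0" "C' \<ge> 0"
    and b: "\<And>\<epsilon> A. 0 < \<epsilon> \<Longrightarrow> \<epsilon> \<le> 1 \<Longrightarrow> norm (A - mat 1) \<le> 1 \<Longrightarrow> \<bar>\<psi> \<epsilon> A\<bar> \<le> C * (1 / \<epsilon>) ^ K"
     "\<And>\<epsilon> A. 0 < \<epsilon> \<Longrightarrow> \<epsilon> \<le> 1 \<Longrightarrow> norm (A - mat 1) \<le> 1 \<Longrightarrow> \<bar>\<eta> \<epsilon> A\<bar> \<le> C' * (1 / \<epsilon>) ^ K'"
    by metis
  have "\<bar>\<psi> \<epsilon> A + \<eta> \<epsilon> A\<bar> \<le> (C + C') * (1 / \<epsilon>) ^ (K + K')"
    if "0 < \<epsilon>" "\<epsilon> \<le> 1" "norm (A - mat 1) \<le> 1" for \<epsilon> and A :: "real^'a^'a"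
  proof -
    have "(1 / \<epsilon>) ^ K \<le> (1 / \<epsilon>) ^ (K + K')" "(1 / \<epsilon>) ^ K' \<le> (1 / \<epsilon>) ^ (K + K')"
      using that by (auto intro!: power_increasing)
    then have "C * (1 / \<epsilon>) ^ K \<le> C * (1 / \<epsilon>) ^ (K + K')" "C' * (1 / \<epsilon>) ^ K' \<le> C' * (1 / \<epsilon>) ^ (K + K')"
      using C by (auto intro!: mult_left_mono)
    then show ?thesis using b(1)[OF that] b(2)[OF that] unfolding distrib_right by linarith
  qed
  then show ?case using C by (intro exI[of _ "C + C'"] conjI exI[of _ "K + K'"]) auto
next
  case (mult \<psi> \<eta>)
  then obtain C K C' K' where C: "C \<ge> 0" "C' \<ge> 0"
    and b: "\<And>\<epsilon> A. 0 < \<epsilon> \<Longrightarrow> \<epsilon> \<le> 1 \<Longrightarrow> norm (A - mat 1) \<le> 1 \<Longrightarrow> \<bar>\<psi> \<epsilon> A\<bar> \<le> C * (1 / \<epsilon>) ^ K"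
     "\<And>\<epsilon> A. 0 < \<epsilon> \<Longrightarrow> \<epsilon> \<le> 1 \<Longrightarrow> norm (A - mat 1) \<le> 1 \<Longrightarrow> \<bar>\<eta> \<epsilon> A\<bar> \<le> C' * (1 / \<epsilon>) ^ K'"
    by metis
  have "\<bar>\<psi> \<epsilon> A * \<eta> \<epsilon> A\<bar> \<le> (C * C') * (1 / \<epsilon>) ^ (K + K')"
    if "0 < \<epsilon>" "\<epsilon> \<le> 1" "norm (A - mat 1) \<le> 1" for \<epsilon> and A :: "real^'a^'a"
    using mult_mono[OF b(1)[OF that] b(2)[OF that]] that C by (simp add: abs_mult power_add mult_ac)
  then show ?case using C by (intro exI[of _ "C * C'"] conjI exI[of _ "K + K'"]) auto
qed

text \<open>Constants and coordinates lack compact support, so the support is prescribed separately;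
  differentiation will preserve it.\<close>

definition test_fun :: "(real \<Rightarrow> real^'a::finite^'a \<Rightarrow> real) \<Rightarrow> bool" where
  "test_fun \<psi> \<longleftrightarrow> test_family \<psi> \<and> (\<forall>\<epsilon>>0. \<forall>A. norm (A - mat 1) > \<epsilon> \<longrightarrow> \<psi> \<epsilon> A = 0)"

lemma test_fun_bound:
  assumes "test_fun \<psi>"
  shows "\<exists>C\<ge>0. \<exists>L. \<forall>\<epsilon> A. 0 < \<epsilon> \<longrightarrow> \<epsilon> \<le> 1 \<longrightarrow> \<bar>\<psi> \<epsilon> A\<bar> \<le> C * (1 / \<epsilon>) ^ L"
proof -
  obtain C L where C: "C \<ge> 0" "\<And>\<epsilon> A. 0 < \<epsilon> \<Longrightarrow> \<epsilon> \<le> 1 \<Longrightarrow> norm (A - mat 1) \<le> 1 \<Longrightarrow> \<bar>\<psi> \<epsilon> A\<bar> \<le> C * (1 / \<epsilon>) ^ L"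
    using test_family_bound[of \<psi>] assms unfolding test_fun_def by metis
  have "\<bar>\<psi> \<epsilon> A\<bar> \<le> C * (1 / \<epsilon>) ^ L" if "0 < \<epsilon>" "\<epsilon> \<le> 1" for \<epsilon> A
  proof (cases "norm (A - mat 1) \<le> 1")
    case False
    then have "\<psi> \<epsilon> A = 0" using assms that by (auto simp: test_fun_def)
    then show ?thesis using C that by simp
  qed (use C that in auto)
  then show ?thesis using C by blast
qed

text \<open>When a lattice is moved by \<open>mexp (t *\<^sub>R Y)\<close>, the kernel is moved by
  right multiplication with the inverse; \<open>\<eta>\<close> is the resulting derivative, taken at
  \<open>A\<close> in the direction \<open>- (A ** Y)\<close>. It is determined by
  \<open>\<psi>\<close> and \<open>Y\<close>, independently of the function to be smoothed.\<close>

lemma test_fun_deriv: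
  fixes \<psi> :: "real \<Rightarrow> real^'a::finite^'a \<Rightarrow> real" and Y :: "real^'a^'a"
  assumes "test_fun \<psi>"
  shows "\<exists>\<eta>. test_fun \<eta> \<and> (\<forall>\<epsilon>>0. \<forall>A t.
    ((\<lambda>t. \<psi> \<epsilon> (A ** mexp ((- t) *\<^sub>R Y))) has_real_derivative \<eta> \<epsilon> (A ** mexp ((- t) *\<^sub>R Y))) (at t))"
proof -
  have tf: "test_family \<psi>" and supp: "\<And>\<epsilon> A. \<epsilon> > 0 \<Longrightarrow> norm (A - mat 1) > \<epsilon> \<Longrightarrow> \<psi> \<epsilon> A = 0"
    using assms by (auto simp: test_fun_def)
  obtain D where D1: "(\<forall>i j. test_family (D i j)) \<and>
    (\<forall>\<epsilon>>0. \<forall>A. (\<psi> \<epsilon> has_derivative (\<lambda>H. \<Sum>i\<in>UNIV. \<Sum>j\<in>UNIV. D i j \<epsilon> A * H $ i $ j)) (at A))"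
    using test_family_derivative[OF tf] by (elim exE) (rule that)
  have D: "test_family (D i j)" for i j
    using D1 by simp
  have d: "(\<psi> \<epsilon> has_derivative (\<lambda>H. \<Sum>i\<in>UNIV. \<Sum>j\<in>UNIV. D i j \<epsilon> A * H $ i $ j)) (at A)" if "\<epsilon> > 0" for \<epsilon> A
    using D1 that by simp
  define \<eta> where "\<eta> \<epsilon> A = (\<Sum>i\<in>UNIV. \<Sum>j\<in>UNIV. D i j \<epsilon> A * ((- 1) * (\<Sum>k\<in>UNIV. A $ i $ k * Y $ k $ j)))" for \<epsilon> A
  have \<eta>_eq: "\<eta> \<epsilon> A = (\<Sum>i\<in>UNIV. \<Sum>j\<in>UNIV. D i j \<epsilon> A * (- (A ** Y)) $ i $ j)" for \<epsilon> A
    by (simp add: \<eta>_def matrix_matrix_mult_def)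
  have "test_family \<eta>"
    unfolding \<eta>_def by (intro test_family_sum test_family.mult test_family.const test_family.coord D) auto
  moreover have "\<eta> \<epsilon> A = 0" if "\<epsilon> > 0" "norm (A - mat 1) > \<epsilon>" for \<epsilon> A
  proof -
    \<comment> \<open>Outside the closed ball \<open>\<psi> \<epsilon>\<close> vanishes on an open
      set, so its derivative there is that of the constant \<open>0\<close>.\<close>
    have "((\<lambda>_. 0) has_derivative (\<lambda>H. \<Sum>i\<in>UNIV. \<Sum>j\<in>UNIV. D i j \<epsilon> A * H $ i $ j)) (at A)"
    proof (rule has_derivative_transform_within_open[OF d[OF that(1)]])
      show "open {B :: real^'a^'a. norm (B - mat 1) > \<epsilon>}"
        by (intro open_Collect_less continuous_intros)
    qed (use that supp in auto)
    then have "(\<lambda>H. \<Sum>i\<in>UNIV. \<Sum>j\<in>UNIV. D i j \<epsilon> A * H $ i $ j) = (\<lambda>_. 0)"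
      using has_derivative_unique has_derivative_const by blast
    then show ?thesis unfolding \<eta>_eq by (rule fun_cong)
  qed
  moreover have "((\<lambda>t. \<psi> \<epsilon> (A ** mexp ((- t) *\<^sub>R Y))) has_real_derivative \<eta> \<epsilon> (A ** mexp ((- t) *\<^sub>R Y))) (at t)"
    if "\<epsilon> > 0" for \<epsilon> A t
  proof -
    have "((\<lambda>t. mexp ((- t) *\<^sub>R Y)) has_vector_derivative ((- 1) *\<^sub>R (Y ** mexp ((- t) *\<^sub>R Y)))) (at t)"
      by (rule vector_diff_chain_at[OF _ has_vector_derivative_mexp, of uminus, unfolded o_def])
         (auto intro!: derivative_eq_intros)
    then have "((\<lambda>t. A ** mexp ((- t) *\<^sub>R Y)) has_vector_derivative (A ** ((- 1) *\<^sub>R (Y ** mexp ((- t) *\<^sub>R Y))))) (at t)"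
      by (rule bounded_linear.has_vector_derivative[OF matmul.bounded_linear_right])
    then have "((\<lambda>t. A ** mexp ((- t) *\<^sub>R Y)) has_derivative (\<lambda>h. h *\<^sub>R (- (A ** mexp ((- t) *\<^sub>R Y) ** Y)))) (at t)"
      by (simp add: has_vector_derivative_def mexp_commute[of Y "- t"] matmul.minus_right matrix_mul_assoc del: scaleR_minus_left)
    from has_derivative_compose[OF this d[OF that]]
    have "((\<lambda>t. \<psi> \<epsilon> (A ** mexp ((- t) *\<^sub>R Y))) has_derivative (\<lambda>h. \<Sum>i\<in>UNIV. \<Sum>j\<in>UNIV. D i j \<epsilon> (A ** mexp ((- t) *\<^sub>R Y)) * (h *\<^sub>R (- (A ** mexp ((- t) *\<^sub>R Y) ** Y))) $ i $ j)) (at t)" .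
    moreover have "(\<lambda>h. \<Sum>i\<in>UNIV. \<Sum>j\<in>UNIV. D i j \<epsilon> (A ** mexp ((- t) *\<^sub>R Y)) * (h *\<^sub>R (- (A ** mexp ((- t) *\<^sub>R Y) ** Y))) $ i $ j) = (*) (\<eta> \<epsilon> (A ** mexp ((- t) *\<^sub>R Y)))"
      by (simp add: \<eta>_eq fun_eq_iff sum_distrib_left sum_distrib_right mult_ac sum_negf)
    ultimately show ?thesis by (simp add: has_field_derivative_def)
  qed
  ultimately show ?thesis unfolding test_fun_def by blast
qed

lemma test_fun_bump: "test_fun (\<lambda>\<epsilon> A. flat_exp 0 (1 - (norm (A - mat 1) / \<epsilon>)\<^sup>2))"
  unfolding test_fun_def
proof (intro conjI allI impI test_family.bump)
  fix \<epsilon> :: real and A :: "real^'a^'a" assume "0 < \<epsilon>" "\<epsilon> < norm (A - mat 1)"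
  then have "1 < (norm (A - mat 1) / \<epsilon>)\<^sup>2" by (simp add: one_less_power)
  then show "flat_exp 0 (1 - (norm (A - mat 1) / \<epsilon>)\<^sup>2) = 0" by (simp add: flat_exp_def)
qed

subsection \<open>The space of lattices\<close>

lemma closed_SL: "closed (SL :: (real^'a::finite^'a) set)"
  unfolding SL_def by (intro closed_Collect_eq continuous_intros)

lemma closed_SLZ: "closed (SLZ :: (real^'a::finite^'a) set)"
proof -
  have "SLZ = SL \<inter> (\<Inter>i j. (\<lambda>A::real^'a^'a. A $ i $ j) -` \<int>)"
    by (auto simp: SLZ_def)
  moreover have "closed (SL \<inter> (\<Inter>i j. (\<lambda>A::real^'a^'a. A $ i $ j) -` \<int>))"
    by (intro closed_Int closed_SL closed_INT ballI closed_vimage closed_Ints continuous_intros)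
  ultimately show ?thesis by simp
qed

lemma SLZ_SL: "\<gamma> \<in> SLZ \<Longrightarrow> \<gamma> \<in> SL"
  by (simp add: SLZ_def)

lemma SLZ_mat_1 [simp]: "mat 1 \<in> SLZ"
  by (simp add: SLZ_def mat_nth)

lemma SLZ_mult: "\<gamma> \<in> SLZ \<Longrightarrow> \<eta> \<in> SLZ \<Longrightarrow> \<gamma> ** \<eta> \<in> SLZ"
  unfolding SLZ_def using SL_mult[of \<gamma> \<eta>] by (auto simp: matrix_matrix_mult_def intro!: Ints_sum Ints_mult)

lemma det_Ints:
  fixes A :: "real^'a::finite^'a"
  assumes "\<And>i j. A $ i $ j \<in> \<int>"
  shows "det A \<in> \<int>"
  unfolding det_def by (intro Ints_sum Ints_mult Ints_of_int Ints_prod assms)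

lemma SLZ_inv:
  assumes "\<gamma> \<in> SLZ"
  shows "matrix_inv \<gamma> \<in> SLZ"
proof -
  have "matrix_inv \<gamma> $ k $ j \<in> \<int>" for k j
    using assms by (subst matrix_inv_SL_cramer) (auto simp: SLZ_def SL_def intro!: det_Ints)
  then show ?thesis
    using assms matrix_inv_SL(3) by (auto simp: SLZ_def)
qed

lemma lcoset_mult_SLZ:
  assumes "\<gamma> \<in> SLZ"
  shows "lcoset (g ** \<gamma>) = lcoset g"
proof -
  have "x \<in> (\<lambda>\<gamma>. g ** \<gamma>) ` SLZ" if "x = g ** \<gamma> ** \<eta>" "\<eta> \<in> SLZ" for x \<eta>
    using that assms by (auto simp: SLZ_mult matrix_mul_assoc[symmetric])
  moreover have "x \<in> (\<lambda>\<eta>. g ** \<gamma> ** \<eta>) ` SLZ" if "x = g ** \<eta>" "\<eta> \<in> SLZ" for x \<eta>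
  proof
    have "\<gamma> ** (matrix_inv \<gamma> ** \<eta>) = \<eta>"
      using matrix_inv_SL(1)[OF SLZ_SL[OF assms]] by (simp add: matrix_mul_assoc)
    then show "x = g ** \<gamma> ** (matrix_inv \<gamma> ** \<eta>)"
      using that by (metis matrix_mul_assoc)
    show "matrix_inv \<gamma> ** \<eta> \<in> SLZ" using that assms by (intro SLZ_mult SLZ_inv)
  qed
  ultimately show ?thesis unfolding lcoset_def by blast
qed

lemma lcoset_eq_iff: "lcoset g = lcoset h \<longleftrightarrow> (\<exists>\<gamma>\<in>SLZ. g = h ** \<gamma>)"
proof
  assume "lcoset g = lcoset h"
  moreover have "g \<in> lcoset g"
    unfolding lcoset_def by (rule image_eqI[of _ _ "mat 1"]) auto
  ultimately show "\<exists>\<gamma>\<in>SLZ. g = h ** \<gamma>" by (auto simp: lcoset_def)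
qed (auto simp: lcoset_mult_SLZ)

lemma act_lcoset: "act g (lcoset h) = lcoset (g ** h)"
  by (auto simp: act_def lcoset_def image_image matrix_mul_assoc)

lemma act_mult: "act (g ** h) \<Lambda> = act g (act h \<Lambda>)"
  by (auto simp: act_def image_image matrix_mul_assoc)

lemma act_mat_1 [simp]: "act (mat 1) \<Lambda> = \<Lambda>"
  by (simp add: act_def)

lemma lcoset_lattices: "g \<in> SL \<Longrightarrow> lcoset g \<in> lattices"
  by (simp add: lattices_def)

lemma lattices_cases:
  assumes "\<Lambda> \<in> lattices"
  obtains g where "g \<in> SL" "\<Lambda> = lcoset g"
  using assms by (auto simp: lattices_def)

lemma act_lattices: "g \<in> SL \<Longrightarrow> \<Lambda> \<in> lattices \<Longrightarrow> act g \<Lambda> \<in> lattices"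
  by (auto elim!: lattices_cases simp: act_lcoset SL_mult lcoset_lattices)

lemma act_inv:
  assumes "g \<in> SL"
  shows "act (matrix_inv g) (act g \<Lambda>) = \<Lambda>" "act g (act (matrix_inv g) \<Lambda>) = \<Lambda>"
  using matrix_inv_SL[OF assms] by (simp_all add: act_mult[symmetric])

lemma continuous_map_lattice_topology:
  assumes "continuous_on SL (\<lambda>g. \<phi> (lcoset g))"
  shows "continuous_map lattice_topology euclideanreal \<phi>"
  unfolding continuous_map_def topspace_lattice_topology openin_lattice_topology
proof (intro conjI allI impI)
  fix U :: "real set" assume "openin euclideanreal U"
  then have "open U" by simp
  from continuous_openin_preimage_gen[OF assms this]
  have "openin (top_of_set SL) (SL \<inter> (\<lambda>g. \<phi> (lcoset g)) -` U)" .
  moreover have "SL \<inter> (\<lambda>g. \<phi> (lcoset g)) -` U = {g \<in> SL. lcoset g \<in> {x \<in> lattices. \<phi> x \<in> U}}"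
    by (auto simp: lcoset_lattices)
  ultimately show "openin (top_of_set SL) {g \<in> SL. lcoset g \<in> {x \<in> lattices. \<phi> x \<in> U}}" by simp
qed auto

text \<open>The saturation of an open set is the union of its preimages under right translations by
  \<open>SLZ\<close>, each of them open.\<close>

lemma openin_lcoset_image:
  assumes "open U"
  shows "openin lattice_topology (lcoset ` (SL \<inter> U))"
  unfolding openin_lattice_topology
proof
  have "{g \<in> SL. lcoset g \<in> lcoset ` (SL \<inter> U)} = SL \<inter> (\<Union>\<gamma>\<in>SLZ. (\<lambda>g. g ** \<gamma>) -` U)"
  proof (intro set_eqI iffI; clarsimp)
    fix g h assume "g \<in> SL" "lcoset g = lcoset h" "h \<in> SL" "h \<in> U"
    then obtain \<gamma> where "\<gamma> \<in> SLZ" "h = g ** \<gamma>" using lcoset_eq_iff[of h g] by auto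
    then show "\<exists>x\<in>SLZ. g ** x \<in> U" using \<open>h \<in> U\<close> by auto
  next
    fix g \<gamma> assume *: "g \<in> SL" "\<gamma> \<in> SLZ" "g ** \<gamma> \<in> U"
    then have "g ** \<gamma> \<in> SL \<inter> U" by (simp add: SL_mult SLZ_SL)
    then show "lcoset g \<in> lcoset ` (SL \<inter> U)"
      using lcoset_mult_SLZ[OF *(2), of g] by (metis image_eqI)
  qed
  moreover have "open (\<Union>\<gamma>\<in>SLZ. (\<lambda>g. g ** \<gamma>) -` U)"
    by (intro open_UN ballI open_vimage assms continuous_intros)
  ultimately show "openin (top_of_set SL) {g \<in> SL. lcoset g \<in> lcoset ` (SL \<inter> U)}"
    by (simp add: openin_open_Int)
qed (auto simp: lcoset_lattices)

text \<open>The saturation of \<open>K\<close> is closed because \<open>K\<close> is compact and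
  \<open>SLZ\<close> closed: in a convergent sequence of products the factors from \<open>K\<close>
  have a convergent subsequence, and along it the factors from \<open>SLZ\<close> converge
  too.\<close>

lemma closedin_lcoset_compact:
  fixes K :: "(real^'a::finite^'a) set"
  assumes "compact K" "K \<subseteq> SL"
  shows "closedin lattice_topology (lcoset ` K)"
proof -
  define P where "P = (\<Union>k\<in>K. \<Union>\<gamma>\<in>SLZ. {k ** \<gamma>})"
  have "closed P"
    unfolding closed_sequential_limits
  proof (intro allI impI, elim conjE)
    fix x :: "nat \<Rightarrow> real^'a^'a" and l assume x: "\<forall>n. x n \<in> P" "x \<longlonglongrightarrow> l"
    then have "\<forall>n. \<exists>k \<gamma>. k \<in> K \<and> \<gamma> \<in> SLZ \<and> x n = k ** \<gamma>"
      unfolding P_def by blast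
    then obtain k \<gamma> where k: "\<And>n. k n \<in> K" "\<And>n. \<gamma> n \<in> SLZ" "\<And>n. x n = k n ** \<gamma> n" by metis
    obtain k0 r where r: "k0 \<in> K" "strict_mono r" "(k \<circ> r) \<longlonglongrightarrow> k0"
      using \<open>compact K\<close> k(1) unfolding compact_def by metis
    have k0: "k0 \<in> SL" using r assms by auto
    have "(\<lambda>n. matrix_inv ((k \<circ> r) n)) \<longlonglongrightarrow> matrix_inv k0"
      by (rule continuous_on_tendsto_compose[OF continuous_on_matrix_inv r(3) k0])
         (use k(1) assms(2) in \<open>auto intro!: always_eventually\<close>)
    from matmul.tendsto[OF this LIMSEQ_subseq_LIMSEQ[OF x(2) r(2)]]
    have "(\<lambda>n. matrix_inv (k (r n)) ** x (r n)) \<longlonglongrightarrow> matrix_inv k0 ** l" by (simp add: o_def)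
    moreover have "matrix_inv (k (r n)) ** x (r n) = \<gamma> (r n)" for n
      using k(1)[of "r n"] assms(2) matrix_inv_SL(2)[of "k (r n)"] by (auto simp: k(3) matrix_mul_assoc)
    ultimately have "(\<lambda>n. \<gamma> (r n)) \<longlonglongrightarrow> matrix_inv k0 ** l" by simp
    then have "matrix_inv k0 ** l \<in> SLZ"
      using closed_SLZ k(2) unfolding closed_sequential_limits by metis
    moreover have "k0 ** (matrix_inv k0 ** l) = l"
      using matrix_inv_SL(1)[OF k0] by (simp add: matrix_mul_assoc)
    ultimately show "l \<in> P" unfolding P_def using r(1) by force
  qed
  then have "openin (top_of_set SL) (SL \<inter> - P)" by (intro openin_open_Int) auto
  moreover have "{g \<in> SL. lcoset g \<in> lattices - lcoset ` K} = SL \<inter> - P"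
    using assms(2) by (auto simp: P_def lcoset_lattices image_iff lcoset_eq_iff)
  ultimately show ?thesis
    unfolding closedin_def topspace_lattice_topology openin_lattice_topology
    using assms(2) by (auto simp: lcoset_lattices)
qed

lemma continuous_map_lcoset: "continuous_map (top_of_set SL) lattice_topology lcoset"
  unfolding continuous_map_def topspace_lattice_topology
  by (auto simp: lcoset_lattices openin_lattice_topology)

lemma compactin_lcoset_compact:
  assumes "compact K" "K \<subseteq> SL"
  shows "compactin lattice_topology (lcoset ` K)"
  using assms by (intro image_compactin[OF _ continuous_map_lcoset]) (simp add: compactin_subtopology)

section \<open>Measurability and invariance on the space of lattices\<close>

locale lattice_prob =
  fixes X :: "(real^'a::finite^'a) set measure"
  assumes inv_prob: "invariant_probability X"
begin

sublocale prob_space X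
  using inv_prob by (simp add: invariant_probability_def)

lemma space_X [simp]: "space X = lattices"
  using inv_prob by (simp add: invariant_probability_def)

lemma sets_X: "sets X = sigma_sets lattices {U. openin lattice_topology U}"
  using inv_prob by (simp add: invariant_probability_def)

lemma openin_sets: "openin lattice_topology U \<Longrightarrow> U \<in> sets X"
  by (simp add: sets_X)

lemma closedin_sets: "closedin lattice_topology U \<Longrightarrow> U \<in> sets X"
  using sets.compl_sets[OF openin_sets, of "lattices - U"]
  by (auto simp: closedin_def topspace_lattice_topology double_diff)

lemma measurable_to_X:
  assumes "\<And>x. x \<in> space M \<Longrightarrow> F x \<in> lattices"
    and "\<And>U. openin lattice_topology U \<Longrightarrow> F -` U \<inter> space M \<in> sets M"
  shows "F \<in> measurable M X"
  by (rule measurable_sigma_sets[OF sets_X]) (use assms openin_subset[of lattice_topology] in \<open>auto simp: topspace_lattice_topology\<close>)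

lemma continuous_map_measurable:
  assumes "continuous_map lattice_topology euclideanreal \<phi>"
  shows "\<phi> \<in> borel_measurable X"
proof (rule borel_measurableI)
  fix S :: "real set" assume "open S"
  then have "openin lattice_topology {x \<in> topspace lattice_topology. \<phi> x \<in> S}"
    using assms by (auto simp: continuous_map_def)
  then show "\<phi> -` S \<inter> space X \<in> sets X"
    using openin_sets by (simp add: topspace_lattice_topology vimage_def Int_def conj_commute)
qed

lemma measurable_lcoset: "lcoset \<in> measurable (restrict_space borel SL) X"
proof (rule measurable_to_X)
  fix U assume "openin lattice_topology (U :: (real^'a^'a) set set)"
  then obtain T where T: "open T" "{g \<in> SL. lcoset g \<in> U} = SL \<inter> T"
    unfolding openin_lattice_topology by (auto simp: openin_open)
  then have "lcoset -` U \<inter> space (restrict_space borel SL) = SL \<inter> T"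
    by (auto simp: space_restrict_space)
  then show "lcoset -` U \<inter> space (restrict_space borel SL) \<in> sets (restrict_space borel SL)"
    using T(1) by (auto simp: sets_restrict_space)
qed (auto simp: space_restrict_space lcoset_lattices)

lemma measurable_lcoset' [measurable (raw)]:
  assumes "F \<in> borel_measurable M" "\<And>x. x \<in> space M \<Longrightarrow> F x \<in> SL"
  shows "(\<lambda>x. lcoset (F x)) \<in> measurable M X"
  using measurable_compose[OF _ measurable_lcoset, of F M] assms
  by (simp add: measurable_restrict_space2_iff)

text \<open>Continuity of the action makes the preimage of an open set open, whereas membership in
  the product sigma-algebra asks for countably many rectangles. A countable base of the matrices
  cuts the preimage into such rectangles; their second sides are open because the quotient map is
  open.\<close>

lemma measurable_act: "(\<lambda>(g, \<Lambda>). act g \<Lambda>) \<in> measurable (restrict_space borel SL \<Otimes>\<^sub>M X) X"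
proof (rule measurable_to_X)
  fix U assume "openin lattice_topology (U :: (real^'a^'a) set set)"
  then obtain T where T: "open T" "{g \<in> SL. lcoset g \<in> U} = SL \<inter> T"
    unfolding openin_lattice_topology by (auto simp: openin_open)
  define V where "V = (\<lambda>(g :: real^'a^'a, h :: real^'a^'a). g ** h) -` T"
  have "open V" unfolding V_def using T(1)
    by (intro open_vimage) (auto simp: case_prod_unfold intro!: continuous_intros)
  obtain \<B> :: "(real^'a^'a) set set" where \<B>: "countable \<B>" "topological_basis \<B>"
    using ex_countable_basis by blast
  define I where "I = {(P, Q) \<in> \<B> \<times> \<B>. P \<times> Q \<subseteq> V}"
  have "countable I" unfolding I_def
    by (rule countable_subset[of _ "\<B> \<times> \<B>"]) (use \<B> in auto)
  have "(\<lambda>(g, \<Lambda>). act g \<Lambda>) -` U \<inter> space (restrict_space borel SL \<Otimes>\<^sub>M X)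
    = (\<Union>(P, Q)\<in>I. (SL \<inter> P) \<times> lcoset ` (SL \<inter> Q))" (is "?L = ?R")
  proof (intro set_eqI iffI; clarify)
    fix g \<Lambda> assume *: "act g \<Lambda> \<in> U" "(g, \<Lambda>) \<in> space (restrict_space borel SL \<Otimes>\<^sub>M X)"
    then have g: "g \<in> SL" "\<Lambda> \<in> lattices" by (auto simp: space_pair_measure space_restrict_space)
    then obtain h where h: "h \<in> SL" "\<Lambda> = lcoset h" by (auto elim: lattices_cases)
    have "g ** h \<in> {g \<in> SL. lcoset g \<in> U}"
      using *(1) g h by (simp add: act_lcoset SL_mult)
    then have "g ** h \<in> SL \<inter> T" unfolding T(2) .
    then have "(g, h) \<in> V" by (simp add: V_def)
    then obtain P0 Q0 where PQ: "open P0" "open Q0" "g \<in> P0" "h \<in> Q0" "P0 \<times> Q0 \<subseteq> V"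
      using \<open>open V\<close> by (auto elim!: open_prod_elim)
    obtain P where P: "P \<in> \<B>" "g \<in> P" "P \<subseteq> P0" using topological_basisE[OF \<B>(2) PQ(1,3)] by metis
    obtain Q where Q: "Q \<in> \<B>" "h \<in> Q" "Q \<subseteq> Q0" using topological_basisE[OF \<B>(2) PQ(2,4)] by metis
    have "(P, Q) \<in> I" using P Q PQ by (auto simp: I_def)
    moreover have "(g, \<Lambda>) \<in> (SL \<inter> P) \<times> lcoset ` (SL \<inter> Q)" using P Q g h by auto
    ultimately show "(g, \<Lambda>) \<in> ?R" by blast
  next
    fix g \<Lambda> h P Q assume *: "(P, Q) \<in> I" "g \<in> SL" "g \<in> P" "h \<in> SL" "h \<in> Q"
    then have "g ** h \<in> SL \<inter> T" by (auto simp: I_def V_def SL_mult)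
    then have "lcoset (g ** h) \<in> U" unfolding T(2)[symmetric] by simp
    then show "(g, lcoset h) \<in> ?L"
      using * by (simp add: act_lcoset space_pair_measure space_restrict_space lcoset_lattices)
  qed
  moreover have "?R \<in> sets (restrict_space borel SL \<Otimes>\<^sub>M X)"
  proof (rule sets.countable_UN''[OF \<open>countable I\<close>], clarify)
    fix P Q assume "(P, Q) \<in> I"
    then have "open P" "open Q" using topological_basis_open[OF \<B>(2)] by (auto simp: I_def)
    then show "(SL \<inter> P) \<times> lcoset ` (SL \<inter> Q) \<in> sets (restrict_space borel SL \<Otimes>\<^sub>M X)"
      by (intro pair_measureI openin_sets openin_lcoset_image) (auto simp: sets_restrict_space)
  qed
  ultimately show "?L \<in> sets (restrict_space borel SL \<Otimes>\<^sub>M X)" by simp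
qed (auto simp: space_pair_measure space_restrict_space act_lattices)

lemma measurable_act' [measurable (raw)]:
  assumes "G \<in> borel_measurable M" "\<And>x. x \<in> space M \<Longrightarrow> G x \<in> SL" "F \<in> measurable M X"
  shows "(\<lambda>x. act (G x) (F x)) \<in> measurable M X"
proof -
  have "(\<lambda>x. (G x, F x)) \<in> measurable M (restrict_space borel SL \<Otimes>\<^sub>M X)"
    using assms by (intro measurable_Pair) (auto simp: measurable_restrict_space2_iff)
  from measurable_compose[OF this measurable_act] show ?thesis by simp
qed

lemma distr_act:
  assumes "g \<in> SL"
  shows "distr X X (act g) = X"
proof (rule measure_eqI)
  have m: "act g \<in> measurable X X"
    using assms by (intro measurable_act') auto
  fix A assume A: "A \<in> sets (distr X X (act g))"
  then have "A \<in> sets X" "A \<subseteq> lattices" using sets.sets_into_space[of A X] by auto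
  have "act g -` A \<inter> lattices = act (matrix_inv g) ` A"
  proof (intro set_eqI iffI)
    fix x assume "x \<in> act g -` A \<inter> lattices"
    then show "x \<in> act (matrix_inv g) ` A"
      using act_inv(1)[OF assms, of x] by (metis IntD1 imageI vimageD)
  next
    fix x assume "x \<in> act (matrix_inv g) ` A"
    then show "x \<in> act g -` A \<inter> lattices"
      using \<open>A \<subseteq> lattices\<close> assms by (auto simp: act_inv act_lattices matrix_inv_SL subset_iff)
  qed
  then have "emeasure (distr X X (act g)) A = emeasure X (act (matrix_inv g) ` A)"
    using A m by (subst emeasure_distr) auto
  also have "\<dots> = emeasure X A"
    using inv_prob assms \<open>A \<in> sets X\<close> by (simp add: invariant_probability_def matrix_inv_SL)
  finally show "emeasure (distr X X (act g)) A = emeasure X A" .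
qed simp

lemma nn_integral_act:
  assumes "g \<in> SL" "F \<in> borel_measurable X"
  shows "(\<integral>\<^sup>+\<Lambda>. F (act g \<Lambda>) \<partial>X) = (\<integral>\<^sup>+\<Lambda>. F \<Lambda> \<partial>X)"
proof -
  have "(\<integral>\<^sup>+\<Lambda>. F \<Lambda> \<partial>X) = (\<integral>\<^sup>+\<Lambda>. F \<Lambda> \<partial>distr X X (act g))"
    by (simp add: distr_act assms)
  also have "\<dots> = (\<integral>\<^sup>+\<Lambda>. F (act g \<Lambda>) \<partial>X)"
    using assms by (intro nn_integral_distr measurable_act') auto
  finally show ?thesis ..
qed

lemma integral_act:
  fixes F :: "(real^'a^'a) set \<Rightarrow> real"
  assumes "g \<in> SL" "F \<in> borel_measurable X"
  shows "(\<integral>\<Lambda>. F (act g \<Lambda>) \<partial>X) = (\<integral>\<Lambda>. F \<Lambda> \<partial>X)"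
proof -
  have "(\<integral>\<Lambda>. F \<Lambda> \<partial>X) = (\<integral>\<Lambda>. F \<Lambda> \<partial>distr X X (act g))"
    by (simp add: distr_act assms)
  also have "\<dots> = (\<integral>\<Lambda>. F (act g \<Lambda>) \<partial>X)"
    using assms by (intro integral_distr measurable_act') auto
  finally show ?thesis ..
qed

text \<open>The images of the balls of radius \<open>n\<close> in \<open>SL\<close> increase to the
  whole space, which has measure \<open>1\<close>. This truncation provides compact supports at a
  small cost in measure.\<close>

lemma compact_exhaustion:
  assumes "e > 0"
  obtains K where "compact K" "K \<subseteq> SL" "lcoset ` K \<in> sets X" "emeasure X (lattices - lcoset ` K) \<le> ennreal e"
proof -
  define K where "K n = SL \<inter> cball (0 :: real^'a^'a) (real n)" for n
  have K: "compact (K n)" "K n \<subseteq> SL" for n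
    using closed_SL by (auto simp: K_def closed_Int_compact)
  have s: "lcoset ` K n \<in> sets X" for n
    by (intro closedin_sets closedin_lcoset_compact K)
  have "incseq (\<lambda>n. lcoset ` K n)"
    by (auto simp: incseq_def K_def intro!: image_mono)
  then have "(\<lambda>n. measure X (lcoset ` K n)) \<longlonglongrightarrow> measure X (\<Union>n. lcoset ` K n)"
    by (intro finite_Lim_measure_incseq) (use s in auto)
  moreover have "(\<Union>n. lcoset ` K n) = space X"
  proof -
    have "\<exists>n. g \<in> K n" if "g \<in> SL" for g
      using real_arch_simple[of "norm g"] that by (auto simp: K_def)
    then show ?thesis using K(2) by (force simp: lcoset_lattices elim!: lattices_cases)
  qed
  ultimately have "(\<lambda>n. measure X (lcoset ` K n)) \<longlonglongrightarrow> 1" using prob_space by simp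
  then have "\<forall>\<^sub>F n in sequentially. 1 - e < measure X (lcoset ` K n)"
    using assms by (intro order_tendstoD(1)) auto
  then obtain n where "1 - e < measure X (lcoset ` K n)" by (auto simp: eventually_sequentially)
  then have "measure X (lattices - lcoset ` K n) \<le> e"
    using prob_compl[OF s[of n]] by simp
  then have "emeasure X (lattices - lcoset ` K n) \<le> ennreal e"
    by (simp add: emeasure_eq_measure ennreal_leI)
  then show ?thesis using that K s by blast
qed

end

text \<open>Dividing by the root of the determinant retracts matrices of positive determinant onto
  \<open>SL\<close> and commutes with right multiplication by \<open>SL\<close>. The default
  \<open>mat 1\<close> keeps all values in \<open>SL\<close>.\<close>

definition nsl :: "real^'a::finite^'a \<Rightarrow> real^'a^'a" where
  "nsl A = (if det A > 0 then inverse (root CARD('a) (det A)) *\<^sub>R A else mat 1)"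

lemma nsl_SL: "nsl A \<in> SL"
proof (cases "det A > 0")
  case True
  then have "root CARD('a) (det A) ^ CARD('a) = det A" by (intro real_root_pow_pos) auto
  then show ?thesis
    using True by (simp add: nsl_def SL_def det_scaleR power_inverse)
qed (simp add: nsl_def)

lemma nsl_mult: "h \<in> SL \<Longrightarrow> det A > 0 \<Longrightarrow> nsl (A ** h) = nsl A ** h"
  by (simp add: nsl_def SL_def det_mul matmul.scaleR_left)

lemma borel_measurable_nsl [measurable]: "(nsl :: real^'a::finite^'a \<Rightarrow> _) \<in> borel_measurable borel"
proof -
  have "continuous_on UNIV (\<lambda>A::real^'a^'a. root CARD('a) (det A))"
    by (intro continuous_intros)
  then have [measurable]: "(\<lambda>A::real^'a^'a. root CARD('a) (det A)) \<in> borel_measurable borel"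
    by (rule borel_measurable_continuous_onI)
  show ?thesis unfolding nsl_def[abs_def] by measurable
qed

lemma differentiable_imp_lipschitz_at:
  fixes f :: "'x::real_normed_vector \<Rightarrow> 'y::real_normed_vector"
  assumes "f differentiable (at x)"
  shows "\<exists>K>0. \<exists>r>0. \<forall>y. norm (y - x) < r \<longrightarrow> norm (f y - f x) \<le> K * norm (y - x)"
proof -
  obtain f' where f': "bounded_linear f'" "\<forall>e>0. \<exists>d>0. \<forall>y. norm (y - x) < d \<longrightarrow> norm (f y - f x - f' (y - x)) \<le> e * norm (y - x)"
    using assms unfolding differentiable_def has_derivative_at_alt by blast
  then obtain d where d: "d > 0" "\<And>y. norm (y - x) < d \<Longrightarrow> norm (f y - f x - f' (y - x)) \<le> 1 * norm (y - x)"
    using zero_less_one by blast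
  obtain B where B: "B > 0" "\<And>x. norm (f' x) \<le> norm x * B"
    using bounded_linear.pos_bounded[OF f'(1)] by blast
  have "norm (f y - f x) \<le> (B + 1) * norm (y - x)" if "norm (y - x) < d" for y
    using norm_triangle_ineq[of "f y - f x - f' (y - x)" "f' (y - x)"] d(2)[OF that] B(2)[of "y - x"]
    by (simp add: algebra_simps)
  then show ?thesis using d(1) B(1) by (intro exI[of _ "B + 1"] conjI exI[of _ d]) auto
qed

lemma differentiable_det: "(det :: real^'a::finite^'a \<Rightarrow> real) differentiable (at A)"
proof -
  have "(\<lambda>A::real^'a^'a. A $ i $ j) differentiable (at A)" for i j
  proof -
    have "bounded_linear (\<lambda>A::real^'a^'a. A $ i $ j)"
      by (intro bounded_linear_compose[OF bounded_linear_vec_nth] bounded_linear_vec_nth)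
    then show ?thesis
      by (rule bounded_linear_imp_differentiable)
  qed
  then have "\<exists>D. \<forall>i j. ((\<lambda>A::real^'a^'a. A $ i $ j) has_derivative D i j) (at A)"
    unfolding differentiable_def by metis
  then obtain D where D: "\<And>i j. ((\<lambda>A::real^'a^'a. A $ i $ j) has_derivative D i j) (at A)" by blast
  have "(\<lambda>A::real^'a^'a. \<Prod>i\<in>UNIV. A $ i $ p i) differentiable (at A)" for p
    unfolding differentiable_def by (rule exI, rule has_derivative_prod, rule D)
  then show ?thesis
    unfolding det_def[abs_def] by (intro differentiable_sum differentiable_mult) (auto simp: finite_permutations)
qed

text \<open>A map differentiable at a point is Lipschitz there. For the inverse,
  \<open>matrix_inv g - mat 1 = matrix_inv g ** (mat 1 - g)\<close> is used near the identity, where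
  inverses are bounded. Through this second bound a smoothing of radius \<epsilon> costs an
  oscillation at scale \<open>K * \<epsilon>\<close>.\<close>

lemma nsl_lipschitz:
  "\<exists>K>0. \<exists>r>0. \<forall>A :: real^'a::finite^'a. norm (A - mat 1) \<le> r \<longrightarrow> det A > 0 \<and>
     norm (nsl A - mat 1) \<le> K * norm (A - mat 1) \<and>
     norm (matrix_inv (nsl A) - mat 1) \<le> K * norm (A - mat 1)"
proof -
  let ?I = "mat 1 :: real^'a^'a"
  have "isCont (det :: real^'a^'a \<Rightarrow> real) ?I"
    using continuous_on_det[of "UNIV :: (real^'a^'a) set"] by (simp add: continuous_on_eq_continuous_at)
  then have "\<forall>\<^sub>F A in nhds ?I. det A > 0"
    unfolding isCont_def tendsto_at_iff_tendsto_nhds by (intro order_tendstoD(1)) auto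
  then obtain r1 where r1: "r1 > 0" "\<And>A. norm (A - ?I) < r1 \<Longrightarrow> det A > 0"
    unfolding eventually_nhds_metric by (auto simp: dist_norm)
  have "(\<lambda>x. inverse (root CARD('a) x)) differentiable (at (det ?I))"
    using DERIV_real_root[of "CARD('a)" 1]
    by (intro differentiable_inverse) (auto simp: real_differentiable_def)
  from differentiable_chain_at[OF differentiable_det this]
  have "(\<lambda>A::real^'a^'a. inverse (root CARD('a) (det A)) *\<^sub>R A) differentiable (at ?I)"
    by (intro differentiable_scaleR) (simp_all add: o_def)
  from differentiable_imp_lipschitz_at[OF this]
  obtain K1 r2 where K1: "K1 > 0" "r2 > 0" "\<And>A. norm (A - ?I) < r2 \<Longrightarrow> norm (inverse (root CARD('a) (det A)) *\<^sub>R A - ?I) \<le> K1 * norm (A - ?I)"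
    by auto
  have nsl1: "norm (nsl A - ?I) \<le> K1 * norm (A - ?I)" if "norm (A - ?I) < min r1 r2" for A
    using r1(2)[of A] K1(3)[of A] that by (simp add: nsl_def)
  obtain C where C: "C > 0" "\<And>(A::real^'a^'a) (B::real^'a^'a). norm (A ** B) \<le> norm A * norm B * C"
    using matmul.pos_bounded by blast
  have "matrix_inv ?I = ?I"
    using matrix_inv_SL(2)[OF SL_mat_1] by simp
  then obtain r3 where r3: "r3 > 0" "\<And>g. g \<in> SL \<Longrightarrow> norm (g - ?I) < r3 \<Longrightarrow> norm (matrix_inv g - ?I) < 1"
    using continuous_on_matrix_inv[unfolded continuous_on_iff, rule_format, of ?I 1] by (auto simp: dist_norm)
  define L where "L = (norm ?I + 1) * C"
  have L: "L > 0" using C by (simp add: L_def add_nonneg_pos)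
  have inv: "norm (matrix_inv g - ?I) \<le> L * norm (g - ?I)" if "g \<in> SL" "norm (g - ?I) < r3" for g
  proof -
    have "matrix_inv g - ?I = matrix_inv g ** (?I - g)"
      using matrix_inv_SL[OF that(1)] by (simp add: matmul.diff_right)
    then have "norm (matrix_inv g - ?I) \<le> norm (matrix_inv g) * norm (g - ?I) * C"
      using C(2)[of "matrix_inv g" "?I - g"] by (simp add: norm_minus_commute)
    also have "\<dots> \<le> (norm ?I + 1) * norm (g - ?I) * C"
      using r3(2)[OF that] norm_triangle_ineq[of "matrix_inv g - ?I" ?I] C
      by (intro mult_right_mono) auto
    finally show ?thesis by (simp add: L_def mult_ac)
  qed
  define K where "K = max K1 (L * K1)"
  define m where "m = min (min r1 r2) (r3 / K1)"
  have m: "0 < m" "m \<le> r1" "m \<le> r2" "m \<le> r3 / K1"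
    using r1 K1 r3 by (auto simp: m_def)
  then have "K1 * m \<le> r3" using K1 by (simp add: field_simps)
  define r where "r = m / 2"
  have r: "r > 0" "r < r1" "r < r2" "K1 * r < r3"
    using m \<open>K1 * m \<le> r3\<close> r3 by (auto simp: r_def)
  have "det A > 0 \<and> norm (nsl A - ?I) \<le> K * norm (A - ?I) \<and> norm (matrix_inv (nsl A) - ?I) \<le> K * norm (A - ?I)"
    if A: "norm (A - ?I) \<le> r" for A
  proof (intro conjI)
    show "det A > 0" using r1(2) A r by simp
    have 1: "norm (nsl A - ?I) \<le> K1 * norm (A - ?I)" using nsl1[of A] A r by simp
    also have "\<dots> \<le> K * norm (A - ?I)" by (intro mult_right_mono) (auto simp: K_def)
    finally show "norm (nsl A - ?I) \<le> K * norm (A - ?I)" .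
    have "K1 * norm (A - ?I) \<le> K1 * r" using A K1 by (intro mult_left_mono) auto
    then have "norm (nsl A - ?I) < r3" using 1 r by linarith
    then have "norm (matrix_inv (nsl A) - ?I) \<le> L * norm (nsl A - ?I)" by (intro inv nsl_SL)
    also have "\<dots> \<le> L * (K1 * norm (A - ?I))" using L 1 by (intro mult_left_mono) auto
    also have "\<dots> = (L * K1) * norm (A - ?I)" by simp
    also have "\<dots> \<le> K * norm (A - ?I)" by (intro mult_right_mono) (auto simp: K_def)
    finally show "norm (matrix_inv (nsl A) - ?I) \<le> K * norm (A - ?I)" .
  qed
  moreover have "K > 0" using K1 by (simp add: K_def)
  ultimately show ?thesis using r(1) by blast
qed

subsection \<open>Smoothing of functions of lattices\<close>

lemma matrix_inv_eqI:
  assumes "g \<in> SL" "g ** h = mat 1"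
  shows "matrix_inv g = h"
  by (metis assms matrix_inv_SL(2) matrix_mul_assoc matrix_mul_lid matrix_mul_rid)

lemma matrix_inv_mexp: "Y \<in> sl \<Longrightarrow> matrix_inv (mexp (t *\<^sub>R Y)) = mexp ((- t) *\<^sub>R Y)"
  by (intro matrix_inv_eqI mexp_in_SL mexp_minus)

lemma integrable_bounded_support:
  fixes F :: "'e::euclidean_space \<Rightarrow> real"
  assumes "F \<in> borel_measurable borel" "\<And>A. \<bar>F A\<bar> \<le> B" "\<And>A. A \<notin> S \<Longrightarrow> F A = 0"
    and S: "S \<in> sets borel" "emeasure lborel S < \<infinity>"
  shows "integrable lborel F"
proof (rule Bochner_Integration.integrable_bound)
  show "integrable lborel (\<lambda>A. B * indicator S A)"
    using S by (intro integrable_mult_right integrable_real_indicator) auto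
  show "AE A in lborel. norm (F A) \<le> norm (B * indicator S A)"
  proof (rule AE_I2)
    fix A show "norm (F A) \<le> norm (B * indicator S A)"
      using assms(2)[of A] assms(3)[of A] by (cases "A \<in> S") auto
  qed
qed (use assms in auto)

text \<open>Dominated convergence of difference quotients: the mean value inequality bounds them by
  \<open>B'\<close>, and for small \<open>t\<close> all of them live on the common set
  \<open>S\<close> of finite measure. All the smoothness sits in \<open>k\<close>; \<open>W\<close>
  will be a merely measurable function along an orbit.\<close>

lemma DERIV_integral:
  fixes k k' :: "real \<Rightarrow> 'e::euclidean_space \<Rightarrow> real"
  assumes d: "\<And>A t. ((\<lambda>t. k t A) has_real_derivative k' t A) (at t)"
    and B': "\<And>A t. \<bar>k' t A\<bar> \<le> B'" and B: "\<And>A t. \<bar>k t A\<bar> \<le> B"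
    and supp: "\<And>A t. \<bar>t\<bar> \<le> 1 \<Longrightarrow> A \<notin> S \<Longrightarrow> k t A = 0"
    and S: "S \<in> sets borel" "emeasure lborel S < \<infinity>"
    and [measurable]: "\<And>t. k t \<in> borel_measurable borel" "k' 0 \<in> borel_measurable borel"
    and [measurable]: "W \<in> borel_measurable borel" and W: "\<And>A. \<bar>W A\<bar> \<le> M"
  shows "((\<lambda>t. \<integral>A. k t A * W A \<partial>lborel) has_real_derivative (\<integral>A. k' 0 A * W A \<partial>lborel)) (at 0)"
  unfolding DERIV_def tendsto_at_iff_sequentially
proof (intro allI impI)
  fix X :: "nat \<Rightarrow> real" assume X: "\<forall>i. X i \<in> UNIV - {0}" "X \<longlonglongrightarrow> 0"
  have "\<forall>\<^sub>F n in sequentially. \<bar>X n\<bar> < 1"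
    using tendstoD[OF X(2), of 1] by (simp add: dist_norm)
  then obtain N where N: "\<And>n. n \<ge> N \<Longrightarrow> \<bar>X n\<bar> \<le> 1"
    by (auto simp: eventually_sequentially intro: less_imp_le)
  have B0: "B' \<ge> 0" "B \<ge> 0" "M \<ge> 0"
    using B'[of 0 undefined] B[of 0 undefined] W[of undefined] by linarith+
  \<comment> \<open>Dropping finitely many terms puts all parameters into \<open>[-1, 1]\<close>,
    where the common support is available.\<close>
  define x where "x n = X (n + N)" for n
  have x: "x n \<noteq> 0" "\<bar>x n\<bar> \<le> 1" for n using X(1) N by (auto simp: x_def)
  have x0: "x \<longlonglongrightarrow> 0" unfolding x_def using X(2) by (rule LIMSEQ_ignore_initial_segment)
  have lip: "\<bar>k h A - k 0 A\<bar> \<le> B' * \<bar>h\<bar>" for h A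
    using field_differentiable_bound[of UNIV "\<lambda>t. k t A" "\<lambda>t. k' t A" B' h 0] d B' by auto
  have int: "integrable lborel (\<lambda>A. k t A * W A)" if "\<bar>t\<bar> \<le> 1" for t
    by (rule integrable_bounded_support[where B="B * M", OF _ _ _ S])
       (auto simp: abs_mult B0 intro!: mult_mono B W supp[OF that])
  have "(\<lambda>n. \<integral>A. (k (x n) A - k 0 A) / x n * W A \<partial>lborel) \<longlonglongrightarrow> (\<integral>A. k' 0 A * W A \<partial>lborel)"
  proof (rule integral_dominated_convergence[where w="\<lambda>A. B' * M * indicator S A"])
    show "integrable lborel (\<lambda>A. B' * M * indicator S A)"
      using S by (intro integrable_mult_right integrable_real_indicator) auto
    show "AE A in lborel. (\<lambda>n. (k (x n) A - k 0 A) / x n * W A) \<longlonglongrightarrow> k' 0 A * W A"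
    proof (rule AE_I2)
      fix A
      have "((\<lambda>h. (k (0 + h) A - k 0 A) / h) \<longlongrightarrow> k' 0 A) (at 0)"
        using d[where t=0] by (simp add: DERIV_def)
      then have "(\<lambda>n. (k (x n) A - k 0 A) / x n) \<longlonglongrightarrow> k' 0 A"
        using x x0 unfolding tendsto_at_iff_sequentially by (auto simp: o_def)
      then show "(\<lambda>n. (k (x n) A - k 0 A) / x n * W A) \<longlonglongrightarrow> k' 0 A * W A"
        by (intro tendsto_mult tendsto_const)
    qed
    fix n
    show "AE A in lborel. norm ((k (x n) A - k 0 A) / x n * W A) \<le> B' * M * indicator S A"
    proof (rule AE_I2)
      fix A
      have "\<bar>(k (x n) A - k 0 A) / x n\<bar> \<le> B'"
        using lip[of "x n" A] x[of n] by (simp add: field_simps)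
      then have "\<bar>(k (x n) A - k 0 A) / x n * W A\<bar> \<le> B' * M"
        unfolding abs_mult using W B0 by (intro mult_mono) auto
      then show "norm ((k (x n) A - k 0 A) / x n * W A) \<le> B' * M * indicator S A"
        using supp[OF x(2)[of n], of A] supp[of 0 A] by (cases "A \<in> S") auto
    qed
  qed measurable
  moreover have eq: "(\<integral>A. (k (x n) A - k 0 A) / x n * W A \<partial>lborel) = ((\<integral>A. k (x n) A * W A \<partial>lborel) - (\<integral>A. k 0 A * W A \<partial>lborel)) / x n" for n
    using int[of "x n"] int[of 0] x[of n]
    by (simp add: left_diff_distrib diff_divide_distrib)
  ultimately have "(\<lambda>n. ((\<integral>A. k (x n) A * W A \<partial>lborel) - (\<integral>A. k 0 A * W A \<partial>lborel)) / x n) \<longlonglongrightarrow> (\<integral>A. k' 0 A * W A \<partial>lborel)"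
    by (simp only: eq)
  then have "(\<lambda>n. (\<lambda>h. ((\<integral>A. k (0 + h) A * W A \<partial>lborel) - (\<integral>A. k 0 A * W A \<partial>lborel)) / h) (X (n + N))) \<longlonglongrightarrow> (\<integral>A. k' 0 A * W A \<partial>lborel)"
    by (simp add: x_def)
  then show "((\<lambda>h. ((\<integral>A. k (0 + h) A * W A \<partial>lborel) - (\<integral>A. k 0 A * W A \<partial>lborel)) / h) \<circ> X) \<longlonglongrightarrow> (\<integral>A. k' 0 A * W A \<partial>lborel)"
    unfolding o_def by (rule LIMSEQ_offset)
qed

text \<open>
  Smoothing by Lebesgue measure on all matrices, projected to the group by \<^const>\<open>nsl\<close>, takes the
  place of convolution with Haar measure.
\<close>

definition conv :: "(real^'a::finite^'a \<Rightarrow> real) \<Rightarrow> ((real^'a^'a) set \<Rightarrow> real) \<Rightarrow> (real^'a^'a) set \<Rightarrow> real" where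
  "conv \<psi> w \<Lambda> = (\<integral>A. \<psi> A * w (act (nsl A) \<Lambda>) \<partial>lborel)"

text \<open>For these radii a kernel of radius \<epsilon> lives where \<open>nsl\<close> commutes
  with right multiplication by \<open>SL\<close>. The \<open>itself\<close> argument fixes the size
  of the matrices.\<close>

definition pos_radius :: "'a::finite itself \<Rightarrow> real \<Rightarrow> bool" where
  "pos_radius _ \<epsilon> \<longleftrightarrow> 0 < \<epsilon> \<and> \<epsilon> \<le> 1 \<and> (\<forall>A :: real^'a^'a. norm (A - mat 1) \<le> \<epsilon> \<longrightarrow> det A > 0)"

text \<open>Since \<open>A = (A ** h) ** g\<close>, kernels translated by a bounded family have a
  common bounded support.\<close>

lemma norm_mult_right_bounded:
  fixes T :: "(real^'a::finite^'a) set"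
  assumes "bounded T"
  shows "\<exists>R. \<forall>A g h. g \<in> T \<longrightarrow> h ** g = mat 1 \<longrightarrow> norm (A ** h - mat 1) \<le> 1 \<longrightarrow> norm (A :: real^'a^'a) \<le> R"
proof -
  obtain C where C: "C > 0" "\<And>(A::real^'a^'a) (B::real^'a^'a). norm (A ** B) \<le> norm A * norm B * C"
    using matmul.pos_bounded by blast
  obtain R where R: "\<And>g. g \<in> T \<Longrightarrow> norm g \<le> R" using assms by (auto simp: bounded_iff)
  have "norm A \<le> (1 + norm (mat 1 :: real^'a^'a)) * R * C"
    if "g \<in> T" "h ** g = mat 1" "norm (A ** h - mat 1) \<le> 1" for A g h :: "real^'a^'a"
  proof -
    have "A = (A ** h) ** g" using that by (simp add: matrix_mul_assoc[symmetric])
    then have "norm A \<le> norm (A ** h) * norm g * C" using C(2) by metis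
    also have "\<dots> \<le> (1 + norm (mat 1 :: real^'a^'a)) * R * C"
      using norm_triangle_ineq[of "A ** h - mat 1" "mat 1"] that R C by (intro mult_right_mono mult_mono) auto
    finally show ?thesis .
  qed
  then show ?thesis by blast
qed

lemma test_fun_support: "test_fun \<psi> \<Longrightarrow> \<epsilon> > 0 \<Longrightarrow> \<psi> \<epsilon> A \<noteq> 0 \<Longrightarrow> norm (A - mat 1) \<le> \<epsilon>"
  unfolding test_fun_def by (meson not_le)

section \<open>Smoothings: derivatives, supports and norms\<close>

context lattice_prob
begin

definition bdd_meas :: "real \<Rightarrow> ((real^'a^'a) set \<Rightarrow> real) \<Rightarrow> bool" where
  "bdd_meas M w \<longleftrightarrow> w \<in> borel_measurable X \<and> (\<forall>\<Lambda>\<in>lattices. \<bar>w \<Lambda>\<bar> \<le> M)"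

lemma measurable_orbit [measurable]:
  assumes "w \<in> borel_measurable X" "\<Lambda> \<in> lattices"
  shows "(\<lambda>A. w (act (nsl A) \<Lambda>)) \<in> borel_measurable borel"
  by (rule measurable_compose[OF _ assms(1)], rule measurable_act') (use assms nsl_SL in auto)

lemma test_fun_measurable: "test_fun \<psi> \<Longrightarrow> \<epsilon> > 0 \<Longrightarrow> \<psi> \<epsilon> \<in> borel_measurable borel"
  by (intro borel_measurable_continuous_onI test_family_continuous) (auto simp: test_fun_def)

text \<open>Substituting \<open>A ** h\<close> transfers the translation from the rough function
  \<open>w\<close> to the smooth kernel; all regularity of smoothings comes from this.\<close>

lemma conv_act:
  assumes "\<psi> \<in> borel_measurable borel" "\<And>A. \<psi> A \<noteq> 0 \<Longrightarrow> det A > 0" "w \<in> borel_measurable X"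
    and "h \<in> SL" "\<Lambda> \<in> lattices"
  shows "conv \<psi> w (act h \<Lambda>) = (\<integral>A. \<psi> (A ** matrix_inv h) * w (act (nsl A) \<Lambda>) \<partial>lborel)"
proof -
  have [measurable]: "\<psi> \<in> borel_measurable borel" "w \<in> borel_measurable X" by fact+
  define G where "G A = \<psi> (A ** matrix_inv h) * w (act (nsl A) \<Lambda>)" for A
  have [measurable]: "G \<in> borel_measurable borel"
    unfolding G_def using assms by measurable
  \<comment> \<open>On the support of the kernel \<open>nsl\<close> is equivariant; elsewhere both
    sides vanish.\<close>
  have "\<psi> A * w (act (nsl A) (act h \<Lambda>)) = G (A ** h)" for A
  proof (cases "\<psi> A = 0")
    case False
    then have "nsl (A ** h) = nsl A ** h" using assms by (intro nsl_mult) auto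
    then show ?thesis
      using matrix_inv_SL(1)[OF assms(4)] by (simp add: G_def act_mult matrix_mul_assoc[symmetric])
  qed (use matrix_inv_SL(1)[OF assms(4)] in \<open>simp add: G_def matrix_mul_assoc[symmetric]\<close>)
  then show ?thesis
    unfolding conv_def using integral_lborel_right_mult_SL[OF assms(4), of G] by (simp add: G_def)
qed

lemma test_fun_det_pos: "test_fun \<psi> \<Longrightarrow> pos_radius TYPE('a) \<epsilon> \<Longrightarrow> \<psi> \<epsilon> (A::real^'a^'a) \<noteq> 0 \<Longrightarrow> det A > 0"
  unfolding test_fun_def pos_radius_def by (metis not_le)

lemma bdd_orbit: "bdd_meas M w \<Longrightarrow> \<Lambda> \<in> lattices \<Longrightarrow> \<bar>w (act (nsl A) \<Lambda>)\<bar> \<le> M"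
  by (simp add: bdd_meas_def act_lattices nsl_SL)

lemma conv_deriv:
  assumes \<psi>: "test_fun \<psi>" and \<eta>: "test_fun \<eta>"
    and d: "\<And>\<epsilon> A t. \<epsilon> > 0 \<Longrightarrow> ((\<lambda>t. \<psi> \<epsilon> (A ** mexp ((- t) *\<^sub>R Y))) has_real_derivative \<eta> \<epsilon> (A ** mexp ((- t) *\<^sub>R Y))) (at t)"
    and \<epsilon>: "pos_radius TYPE('a) \<epsilon>" and w: "bdd_meas M w" and "\<Lambda> \<in> lattices" "Y \<in> sl"
  shows "((\<lambda>t. conv (\<psi> \<epsilon>) w (act (mexp (t *\<^sub>R Y)) \<Lambda>)) has_real_derivative conv (\<eta> \<epsilon>) w \<Lambda>) (at 0)"
proof -
  have \<epsilon>': "0 < \<epsilon>" "\<epsilon> \<le> 1" using \<epsilon> by (auto simp: pos_radius_def)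
  have wm [measurable]: "w \<in> borel_measurable X" using w by (simp add: bdd_meas_def)
  note [measurable] = test_fun_measurable[OF \<psi> \<epsilon>'(1)] test_fun_measurable[OF \<eta> \<epsilon>'(1)]
  obtain B where B: "\<And>A. \<bar>\<psi> \<epsilon> A\<bar> \<le> B" using test_fun_bound[OF \<psi>] \<epsilon>' by metis
  obtain B' where B': "\<And>A. \<bar>\<eta> \<epsilon> A\<bar> \<le> B'" using test_fun_bound[OF \<eta>] \<epsilon>' by metis
  have "continuous_on UNIV (\<lambda>t. mexp (t *\<^sub>R Y))"
    using has_vector_derivative_continuous[OF has_vector_derivative_mexp]
    by (auto intro!: continuous_at_imp_continuous_on)
  then have "bounded ((\<lambda>t. mexp (t *\<^sub>R Y)) ` {-1..1})"
    by (intro compact_imp_bounded compact_continuous_image) (auto intro: continuous_on_subset)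
  from norm_mult_right_bounded[OF this] obtain R where R: "\<And>A g h. g \<in> (\<lambda>t. mexp (t *\<^sub>R Y)) ` {-1..1} \<Longrightarrow> h ** g = mat 1 \<Longrightarrow> norm (A ** h - mat 1) \<le> 1 \<Longrightarrow> norm A \<le> R"
    by metis
  have supp: "\<psi> \<epsilon> (A ** mexp ((- t) *\<^sub>R Y)) = 0" if "\<bar>t\<bar> \<le> 1" "A \<notin> cball 0 R" for A t
  proof (rule ccontr)
    assume "\<psi> \<epsilon> (A ** mexp ((- t) *\<^sub>R Y)) \<noteq> 0"
    then have "norm (A ** mexp ((- t) *\<^sub>R Y) - mat 1) \<le> 1"
      using test_fun_support[OF \<psi> \<epsilon>'(1)] \<epsilon>'(2) by force
    moreover have "mexp ((- t) *\<^sub>R Y) ** mexp (t *\<^sub>R Y) = mat 1" using mexp_minus[of "- t" Y] by simp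
    ultimately have "norm A \<le> R" using R[of "mexp (t *\<^sub>R Y)"] that by (auto simp: abs_le_iff)
    then show False using that by simp
  qed
  have "((\<lambda>t. \<integral>A. \<psi> \<epsilon> (A ** mexp ((- t) *\<^sub>R Y)) * w (act (nsl A) \<Lambda>) \<partial>lborel) has_real_derivative
     (\<integral>A. \<eta> \<epsilon> (A ** mexp ((- 0) *\<^sub>R Y)) * w (act (nsl A) \<Lambda>) \<partial>lborel)) (at 0)"
    by (rule DERIV_integral[where k="\<lambda>t A. \<psi> \<epsilon> (A ** mexp ((- t) *\<^sub>R Y))" and k'="\<lambda>t A. \<eta> \<epsilon> (A ** mexp ((- t) *\<^sub>R Y))" and S="cball 0 R" and M=M and B=B and B'=B'])
       (use d[OF \<epsilon>'(1)] B B' supp bdd_orbit[OF w] assms(6) emeasure_compact_finite[of "cball 0 R"] in auto)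
  moreover have "conv (\<psi> \<epsilon>) w (act (mexp (t *\<^sub>R Y)) \<Lambda>) = (\<integral>A. \<psi> \<epsilon> (A ** mexp ((- t) *\<^sub>R Y)) * w (act (nsl A) \<Lambda>) \<partial>lborel)" for t
    by (subst conv_act) (use test_fun_det_pos[OF \<psi> \<epsilon>] assms(6,7) in \<open>auto simp: mexp_in_SL matrix_inv_mexp simp del: scaleR_minus_left\<close>)
  ultimately show ?thesis by (simp add: conv_def)
qed

text \<open>Dominated convergence for the translated kernels; a convergent sequence in the group is
  bounded, which gives them a common support.\<close>

lemma conv_continuous:
  assumes \<psi>: "test_fun \<psi>" and \<epsilon>: "pos_radius TYPE('a) \<epsilon>" and w: "bdd_meas M w"
  shows "continuous_on SL (\<lambda>g. conv (\<psi> \<epsilon>) w (lcoset g))"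
  unfolding continuous_on_sequentially
proof (intro allI ballI impI, elim conjE)
  fix x :: "nat \<Rightarrow> real^'a^'a" and a assume a: "a \<in> SL" and x: "\<forall>n. x n \<in> SL" "x \<longlonglongrightarrow> a"
  have \<epsilon>': "0 < \<epsilon>" "\<epsilon> \<le> 1" using \<epsilon> by (auto simp: pos_radius_def)
  have wm [measurable]: "w \<in> borel_measurable X" using w by (simp add: bdd_meas_def)
  note [measurable] = test_fun_measurable[OF \<psi> \<epsilon>'(1)]
  have L: "lcoset (mat 1) \<in> lattices" by (simp add: lcoset_lattices)
  note [measurable] = measurable_orbit[OF wm L]
  obtain B where B: "\<And>A. \<bar>\<psi> \<epsilon> A\<bar> \<le> B" using test_fun_bound[OF \<psi>] \<epsilon>' by metis
  have B0: "B \<ge> 0" "M \<ge> 0"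
    using B[of undefined] bdd_orbit[OF w L, of undefined] by linarith+
  have eq: "conv (\<psi> \<epsilon>) w (lcoset g) = (\<integral>A. \<psi> \<epsilon> (A ** matrix_inv g) * w (act (nsl A) (lcoset (mat 1))) \<partial>lborel)" if "g \<in> SL" for g
    using conv_act[OF _ test_fun_det_pos[OF \<psi> \<epsilon>] wm that L] by (simp add: act_lcoset)
  have inv: "(\<lambda>n. matrix_inv (x n)) \<longlonglongrightarrow> matrix_inv a"
    by (rule continuous_on_tendsto_compose[OF continuous_on_matrix_inv x(2) a])
       (use x in \<open>auto intro!: always_eventually\<close>)
  have "bounded (range x)" using x(2) by (rule convergent_imp_bounded)
  from norm_mult_right_bounded[OF this] obtain R where R: "\<And>A g h. g \<in> range x \<Longrightarrow> h ** g = mat 1 \<Longrightarrow> norm (A ** h - mat 1) \<le> 1 \<Longrightarrow> norm A \<le> R"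
    by metis
  have supp: "\<psi> \<epsilon> (A ** matrix_inv (x n)) = 0" if "A \<notin> cball 0 R" for A n
  proof (rule ccontr)
    assume "\<psi> \<epsilon> (A ** matrix_inv (x n)) \<noteq> 0"
    then have "norm (A ** matrix_inv (x n) - mat 1) \<le> 1"
      using test_fun_support[OF \<psi> \<epsilon>'(1)] \<epsilon>'(2) by force
    then have "norm A \<le> R" using R[of "x n"] matrix_inv_SL(2)[of "x n"] x by auto
    then show False using that by simp
  qed
  have "(\<lambda>n. \<integral>A. \<psi> \<epsilon> (A ** matrix_inv (x n)) * w (act (nsl A) (lcoset (mat 1))) \<partial>lborel)
     \<longlonglongrightarrow> (\<integral>A. \<psi> \<epsilon> (A ** matrix_inv a) * w (act (nsl A) (lcoset (mat 1))) \<partial>lborel)"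
  proof (rule integral_dominated_convergence[where w="\<lambda>A. B * M * indicator (cball 0 R) A"])
    show "integrable lborel (\<lambda>A. B * M * indicator (cball 0 R) (A :: real^'a^'a))"
      using emeasure_compact_finite[of "cball 0 R :: (real^'a^'a) set"] by (intro integrable_mult_right integrable_real_indicator) auto
    show "AE A in lborel. (\<lambda>n. \<psi> \<epsilon> (A ** matrix_inv (x n)) * w (act (nsl A) (lcoset (mat 1)))) \<longlonglongrightarrow> \<psi> \<epsilon> (A ** matrix_inv a) * w (act (nsl A) (lcoset (mat 1)))"
    proof (intro AE_I2 tendsto_mult tendsto_const)
      fix A
      have "continuous_on UNIV (\<psi> \<epsilon>)" using \<psi> \<epsilon>' by (intro test_family_continuous) (auto simp: test_fun_def)
      then show "(\<lambda>n. \<psi> \<epsilon> (A ** matrix_inv (x n))) \<longlonglongrightarrow> \<psi> \<epsilon> (A ** matrix_inv a)"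
        by (rule continuous_on_tendsto_compose) (auto intro!: matmul.tendsto inv)
    qed
    fix n
    show "AE A in lborel. norm (\<psi> \<epsilon> (A ** matrix_inv (x n)) * w (act (nsl A) (lcoset (mat 1)))) \<le> B * M * indicator (cball 0 R) A"
    proof (rule AE_I2)
      fix A
      have "\<bar>\<psi> \<epsilon> (A ** matrix_inv (x n)) * w (act (nsl A) (lcoset (mat 1)))\<bar> \<le> B * M"
        unfolding abs_mult using B bdd_orbit[OF w L] B0 by (intro mult_mono) auto
      then show "norm (\<psi> \<epsilon> (A ** matrix_inv (x n)) * w (act (nsl A) (lcoset (mat 1)))) \<le> B * M * indicator (cball 0 R) A"
        using supp[of A n] by (cases "A \<in> cball 0 R") auto
    qed
  qed measurable
  then show "((\<lambda>g. conv (\<psi> \<epsilon>) w (lcoset g)) \<circ> x) \<longlonglongrightarrow> conv (\<psi> \<epsilon>) w (lcoset a)"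
    using x a by (simp add: eq o_def)
qed

text \<open>The kernel \<open>\<eta>\<close> is chosen before \<epsilon> and \<open>w\<close>, so a
  bound for it yields \<open>C\<^sup>k\<close> bounds that hold for all of these at once.\<close>

lemma lie_derivs_conv:
  assumes "test_fun \<psi>" "set Ys \<subseteq> (sl :: (real^'a^'a) set)"
  shows "\<exists>\<eta>. test_fun \<eta> \<and> (\<forall>\<epsilon> w M. pos_radius TYPE('a) \<epsilon> \<longrightarrow> bdd_meas M w \<longrightarrow>
     (\<forall>\<Lambda>\<in>lattices. lie_derivs Ys (conv (\<psi> \<epsilon>) w) \<Lambda> = conv (\<eta> \<epsilon>) w \<Lambda>))"
  using assms(2)
proof (induction Ys)
  case Nil
  show ?case using assms(1) by auto
next
  case (Cons Y Ys)
  then have "set Ys \<subseteq> sl" by simp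
  obtain \<eta> where "test_fun \<eta> \<and> (\<forall>\<epsilon> w M. pos_radius TYPE('a) \<epsilon> \<longrightarrow> bdd_meas M w \<longrightarrow>
     (\<forall>\<Lambda>\<in>lattices. lie_derivs Ys (conv (\<psi> \<epsilon>) w) \<Lambda> = conv (\<eta> \<epsilon>) w \<Lambda>))"
    using Cons.IH[OF \<open>set Ys \<subseteq> sl\<close>] by (elim exE) (rule that)
  then have \<eta>: "test_fun \<eta>" "\<And>\<epsilon> w M \<Lambda>. pos_radius TYPE('a) \<epsilon> \<Longrightarrow> bdd_meas M w \<Longrightarrow>
     \<Lambda> \<in> lattices \<Longrightarrow> lie_derivs Ys (conv (\<psi> \<epsilon>) w) \<Lambda> = conv (\<eta> \<epsilon>) w \<Lambda>"
    by blast+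
  obtain \<xi> where \<xi>: "test_fun \<xi>" "\<And>\<epsilon> A t. \<epsilon> > 0 \<Longrightarrow> ((\<lambda>t. \<eta> \<epsilon> (A ** mexp ((- t) *\<^sub>R Y))) has_real_derivative \<xi> \<epsilon> (A ** mexp ((- t) *\<^sub>R Y))) (at t)"
    using test_fun_deriv[OF \<eta>(1), of Y] by blast
  have Y: "Y \<in> sl" using Cons by simp
  have "lie_derivs (Y # Ys) (conv (\<psi> \<epsilon>) w) \<Lambda> = conv (\<xi> \<epsilon>) w \<Lambda>"
    if *: "pos_radius TYPE('a) \<epsilon>" "bdd_meas M w" "\<Lambda> \<in> lattices" for \<epsilon> w M \<Lambda>
  proof -
    have "lie_derivs (Y # Ys) (conv (\<psi> \<epsilon>) w) \<Lambda> = deriv (\<lambda>t. conv (\<eta> \<epsilon>) w (act (mexp (t *\<^sub>R Y)) \<Lambda>)) 0"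
      using \<eta>(2)[OF *(1,2)] *(3) Y by (simp add: lie_deriv_def act_lattices mexp_in_SL)
    also have "\<dots> = conv (\<xi> \<epsilon>) w \<Lambda>"
      by (intro DERIV_imp_deriv conv_deriv[OF \<eta>(1) \<xi> *(1,2,3) Y])
    finally show ?thesis .
  qed
  then show ?case using \<xi>(1) by blast
qed

lemma smooth_conv:
  assumes \<psi>: "test_fun \<psi>" and \<epsilon>: "pos_radius TYPE('a) \<epsilon>" and w: "bdd_meas M w"
  shows "smooth_on_lattices (conv (\<psi> \<epsilon>) w)"
  unfolding smooth_on_lattices_def
proof (intro allI impI)
  fix Ys :: "(real^'a^'a) list" assume Ys: "set Ys \<subseteq> sl"
  obtain \<eta> where \<eta>: "test_fun \<eta>" "\<And>\<epsilon> w M \<Lambda>. pos_radius TYPE('a) \<epsilon> \<Longrightarrow> bdd_meas M w \<Longrightarrow>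
     \<Lambda> \<in> lattices \<Longrightarrow> lie_derivs Ys (conv (\<psi> \<epsilon>) w) \<Lambda> = conv (\<eta> \<epsilon>) w \<Lambda>"
    using lie_derivs_conv[OF \<psi> Ys] by blast
  note eq = \<eta>(2)[OF \<epsilon> w]
  have "continuous_on SL (\<lambda>g. lie_derivs Ys (conv (\<psi> \<epsilon>) w) (lcoset g))"
    by (rule continuous_on_eq[OF conv_continuous[OF \<eta>(1) \<epsilon> w]]) (simp add: eq lcoset_lattices)
  moreover have "(\<lambda>t. lie_derivs Ys (conv (\<psi> \<epsilon>) w) (act (mexp (t *\<^sub>R Y)) \<Lambda>)) differentiable (at 0)"
    if "Y \<in> sl" "\<Lambda> \<in> lattices" for Y \<Lambda>
  proof -
    obtain \<xi> where \<xi>: "test_fun \<xi>" "\<And>\<epsilon> A t. \<epsilon> > 0 \<Longrightarrow> ((\<lambda>t. \<eta> \<epsilon> (A ** mexp ((- t) *\<^sub>R Y))) has_real_derivative \<xi> \<epsilon> (A ** mexp ((- t) *\<^sub>R Y))) (at t)"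
      using test_fun_deriv[OF \<eta>(1), of Y] by blast
    show ?thesis
      using conv_deriv[OF \<eta>(1) \<xi> \<epsilon> w that(2,1)] that
      by (auto simp: eq act_lattices mexp_in_SL real_differentiable_def)
  qed
  ultimately show "continuous_map lattice_topology euclideanreal (lie_derivs Ys (conv (\<psi> \<epsilon>) w)) \<and>
     (\<forall>Y\<in>sl. \<forall>\<Lambda>\<in>lattices. (\<lambda>t. lie_derivs Ys (conv (\<psi> \<epsilon>) w) (act (mexp (t *\<^sub>R Y)) \<Lambda>)) differentiable (at 0))"
    by (auto intro: continuous_map_lattice_topology)
qed

lemma conv_bound:
  assumes \<psi>: "test_fun \<psi>"
  shows "\<exists>C\<ge>0. \<exists>L. \<forall>\<epsilon> w M \<Lambda>. pos_radius TYPE('a) \<epsilon> \<longrightarrow> bdd_meas M w \<longrightarrow> \<Lambda> \<in> lattices \<longrightarrow>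
     \<bar>conv (\<psi> \<epsilon>) w \<Lambda>\<bar> \<le> C * (1 / \<epsilon>) ^ L * M"
proof -
  obtain C L where C: "C \<ge> 0" "\<And>\<epsilon> A. 0 < \<epsilon> \<Longrightarrow> \<epsilon> \<le> 1 \<Longrightarrow> \<bar>\<psi> \<epsilon> A\<bar> \<le> C * (1 / \<epsilon>) ^ L"
    using test_fun_bound[OF \<psi>] by metis
  define V where "V = measure lborel (cball (mat 1 :: real^'a^'a) 1)"
  have "\<bar>conv (\<psi> \<epsilon>) w \<Lambda>\<bar> \<le> (C * V) * (1 / \<epsilon>) ^ L * M"
    if *: "pos_radius TYPE('a) \<epsilon>" "bdd_meas M w" "\<Lambda> \<in> lattices" for \<epsilon> w M \<Lambda>
  proof -
    have \<epsilon>': "0 < \<epsilon>" "\<epsilon> \<le> 1" using * by (auto simp: pos_radius_def)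
    have M: "M \<ge> 0" using bdd_orbit[OF *(2,3), of undefined] by linarith
    have K: "emeasure lborel (cball (mat 1 :: real^'a^'a) 1) < \<infinity>"
      by (rule emeasure_compact_finite) simp
    have wm [measurable]: "w \<in> borel_measurable X" using * by (simp add: bdd_meas_def)
    note [measurable] = measurable_orbit[OF wm *(3)] test_fun_measurable[OF \<psi> \<epsilon>'(1)]
    have le: "\<bar>\<psi> \<epsilon> A * w (act (nsl A) \<Lambda>)\<bar> \<le> C * (1 / \<epsilon>) ^ L * M" for A
      unfolding abs_mult using C \<epsilon>' bdd_orbit[OF *(2,3), of A] M by (intro mult_mono) auto
    have z: "\<psi> \<epsilon> A = 0" if "A \<notin> cball (mat 1) 1" for A
      using \<psi> \<epsilon>' that unfolding test_fun_def by (auto simp: dist_norm norm_minus_commute)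
    have "\<bar>conv (\<psi> \<epsilon>) w \<Lambda>\<bar> \<le> (\<integral>A. \<bar>\<psi> \<epsilon> A * w (act (nsl A) \<Lambda>)\<bar> \<partial>lborel)"
      unfolding conv_def by (rule integral_abs_bound)
    also have "\<dots> \<le> (\<integral>A. C * (1 / \<epsilon>) ^ L * M * indicator (cball (mat 1) 1) (A :: real^'a^'a) \<partial>lborel)"
    proof (rule integral_mono)
      show "integrable lborel (\<lambda>A. \<bar>\<psi> \<epsilon> A * w (act (nsl A) \<Lambda>)\<bar>)"
        by (intro integrable_abs integrable_bounded_support[OF _ le _ _ K]) (auto simp: z)
      show "integrable lborel (\<lambda>A. C * (1 / \<epsilon>) ^ L * M * indicator (cball (mat 1) 1) (A :: real^'a^'a))"
        using K by (intro integrable_mult_right integrable_real_indicator) auto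
      show "\<bar>\<psi> \<epsilon> A * w (act (nsl A) \<Lambda>)\<bar> \<le> C * (1 / \<epsilon>) ^ L * M * indicator (cball (mat 1) 1) A" for A
        using le[of A] z[of A] by (cases "A \<in> cball (mat 1) 1") auto
    qed
    also have "\<dots> = (C * V) * (1 / \<epsilon>) ^ L * M" using K by (simp add: V_def)
    finally show ?thesis .
  qed
  then show ?thesis using C(1) by (intro exI[of _ "C * V"] conjI exI[of _ L]) (auto simp: V_def)
qed

text \<open>If \<open>w\<close> lives over \<open>K\<close>, its smoothing lives over the set of
  products of inverses of normalised kernel points with points of \<open>K\<close>, a continuous
  image of a compact set.\<close>

lemma conv_support:
  assumes \<psi>: "test_fun \<psi>" and \<epsilon>: "pos_radius TYPE('a) \<epsilon>"
    and K: "compact (K :: (real^'a^'a) set)" "K \<subseteq> SL" and w: "\<And>\<Lambda>. \<Lambda> \<notin> lcoset ` K \<Longrightarrow> w \<Lambda> = 0"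
  shows "compactly_supported_on_lattices (conv (\<psi> \<epsilon>) w)"
proof -
  define K' where "K' = (\<lambda>(A, k). matrix_inv (nsl A) ** k) ` (cball (mat 1) \<epsilon> \<times> K)"
  have pos: "det A > 0" if "A \<in> cball (mat 1) \<epsilon>" for A :: "real^'a^'a"
    using that \<epsilon> by (auto simp: pos_radius_def dist_norm norm_minus_commute)
  have "continuous_on (cball (mat 1) \<epsilon>) (\<lambda>A :: real^'a^'a. inverse (root CARD('a) (det A)) *\<^sub>R A)"
    by (intro continuous_intros) (use pos in force)
  then have "continuous_on (cball (mat 1) \<epsilon>) (nsl :: real^'a^'a \<Rightarrow> _)"
    by (rule continuous_on_eq) (use pos in \<open>simp add: nsl_def\<close>)
  then have "continuous_on (cball (mat 1) \<epsilon>) (\<lambda>A :: real^'a^'a. matrix_inv (nsl A))"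
    by (rule continuous_on_compose2[OF continuous_on_matrix_inv]) (use nsl_SL in auto)
  then have "continuous_on (cball (mat 1) \<epsilon> \<times> K) (\<lambda>p. matrix_inv (nsl (fst p :: real^'a^'a)) ** (snd p :: real^'a^'a))"
    by (intro continuous_on_matmul continuous_on_compose2[of _ "\<lambda>A. matrix_inv (nsl A)" _ fst] continuous_intros) auto
  then have "compact K'"
    unfolding K'_def case_prod_unfold by (intro compact_continuous_image compact_Times K) auto
  have "K' \<subseteq> SL"
    using K nsl_SL by (auto simp: K'_def intro!: SL_mult matrix_inv_SL)
  have "{\<Lambda> \<in> lattices. conv (\<psi> \<epsilon>) w \<Lambda> \<noteq> 0} \<subseteq> lcoset ` K'"
  proof clarify
    fix \<Lambda> assume \<Lambda>: "\<Lambda> \<in> lattices" "conv (\<psi> \<epsilon>) w \<Lambda> \<noteq> 0"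
    have "\<exists>A. \<psi> \<epsilon> A * w (act (nsl A) \<Lambda>) \<noteq> 0"
    proof (rule ccontr)
      assume "\<not> ?thesis"
      then have "(\<lambda>A. \<psi> \<epsilon> A * w (act (nsl A) \<Lambda>)) = (\<lambda>_. 0)" by blast
      then have "conv (\<psi> \<epsilon>) w \<Lambda> = 0" by (simp only: conv_def integral_zero)
      then show False using \<Lambda> by simp
    qed
    then obtain A where A: "\<psi> \<epsilon> A \<noteq> 0" "w (act (nsl A) \<Lambda>) \<noteq> 0" by auto
    then obtain k where k: "k \<in> K" "act (nsl A) \<Lambda> = lcoset k" using w by blast
    have "A \<in> cball (mat 1) \<epsilon>"
      using A(1) \<psi> \<epsilon> by (auto simp: test_fun_def pos_radius_def dist_norm norm_minus_commute not_less[symmetric])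
    moreover have "\<Lambda> = lcoset (matrix_inv (nsl A) ** k)"
      using act_inv(1)[OF nsl_SL, of A \<Lambda>] k(2) by (simp add: act_lcoset)
    ultimately show "\<Lambda> \<in> lcoset ` K'" using k(1) by (force simp: K'_def)
  qed
  then have "lattice_topology closure_of {\<Lambda> \<in> lattices. conv (\<psi> \<epsilon>) w \<Lambda> \<noteq> 0} \<subseteq> lcoset ` K'"
    by (intro closure_of_minimal closedin_lcoset_compact \<open>compact K'\<close> \<open>K' \<subseteq> SL\<close>)
  then show ?thesis
    unfolding compactly_supported_on_lattices_def
    by (intro closed_compactin[OF compactin_lcoset_compact[OF \<open>compact K'\<close> \<open>K' \<subseteq> SL\<close>]]) auto
qed

lemma Ck_norm_conv:
  assumes \<psi>: "test_fun \<psi>" and B: "basis_of_sl (B :: (real^'a^'a) set)"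
  shows "\<exists>C\<ge>0. \<exists>L. \<forall>\<epsilon> w M. pos_radius TYPE('a) \<epsilon> \<longrightarrow> bdd_meas M w \<longrightarrow>
     Ck_norm_lattices B k (conv (\<psi> \<epsilon>) w) \<le> ennreal (C * (1 / \<epsilon>) ^ L * M)"
proof -
  define \<Y> where "\<Y> = {Ys. set Ys \<subseteq> B \<and> length Ys \<le> k}"
  have "finite B" using B independent_imp_finite by (auto simp: basis_of_sl_def)
  then have fin: "finite \<Y>" unfolding \<Y>_def by (rule finite_lists_length_le)
  have Bsl: "B \<subseteq> sl" using B span_superset[of B] by (auto simp: basis_of_sl_def)
  have "\<exists>C L. C \<ge> 0 \<and> (\<forall>\<epsilon> w M \<Lambda>. pos_radius TYPE('a) \<epsilon> \<longrightarrow> bdd_meas M w \<longrightarrow> \<Lambda> \<in> lattices \<longrightarrow>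
     \<bar>lie_derivs Ys (conv (\<psi> \<epsilon>) w) \<Lambda>\<bar> \<le> C * (1 / \<epsilon>) ^ L * M)" if "Ys \<in> \<Y>" for Ys
  proof -
    have Ys: "set Ys \<subseteq> sl" using that Bsl by (auto simp: \<Y>_def)
    obtain \<eta> where \<eta>: "test_fun \<eta>" "\<And>\<epsilon> w M \<Lambda>. pos_radius TYPE('a) \<epsilon> \<Longrightarrow> bdd_meas M w \<Longrightarrow>
       \<Lambda> \<in> lattices \<Longrightarrow> lie_derivs Ys (conv (\<psi> \<epsilon>) w) \<Lambda> = conv (\<eta> \<epsilon>) w \<Lambda>"
      using lie_derivs_conv[OF \<psi> Ys] by blast
    obtain C L where C: "C \<ge> 0" "\<And>\<epsilon> w M \<Lambda>. pos_radius TYPE('a) \<epsilon> \<Longrightarrow> bdd_meas M w \<Longrightarrow> \<Lambda> \<in> lattices \<Longrightarrow>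
       \<bar>conv (\<eta> \<epsilon>) w \<Lambda>\<bar> \<le> C * (1 / \<epsilon>) ^ L * M"
      using conv_bound[OF \<eta>(1)] by blast
    show ?thesis
      by (intro exI[of _ C] exI[of _ L] conjI allI impI C(1)) (simp add: \<eta>(2) C(2))
  qed
  then obtain C L where C: "\<And>Ys. Ys \<in> \<Y> \<Longrightarrow> C Ys \<ge> 0"
    and b: "\<And>Ys \<epsilon> w M \<Lambda>. Ys \<in> \<Y> \<Longrightarrow> pos_radius TYPE('a) \<epsilon> \<Longrightarrow> bdd_meas M w \<Longrightarrow> \<Lambda> \<in> lattices \<Longrightarrow>
     \<bar>lie_derivs Ys (conv (\<psi> \<epsilon>) w) \<Lambda>\<bar> \<le> C Ys * (1 / \<epsilon>) ^ L Ys * M"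
    by metis
  \<comment> \<open>Sums over the finitely many words in the basis serve as common constants; a
    larger exponent is harmless because \<open>1 / \<epsilon> \<ge> 1\<close>.\<close>
  define C' where "C' = sum C \<Y>"
  define L' where "L' = sum L \<Y>"
  have "Ck_norm_lattices B k (conv (\<psi> \<epsilon>) w) \<le> ennreal (C' * (1 / \<epsilon>) ^ L' * M)"
    if *: "pos_radius TYPE('a) \<epsilon>" "bdd_meas M w" for \<epsilon> w M
    unfolding Ck_norm_lattices_def \<Y>_def[symmetric]
  proof (intro SUP_least ennreal_leI)
    fix Ys \<Lambda> assume Ys: "Ys \<in> \<Y>" "\<Lambda> \<in> (lattices :: (real^'a^'a) set set)"
    have \<epsilon>: "0 < \<epsilon>" "\<epsilon> \<le> 1" using * by (auto simp: pos_radius_def)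
    have M: "M \<ge> 0" using *(2) Ys(2) unfolding bdd_meas_def by force
    have "C Ys \<le> C'" unfolding C'_def by (rule member_le_sum) (use Ys fin C in auto)
    moreover have "L Ys \<le> L'" unfolding L'_def by (rule member_le_sum) (use Ys fin in auto)
    ultimately have "C Ys * (1 / \<epsilon>) ^ L Ys * M \<le> C' * (1 / \<epsilon>) ^ L' * M"
      using \<epsilon> M C[OF Ys(1)] by (intro mult_right_mono mult_mono power_increasing) auto
    with b[OF Ys(1) * Ys(2)] show "\<bar>lie_derivs Ys (conv (\<psi> \<epsilon>) w) \<Lambda>\<bar> \<le> C' * (1 / \<epsilon>) ^ L' * M" by linarith
  qed
  moreover have "C' \<ge> 0" unfolding C'_def by (intro sum_nonneg C)
  ultimately show ?thesis by blast
qed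

end

text \<open>Normalising the bump divides by its integral; this bound makes the division cost only a
  power of \<open>1 / \<epsilon>\<close>.\<close>

lemma bump_integral_lower:
  "\<exists>c>0. \<forall>\<epsilon>. 0 < \<epsilon> \<longrightarrow> \<epsilon> \<le> 1 \<longrightarrow>
     c * \<epsilon> ^ DIM(real^'a::finite^'a) \<le> (\<integral>A. flat_exp 0 (1 - (norm (A - mat 1 :: real^'a^'a) / \<epsilon>)\<^sup>2) \<partial>lborel)"
proof -
  define D where "D = DIM(real^'a^'a)"
  \<comment> \<open>On the ball of half the radius the argument of \<open>flat_exp 0\<close> is at
    least \<open>3 / 4\<close>, hence its value at least \<open>exp (- 4 / 3)\<close>;
    \<open>(1/2) ^ D\<close> is the ratio of the volumes.\<close>
  define c where "c = exp (- 4 / 3) * measure lborel (cball (0 :: real^'a^'a) 1) * (1/2) ^ D"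
  have "measure lborel (cball (0 :: real^'a^'a) 1) > 0"
    using content_cball_pos[of 1 "0 :: real^'a^'a"] by simp
  then have "c > 0" by (simp add: c_def)
  moreover have "c * \<epsilon> ^ D \<le> (\<integral>A. flat_exp 0 (1 - (norm (A - mat 1 :: real^'a^'a) / \<epsilon>)\<^sup>2) \<partial>lborel)"
    if \<epsilon>: "0 < \<epsilon>" "\<epsilon> \<le> 1" for \<epsilon>
  proof -
    let ?b = "\<lambda>A :: real^'a^'a. flat_exp 0 (1 - (norm (A - mat 1) / \<epsilon>)\<^sup>2)"
    let ?S = "cball (mat 1 :: real^'a^'a) (\<epsilon> / 2)"
    have fin: "emeasure lborel ?S < \<infinity>" "emeasure lborel (cball (mat 1 :: real^'a^'a) \<epsilon>) < \<infinity>"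
      by (intro emeasure_compact_finite compact_cball)+
    have [measurable]: "?b \<in> borel_measurable borel"
      by (intro borel_measurable_continuous_onI test_family_continuous[OF test_family.bump] \<epsilon>)
    have "measure lborel ?S = measure lborel (cball (0 :: real^'a^'a) 1) * (\<epsilon> / 2) ^ D"
      using \<epsilon> content_cball[of "\<epsilon> / 2" "mat 1 :: real^'a^'a"] content_cball[of 1 "0 :: real^'a^'a"] by (simp add: D_def)
    then have "c * \<epsilon> ^ D = (\<integral>A. exp (- 4 / 3) * indicator ?S A \<partial>lborel)"
      using fin by (simp add: c_def power_divide)
    also have "\<dots> \<le> (\<integral>A. ?b A \<partial>lborel)"
    proof (rule integral_mono)
      show "integrable lborel (\<lambda>A. exp (- 4 / 3) * indicator ?S A :: real)"
        using fin by (intro integrable_mult_right integrable_real_indicator) auto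
      show "integrable lborel ?b"
      proof (rule integrable_bounded_support[where B=1 and S="cball (mat 1) \<epsilon>"])
        show "\<bar>?b A\<bar> \<le> 1" for A using flat_nonneg[of 0] flat_le_fact[of 0] by simp
        show "?b A = 0" if "A \<notin> cball (mat 1) \<epsilon>" for A
          using test_fun_support[OF test_fun_bump \<epsilon>(1), of A] that by (auto simp: dist_norm norm_minus_commute)
      qed (use fin in auto)
      show "exp (- 4 / 3) * indicator ?S A \<le> ?b A" for A :: "real^'a^'a"
      proof (cases "A \<in> ?S")
        case True
        then have "norm (A - mat 1) / \<epsilon> \<le> 1 / 2" using \<epsilon> by (simp add: dist_norm norm_minus_commute field_simps)
        then have "(norm (A - mat 1) / \<epsilon>)\<^sup>2 \<le> (1 / 2)\<^sup>2" using \<epsilon> by (intro power_mono) auto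
        then have q: "1 - (norm (A - mat 1) / \<epsilon>)\<^sup>2 \<ge> 3 / 4" by (simp add: power2_eq_square)
        then have "- 4 / 3 \<le> - 1 / (1 - (norm (A - mat 1) / \<epsilon>)\<^sup>2)" by (simp add: field_simps)
        then show ?thesis using True q by (simp add: flat_exp_def)
      qed (simp add: flat_nonneg)
    qed
    finally show ?thesis .
  qed
  ultimately show ?thesis unfolding D_def by blast
qed

text \<open>
  The class of functions to which the regularity hypothesis applies, with \<open>H\<close> the constant in
  \<open>\<integral>\<tau>\<^sub>\<epsilon> \<le> H\<epsilon>\<close>.  It is stable under products and under translation by the flow.
\<close>

definition regular :: "(real^'a::finite^'a) set measure \<Rightarrow> real \<Rightarrow> ((real^'a^'a) set \<Rightarrow> real) \<Rightarrow> bool" where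
  "regular X H F \<longleftrightarrow> F \<in> borel_measurable X \<and> (\<forall>\<Lambda>\<in>lattices. \<bar>F \<Lambda>\<bar> \<le> 1) \<and>
     (\<forall>\<epsilon>>0. \<exists>\<tau>\<in>borel_measurable X. (\<forall>\<Lambda>\<in>lattices. 0 \<le> \<tau> \<Lambda>) \<and>
        (\<integral>\<^sup>+\<Lambda>. ennreal (\<tau> \<Lambda>) \<partial>X) \<le> ennreal (H * \<epsilon>) \<and>
        (\<forall>g\<in>SL. norm (g - mat 1) < \<epsilon> \<longrightarrow> (\<forall>\<Lambda>\<in>lattices. \<bar>F (act g \<Lambda>) - F \<Lambda>\<bar> \<le> \<tau> \<Lambda>)))"

definition Cc_smooth :: "((real^'a::finite^'a) set \<Rightarrow> real) \<Rightarrow> bool" where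
  "Cc_smooth \<phi> \<longleftrightarrow> smooth_on_lattices \<phi> \<and> compactly_supported_on_lattices \<phi>"

section \<open>Approximation of regular functions by smooth ones\<close>

context lattice_prob
begin

lemma Cc_smooth_measurable: "Cc_smooth \<phi> \<Longrightarrow> \<phi> \<in> borel_measurable X"
  unfolding Cc_smooth_def smooth_on_lattices_def
  by (rule continuous_map_measurable) (metis empty_iff empty_set lie_derivs.simps(1) subsetI)

text \<open>As an average over a probability measure the normalised smoothing visibly preserves
  bounds by \<open>1\<close>, and Fubini can be applied to it.\<close>

lemma smoothing_measure:
  assumes \<epsilon>: "pos_radius TYPE('a) \<epsilon>"
    and Z_def: "Z = (\<integral>A. flat_exp 0 (1 - (norm (A - mat 1 :: real^'a^'a) / \<epsilon>)\<^sup>2) \<partial>lborel)" and Z: "Z > 0"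
  shows "\<exists>P :: (real^'a^'a) measure. prob_space P \<and> sets P = sets borel \<and>
     (AE A in P. norm (A - mat 1) \<le> \<epsilon>) \<and>
     (\<forall>w M \<Lambda>. bdd_meas M w \<longrightarrow> \<Lambda> \<in> lattices \<longrightarrow>
        conv (\<lambda>A. flat_exp 0 (1 - (norm (A - mat 1) / \<epsilon>)\<^sup>2)) (\<lambda>\<Lambda>. w \<Lambda> / Z) \<Lambda> = (\<integral>A. w (act (nsl A) \<Lambda>) \<partial>P))"
proof -
  have \<epsilon>': "0 < \<epsilon>" "\<epsilon> \<le> 1" using \<epsilon> by (auto simp: pos_radius_def)
  let ?b = "\<lambda>A :: real^'a^'a. flat_exp 0 (1 - (norm (A - mat 1) / \<epsilon>)\<^sup>2)"
  have [measurable]: "?b \<in> borel_measurable borel"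
    by (intro borel_measurable_continuous_onI test_family_continuous[OF test_family.bump] \<epsilon>')
  define P where "P = density lborel (\<lambda>A. ennreal (?b A / Z))"
  have nn: "0 \<le> ?b A / Z" for A using Z flat_nonneg by simp
  \<comment> \<open>A function that is not integrable has Bochner integral \<open>0\<close>, while
    \<open>Z > 0\<close>.\<close>
  have int: "integrable lborel ?b"
    using Z not_integrable_integral_eq[of lborel ?b] unfolding Z_def by force
  have "(\<integral>\<^sup>+A. ennreal (?b A / Z) \<partial>lborel) = ennreal (\<integral>A. ?b A / Z \<partial>lborel)"
    by (rule nn_integral_eq_integral) (use int nn in auto)
  also have "\<dots> = 1" using Z Z_def by simp
  finally have "emeasure P (space P) = 1"
    unfolding P_def by (simp add: emeasure_density)
  then have "prob_space P" by (rule prob_spaceI)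
  moreover have "AE A in P. norm (A - mat 1) \<le> \<epsilon>"
    unfolding P_def
  proof (subst AE_density)
    show "AE A in lborel. 0 < ennreal (?b A / Z) \<longrightarrow> norm (A - mat 1) \<le> \<epsilon>"
    proof (rule AE_I2, rule impI)
      fix A :: "real^'a^'a" assume "0 < ennreal (?b A / Z)"
      then have "?b A \<noteq> 0" by auto
      then show "norm (A - mat 1) \<le> \<epsilon>"
        using test_fun_support[OF test_fun_bump \<epsilon>'(1), of A] by blast
    qed
  qed simp
  moreover have "conv ?b (\<lambda>\<Lambda>. w \<Lambda> / Z) \<Lambda> = (\<integral>A. w (act (nsl A) \<Lambda>) \<partial>P)"
    if "bdd_meas M w" "\<Lambda> \<in> lattices" for w M \<Lambda>
  proof -
    have [measurable]: "w \<in> borel_measurable X" using that by (simp add: bdd_meas_def)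
    note [measurable] = measurable_orbit[OF this that(2)]
    show ?thesis
      unfolding P_def conv_def by (subst integral_density) (auto simp: nn flat_nonneg Z less_imp_le mult_ac)
  qed
  moreover have "sets P = sets borel" by (simp add: P_def)
  ultimately show ?thesis by blast
qed

text \<open>The majorant of the error is smooth as well, so its mean can later be compared between
  \<open>X\<close> and orbits. It is written \<open>1 + e\<close> because far out, where
  \<open>F\<close> is replaced by \<open>0\<close>, it equals \<open>1\<close>; only
  \<open>e\<close> has compact support.\<close>

lemma smooth_approximation:
  assumes B: "basis_of_sl (B :: (real^'a^'a) set)"
  shows "\<exists>C\<ge>1. \<exists>L\<ge>1. \<exists>\<epsilon>0>0. \<epsilon>0 \<le> 1 \<and> (\<forall>\<epsilon> H F. 0 < \<epsilon> \<longrightarrow> \<epsilon> \<le> \<epsilon>0 \<longrightarrow> 0 \<le> H \<longrightarrow> regular X H F \<longrightarrow>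
     (\<exists>\<phi> e. Cc_smooth \<phi> \<and> Cc_smooth e \<and>
        Ck_norm_lattices B k \<phi> \<le> ennreal (C * (1 / \<epsilon>) ^ L) \<and> Ck_norm_lattices B k e \<le> ennreal (C * (1 / \<epsilon>) ^ L) \<and>
        (\<forall>\<Lambda>\<in>lattices. \<bar>\<phi> \<Lambda>\<bar> \<le> 1 \<and> \<bar>e \<Lambda>\<bar> \<le> 1 \<and> \<bar>F \<Lambda> - \<phi> \<Lambda>\<bar> \<le> 1 + e \<Lambda>) \<and>
        (\<integral>\<Lambda>. 1 + e \<Lambda> \<partial>X) \<le> C * (H + 1) * \<epsilon>))"
proof -
  obtain K r where K: "K > 0" and r: "r > 0" "\<And>A :: real^'a^'a. norm (A - mat 1) \<le> r \<Longrightarrow> det A > 0"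
     and lip: "\<And>A :: real^'a^'a. norm (A - mat 1) \<le> r \<Longrightarrow> norm (matrix_inv (nsl A) - mat 1) \<le> K * norm (A - mat 1)"
    using nsl_lipschitz[where 'a='a] by blast
  obtain c where c: "c > 0" "\<And>\<epsilon>. 0 < \<epsilon> \<Longrightarrow> \<epsilon> \<le> 1 \<Longrightarrow>
     c * \<epsilon> ^ DIM(real^'a^'a) \<le> (\<integral>A. flat_exp 0 (1 - (norm (A - mat 1 :: real^'a^'a) / \<epsilon>)\<^sup>2) \<partial>lborel)"
    using bump_integral_lower[where 'a='a] by blast
  obtain C0 L0 where C0: "C0 \<ge> 0" "\<And>\<epsilon> w M. pos_radius TYPE('a) \<epsilon> \<Longrightarrow> bdd_meas M w \<Longrightarrow>
     Ck_norm_lattices B k (conv (\<lambda>A. flat_exp 0 (1 - (norm (A - mat 1) / \<epsilon>)\<^sup>2)) w) \<le> ennreal (C0 * (1 / \<epsilon>) ^ L0 * M)"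
    using Ck_norm_conv[OF test_fun_bump B] by blast
  define \<epsilon>0 where "\<epsilon>0 = min 1 r"
  \<comment> \<open>\<open>C0 / c\<close> comes from normalising the kernel, \<open>2 * K\<close>
    from the oscillation of \<open>F\<close> at scale \<open>2 * K * \<epsilon>\<close>, and
    \<open>1\<close> from the mass outside the compact set.\<close>
  define C where "C = max (max 1 (C0 / c)) (2 * K)"
  define L where "L = L0 + DIM(real^'a^'a)"
  have "\<exists>\<phi> e. Cc_smooth \<phi> \<and> Cc_smooth e \<and>
        Ck_norm_lattices B k \<phi> \<le> ennreal (C * (1 / \<epsilon>) ^ L) \<and> Ck_norm_lattices B k e \<le> ennreal (C * (1 / \<epsilon>) ^ L) \<and>
        (\<forall>\<Lambda>\<in>lattices. \<bar>\<phi> \<Lambda>\<bar> \<le> 1 \<and> \<bar>e \<Lambda>\<bar> \<le> 1 \<and> \<bar>F \<Lambda> - \<phi> \<Lambda>\<bar> \<le> 1 + e \<Lambda>) \<and>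
        (\<integral>\<Lambda>. 1 + e \<Lambda> \<partial>X) \<le> C * (H + 1) * \<epsilon>"
    if \<epsilon>: "0 < \<epsilon>" "\<epsilon> \<le> \<epsilon>0" and H: "0 \<le> H" and F: "regular X H F" for \<epsilon> H F
  proof -
    have pr: "pos_radius TYPE('a) \<epsilon>"
      using \<epsilon> r unfolding pos_radius_def \<epsilon>0_def by auto
    define Z where "Z = (\<integral>A. flat_exp 0 (1 - (norm (A - mat 1 :: real^'a^'a) / \<epsilon>)\<^sup>2) \<partial>lborel)"
    have Zc: "c * \<epsilon> ^ DIM(real^'a^'a) \<le> Z" unfolding Z_def using \<epsilon> by (intro c(2)) (auto simp: \<epsilon>0_def)
    moreover have "c * \<epsilon> ^ DIM(real^'a^'a) > 0" using c(1) \<epsilon> by simp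
    ultimately have Z: "Z > 0" by linarith
    obtain P :: "(real^'a^'a) measure" where P: "prob_space P" "sets P = sets borel" "AE A in P. norm (A - mat 1) \<le> \<epsilon>"
      and mean: "\<And>w M \<Lambda>. bdd_meas M w \<Longrightarrow> \<Lambda> \<in> lattices \<Longrightarrow>
        conv (\<lambda>A. flat_exp 0 (1 - (norm (A - mat 1) / \<epsilon>)\<^sup>2)) (\<lambda>\<Lambda>. w \<Lambda> / Z) \<Lambda> = (\<integral>A. w (act (nsl A) \<Lambda>) \<partial>P)"
      using smoothing_measure[OF pr Z_def Z] by blast
    interpret P: prob_space P by fact
    note [measurable_cong] = P(2)
    have FX [measurable]: "F \<in> borel_measurable X" and F1: "\<And>\<Lambda>. \<Lambda> \<in> lattices \<Longrightarrow> \<bar>F \<Lambda>\<bar> \<le> 1"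
      using F by (auto simp: regular_def)
    \<comment> \<open>The inverse of a normalised kernel point lies within
      \<open>K * \<epsilon>\<close> of the identity; the factor \<open>2\<close> provides the strict
      inequality.\<close>
    have "\<exists>\<tau>\<in>borel_measurable X. (\<forall>\<Lambda>\<in>lattices. 0 \<le> \<tau> \<Lambda>) \<and>
        (\<integral>\<^sup>+\<Lambda>. ennreal (\<tau> \<Lambda>) \<partial>X) \<le> ennreal (H * (2 * K * \<epsilon>)) \<and>
        (\<forall>g\<in>SL. norm (g - mat 1) < 2 * K * \<epsilon> \<longrightarrow> (\<forall>\<Lambda>\<in>lattices. \<bar>F (act g \<Lambda>) - F \<Lambda>\<bar> \<le> \<tau> \<Lambda>))"
      using F K \<epsilon> unfolding regular_def by simp
    then obtain \<tau> where \<tau>m [measurable]: "\<tau> \<in> borel_measurable X" and \<tau>0: "\<And>\<Lambda>. \<Lambda> \<in> lattices \<Longrightarrow> 0 \<le> \<tau> \<Lambda>"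
      and \<tau>i: "(\<integral>\<^sup>+\<Lambda>. ennreal (\<tau> \<Lambda>) \<partial>X) \<le> ennreal (H * (2 * K * \<epsilon>))"
      and \<tau>: "\<And>g \<Lambda>. g \<in> SL \<Longrightarrow> norm (g - mat 1) < 2 * K * \<epsilon> \<Longrightarrow> \<Lambda> \<in> lattices \<Longrightarrow> \<bar>F (act g \<Lambda>) - F \<Lambda>\<bar> \<le> \<tau> \<Lambda>"
      by blast
    obtain Q where Q: "compact Q" "Q \<subseteq> SL" and Qm [measurable]: "lcoset ` Q \<in> sets X"
      and Qe: "emeasure X (lattices - lcoset ` Q) \<le> ennreal \<epsilon>"
      using compact_exhaustion[OF \<epsilon>(1)] by blast
    define v where "v \<Lambda> = (if \<Lambda> \<in> lcoset ` Q then F \<Lambda> else 0)" for \<Lambda>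
    \<comment> \<open>Over the image of \<open>Q\<close>, \<open>1 + u\<close> bounds the
      oscillation of \<open>F\<close>, which is at most \<open>2\<close> in any case; elsewhere it
      is \<open>1\<close>, which bounds \<open>F - 0\<close>. The cap keeps \<open>u\<close> within
      \<open>[-1, 1]\<close>.\<close>
    define u where "u \<Lambda> = (if \<Lambda> \<in> lcoset ` Q then min (\<tau> \<Lambda>) 2 - 1 else 0)" for \<Lambda>
    have [measurable]: "v \<in> borel_measurable X" "u \<in> borel_measurable X"
      unfolding v_def u_def by measurable
    have vb: "bdd_meas 1 v" unfolding bdd_meas_def using F1 by (auto simp: v_def)
    have ub: "bdd_meas 1 u" unfolding bdd_meas_def using \<tau>0 by (auto simp: u_def min_def abs_le_iff) 
    define \<phi> where "\<phi> = conv (\<lambda>A. flat_exp 0 (1 - (norm (A - mat 1) / \<epsilon>)\<^sup>2)) (\<lambda>\<Lambda>. v \<Lambda> / Z)"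
    define e where "e = conv (\<lambda>A. flat_exp 0 (1 - (norm (A - mat 1) / \<epsilon>)\<^sup>2)) (\<lambda>\<Lambda>. u \<Lambda> / Z)"
    have scaled: "bdd_meas (1 / Z) (\<lambda>\<Lambda>. v \<Lambda> / Z)" "bdd_meas (1 / Z) (\<lambda>\<Lambda>. u \<Lambda> / Z)"
      using vb ub Z by (auto simp: bdd_meas_def divide_right_mono)
    have cc: "Cc_smooth \<phi>" "Cc_smooth e"
      unfolding Cc_smooth_def \<phi>_def e_def
      by (intro conjI smooth_conv[OF test_fun_bump pr scaled(1)] smooth_conv[OF test_fun_bump pr scaled(2)]
          conv_support[OF test_fun_bump pr Q]; simp add: v_def u_def)+
    have "C0 * (1 / \<epsilon>) ^ L0 * (1 / Z) \<le> C0 * (1 / \<epsilon>) ^ L0 * (1 / (c * \<epsilon> ^ DIM(real^'a^'a)))"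
      using Zc c \<epsilon> C0(1) by (intro mult_left_mono divide_left_mono) (auto intro!: mult_pos_pos Z)
    also have "\<dots> = (C0 / c) * (1 / \<epsilon>) ^ L"
      by (simp add: L_def power_add power_divide field_simps)
    also have "\<dots> \<le> C * (1 / \<epsilon>) ^ L"
      using \<epsilon> by (intro mult_right_mono) (auto simp: C_def)
    finally have nb: "ennreal (C0 * (1 / \<epsilon>) ^ L0 * (1 / Z)) \<le> ennreal (C * (1 / \<epsilon>) ^ L)" by (rule ennreal_leI)
    have norms: "Ck_norm_lattices B k \<phi> \<le> ennreal (C * (1 / \<epsilon>) ^ L)" "Ck_norm_lattices B k e \<le> ennreal (C * (1 / \<epsilon>) ^ L)"
      unfolding \<phi>_def e_def using C0(2)[OF pr scaled(1)] C0(2)[OF pr scaled(2)] nb by (auto intro: order_trans)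
    have intP: "integrable P (\<lambda>A. w (act (nsl A) \<Lambda>))" if "bdd_meas M w" "\<Lambda> \<in> lattices" for w M \<Lambda>
    proof (rule P.integrable_const_bound[where B=M])
      have "w \<in> borel_measurable X" using that by (simp add: bdd_meas_def)
      from measurable_orbit[OF this that(2)] show "(\<lambda>A. w (act (nsl A) \<Lambda>)) \<in> borel_measurable P"
        using P(2) by (simp cong: measurable_cong_sets)
    qed (use bdd_orbit[OF that] in auto)
    have \<phi>_eq: "\<phi> \<Lambda> = (\<integral>A. v (act (nsl A) \<Lambda>) \<partial>P)" and e_eq: "e \<Lambda> = (\<integral>A. u (act (nsl A) \<Lambda>) \<partial>P)" if "\<Lambda> \<in> lattices" for \<Lambda>
      unfolding \<phi>_def e_def using mean[OF vb that] mean[OF ub that] by auto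
    have abs1: "\<bar>\<integral>A. w (act (nsl A) \<Lambda>) \<partial>P\<bar> \<le> 1" if "bdd_meas 1 w" "\<Lambda> \<in> lattices" for w \<Lambda>
    proof -
      have "\<bar>\<integral>A. w (act (nsl A) \<Lambda>) \<partial>P\<bar> \<le> (\<integral>A. \<bar>w (act (nsl A) \<Lambda>)\<bar> \<partial>P)" by (rule integral_abs_bound)
      also have "\<dots> \<le> (\<integral>A. 1 \<partial>P)"
        by (rule integral_mono) (use intP[OF that] bdd_orbit[OF that] in auto)
      finally show ?thesis by (simp add: P.prob_space)
    qed
    have bound: "\<bar>F \<Lambda> - \<phi> \<Lambda>\<bar> \<le> 1 + e \<Lambda>" if \<Lambda>: "\<Lambda> \<in> lattices" for \<Lambda>
    proof -
      have "F \<Lambda> - \<phi> \<Lambda> = (\<integral>A. F \<Lambda> - v (act (nsl A) \<Lambda>) \<partial>P)"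
        using intP[OF vb \<Lambda>] by (simp add: \<phi>_eq[OF \<Lambda>] P.prob_space)
      then have "\<bar>F \<Lambda> - \<phi> \<Lambda>\<bar> \<le> (\<integral>A. \<bar>F \<Lambda> - v (act (nsl A) \<Lambda>)\<bar> \<partial>P)" by (simp add: integral_abs_bound)
      also have "\<dots> \<le> (\<integral>A. 1 + u (act (nsl A) \<Lambda>) \<partial>P)"
      proof (rule integral_mono_AE)
        show "integrable P (\<lambda>A. \<bar>F \<Lambda> - v (act (nsl A) \<Lambda>)\<bar>)" "integrable P (\<lambda>A. 1 + u (act (nsl A) \<Lambda>))"
          using intP[OF vb \<Lambda>] intP[OF ub \<Lambda>] by auto
        show "AE A in P. \<bar>F \<Lambda> - v (act (nsl A) \<Lambda>)\<bar> \<le> 1 + u (act (nsl A) \<Lambda>)"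
          using P(3)
        proof (rule AE_mp, intro AE_I2 impI)
          fix A :: "real^'a^'a" assume A: "norm (A - mat 1) \<le> \<epsilon>"
          define \<Lambda>' where "\<Lambda>' = act (nsl A) \<Lambda>"
          have \<Lambda>': "\<Lambda>' \<in> lattices" "\<Lambda> = act (matrix_inv (nsl A)) \<Lambda>'"
            using \<Lambda> nsl_SL[of A] by (auto simp: \<Lambda>'_def act_lattices act_inv)
          have "norm (matrix_inv (nsl A) - mat 1) \<le> K * norm (A - mat 1)"
            using A \<epsilon> by (intro lip) (auto simp: \<epsilon>0_def)
          also have "\<dots> \<le> K * \<epsilon>" using A K by (intro mult_left_mono) auto
          also have "\<dots> < 2 * K * \<epsilon>" using K \<epsilon> by simp
          finally have "\<bar>F \<Lambda> - F \<Lambda>'\<bar> \<le> \<tau> \<Lambda>'"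
            using \<tau>[OF matrix_inv_SL(3)[OF nsl_SL] _ \<Lambda>'(1), of A] \<Lambda>'(2) by simp
          moreover have "\<bar>F \<Lambda> - F \<Lambda>'\<bar> \<le> 2" using F1[OF \<Lambda>] F1[OF \<Lambda>'(1)] by linarith
          ultimately have "\<bar>F \<Lambda> - v \<Lambda>'\<bar> \<le> 1 + u \<Lambda>'"
            using F1[OF \<Lambda>] by (auto simp: v_def u_def)
          then show "\<bar>F \<Lambda> - v (act (nsl A) \<Lambda>)\<bar> \<le> 1 + u (act (nsl A) \<Lambda>)" by (simp add: \<Lambda>'_def)
        qed
      qed
      also have "\<dots> = 1 + e \<Lambda>"
        using intP[OF ub \<Lambda>] by (simp add: e_eq[OF \<Lambda>] P.prob_space)
      finally show ?thesis .
    qed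
    have em [measurable]: "e \<in> borel_measurable X" by (rule Cc_smooth_measurable[OF cc(2)])
    have e1: "\<bar>e \<Lambda>\<bar> \<le> 1" "\<bar>\<phi> \<Lambda>\<bar> \<le> 1" if "\<Lambda> \<in> lattices" for \<Lambda>
      using abs1[OF ub that] abs1[OF vb that] by (simp_all add: e_eq \<phi>_eq that)
    \<comment> \<open>By Fubini and invariance, averaging over translates does not change the mean,
      so that of \<open>1 + e\<close> is that of \<open>1 + u\<close>.\<close>
    have "(\<integral>\<^sup>+\<Lambda>. ennreal (1 + e \<Lambda>) \<partial>X) = (\<integral>\<^sup>+\<Lambda>. (\<integral>\<^sup>+A. ennreal (1 + u (act (nsl A) \<Lambda>)) \<partial>P) \<partial>X)"
    proof (rule nn_integral_cong)
      fix \<Lambda> assume "\<Lambda> \<in> space X"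
      then have \<Lambda>: "\<Lambda> \<in> lattices" by simp
      have "(\<integral>\<^sup>+A. ennreal (1 + u (act (nsl A) \<Lambda>)) \<partial>P) = ennreal (\<integral>A. 1 + u (act (nsl A) \<Lambda>) \<partial>P)"
      proof (rule nn_integral_eq_integral)
        show "AE A in P. 0 \<le> 1 + u (act (nsl A) \<Lambda>)"
        proof (rule AE_I2)
          fix A show "0 \<le> 1 + u (act (nsl A) \<Lambda>)" using bdd_orbit[OF ub \<Lambda>, of A] by linarith
        qed
      qed (use intP[OF ub \<Lambda>] in auto)
      also have "\<dots> = ennreal (1 + e \<Lambda>)"
        using intP[OF ub \<Lambda>] by (simp add: e_eq[OF \<Lambda>] P.prob_space)
      finally show "ennreal (1 + e \<Lambda>) = (\<integral>\<^sup>+A. ennreal (1 + u (act (nsl A) \<Lambda>)) \<partial>P)" ..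
    qed
    also have "\<dots> = (\<integral>\<^sup>+A. (\<integral>\<^sup>+\<Lambda>. ennreal (1 + u (act (nsl A) \<Lambda>)) \<partial>X) \<partial>P)"
    proof -
      interpret PX: pair_sigma_finite P X ..
      have "(\<lambda>p. act (nsl (fst p)) (snd p)) \<in> measurable (P \<Otimes>\<^sub>M X) X"
        by (rule measurable_act') (auto simp: nsl_SL intro!: measurable_compose[OF measurable_fst])
      from measurable_compose[OF this, of u borel]
      have "(\<lambda>p. ennreal (1 + u (act (nsl (fst p)) (snd p)))) \<in> borel_measurable (P \<Otimes>\<^sub>M X)"
        by measurable
      then have "case_prod (\<lambda>A \<Lambda>. ennreal (1 + u (act (nsl A) \<Lambda>))) \<in> borel_measurable (P \<Otimes>\<^sub>M X)"
        by (simp only: case_prod_unfold)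
      then show ?thesis by (rule PX.Fubini')
    qed
    also have "\<dots> = (\<integral>\<^sup>+A. (\<integral>\<^sup>+\<Lambda>. ennreal (1 + u \<Lambda>) \<partial>X) \<partial>P)"
      by (intro nn_integral_cong nn_integral_act[OF nsl_SL, of "\<lambda>\<Lambda>. ennreal (1 + u \<Lambda>)"]) measurable
    also have "\<dots> = (\<integral>\<^sup>+\<Lambda>. ennreal (1 + u \<Lambda>) \<partial>X)" by (simp add: P.emeasure_space_1)
    also have "\<dots> \<le> (\<integral>\<^sup>+\<Lambda>. ennreal (\<tau> \<Lambda>) + indicator (lattices - lcoset ` Q) \<Lambda> \<partial>X)"
      by (intro nn_integral_mono) (auto simp: u_def \<tau>0 intro!: ennreal_leI)
    also have "\<dots> = (\<integral>\<^sup>+\<Lambda>. ennreal (\<tau> \<Lambda>) \<partial>X) + emeasure X (lattices - lcoset ` Q)"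
      using sets.compl_sets[OF Qm] by (subst nn_integral_add) auto
    also have "\<dots> \<le> ennreal (H * (2 * K * \<epsilon>)) + ennreal \<epsilon>"
      using \<tau>i Qe by (rule add_mono)
    also have "\<dots> = ennreal (H * (2 * K * \<epsilon>) + \<epsilon>)" using H K \<epsilon> by (simp add: ennreal_plus)
    finally have le: "(\<integral>\<^sup>+\<Lambda>. ennreal (1 + e \<Lambda>) \<partial>X) \<le> ennreal (H * (2 * K * \<epsilon>) + \<epsilon>)" .
    have "(\<integral>\<Lambda>. 1 + e \<Lambda> \<partial>X) = enn2real (\<integral>\<^sup>+\<Lambda>. ennreal (1 + e \<Lambda>) \<partial>X)"
    proof (rule integral_eq_nn_integral)
      show "AE \<Lambda> in X. 0 \<le> 1 + e \<Lambda>"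
      proof (rule AE_I2)
        fix \<Lambda> assume "\<Lambda> \<in> space X" then show "0 \<le> 1 + e \<Lambda>" using e1(1)[of \<Lambda>] by simp
      qed
    qed simp
    also have "\<dots> \<le> H * (2 * K * \<epsilon>) + \<epsilon>"
      using le H K \<epsilon> by (intro enn2real_leI) auto
    also have "\<dots> = (2 * K) * (H * \<epsilon>) + 1 * \<epsilon>" by simp
    also have "\<dots> \<le> C * (H * \<epsilon>) + C * \<epsilon>"
      using H \<epsilon> by (intro add_mono mult_right_mono) (auto simp: C_def)
    also have "\<dots> = C * (H + 1) * \<epsilon>" by (simp add: algebra_simps)
    finally have "(\<integral>\<Lambda>. 1 + e \<Lambda> \<partial>X) \<le> C * (H + 1) * \<epsilon>" .
    then show ?thesis using cc norms e1 bound by blast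
  qed
  moreover have "\<epsilon>0 > 0" "\<epsilon>0 \<le> 1" "C \<ge> 1" using r by (auto simp: \<epsilon>0_def C_def)
  moreover have "L \<ge> 1" unfolding L_def using DIM_positive[where 'a="real^'a^'a"] by linarith
  ultimately show ?thesis by blast
qed

end

subsection \<open>The diagonal flow\<close>

lemma diag_flow_nth: "diag_flow t $ i $ j = (if i = j then (case i of
   Inl _ \<Rightarrow> exp (real CARD('n) / real CARD('m) * t) | Inr _ \<Rightarrow> exp (- t)) else 0)"
  for i :: "'m::finite + 'n::finite"
  by (simp add: diag_flow_def)

lemma diag_flow_SL: "(diag_flow t :: real^('m::finite + 'n::finite)^('m + 'n)) \<in> SL"
proof -
  have "det (diag_flow t :: real^('m + 'n)^('m + 'n)) = (\<Prod>i\<in>UNIV. diag_flow t $ i $ (i :: 'm + 'n))"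
    by (rule det_diagonal) (simp add: diag_flow_nth)
  also have "\<dots> = (\<Prod>i\<in>(UNIV :: 'm set) <+> (UNIV :: 'n set). diag_flow t $ i $ i)"
    by (simp add: UNIV_Plus_UNIV)
  also have "\<dots> = exp (real CARD('n) / real CARD('m) * t) ^ CARD('m) * exp (- t) ^ CARD('n)"
    by (subst prod.Plus) (simp_all add: diag_flow_nth)
  also have "\<dots> = exp (real CARD('m) * (real CARD('n) / real CARD('m) * t) + real CARD('n) * (- t))"
    by (simp only: exp_of_nat_mult exp_add)
  also have "\<dots> = 1" by simp
  finally show ?thesis by (simp add: SL_def)
qed

lemma diag_flow_add: "(diag_flow (s + t) :: real^('m::finite + 'n::finite)^('m + 'n)) = diag_flow s ** diag_flow t"
proof -
  have "(diag_flow s ** diag_flow t) $ i $ j = (\<Sum>k\<in>UNIV. if k = i then diag_flow s $ i $ i * diag_flow t $ i $ j else 0)"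
    for i j :: "'m + 'n"
    unfolding matrix_matrix_mult_def vec_lambda_beta by (intro sum.cong refl) (simp add: diag_flow_nth)
  then show ?thesis
    by (simp add: vec_eq_iff diag_flow_nth exp_add[symmetric] algebra_simps add_divide_distrib split: sum.split)
qed

lemma diag_flow_0 [simp]: "diag_flow 0 = mat 1"
  by (auto simp: vec_eq_iff diag_flow_nth mat_nth split: sum.split)

lemma act_diag_flow_add: "act (diag_flow (s + t)) \<Lambda> = act (diag_flow s) (act (diag_flow t) \<Lambda>)"
  by (simp add: diag_flow_add act_mult)

text \<open>The largest exponential rate at which conjugation by the flow expands matrix entries:
  those with row in \<open>'m\<close> and column in \<open>'n\<close> gain the exponent
  \<open>CARD('n) / CARD('m)\<close> from the left factor and \<open>1\<close> from the right
  one.\<close>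

definition expansion :: "'m::finite itself \<Rightarrow> 'n::finite itself \<Rightarrow> real" where
  "expansion _ _ = 1 + real CARD('n) / real CARD('m)"

lemma norm_conj_diag_flow:
  fixes B :: "real^('m::finite + 'n::finite)^('m + 'n)"
  assumes "s \<ge> 0"
  shows "norm (diag_flow s ** B ** diag_flow (- s)) \<le> exp (expansion TYPE('m) TYPE('n) * s) * norm B"
proof -
  let ?c = "expansion TYPE('m) TYPE('n)"
  have nth: "(diag_flow s ** B ** diag_flow (- s)) $ i $ j = diag_flow s $ i $ i * B $ i $ j * diag_flow (- s) $ j $ j" for i j
  proof -
    have "(diag_flow s ** B) $ i $ k = (\<Sum>l\<in>UNIV. if l = i then diag_flow s $ i $ i * B $ i $ k else 0)" for k
      unfolding matrix_matrix_mult_def vec_lambda_beta by (intro sum.cong refl) (simp add: diag_flow_nth)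
    then have 1: "(diag_flow s ** B) $ i $ k = diag_flow s $ i $ i * B $ i $ k" for k by simp
    have "(diag_flow s ** B ** diag_flow (- s)) $ i $ j = (\<Sum>l\<in>UNIV. if l = j then (diag_flow s ** B) $ i $ j * diag_flow (- s) $ j $ j else 0)"
      unfolding matrix_matrix_mult_def[of "diag_flow s ** B"] vec_lambda_beta by (intro sum.cong refl) (simp add: diag_flow_nth)
    then show ?thesis by (simp add: 1)
  qed
  have le: "diag_flow s $ i $ i * diag_flow (- s) $ j $ j \<le> exp (?c * s)" for i j :: "'m + 'n"
  proof -
    have "real CARD('n) / real CARD('m) * s \<ge> 0" using assms by simp
    then show ?thesis
      using assms by (auto simp: diag_flow_nth exp_add[symmetric] expansion_def algebra_simps split: sum.split)
  qed
  have "norm (diag_flow s ** B ** diag_flow (- s)) \<le> norm (exp (?c * s) *\<^sub>R B)"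
  proof (intro norm_le_componentwise_cart)
    fix i j :: "'m + 'n"
    have "0 \<le> diag_flow s $ i $ i * diag_flow (- s) $ j $ j" by (simp add: diag_flow_nth split: sum.split)
    then have "\<bar>diag_flow s $ i $ i * diag_flow (- s) $ j $ j * B $ i $ j\<bar> \<le> exp (?c * s) * \<bar>B $ i $ j\<bar>"
      unfolding abs_mult using le[of i j] by (intro mult_right_mono) (auto simp: abs_mult[symmetric])
    then show "norm ((diag_flow s ** B ** diag_flow (- s)) $ i $ j) \<le> norm ((exp (?c * s) *\<^sub>R B) $ i $ j)"
      by (simp add: nth mult_ac abs_mult)
  qed
  then show ?thesis by simp
qed

section \<open>The unipotent matrices\<close>

lemma unip_nth:
  "unip \<theta> $ Inl p $ Inl q = (if p = q then 1 else 0)" "unip \<theta> $ Inl p $ Inr q' = \<theta> $ p $ q'"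
  "unip \<theta> $ Inr p' $ Inl q = 0" "unip \<theta> $ Inr p' $ Inr q' = (if p' = q' then 1 else 0)"
  by (simp_all add: unip_def)

lemma sum_UNIV_Plus: "(\<Sum>k\<in>UNIV. G k) = (\<Sum>p\<in>UNIV. G (Inl p)) + (\<Sum>q\<in>UNIV. G (Inr q))"
  for G :: "'m::finite + 'n::finite \<Rightarrow> real"
  by (subst UNIV_Plus_UNIV[symmetric], subst sum.Plus) simp_all

lemma unip_add: "unip (\<theta> + \<theta>') = unip \<theta> ** unip \<theta>'"
proof -
  have "unip (\<theta> + \<theta>') $ i $ j = (unip \<theta> ** unip \<theta>') $ i $ j" for i j
    by (cases i; cases j)
       (simp_all add: unip_nth matrix_matrix_mult_def sum_UNIV_Plus
         if_distrib[of "\<lambda>x. _ * x"] if_distrib[of "\<lambda>x. x * _"] cong: if_cong)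
  then show ?thesis by (simp add: vec_eq_iff)
qed

lemma unip_0: "unip (0 :: real^'n::finite^'m::finite) = mat 1"
proof -
  have "unip (0 :: real^'n^'m) $ i $ j = mat 1 $ i $ j" for i j
    by (cases i; cases j) (simp_all add: unip_nth mat_nth)
  then show ?thesis by (simp add: vec_eq_iff)
qed

text \<open>
  Conjugation by the flow rescales \<open>\<theta>\<close>, so \<open>unip \<theta>\<close> and its square have the same determinant.
\<close>

lemma unip_SL: "unip \<theta> \<in> SL" for \<theta> :: "real^'n::finite^'m::finite"
proof -
  let ?c = "expansion TYPE('m) TYPE('n)"
  \<comment> \<open>At this time conjugation multiplies \<theta> by \<open>2\<close>, that is, it
    turns \<open>unip \<theta>\<close> into its square.\<close>
  define s where "s = ln 2 / ?c"
  have "?c > 0" by (simp add: expansion_def add_pos_nonneg)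
  then have "exp (?c * s) = 2" by (simp add: s_def)
  moreover have "exp (real CARD('n) / real CARD('m) * s) * exp s = exp (?c * s)"
    by (simp add: expansion_def exp_add[symmetric] algebra_simps)
  ultimately have two: "exp (real CARD('n) * s / real CARD('m)) * exp s = 2" by simp
  have nth: "(diag_flow s ** unip \<theta>) $ i $ j = diag_flow s $ i $ i * unip \<theta> $ i $ j" for i j
  proof -
    have "(diag_flow s ** unip \<theta>) $ i $ j = (\<Sum>l\<in>UNIV. if l = i then diag_flow s $ i $ i * unip \<theta> $ i $ j else 0)"
      unfolding matrix_matrix_mult_def vec_lambda_beta by (intro sum.cong refl) (simp add: diag_flow_nth)
    then show ?thesis by simp
  qed
  have nth': "(unip (\<theta> + \<theta>) ** diag_flow s) $ i $ j = unip (\<theta> + \<theta>) $ i $ j * diag_flow s $ j $ j" for i j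
  proof -
    have "(unip (\<theta> + \<theta>) ** diag_flow s) $ i $ j = (\<Sum>l\<in>UNIV. if l = j then unip (\<theta> + \<theta>) $ i $ j * diag_flow s $ j $ j else 0)"
      unfolding matrix_matrix_mult_def vec_lambda_beta by (intro sum.cong refl) (simp add: diag_flow_nth)
    then show ?thesis by simp
  qed
  have "(diag_flow s ** unip \<theta>) $ i $ j = (unip (\<theta> + \<theta>) ** diag_flow s) $ i $ j" for i j
  proof -
    have "exp (real CARD('n) * s / real CARD('m)) = 2 * exp (- s)"
      using two by (simp add: exp_minus field_simps)
    then show ?thesis
      unfolding nth nth' by (cases i; cases j) (simp_all add: unip_nth diag_flow_nth)
  qed
  then have "diag_flow s ** unip \<theta> = unip (\<theta> + \<theta>) ** diag_flow s" by (simp add: vec_eq_iff)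
  then have "det (diag_flow s ** unip \<theta>) = det (unip (\<theta> + \<theta>) ** diag_flow s)" by (rule arg_cong)
  then have "det (unip \<theta>) = det (unip (\<theta> + \<theta>))"
    using diag_flow_SL[of s, where 'm='m and 'n='n] by (simp add: det_mul SL_def)
  also have "\<dots> = det (unip \<theta>) * det (unip \<theta>)" by (simp only: unip_add det_mul)
  finally have "det (unip \<theta>) = det (unip \<theta>) * det (unip \<theta>)" .
  moreover have "det (unip \<theta>) * det (unip (- \<theta>)) = 1"
    by (metis add.right_inverse det_I det_mul unip_0 unip_add)
  then have "det (unip \<theta>) \<noteq> 0" by auto
  ultimately show ?thesis by (simp add: SL_def)
qed

lemma continuous_on_unip: "continuous_on UNIV (unip :: real^'n::finite^'m::finite \<Rightarrow> _)"
proof -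
  have "continuous_on UNIV (\<lambda>\<theta> :: real^'n^'m. case (i, j) of (Inl p, Inl q) \<Rightarrow> if p = q then 1 else 0
    | (Inl p, Inr q) \<Rightarrow> \<theta> $ p $ q | (Inr p, Inl q) \<Rightarrow> 0 | (Inr p, Inr q) \<Rightarrow> if p = q then 1 else 0)" for i j
    by (cases i; cases j) (auto intro!: continuous_intros)
  then show ?thesis
    unfolding unip_def[abs_def] by (intro continuous_on_vec_lambda)
qed

lemma regular_mono: "regular X H F \<Longrightarrow> H \<le> H' \<Longrightarrow> regular X H' F"
  unfolding regular_def
proof (elim conjE, intro conjI allI impI)
  fix \<epsilon> :: real assume *: "H \<le> H'" "\<epsilon> > 0"
    "\<forall>\<epsilon>>0. \<exists>\<tau>\<in>borel_measurable X. (\<forall>\<Lambda>\<in>lattices. 0 \<le> \<tau> \<Lambda>) \<and>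
        (\<integral>\<^sup>+\<Lambda>. ennreal (\<tau> \<Lambda>) \<partial>X) \<le> ennreal (H * \<epsilon>) \<and>
        (\<forall>g\<in>SL. norm (g - mat 1) < \<epsilon> \<longrightarrow> (\<forall>\<Lambda>\<in>lattices. \<bar>F (act g \<Lambda>) - F \<Lambda>\<bar> \<le> \<tau> \<Lambda>))"
  have le: "ennreal (H * \<epsilon>) \<le> ennreal (H' * \<epsilon>)" using * by (intro ennreal_leI mult_right_mono) auto
  obtain \<tau> where \<tau>: "\<tau> \<in> borel_measurable X" "\<forall>\<Lambda>\<in>lattices. 0 \<le> \<tau> \<Lambda>"
    "(\<integral>\<^sup>+\<Lambda>. ennreal (\<tau> \<Lambda>) \<partial>X) \<le> ennreal (H * \<epsilon>)"
    "\<forall>g\<in>SL. norm (g - mat 1) < \<epsilon> \<longrightarrow> (\<forall>\<Lambda>\<in>lattices. \<bar>F (act g \<Lambda>) - F \<Lambda>\<bar> \<le> \<tau> \<Lambda>)"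
    using *(3)[rule_format, OF *(2)] by (elim bexE conjE) (rule that)
  show "\<exists>\<tau>\<in>borel_measurable X. (\<forall>\<Lambda>\<in>lattices. 0 \<le> \<tau> \<Lambda>) \<and>
        (\<integral>\<^sup>+\<Lambda>. ennreal (\<tau> \<Lambda>) \<partial>X) \<le> ennreal (H' * \<epsilon>) \<and>
        (\<forall>g\<in>SL. norm (g - mat 1) < \<epsilon> \<longrightarrow> (\<forall>\<Lambda>\<in>lattices. \<bar>F (act g \<Lambda>) - F \<Lambda>\<bar> \<le> \<tau> \<Lambda>))"
    using \<tau>(1,2,4) order_trans[OF \<tau>(3) le] by (intro bexI[of _ \<tau>] conjI)
qed auto

text \<open>For factors bounded by \<open>1\<close> the difference of two products is at most the
  sum of the differences of the factors, so the moduli \<open>\<tau> i\<close> add up.\<close>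

lemma (in lattice_prob) regular_prod:
  assumes "finite I" "\<And>i. i \<in> I \<Longrightarrow> regular X H (F i)" "H \<ge> 0"
  shows "regular X (real (card I) * H) (\<lambda>\<Lambda>. \<Prod>i\<in>I. F i \<Lambda>)"
  unfolding regular_def
proof (intro conjI ballI allI impI)
  have m: "F i \<in> borel_measurable X" if "i \<in> I" for i using assms(2)[OF that] by (simp add: regular_def)
  have F1: "\<bar>F i \<Lambda>\<bar> \<le> 1" if "i \<in> I" "\<Lambda> \<in> lattices" for i \<Lambda>
    using assms(2)[OF that(1)] that(2) by (simp add: regular_def)
  show "(\<lambda>\<Lambda>. \<Prod>i\<in>I. F i \<Lambda>) \<in> borel_measurable X" by (rule borel_measurable_prod) (rule m)
  show "\<bar>\<Prod>i\<in>I. F i \<Lambda>\<bar> \<le> 1" if "\<Lambda> \<in> lattices" for \<Lambda>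
    using F1[OF _ that] by (simp add: abs_prod prod_le_1)
  fix \<epsilon> :: real assume \<epsilon>: "\<epsilon> > 0"
  have "\<forall>i\<in>I. \<exists>\<tau>\<in>borel_measurable X. (\<forall>\<Lambda>\<in>lattices. 0 \<le> \<tau> \<Lambda>) \<and>
        (\<integral>\<^sup>+\<Lambda>. ennreal (\<tau> \<Lambda>) \<partial>X) \<le> ennreal (H * \<epsilon>) \<and>
        (\<forall>g\<in>SL. norm (g - mat 1) < \<epsilon> \<longrightarrow> (\<forall>\<Lambda>\<in>lattices. \<bar>F i (act g \<Lambda>) - F i \<Lambda>\<bar> \<le> \<tau> \<Lambda>))"
    using assms(2) \<epsilon> by (simp add: regular_def)
  from bchoice[OF this[unfolded Bex_def]] obtain \<tau> where \<tau>: "\<And>i. i \<in> I \<Longrightarrow> \<tau> i \<in> borel_measurable X"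
     "\<And>i \<Lambda>. i \<in> I \<Longrightarrow> \<Lambda> \<in> lattices \<Longrightarrow> 0 \<le> \<tau> i \<Lambda>"
     "\<And>i. i \<in> I \<Longrightarrow> (\<integral>\<^sup>+\<Lambda>. ennreal (\<tau> i \<Lambda>) \<partial>X) \<le> ennreal (H * \<epsilon>)"
     "\<And>i g \<Lambda>. i \<in> I \<Longrightarrow> g \<in> SL \<Longrightarrow> norm (g - mat 1) < \<epsilon> \<Longrightarrow> \<Lambda> \<in> lattices \<Longrightarrow> \<bar>F i (act g \<Lambda>) - F i \<Lambda>\<bar> \<le> \<tau> i \<Lambda>"
    by blast
  show "\<exists>\<tau>\<in>borel_measurable X. (\<forall>\<Lambda>\<in>lattices. 0 \<le> \<tau> \<Lambda>) \<and>
        (\<integral>\<^sup>+\<Lambda>. ennreal (\<tau> \<Lambda>) \<partial>X) \<le> ennreal (real (card I) * H * \<epsilon>) \<and>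
        (\<forall>g\<in>SL. norm (g - mat 1) < \<epsilon> \<longrightarrow> (\<forall>\<Lambda>\<in>lattices. \<bar>(\<Prod>i\<in>I. F i (act g \<Lambda>)) - (\<Prod>i\<in>I. F i \<Lambda>)\<bar> \<le> \<tau> \<Lambda>))"
  proof (intro bexI[of _ "\<lambda>\<Lambda>. \<Sum>i\<in>I. \<tau> i \<Lambda>"] conjI ballI impI)
    show "0 \<le> (\<Sum>i\<in>I. \<tau> i \<Lambda>)" if "\<Lambda> \<in> lattices" for \<Lambda> by (intro sum_nonneg \<tau>(2) that)
    have "(\<integral>\<^sup>+\<Lambda>. ennreal (\<Sum>i\<in>I. \<tau> i \<Lambda>) \<partial>X) = (\<integral>\<^sup>+\<Lambda>. (\<Sum>i\<in>I. ennreal (\<tau> i \<Lambda>)) \<partial>X)"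
      by (intro nn_integral_cong) (simp add: sum_ennreal \<tau>(2))
    also have "\<dots> = (\<Sum>i\<in>I. (\<integral>\<^sup>+\<Lambda>. ennreal (\<tau> i \<Lambda>) \<partial>X))" by (rule nn_integral_sum) (use \<tau>(1) in auto)
    also have "\<dots> \<le> (\<Sum>i\<in>I. ennreal (H * \<epsilon>))" by (intro sum_mono \<tau>(3))
    also have "\<dots> = ennreal (real (card I) * H * \<epsilon>)"
      using \<epsilon> assms(3) by (simp add: ennreal_of_nat_eq_real_of_nat ennreal_mult' mult.assoc)
    finally show "(\<integral>\<^sup>+\<Lambda>. ennreal (\<Sum>i\<in>I. \<tau> i \<Lambda>) \<partial>X) \<le> ennreal (real (card I) * H * \<epsilon>)" .
    fix g \<Lambda> assume g: "g \<in> (SL :: (real^'a^'a) set)" "norm (g - mat 1) < \<epsilon>" "\<Lambda> \<in> (lattices :: (real^'a^'a) set set)"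
    have "norm ((\<Prod>i\<in>I. F i (act g \<Lambda>)) - (\<Prod>i\<in>I. F i \<Lambda>)) \<le> (\<Sum>i\<in>I. norm (F i (act g \<Lambda>) - F i \<Lambda>))"
      by (rule norm_prod_diff) (use F1 g act_lattices in auto)
    also have "\<dots> \<le> (\<Sum>i\<in>I. \<tau> i \<Lambda>)" by (intro sum_mono) (use \<tau>(4) g in auto)
    finally show "\<bar>(\<Prod>i\<in>I. F i (act g \<Lambda>)) - (\<Prod>i\<in>I. F i \<Lambda>)\<bar> \<le> (\<Sum>i\<in>I. \<tau> i \<Lambda>)" by simp
  qed (rule borel_measurable_sum, rule \<tau>(1))
qed

text \<open>Moving \<open>g\<close> past the flow replaces it by its conjugate, whose distance from
  the identity grows at most by the factor \<open>?e\<close>. The modulus at the enlarged scale is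
  transported by the flow, which preserves its mean.\<close>

lemma regular_act_diag_flow:
  fixes X :: "(real^('m::finite + 'n::finite)^('m + 'n)) set measure"
  assumes X: "lattice_prob X" and F: "regular X H F" and s: "s \<ge> 0" and H: "H \<ge> 0"
  shows "regular X (H * exp (expansion TYPE('m) TYPE('n) * s)) (\<lambda>\<Lambda>. F (act (diag_flow s) \<Lambda>))"
  unfolding regular_def
proof (intro conjI ballI allI impI)
  interpret lattice_prob X by fact
  let ?e = "exp (expansion TYPE('m) TYPE('n) * s)"
  have act_m: "act (diag_flow s) \<in> measurable X X"
    by (intro measurable_act') (auto simp: diag_flow_SL)
  have Fm: "F \<in> borel_measurable X" using F by (simp add: regular_def)
  show "(\<lambda>\<Lambda>. F (act (diag_flow s) \<Lambda>)) \<in> borel_measurable X" by (rule measurable_compose[OF act_m Fm])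
  show "\<bar>F (act (diag_flow s) \<Lambda>)\<bar> \<le> 1" if "\<Lambda> \<in> lattices" for \<Lambda>
    using F that by (simp add: regular_def act_lattices diag_flow_SL)
  fix \<epsilon> :: real assume \<epsilon>: "\<epsilon> > 0"
  then have "?e * \<epsilon> > 0" by simp
  then obtain \<tau> where \<tau> [measurable]: "\<tau> \<in> borel_measurable X" "\<And>\<Lambda>. \<Lambda> \<in> lattices \<Longrightarrow> 0 \<le> \<tau> \<Lambda>"
     "(\<integral>\<^sup>+\<Lambda>. ennreal (\<tau> \<Lambda>) \<partial>X) \<le> ennreal (H * (?e * \<epsilon>))"
     "\<And>g \<Lambda>. g \<in> SL \<Longrightarrow> norm (g - mat 1) < ?e * \<epsilon> \<Longrightarrow> \<Lambda> \<in> lattices \<Longrightarrow> \<bar>F (act g \<Lambda>) - F \<Lambda>\<bar> \<le> \<tau> \<Lambda>"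
    using F unfolding regular_def by blast
  show "\<exists>\<tau>\<in>borel_measurable X. (\<forall>\<Lambda>\<in>lattices. 0 \<le> \<tau> \<Lambda>) \<and>
        (\<integral>\<^sup>+\<Lambda>. ennreal (\<tau> \<Lambda>) \<partial>X) \<le> ennreal (H * ?e * \<epsilon>) \<and>
        (\<forall>g\<in>SL. norm (g - mat 1) < \<epsilon> \<longrightarrow> (\<forall>\<Lambda>\<in>lattices. \<bar>F (act (diag_flow s) (act g \<Lambda>)) - F (act (diag_flow s) \<Lambda>)\<bar> \<le> \<tau> \<Lambda>))"
  proof (intro bexI[of _ "\<lambda>\<Lambda>. \<tau> (act (diag_flow s) \<Lambda>)"] conjI ballI impI)
    show "0 \<le> \<tau> (act (diag_flow s) \<Lambda>)" if "\<Lambda> \<in> lattices" for \<Lambda>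
      by (intro \<tau>(2) act_lattices diag_flow_SL that)
    have "(\<integral>\<^sup>+\<Lambda>. ennreal (\<tau> (act (diag_flow s) \<Lambda>)) \<partial>X) = (\<integral>\<^sup>+\<Lambda>. ennreal (\<tau> \<Lambda>) \<partial>X)"
      by (rule nn_integral_act[OF diag_flow_SL, of "\<lambda>\<Lambda>. ennreal (\<tau> \<Lambda>)"]) measurable
    then show "(\<integral>\<^sup>+\<Lambda>. ennreal (\<tau> (act (diag_flow s) \<Lambda>)) \<partial>X) \<le> ennreal (H * ?e * \<epsilon>)"
      using \<tau>(3) by (simp add: mult.assoc)
    fix g :: "real^('m + 'n)^('m + 'n)" and \<Lambda> :: "(real^('m + 'n)^('m + 'n)) set" assume g: "g \<in> SL" "norm (g - mat 1) < \<epsilon>" and \<Lambda>: "\<Lambda> \<in> lattices"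
    define g' where "g' = diag_flow s ** g ** diag_flow (- s)"
    have inv: "diag_flow s ** diag_flow (- s) = (mat 1 :: real^('m + 'n)^('m + 'n))"
      "diag_flow (- s) ** diag_flow s = (mat 1 :: real^('m + 'n)^('m + 'n))"
      by (simp_all add: diag_flow_add[symmetric])
    have "g' - mat 1 = diag_flow s ** (g - mat 1) ** diag_flow (- s)"
      using inv by (simp add: g'_def matmul.diff_left matmul.diff_right)
    then have "norm (g' - mat 1) \<le> ?e * norm (g - mat 1)"
      using norm_conj_diag_flow[OF s, of "g - mat 1"] by simp
    also have "\<dots> < ?e * \<epsilon>" using g by simp
    finally have "\<bar>F (act g' (act (diag_flow s) \<Lambda>)) - F (act (diag_flow s) \<Lambda>)\<bar> \<le> \<tau> (act (diag_flow s) \<Lambda>)"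
      using g \<Lambda> by (intro \<tau>(4)) (auto simp: g'_def SL_mult diag_flow_SL act_lattices)
    moreover have "act g' (act (diag_flow s) \<Lambda>) = act (diag_flow s) (act g \<Lambda>)"
      unfolding g'_def act_mult[symmetric] using inv by (simp add: matrix_mul_assoc[symmetric])
    ultimately show "\<bar>F (act (diag_flow s) (act g \<Lambda>)) - F (act (diag_flow s) \<Lambda>)\<bar> \<le> \<tau> (act (diag_flow s) \<Lambda>)" by simp
  qed (rule measurable_compose[OF act_m \<tau>(1)])
qed

subsection \<open>Mixing for functions of low regularity\<close>

lemma (in lattice_prob) prob_lattices [simp]: "prob lattices = 1"
  using prob_space by simp

lemma finite_gap_set: "finite ({t i | i. i < r} \<union> {\<bar>t i - t j\<bar> | i j. i < r \<and> j < r \<and> i \<noteq> j})"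
  for r :: nat and t :: "nat \<Rightarrow> real"
proof -
  have "{t i | i. i < r} \<subseteq> t ` {..<r}" by auto
  moreover have "{\<bar>t i - t j\<bar> | i j. i < r \<and> j < r \<and> i \<noteq> j} \<subseteq> (\<lambda>(i, j). \<bar>t i - t j\<bar>) ` ({..<r} \<times> {..<r})" by auto
  ultimately show ?thesis by (meson finite_SigmaI finite_UnI finite_imageI finite_lessThan finite_subset)
qed

lemma gap_le: "i < r \<Longrightarrow> gap r t \<le> t i"
  unfolding gap_def by (intro Min_le finite_gap_set) auto

lemma gap_ge:
  assumes "r \<ge> 1" "\<And>i. i < r \<Longrightarrow> D \<le> t i" "\<And>i j. i < r \<Longrightarrow> j < r \<Longrightarrow> i \<noteq> j \<Longrightarrow> D \<le> \<bar>t i - t j\<bar>"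
  shows "D \<le> gap r t"
proof -
  have "t 0 \<in> {t i | i. i < r} \<union> {\<bar>t i - t j\<bar> | i j. i < r \<and> j < r \<and> i \<noteq> j}" using assms(1) by auto
  then show ?thesis
    unfolding gap_def by (intro Min.boundedI finite_gap_set) (use assms(2,3) in blast)+
qed

lemma dir_derivs_1: "\<exists>c. \<bar>c\<bar> \<le> 1 \<and> dir_derivs vs (\<lambda>_. 1) = (\<lambda>_. c)"
proof (induction vs)
  case Nil
  show ?case by (rule exI[of _ 1]) simp
next
  case (Cons v vs)
  then obtain c where "dir_derivs vs (\<lambda>_. 1) = (\<lambda>_. c)" by auto
  then have "dir_derivs (v # vs) (\<lambda>_. 1) = (\<lambda>_. 0)" by (simp add: dir_deriv_def fun_eq_iff)
  then show ?case by (intro exI[of _ 0]) simp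
qed

lemma smooth_1: "smooth (\<lambda>_. 1)"
  unfolding smooth_def
proof (intro allI impI)
  fix vs :: "'a list"
  obtain c where "dir_derivs vs (\<lambda>_. 1) = (\<lambda>_. c)" using dir_derivs_1 by metis
  then show "continuous_on UNIV (dir_derivs vs (\<lambda>_. 1)) \<and>
    (\<forall>v\<in>Basis. \<forall>x. (\<lambda>t. dir_derivs vs (\<lambda>_. 1) (x + t *\<^sub>R v)) differentiable (at 0))" by simp
qed

lemma Ck_norm_1: "Ck_norm k (\<lambda>_. 1) \<le> 1"
  unfolding Ck_norm_def
proof (intro SUP_least)
  fix vs and x :: 'a
  obtain c where "\<bar>c\<bar> \<le> 1" "dir_derivs vs (\<lambda>_. 1) = (\<lambda>_ :: 'a. c)" using dir_derivs_1 by metis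
  then show "ennreal \<bar>dir_derivs vs (\<lambda>_. 1) x\<bar> \<le> 1" by (metis ennreal_1 ennreal_leI)
qed

section \<open>Orbits and condition (EMEI)\<close>

locale emei = lattice_prob X
  for X :: "(real^('m::finite + 'n::finite)^('m + 'n)) set measure" +
  fixes mu :: "(real^'n^'m) measure" and B :: "(real^('m + 'n)^('m + 'n)) set"
  assumes B: "basis_of_sl B" and prob_mu: "prob_space mu" and sets_mu: "sets mu = sets borel"
    and EMEI: "EMEI B X mu"
begin

sublocale mu: prob_space mu by (rule prob_mu)

definition orb :: "real \<Rightarrow> real^'n^'m \<Rightarrow> (real^('m + 'n)^('m + 'n)) set" where
  "orb t \<theta> = act (diag_flow t) (lcoset (unip \<theta>))"

lemma orb_lattices: "orb t \<theta> \<in> lattices"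
  by (simp add: orb_def act_lattices diag_flow_SL lcoset_lattices unip_SL)

lemma orb_add: "act (diag_flow s) (orb t \<theta>) = orb (s + t) \<theta>"
  by (simp add: orb_def act_diag_flow_add)

lemma measurable_orb: "orb t \<in> measurable mu X"
proof -
  have "unip \<in> borel_measurable mu"
    using borel_measurable_continuous_onI[OF continuous_on_unip] sets_mu by (simp cong: measurable_cong_sets)
  then show ?thesis
    unfolding orb_def[abs_def] by (intro measurable_act' measurable_lcoset') (auto simp: diag_flow_SL unip_SL)
qed

lemma measurable_orb' [measurable (raw)]: "F \<in> borel_measurable X \<Longrightarrow> (\<lambda>\<theta>. F (orb t \<theta>)) \<in> borel_measurable mu"
  by (rule measurable_compose[OF measurable_orb])

text \<open>The case of constant \<open>F0\<close>, with one common bound \<open>M\<close> for the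
  norms. \<delta> and \<open>k\<close> stay fixed while \<open>r\<close> varies, since the cases
  \<open>1\<close> and \<open>r\<close> will be combined.\<close>

lemma EMEI_real:
  obtains \<delta> k where "\<delta> > 0" "\<And>r. r \<ge> 1 \<Longrightarrow> \<exists>C\<ge>0. \<forall>F t M.
     (\<forall>i<r. Cc_smooth (F i) \<and> Ck_norm_lattices B k (F i) \<le> ennreal M) \<longrightarrow> (\<forall>i<r. t i > 0) \<longrightarrow> M \<ge> 0 \<longrightarrow>
     \<bar>(\<integral>\<theta>. (\<Prod>i<r. F i (orb (t i) \<theta>)) \<partial>mu) - (\<Prod>i<r. \<integral>\<Lambda>. F i \<Lambda> \<partial>X)\<bar> \<le> C * exp (- \<delta> * gap r t) * M ^ r"
proof -
  obtain \<delta> k where \<delta>: "\<delta> > 0" and main: "\<forall>r\<ge>1. \<exists>C\<ge>0. \<forall>F0 F t.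
        smooth F0 \<longrightarrow>
        (\<forall>i<r. smooth_on_lattices (F i) \<and> compactly_supported_on_lattices (F i)) \<longrightarrow>
        (\<forall>i<r. t i > 0) \<longrightarrow>
        ennreal \<bar>(\<integral>\<theta>. F0 \<theta> * (\<Prod>i<r. F i (act (diag_flow (t i)) (lcoset (unip \<theta>)))) \<partial>mu)
                  - (\<integral>\<theta>. F0 \<theta> \<partial>mu) * (\<Prod>i<r. \<integral>\<Lambda>. F i \<Lambda> \<partial>X)\<bar>
          \<le> ennreal (C * exp (- \<delta> * gap r t)) * Ck_norm k F0 * (\<Prod>i<r. Ck_norm_lattices B k (F i))"
    using EMEI unfolding EMEI_def by (elim exE conjE) (rule that)
  have "\<exists>C\<ge>0. \<forall>F t M.
     (\<forall>i<r. Cc_smooth (F i) \<and> Ck_norm_lattices B k (F i) \<le> ennreal M) \<longrightarrow> (\<forall>i<r. t i > 0) \<longrightarrow> M \<ge> 0 \<longrightarrow>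
     \<bar>(\<integral>\<theta>. (\<Prod>i<r. F i (orb (t i) \<theta>)) \<partial>mu) - (\<Prod>i<r. \<integral>\<Lambda>. F i \<Lambda> \<partial>X)\<bar> \<le> C * exp (- \<delta> * gap r t) * M ^ r"
    if r1: "r \<ge> 1" for r
  proof -
    obtain C where C: "C \<ge> 0" and le: "\<forall>F0 F t.
        smooth F0 \<longrightarrow>
        (\<forall>i<r. smooth_on_lattices (F i) \<and> compactly_supported_on_lattices (F i)) \<longrightarrow>
        (\<forall>i<r. t i > 0) \<longrightarrow>
        ennreal \<bar>(\<integral>\<theta>. F0 \<theta> * (\<Prod>i<r. F i (act (diag_flow (t i)) (lcoset (unip \<theta>)))) \<partial>mu)
                  - (\<integral>\<theta>. F0 \<theta> \<partial>mu) * (\<Prod>i<r. \<integral>\<Lambda>. F i \<Lambda> \<partial>X)\<bar>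
          \<le> ennreal (C * exp (- \<delta> * gap r t)) * Ck_norm k F0 * (\<Prod>i<r. Ck_norm_lattices B k (F i))"
      using main[rule_format, OF r1] by (elim exE conjE) (rule that)
    have "\<bar>(\<integral>\<theta>. (\<Prod>i<r. F i (orb (t i) \<theta>)) \<partial>mu) - (\<Prod>i<r. \<integral>\<Lambda>. F i \<Lambda> \<partial>X)\<bar> \<le> C * exp (- \<delta> * gap r t) * M ^ r"
      if F: "\<forall>i<r. Cc_smooth (F i) \<and> Ck_norm_lattices B k (F i) \<le> ennreal M" and t: "\<forall>i<r. t i > 0" and M: "M \<ge> 0"
      for F and t :: "nat \<Rightarrow> real" and M
    proof -
      have "ennreal \<bar>(\<integral>\<theta>. (\<Prod>i<r. F i (orb (t i) \<theta>)) \<partial>mu) - (\<Prod>i<r. \<integral>\<Lambda>. F i \<Lambda> \<partial>X)\<bar>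
        \<le> ennreal (C * exp (- \<delta> * gap r t)) * Ck_norm k (\<lambda>_ :: real^'n^'m. 1) * (\<Prod>i<r. Ck_norm_lattices B k (F i))"
        using le[rule_format, OF smooth_1, of F t] F t by (simp add: Cc_smooth_def orb_def mu.prob_space)
      also have "\<dots> \<le> ennreal (C * exp (- \<delta> * gap r t)) * 1 * ennreal M ^ r"
      proof (intro mult_mono mult_left_mono Ck_norm_1)
        have "(\<Prod>i<n. Ck_norm_lattices B k (F i)) \<le> ennreal M ^ n" if "n \<le> r" for n
          using that
        proof (induction n)
          case (Suc n)
          then have "(\<Prod>i<n. Ck_norm_lattices B k (F i)) * Ck_norm_lattices B k (F n) \<le> ennreal M ^ n * ennreal M"
            using F by (intro mult_mono) auto
          then show ?case by (simp add: mult.commute)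
        qed simp
        then show "(\<Prod>i<r. Ck_norm_lattices B k (F i)) \<le> ennreal M ^ r" by simp
      qed auto
      also have "\<dots> = ennreal (C * exp (- \<delta> * gap r t) * M ^ r)"
        using C M by (simp add: ennreal_mult ennreal_power)
      finally show ?thesis using C M by (simp add: ennreal_le_iff)
    qed
    then show ?thesis using C by (intro exI[of _ C] conjI allI impI)
  qed
  from that[OF \<delta> this] show ?thesis .
qed

text \<open>Three replacements: \<open>F i\<close> by \<open>\<phi> i\<close> on orbits, orbits by
  \<open>X\<close> for the smooth functions, and \<open>\<phi> i\<close> by \<open>F i\<close> on
  \<open>X\<close>. The error of the first is controlled by the mean of \<open>e i\<close> along
  orbits, which (EMEI) at a single time compares with its mean over \<open>X\<close>.\<close>

lemma mixing_mu:
  assumes r: "(r :: nat) \<ge> 1"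
  shows "\<exists>C\<ge>0. \<exists>\<delta>>0. \<forall>H F t D. H \<ge> 1 \<longrightarrow> (\<forall>i<r. regular X H (F i)) \<longrightarrow> (\<forall>i<r. D \<le> t i) \<longrightarrow> D > 0 \<longrightarrow>
     (\<forall>i<r. \<forall>j<r. i \<noteq> j \<longrightarrow> D \<le> \<bar>t i - t j\<bar>) \<longrightarrow>
     \<bar>(\<integral>\<theta>. (\<Prod>i<r. F i (orb (t i) \<theta>)) \<partial>mu) - (\<Prod>i<r. \<integral>\<Lambda>. F i \<Lambda> \<partial>X)\<bar> \<le> C * H * exp (- \<delta> * D)"
proof -
  obtain \<delta> k where \<delta>: "\<delta> > 0" and main: "\<And>r. r \<ge> 1 \<Longrightarrow> \<exists>C\<ge>0. \<forall>F t M.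
     (\<forall>i<r. Cc_smooth (F i) \<and> Ck_norm_lattices B k (F i) \<le> ennreal M) \<longrightarrow> (\<forall>i<r. t i > 0) \<longrightarrow> M \<ge> 0 \<longrightarrow>
     \<bar>(\<integral>\<theta>. (\<Prod>i<r. F i (orb (t i) \<theta>)) \<partial>mu) - (\<Prod>i<r. \<integral>\<Lambda>. F i \<Lambda> \<partial>X)\<bar> \<le> C * exp (- \<delta> * gap r t) * M ^ r"
    by (rule EMEI_real) (rule that)
  obtain A L \<epsilon>0 where A: "A \<ge> 1" "L \<ge> 1" "\<epsilon>0 > 0" "\<epsilon>0 \<le> 1" and approx: "\<forall>\<epsilon> H F. 0 < \<epsilon> \<longrightarrow> \<epsilon> \<le> \<epsilon>0 \<longrightarrow> 0 \<le> H \<longrightarrow> regular X H F \<longrightarrow>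
     (\<exists>\<phi> e. Cc_smooth \<phi> \<and> Cc_smooth e \<and>
        Ck_norm_lattices B k \<phi> \<le> ennreal (A * (1 / \<epsilon>) ^ L) \<and> Ck_norm_lattices B k e \<le> ennreal (A * (1 / \<epsilon>) ^ L) \<and>
        (\<forall>\<Lambda>\<in>lattices. \<bar>\<phi> \<Lambda>\<bar> \<le> 1 \<and> \<bar>e \<Lambda>\<bar> \<le> 1 \<and> \<bar>F \<Lambda> - \<phi> \<Lambda>\<bar> \<le> 1 + e \<Lambda>) \<and>
        (\<integral>\<Lambda>. 1 + e \<Lambda> \<partial>X) \<le> A * (H + 1) * \<epsilon>)"
    using smooth_approximation[OF B, of k] by (elim exE conjE) (rule that)
  have "(1::nat) \<le> Suc 0" by simp
  obtain C1 where C1: "C1 \<ge> 0" "\<forall>F t M.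
     (\<forall>i<Suc 0. Cc_smooth (F i) \<and> Ck_norm_lattices B k (F i) \<le> ennreal M) \<longrightarrow> (\<forall>i<Suc 0. t i > 0) \<longrightarrow> M \<ge> 0 \<longrightarrow>
     \<bar>(\<integral>\<theta>. (\<Prod>i<Suc 0. F i (orb (t i) \<theta>)) \<partial>mu) - (\<Prod>i<Suc 0. \<integral>\<Lambda>. F i \<Lambda> \<partial>X)\<bar> \<le> C1 * exp (- \<delta> * gap (Suc 0) t) * M ^ Suc 0"
    using main[OF \<open>1 \<le> Suc 0\<close>] by (elim exE conjE) (rule that)
  have single: "\<bar>(\<integral>\<theta>. F (orb t \<theta>) \<partial>mu) - (\<integral>\<Lambda>. F \<Lambda> \<partial>X)\<bar> \<le> C1 * exp (- \<delta> * t) * M"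
    if "Cc_smooth F" "Ck_norm_lattices B k F \<le> ennreal M" "t > 0" "M \<ge> 0" for F t M
  proof -
    have "gap (Suc 0) (\<lambda>_. t) = t" by (rule antisym[OF gap_le gap_ge]) auto
    then show ?thesis using C1(2)[rule_format, of "\<lambda>_. F" M "\<lambda>_. t"] that by simp
  qed
  obtain Cr where Cr: "Cr \<ge> 0" "\<forall>F t M.
     (\<forall>i<r. Cc_smooth (F i) \<and> Ck_norm_lattices B k (F i) \<le> ennreal M) \<longrightarrow> (\<forall>i<r. t i > 0) \<longrightarrow> M \<ge> 0 \<longrightarrow>
     \<bar>(\<integral>\<theta>. (\<Prod>i<r. F i (orb (t i) \<theta>)) \<partial>mu) - (\<Prod>i<r. \<integral>\<Lambda>. F i \<Lambda> \<partial>X)\<bar> \<le> Cr * exp (- \<delta> * gap r t) * M ^ r"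
    using main[OF r] by (elim exE conjE) (rule that)
  \<comment> \<open>With smoothing radius proportional to \<open>exp (- \<kappa> * D)\<close> the
    \<open>r\<close> norms cost \<open>exp (\<kappa> * real L * real r * D)\<close>. This choice
    makes the cost \<open>exp (\<delta> / 2 * D)\<close>, which leaves a decay rate of at least
    \<kappa>.\<close>
  define \<kappa> where "\<kappa> = \<delta> / (2 * real r * real L)"
  have rL: "real r \<ge> 1" "real L \<ge> 1" using r A by auto
  have \<kappa>: "\<kappa> > 0" "\<kappa> * real L * real r = \<delta> / 2" using \<delta> rL by (auto simp: \<kappa>_def)
  have "\<kappa> * real L \<le> \<kappa> * real L * real r" "\<kappa> \<le> \<kappa> * real L" using \<kappa>(1) rL by auto
  then have \<kappa>L: "\<kappa> * real L \<le> \<delta> / 2" "\<kappa> \<le> \<delta> / 2" using \<kappa>(2) by linarith+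
  define Q where "Q = A * (1 / \<epsilon>0) ^ L"
  have Q: "Q \<ge> 0" using A by (simp add: Q_def)
  define E where "E = 2 * A + C1 * Q"
  define C where "C = 2 * real r * E + Cr * Q ^ r"
  have E0: "E \<ge> 0" using A C1 Q by (simp add: E_def)
  have "\<bar>(\<integral>\<theta>. (\<Prod>i<r. F i (orb (t i) \<theta>)) \<partial>mu) - (\<Prod>i<r. \<integral>\<Lambda>. F i \<Lambda> \<partial>X)\<bar> \<le> C * H * exp (- \<kappa> * D)"
    if H: "H \<ge> 1" and F: "\<forall>i<r. regular X H (F i)" and tD: "\<forall>i<r. D \<le> t i" and D: "D > 0"
      and sep: "\<forall>i<r. \<forall>j<r. i \<noteq> j \<longrightarrow> D \<le> \<bar>t i - t j\<bar>" for H F D and t :: "nat \<Rightarrow> real"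
  proof -
    have gap: "D \<le> gap r t" using r tD sep by (intro gap_ge) auto
    define \<epsilon> where "\<epsilon> = \<epsilon>0 * exp (- \<kappa> * D)"
    have \<epsilon>: "0 < \<epsilon>" "\<epsilon> \<le> \<epsilon>0" "\<epsilon> \<le> exp (- \<kappa> * D)" using A \<kappa> D by (auto simp: \<epsilon>_def mult_le_cancel_left1)
    have eM: "A * (1 / \<epsilon>) ^ L = Q * exp (\<kappa> * real L * D)"
      by (simp add: \<epsilon>_def Q_def power_divide power_mult_distrib exp_minus exp_of_nat_mult[symmetric] field_simps)
    define M where "M = A * (1 / \<epsilon>) ^ L"
    have M: "M \<ge> 0" unfolding M_def eM using Q by simp
    define P where "P i \<phi> e \<longleftrightarrow> Cc_smooth \<phi> \<and> Cc_smooth e \<and>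
        Ck_norm_lattices B k \<phi> \<le> ennreal M \<and> Ck_norm_lattices B k e \<le> ennreal M \<and>
        (\<forall>\<Lambda>\<in>lattices. \<bar>\<phi> \<Lambda>\<bar> \<le> 1 \<and> \<bar>e \<Lambda>\<bar> \<le> 1 \<and> \<bar>F i \<Lambda> - \<phi> \<Lambda>\<bar> \<le> 1 + e \<Lambda>) \<and>
        (\<integral>\<Lambda>. 1 + e \<Lambda> \<partial>X) \<le> A * (H + 1) * \<epsilon>" for i \<phi> e
    have "\<forall>i. \<exists>\<phi> e. i < r \<longrightarrow> P i \<phi> e"
      using approx[rule_format, OF \<epsilon>(1,2), of H] F H unfolding P_def M_def by auto
    from choice[OF this] obtain \<phi> where "\<forall>i. \<exists>e. i < r \<longrightarrow> P i (\<phi> i) e" by (elim exE)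
    from choice[OF this] obtain e where "\<forall>i. i < r \<longrightarrow> P i (\<phi> i) (e i)" by (elim exE)
    then have P: "P i (\<phi> i) (e i)" if "i < r" for i using that by simp
    have cc: "Cc_smooth (\<phi> i)" "Cc_smooth (e i)"
      and nm: "Ck_norm_lattices B k (\<phi> i) \<le> ennreal M" "Ck_norm_lattices B k (e i) \<le> ennreal M"
      and ei: "(\<integral>\<Lambda>. 1 + e i \<Lambda> \<partial>X) \<le> A * (H + 1) * \<epsilon>" if "i < r" for i
      using P[OF that] by (simp_all add: P_def)
    have b: "\<bar>\<phi> i \<Lambda>\<bar> \<le> 1" "\<bar>e i \<Lambda>\<bar> \<le> 1" "\<bar>F i \<Lambda> - \<phi> i \<Lambda>\<bar> \<le> 1 + e i \<Lambda>"
      if "i < r" "\<Lambda> \<in> lattices" for i \<Lambda>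
      using P[OF that(1)] that(2) by (simp_all add: P_def)
    have Fm: "F i \<in> borel_measurable X" and F1: "\<Lambda> \<in> lattices \<Longrightarrow> \<bar>F i \<Lambda>\<bar> \<le> 1" if "i < r" for i \<Lambda>
      using F that by (auto simp: regular_def)
    have meas: "\<phi> i \<in> borel_measurable X" "e i \<in> borel_measurable X" if "i < r" for i
      using cc that by (auto intro: Cc_smooth_measurable)
    have intX: "integrable X w" if "w \<in> borel_measurable X" "\<And>\<Lambda>. \<Lambda> \<in> lattices \<Longrightarrow> \<bar>w \<Lambda>\<bar> \<le> 1" for w :: "_ \<Rightarrow> real"
      by (rule integrable_const_bound[where B=1]) (use that in auto)
    have intmu: "integrable mu (\<lambda>\<theta>. w (orb s \<theta>))" if "w \<in> borel_measurable X" "\<And>\<Lambda>. \<Lambda> \<in> lattices \<Longrightarrow> \<bar>w \<Lambda>\<bar> \<le> 1" for w :: "_ \<Rightarrow> real" and s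
      by (rule mu.integrable_const_bound[where B=1]) (use that orb_lattices in auto)
    have tpos: "t i > 0" if "i < r" for i using tD D that by fastforce
    have e2: "A * (H + 1) * \<epsilon> \<le> 2 * A * H * exp (- \<kappa> * D)"
      using mult_mono[of "A * (H + 1)" "A * (2 * H)" \<epsilon> "exp (- \<kappa> * D)"] A H \<epsilon> by (simp add: mult_ac)
    have eX: "(\<integral>\<Lambda>. 1 + e i \<Lambda> \<partial>X) \<le> E * H * exp (- \<kappa> * D)" if "i < r" for i
    proof -
      have "2 * A * H * exp (- \<kappa> * D) \<le> E * H * exp (- \<kappa> * D)"
        using H C1(1) Q by (intro mult_right_mono) (auto simp: E_def)
      then show ?thesis using ei[OF that] e2 by linarith
    qed
    have emu: "(\<integral>\<theta>. 1 + e i (orb (t i) \<theta>) \<partial>mu) \<le> E * H * exp (- \<kappa> * D)" if i: "i < r" for i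
    proof -
      have "\<bar>(\<integral>\<theta>. e i (orb (t i) \<theta>) \<partial>mu) - (\<integral>\<Lambda>. e i \<Lambda> \<partial>X)\<bar> \<le> C1 * exp (- \<delta> * t i) * M"
        by (rule single[OF cc(2) nm(2) tpos M]) (use i in auto)
      also have "\<dots> \<le> C1 * exp (- \<delta> * D) * M"
        using tD i \<delta> C1(1) M by (intro mult_right_mono mult_left_mono) auto
      also have "\<dots> = C1 * Q * exp ((\<kappa> * real L - \<delta>) * D)"
        unfolding M_def eM by (simp add: exp_add[symmetric] algebra_simps)
      also have "\<dots> \<le> C1 * Q * exp (- \<kappa> * D)"
      proof -
        have "\<kappa> * real L - \<delta> \<le> - \<kappa>" using \<kappa>L by linarith
        then have "(\<kappa> * real L - \<delta>) * D \<le> - \<kappa> * D" using D by (intro mult_right_mono) auto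
        then show ?thesis using C1(1) Q by (intro mult_left_mono) auto
      qed
      also have "\<dots> \<le> C1 * Q * H * exp (- \<kappa> * D)"
        using mult_left_mono[OF H, of "C1 * Q"] C1(1) Q by (intro mult_right_mono) auto
      finally have 1: "\<bar>(\<integral>\<theta>. e i (orb (t i) \<theta>) \<partial>mu) - (\<integral>\<Lambda>. e i \<Lambda> \<partial>X)\<bar> \<le> C1 * Q * H * exp (- \<kappa> * D)" .
      have "(\<integral>\<theta>. 1 + e i (orb (t i) \<theta>) \<partial>mu) = 1 + (\<integral>\<theta>. e i (orb (t i) \<theta>) \<partial>mu)"
        using intmu[OF meas(2) b(2), OF i i] by (simp add: mu.prob_space)
      moreover have "(\<integral>\<Lambda>. 1 + e i \<Lambda> \<partial>X) = 1 + (\<integral>\<Lambda>. e i \<Lambda> \<partial>X)"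
        using intX[OF meas(2) b(2), OF i i] by (simp add: prob_space)
      ultimately have "(\<integral>\<theta>. 1 + e i (orb (t i) \<theta>) \<partial>mu) \<le> 2 * A * H * exp (- \<kappa> * D) + C1 * Q * H * exp (- \<kappa> * D)"
        using 1 ei[OF i] e2 by linarith
      then show ?thesis by (simp add: E_def algebra_simps)
    qed
    have T1: "\<bar>(\<integral>\<theta>. (\<Prod>i<r. F i (orb (t i) \<theta>)) \<partial>mu) - (\<integral>\<theta>. (\<Prod>i<r. \<phi> i (orb (t i) \<theta>)) \<partial>mu)\<bar> \<le> real r * (E * H * exp (- \<kappa> * D))"
    proof -
      have prm: "integrable mu (\<lambda>\<theta>. \<Prod>i<r. w i (orb (t i) \<theta>))"
        if "\<And>i. i < r \<Longrightarrow> w i \<in> borel_measurable X" "\<And>i \<Lambda>. i < r \<Longrightarrow> \<Lambda> \<in> lattices \<Longrightarrow> \<bar>w i \<Lambda>\<bar> \<le> 1" for w :: "nat \<Rightarrow> _ \<Rightarrow> real"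
      proof (rule mu.integrable_const_bound[where B=1])
        show "AE \<theta> in mu. norm (\<Prod>i<r. w i (orb (t i) \<theta>)) \<le> 1"
          by (intro AE_I2) (auto simp: abs_prod intro!: prod_le_1 that orb_lattices)
        show "(\<lambda>\<theta>. \<Prod>i<r. w i (orb (t i) \<theta>)) \<in> borel_measurable mu"
          by (intro borel_measurable_prod measurable_orb' that) auto
      qed
      note pF = prm[of F, OF Fm F1] and p\<phi> = prm[of \<phi>, OF meas(1) b(1)]
      have "\<bar>(\<integral>\<theta>. (\<Prod>i<r. F i (orb (t i) \<theta>)) \<partial>mu) - (\<integral>\<theta>. (\<Prod>i<r. \<phi> i (orb (t i) \<theta>)) \<partial>mu)\<bar>
        = \<bar>\<integral>\<theta>. (\<Prod>i<r. F i (orb (t i) \<theta>)) - (\<Prod>i<r. \<phi> i (orb (t i) \<theta>)) \<partial>mu\<bar>"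
        using pF p\<phi> by simp
      also have "\<dots> \<le> (\<integral>\<theta>. \<bar>(\<Prod>i<r. F i (orb (t i) \<theta>)) - (\<Prod>i<r. \<phi> i (orb (t i) \<theta>))\<bar> \<partial>mu)"
        by (rule integral_abs_bound)
      also have "\<dots> \<le> (\<integral>\<theta>. (\<Sum>i<r. 1 + e i (orb (t i) \<theta>)) \<partial>mu)"
      proof (rule integral_mono)
        show "integrable mu (\<lambda>\<theta>. \<bar>(\<Prod>i<r. F i (orb (t i) \<theta>)) - (\<Prod>i<r. \<phi> i (orb (t i) \<theta>))\<bar>)"
          using pF p\<phi> by simp
        show "integrable mu (\<lambda>\<theta>. \<Sum>i<r. 1 + e i (orb (t i) \<theta>))"
          using intmu[OF meas(2) b(2)] by auto
        fix \<theta>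
        have "norm ((\<Prod>i<r. F i (orb (t i) \<theta>)) - (\<Prod>i<r. \<phi> i (orb (t i) \<theta>))) \<le> (\<Sum>i<r. norm (F i (orb (t i) \<theta>) - \<phi> i (orb (t i) \<theta>)))"
          by (rule norm_prod_diff) (use F1 b(1) orb_lattices in auto)
        also have "\<dots> \<le> (\<Sum>i<r. 1 + e i (orb (t i) \<theta>))"
          by (intro sum_mono) (use b(3) orb_lattices in auto)
        finally show "\<bar>(\<Prod>i<r. F i (orb (t i) \<theta>)) - (\<Prod>i<r. \<phi> i (orb (t i) \<theta>))\<bar> \<le> (\<Sum>i<r. 1 + e i (orb (t i) \<theta>))" by simp
      qed
      also have "\<dots> = (\<Sum>i<r. \<integral>\<theta>. 1 + e i (orb (t i) \<theta>) \<partial>mu)"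
        by (rule Bochner_Integration.integral_sum) (use intmu[OF meas(2) b(2)] in auto)
      also have "\<dots> \<le> (\<Sum>i<r. E * H * exp (- \<kappa> * D))" by (intro sum_mono emu) auto
      finally show ?thesis by simp
    qed
    have T2: "\<bar>(\<integral>\<theta>. (\<Prod>i<r. \<phi> i (orb (t i) \<theta>)) \<partial>mu) - (\<Prod>i<r. \<integral>\<Lambda>. \<phi> i \<Lambda> \<partial>X)\<bar> \<le> Cr * Q ^ r * H * exp (- \<kappa> * D)"
    proof -
      have "\<bar>(\<integral>\<theta>. (\<Prod>i<r. \<phi> i (orb (t i) \<theta>)) \<partial>mu) - (\<Prod>i<r. \<integral>\<Lambda>. \<phi> i \<Lambda> \<partial>X)\<bar> \<le> Cr * exp (- \<delta> * gap r t) * M ^ r"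
        by (rule Cr(2)[rule_format]) (use cc nm tpos M in auto)
      also have "\<dots> \<le> Cr * exp (- \<delta> * D) * M ^ r"
        using gap \<delta> Cr(1) M by (intro mult_right_mono mult_left_mono) auto
      also have "\<dots> = Cr * Q ^ r * exp ((\<kappa> * real L * real r - \<delta>) * D)"
        unfolding M_def eM by (simp add: power_mult_distrib exp_of_nat_mult[symmetric] exp_add[symmetric] algebra_simps)
      also have "\<dots> \<le> Cr * Q ^ r * exp (- \<kappa> * D)"
      proof -
        have "\<kappa> * real L * real r - \<delta> \<le> - \<kappa>" using \<kappa>L \<kappa>(2) by linarith
        then have "(\<kappa> * real L * real r - \<delta>) * D \<le> - \<kappa> * D" using D by (intro mult_right_mono) auto
        then show ?thesis using Cr(1) Q by (intro mult_left_mono) auto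
      qed
      also have "\<dots> \<le> Cr * Q ^ r * H * exp (- \<kappa> * D)"
        using mult_left_mono[OF H, of "Cr * Q ^ r"] Cr(1) Q by (intro mult_right_mono) auto
      finally show ?thesis .
    qed
    have T3: "\<bar>(\<Prod>i<r. \<integral>\<Lambda>. \<phi> i \<Lambda> \<partial>X) - (\<Prod>i<r. \<integral>\<Lambda>. F i \<Lambda> \<partial>X)\<bar> \<le> real r * (E * H * exp (- \<kappa> * D))"
    proof -
      have le1: "\<bar>\<integral>\<Lambda>. w \<Lambda> \<partial>X\<bar> \<le> 1" if "w \<in> borel_measurable X" "\<And>\<Lambda>. \<Lambda> \<in> lattices \<Longrightarrow> \<bar>w \<Lambda>\<bar> \<le> 1" for w :: "_ \<Rightarrow> real"
      proof -
        have "\<bar>\<integral>\<Lambda>. w \<Lambda> \<partial>X\<bar> \<le> (\<integral>\<Lambda>. \<bar>w \<Lambda>\<bar> \<partial>X)" by (rule integral_abs_bound)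
        also have "\<dots> \<le> (\<integral>\<Lambda>. 1 \<partial>X)" by (rule integral_mono) (use intX[OF that] that in auto)
        finally show ?thesis by (simp add: prob_space)
      qed
      have "norm ((\<Prod>i<r. \<integral>\<Lambda>. \<phi> i \<Lambda> \<partial>X) - (\<Prod>i<r. \<integral>\<Lambda>. F i \<Lambda> \<partial>X)) \<le> (\<Sum>i<r. norm ((\<integral>\<Lambda>. \<phi> i \<Lambda> \<partial>X) - (\<integral>\<Lambda>. F i \<Lambda> \<partial>X)))"
        by (rule norm_prod_diff) (use le1 meas(1) b(1) Fm F1 in auto)
      also have "\<dots> \<le> (\<Sum>i<r. E * H * exp (- \<kappa> * D))"
      proof (intro sum_mono)
        fix i assume "i \<in> {..<r}"
        then have i: "i < r" by simp
        note i1 = intX[OF meas(1) b(1), OF i i] and i2 = intX[OF Fm F1, OF i i] and i3 = intX[OF meas(2) b(2), OF i i]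
        have "norm ((\<integral>\<Lambda>. \<phi> i \<Lambda> \<partial>X) - (\<integral>\<Lambda>. F i \<Lambda> \<partial>X)) = \<bar>\<integral>\<Lambda>. \<phi> i \<Lambda> - F i \<Lambda> \<partial>X\<bar>"
          using i1 i2 by simp
        also have "\<dots> \<le> (\<integral>\<Lambda>. \<bar>\<phi> i \<Lambda> - F i \<Lambda>\<bar> \<partial>X)" by (rule integral_abs_bound)
        also have "\<dots> \<le> (\<integral>\<Lambda>. 1 + e i \<Lambda> \<partial>X)"
          by (rule integral_mono) (use i1 i2 i3 b(3)[OF i] in \<open>auto simp: abs_minus_commute\<close>)
        also have "\<dots> \<le> E * H * exp (- \<kappa> * D)" by (rule eX[OF i])
        finally show "norm ((\<integral>\<Lambda>. \<phi> i \<Lambda> \<partial>X) - (\<integral>\<Lambda>. F i \<Lambda> \<partial>X)) \<le> E * H * exp (- \<kappa> * D)" .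
      qed
      finally show ?thesis by simp
    qed
    have "C * H * exp (- \<kappa> * D) = real r * (E * H * exp (- \<kappa> * D)) + Cr * Q ^ r * H * exp (- \<kappa> * D) + real r * (E * H * exp (- \<kappa> * D))"
      by (simp add: C_def algebra_simps)
    then show ?thesis using T1 T2 T3 by linarith
  qed
  moreover have "C \<ge> 0" using E0 Cr Q by (simp add: C_def)
  ultimately show ?thesis using \<kappa>(1) by (intro exI[of _ C] exI[of _ \<kappa>] conjI allI impI)
qed

end

lemma partition_prod:
  fixes g :: "'i \<Rightarrow> 'b::comm_monoid_mult"
  assumes "finite I" "partition_on I P"
  shows "(\<Prod>i\<in>I. g i) = (\<Prod>p\<in>P. \<Prod>i\<in>p. g i)"
proof -
  have "I = \<Union>P" using assms(2) by (auto dest: partition_onD1)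
  moreover have "finite p" if "p \<in> P" for p using that assms \<open>I = \<Union>P\<close> by (meson Union_upper finite_subset)
  moreover have "p \<inter> q = {}" if "p \<in> P" "q \<in> P" "p \<noteq> q" for p q
    using partition_onD2[OF assms(2)] that by (auto simp: disjoint_def)
  ultimately show ?thesis by (simp add: prod.Union_disjoint)
qed

text \<open>A family of \<open>r\<close> times may form any number of clusters up to
  \<open>r\<close>; monotonicity in the constants lets one pair serve all these numbers.\<close>

lemma finite_choice_max:
  assumes "\<And>m::nat. 1 \<le> m \<Longrightarrow> m \<le> r \<Longrightarrow> \<exists>C\<ge>0. \<exists>\<delta>>0. Q m C \<delta>"
    and mono: "\<And>m C \<delta> C' \<delta>'. Q m C \<delta> \<Longrightarrow> C \<le> C' \<Longrightarrow> \<delta>' \<le> \<delta> \<Longrightarrow> 0 < \<delta>' \<Longrightarrow> 0 \<le> C \<Longrightarrow> Q m C' \<delta>'"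
  shows "\<exists>C\<ge>0. \<exists>\<delta>>0. \<forall>m. 1 \<le> m \<longrightarrow> m \<le> r \<longrightarrow> Q m (C::real) (\<delta>::real)"
  using assms(1)
proof (induction r)
  case 0
  show ?case by (intro exI[of _ 0] conjI exI[of _ 1]) auto
next
  case (Suc r)
  then obtain C \<delta> where C: "C \<ge> 0" "\<delta> > 0" "\<And>m. 1 \<le> m \<Longrightarrow> m \<le> r \<Longrightarrow> Q m C \<delta>" by auto
  obtain C' \<delta>' where C': "C' \<ge> 0" "\<delta>' > 0" "Q (Suc r) C' \<delta>'" using Suc.prems[of "Suc r"] by auto
  have "Q m (max C C') (min \<delta> \<delta>')" if "1 \<le> m" "m \<le> Suc r" for m
  proof (cases "m = Suc r")
    case True
    then show ?thesis using mono[OF C'(3)] C C' by auto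
  next
    case False
    then show ?thesis using mono[OF C(3)[of m]] C C' that by auto
  qed
  then show ?case using C C' by (intro exI[of _ "max C C'"] conjI exI[of _ "min \<delta> \<delta>'"]) auto
qed

definition clustered :: "(nat \<Rightarrow> nat) \<Rightarrow> nat set set \<Rightarrow> real \<Rightarrow> real \<Rightarrow> bool" where
  "clustered s P D1 D2 \<longleftrightarrow> (\<forall>p\<in>P. \<forall>i\<in>p. \<forall>j\<in>p. \<bar>real (s i) - real (s j)\<bar> \<le> D1) \<and>
     (\<forall>p\<in>P. \<forall>q\<in>P. p \<noteq> q \<longrightarrow> (\<forall>i\<in>p. \<forall>j\<in>q. D2 \<le> \<bar>real (s i) - real (s j)\<bar>))"

subsection \<open>Decay of correlations for clustered times\<close>

context emei
begin

lemma regular_mult_act: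
  assumes "finite I" "\<And>i. i \<in> I \<Longrightarrow> regular X H (F i)" "\<And>i. i \<in> I \<Longrightarrow> 0 \<le> s i \<and> s i \<le> D" "H \<ge> 0"
  shows "regular X (real (card I) * (H * exp (expansion TYPE('m) TYPE('n) * D))) (\<lambda>\<Lambda>. \<Prod>i\<in>I. F i (act (diag_flow (s i)) \<Lambda>))"
proof (rule regular_prod[OF assms(1)])
  fix i assume i: "i \<in> I"
  have "regular X (H * exp (expansion TYPE('m) TYPE('n) * s i)) (\<lambda>\<Lambda>. F i (act (diag_flow (s i)) \<Lambda>))"
    by (rule regular_act_diag_flow[OF lattice_prob_axioms assms(2)[OF i]]) (use assms i in auto)
  then show "regular X (H * exp (expansion TYPE('m) TYPE('n) * D)) (\<lambda>\<Lambda>. F i (act (diag_flow (s i)) \<Lambda>))"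
  proof (rule regular_mono)
    have "expansion TYPE('m) TYPE('n) \<ge> 0" by (simp add: expansion_def)
    then show "H * exp (expansion TYPE('m) TYPE('n) * s i) \<le> H * exp (expansion TYPE('m) TYPE('n) * D)"
      using assms i by (intro mult_left_mono) (auto intro!: mult_left_mono)
  qed
qed (use assms in auto)

text \<open>
  Since \<open>\<mu>\<close>-orbits equidistribute, correlations on the space of lattices are limits of correlations
  along orbits, and inherit their decay.
\<close>

lemma mixing_X:
  assumes r: "(r :: nat) \<ge> 1"
  shows "\<exists>C\<ge>0. \<exists>\<delta>>0. \<forall>H F t D. H \<ge> 1 \<longrightarrow> (\<forall>i<r. regular X H (F i)) \<longrightarrow> (\<forall>i<r. 0 \<le> t i) \<longrightarrow> D > 0 \<longrightarrow>
     (\<forall>i<r. \<forall>j<r. i \<noteq> j \<longrightarrow> D \<le> \<bar>t i - t j\<bar>) \<longrightarrow>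
     \<bar>(\<integral>\<Lambda>. (\<Prod>i<r. F i (act (diag_flow (t i)) \<Lambda>)) \<partial>X) - (\<Prod>i<r. \<integral>\<Lambda>. F i \<Lambda> \<partial>X)\<bar> \<le> C * H * exp (- \<delta> * D)"
proof -
  obtain C \<delta> where C: "C \<ge> 0" "\<delta> > 0" and main: "\<forall>H F t D. H \<ge> 1 \<longrightarrow> (\<forall>i<r. regular X H (F i)) \<longrightarrow> (\<forall>i<r. D \<le> t i) \<longrightarrow> D > 0 \<longrightarrow>
     (\<forall>i<r. \<forall>j<r. i \<noteq> j \<longrightarrow> D \<le> \<bar>t i - t j\<bar>) \<longrightarrow>
     \<bar>(\<integral>\<theta>. (\<Prod>i<r. F i (orb (t i) \<theta>)) \<partial>mu) - (\<Prod>i<r. \<integral>\<Lambda>. F i \<Lambda> \<partial>X)\<bar> \<le> C * H * exp (- \<delta> * D)"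
    using mixing_mu[OF r] by (elim exE conjE) (rule that)
  have "(1::nat) \<le> Suc 0" by simp
  obtain C1 \<delta>1 where C1: "C1 \<ge> 0" "\<delta>1 > 0" and one: "\<forall>H F t D. H \<ge> 1 \<longrightarrow> (\<forall>i<Suc 0. regular X H (F i)) \<longrightarrow> (\<forall>i<Suc 0. D \<le> t i) \<longrightarrow> D > 0 \<longrightarrow>
     (\<forall>i<Suc 0. \<forall>j<Suc 0. i \<noteq> j \<longrightarrow> D \<le> \<bar>t i - t j\<bar>) \<longrightarrow>
     \<bar>(\<integral>\<theta>. (\<Prod>i<Suc 0. F i (orb (t i) \<theta>)) \<partial>mu) - (\<Prod>i<Suc 0. \<integral>\<Lambda>. F i \<Lambda> \<partial>X)\<bar> \<le> C1 * H * exp (- \<delta>1 * D)"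
    using mixing_mu[OF \<open>1 \<le> Suc 0\<close>] by (elim exE conjE) (rule that)
  have "\<bar>(\<integral>\<Lambda>. (\<Prod>i<r. F i (act (diag_flow (t i)) \<Lambda>)) \<partial>X) - (\<Prod>i<r. \<integral>\<Lambda>. F i \<Lambda> \<partial>X)\<bar> \<le> C * H * exp (- \<delta> * D)"
    if H: "H \<ge> 1" and F: "\<forall>i<r. regular X H (F i)" and t: "\<forall>i<r. 0 \<le> t i" and D: "D > 0"
      and sep: "\<forall>i<r. \<forall>j<r. i \<noteq> j \<longrightarrow> D \<le> \<bar>t i - t j\<bar>" for H F D and t :: "nat \<Rightarrow> real"
  proof -
    define G where "G \<Lambda> = (\<Prod>i<r. F i (act (diag_flow (t i)) \<Lambda>))" for \<Lambda>
    \<comment> \<open>A crude common bound for the times. The constant \<open>H'\<close> built from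
      it may be enormous, but it is multiplied by \<open>exp (- \<delta>1 * T)\<close> and
      disappears as \<open>T\<close> tends to infinity.\<close>
    define S where "S = (\<Sum>i<r. t i)"
    have tS: "t i \<le> S" if "i < r" for i
      unfolding S_def by (rule member_le_sum) (use that t in auto)
    define H' where "H' = max 1 (real r * (H * exp (expansion TYPE('m) TYPE('n) * S)))"
    have "regular X (real (card {..<r}) * (H * exp (expansion TYPE('m) TYPE('n) * S))) G"
      unfolding G_def by (rule regular_mult_act) (use F t tS H in auto)
    then have G: "regular X H' G" by (rule regular_mono) (simp add: H'_def)
    define P where "P = (\<Prod>i<r. \<integral>\<Lambda>. F i \<Lambda> \<partial>X)"
    have bound: "\<bar>(\<integral>\<Lambda>. G \<Lambda> \<partial>X) - P\<bar> \<le> C1 * H' * exp (- \<delta>1 * T) + C * H * exp (- \<delta> * D)" if "T \<ge> D" for T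
    proof -
      have "\<bar>(\<integral>\<theta>. G (orb T \<theta>) \<partial>mu) - (\<integral>\<Lambda>. G \<Lambda> \<partial>X)\<bar> \<le> C1 * H' * exp (- \<delta>1 * T)"
        using one[rule_format, of H' "\<lambda>_. G" T "\<lambda>_. T"] G that D by (simp add: H'_def)
      moreover have "\<bar>(\<integral>\<theta>. (\<Prod>i<r. F i (orb (t i + T) \<theta>)) \<partial>mu) - P\<bar> \<le> C * H * exp (- \<delta> * D)"
        unfolding P_def by (rule main[rule_format]) (use H F t D sep that in force)+
      moreover have eq: "(\<Prod>i<r. F i (orb (t i + T) \<theta>)) = G (orb T \<theta>)" for \<theta>
        by (simp add: G_def orb_add)
      ultimately show ?thesis unfolding eq by linarith
    qed
    have "((\<lambda>T. C1 * H' * exp (- \<delta>1 * T) + C * H * exp (- \<delta> * D)) \<longlongrightarrow> C1 * H' * 0 + C * H * exp (- \<delta> * D)) at_top"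
    proof (intro tendsto_add tendsto_mult tendsto_const)
      show "((\<lambda>T. exp (- \<delta>1 * T)) \<longlongrightarrow> 0) at_top"
        using C1(2) by real_asymp
    qed
    then have "\<bar>(\<integral>\<Lambda>. G \<Lambda> \<partial>X) - P\<bar> \<le> C1 * H' * 0 + C * H * exp (- \<delta> * D)"
      by (rule tendsto_lowerbound) (use bound in \<open>auto intro!: eventually_at_top_linorderI[of D]\<close>)
    then show ?thesis by (simp add: G_def P_def)
  qed
  then show ?thesis using C by (intro exI[of _ C] exI[of _ \<delta>] conjI allI impI)
qed

text \<open>Each part becomes one observable \<open>F j\<close>, observed at the earliest time
  \<open>t j\<close> of the part; its regularity constant carries the factor
  \<open>exp (?x * D1)\<close>. Mixing is then applied to the earliest times, which are separated by
  \<open>D2\<close>.\<close>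

lemma cluster_decay:
  fixes r :: nat
  assumes h: "regular X H0 h" and H0: "H0 \<ge> 1"
  shows "\<exists>C\<ge>0. \<exists>\<delta>>0. \<forall>I s P D1 D2. finite I \<longrightarrow> card I \<le> r \<longrightarrow> partition_on I P \<longrightarrow> 0 \<le> D1 \<longrightarrow> 0 < D2 \<longrightarrow> clustered s P D1 D2 \<longrightarrow>
     ((\<forall>i\<in>I. D2 \<le> real (s i)) \<longrightarrow>
       \<bar>(\<integral>\<theta>. (\<Prod>i\<in>I. h (orb (s i) \<theta>)) \<partial>mu) - (\<Prod>p\<in>P. \<integral>\<Lambda>. (\<Prod>i\<in>p. h (act (diag_flow (s i)) \<Lambda>)) \<partial>X)\<bar>
         \<le> C * exp (expansion TYPE('m) TYPE('n) * D1 - \<delta> * D2)) \<and>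
     \<bar>(\<integral>\<Lambda>. (\<Prod>i\<in>I. h (act (diag_flow (s i)) \<Lambda>)) \<partial>X) - (\<Prod>p\<in>P. \<integral>\<Lambda>. (\<Prod>i\<in>p. h (act (diag_flow (s i)) \<Lambda>)) \<partial>X)\<bar>
         \<le> C * exp (expansion TYPE('m) TYPE('n) * D1 - \<delta> * D2)"
proof -
  let ?x = "expansion TYPE('m) TYPE('n)"
  define Q1 where "Q1 m C \<delta> \<longleftrightarrow> (\<forall>H F t D. H \<ge> 1 \<longrightarrow> (\<forall>i<m. regular X H (F i)) \<longrightarrow> (\<forall>i<m. D \<le> t i) \<longrightarrow> D > 0 \<longrightarrow>
     (\<forall>i<m. \<forall>j<m. i \<noteq> j \<longrightarrow> D \<le> \<bar>t i - t j\<bar>) \<longrightarrow>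
     \<bar>(\<integral>\<theta>. (\<Prod>i<m. F i (orb (t i) \<theta>)) \<partial>mu) - (\<Prod>i<m. \<integral>\<Lambda>. F i \<Lambda> \<partial>X)\<bar> \<le> C * H * exp (- \<delta> * D))" for m :: nat and C \<delta> :: real
  define Q2 where "Q2 m C \<delta> \<longleftrightarrow> (\<forall>H F t D. H \<ge> 1 \<longrightarrow> (\<forall>i<m. regular X H (F i)) \<longrightarrow> (\<forall>i<m. 0 \<le> t i) \<longrightarrow> D > 0 \<longrightarrow>
     (\<forall>i<m. \<forall>j<m. i \<noteq> j \<longrightarrow> D \<le> \<bar>t i - t j\<bar>) \<longrightarrow>
     \<bar>(\<integral>\<Lambda>. (\<Prod>i<m. F i (act (diag_flow (t i)) \<Lambda>)) \<partial>X) - (\<Prod>i<m. \<integral>\<Lambda>. F i \<Lambda> \<partial>X)\<bar> \<le> C * H * exp (- \<delta> * D))" for m :: nat and C \<delta> :: real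
  have le: "C * H * exp (- \<delta> * D) \<le> C' * H * exp (- \<delta>' * D)"
    if "C \<le> C'" "\<delta>' \<le> \<delta>" "0 \<le> C" "H \<ge> 1" "D > 0" for C C' \<delta> \<delta>' H D :: real
    using that by (intro mult_mono mult_right_mono) auto
  have "\<exists>C\<ge>0. \<exists>\<delta>>0. \<forall>m. 1 \<le> m \<longrightarrow> m \<le> r \<longrightarrow> Q1 m C \<delta>"
  proof (rule finite_choice_max)
    show "\<exists>C\<ge>0. \<exists>\<delta>>0. Q1 m C \<delta>" if "1 \<le> m" "m \<le> r" for m
      unfolding Q1_def by (rule mixing_mu[OF that(1)])
    show "Q1 m C' \<delta>'" if Q: "Q1 m C \<delta>" and *: "C \<le> C'" "\<delta>' \<le> \<delta>" "0 < \<delta>'" "0 \<le> C" for m C \<delta> C' \<delta>'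
      unfolding Q1_def by (intro allI impI, rule order_trans[OF Q[unfolded Q1_def, rule_format] le]) (use * in auto)
  qed
  then obtain C1 \<delta>1 where C1: "C1 \<ge> 0" "\<delta>1 > 0" "\<And>m. 1 \<le> m \<Longrightarrow> m \<le> r \<Longrightarrow> Q1 m C1 \<delta>1" by blast
  have "\<exists>C\<ge>0. \<exists>\<delta>>0. \<forall>m. 1 \<le> m \<longrightarrow> m \<le> r \<longrightarrow> Q2 m C \<delta>"
  proof (rule finite_choice_max)
    show "\<exists>C\<ge>0. \<exists>\<delta>>0. Q2 m C \<delta>" if "1 \<le> m" "m \<le> r" for m
      unfolding Q2_def by (rule mixing_X[OF that(1)])
    show "Q2 m C' \<delta>'" if Q: "Q2 m C \<delta>" and *: "C \<le> C'" "\<delta>' \<le> \<delta>" "0 < \<delta>'" "0 \<le> C" for m C \<delta> C' \<delta>'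
      unfolding Q2_def by (intro allI impI, rule order_trans[OF Q[unfolded Q2_def, rule_format] le]) (use * in auto)
  qed
  then obtain C2 \<delta>2 where C2: "C2 \<ge> 0" "\<delta>2 > 0" "\<And>m. 1 \<le> m \<Longrightarrow> m \<le> r \<Longrightarrow> Q2 m C2 \<delta>2" by blast
  define \<delta> where "\<delta> = min \<delta>1 \<delta>2"
  define C where "C = max C1 C2 * (real r * H0 + 1)"
  have "\<delta> > 0" "C \<ge> 0" using C1 C2 H0 by (auto simp: \<delta>_def C_def)
  have "((\<forall>i\<in>I. D2 \<le> real (s i)) \<longrightarrow>
       \<bar>(\<integral>\<theta>. (\<Prod>i\<in>I. h (orb (s i) \<theta>)) \<partial>mu) - (\<Prod>p\<in>P. \<integral>\<Lambda>. (\<Prod>i\<in>p. h (act (diag_flow (s i)) \<Lambda>)) \<partial>X)\<bar> \<le> C * exp (?x * D1 - \<delta> * D2)) \<and>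
     \<bar>(\<integral>\<Lambda>. (\<Prod>i\<in>I. h (act (diag_flow (s i)) \<Lambda>)) \<partial>X) - (\<Prod>p\<in>P. \<integral>\<Lambda>. (\<Prod>i\<in>p. h (act (diag_flow (s i)) \<Lambda>)) \<partial>X)\<bar> \<le> C * exp (?x * D1 - \<delta> * D2)"
    if I: "finite I" "card I \<le> r" and P: "partition_on I P" and D: "0 \<le> D1" "0 < D2" and cl: "clustered s P D1 D2"
    for I P D1 D2 and s :: "nat \<Rightarrow> nat"
  proof (cases "I = {}")
    case True
    then have "P = {}" using P by (simp add: partition_on_empty)
    then show ?thesis using True \<open>C \<ge> 0\<close> by (simp add: mu.prob_space prob_space)
  next
    case False
    have finP: "finite P" using finite_elements[OF I(1) P] .
    have IP: "I = \<Union>P" using P by (auto dest: partition_onD1)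
    have pne: "p \<noteq> {}" if "p \<in> P" for p using P that by (auto dest: partition_onD3)
    have psub: "p \<subseteq> I" if "p \<in> P" for p using that IP by auto
    have pfin: "finite p" "p \<subseteq> I" if "p \<in> P" for p
      using finite_subset[OF psub[OF that] I(1)] psub[OF that] by auto
    define m where "m = card P"
    have m1: "1 \<le> m" using False IP finP by (auto simp: m_def Suc_le_eq card_gt_0_iff)
    have "m \<le> r"
    proof -
      have "\<forall>p\<in>P. \<exists>i. i \<in> p" using pne by blast
      then obtain c where c: "\<And>p. p \<in> P \<Longrightarrow> c p \<in> p" by metis
      have "inj_on c P"
        by (rule inj_onI) (metis c P disjoint_def disjoint_iff partition_onD2)
      moreover have "c ` P \<subseteq> I" using c IP by auto
      ultimately have "card P \<le> card I" using I(1) by (metis card_inj_on_le)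
      then show ?thesis using I(2) by (simp add: m_def)
    qed
    obtain e where e: "bij_betw e {..<m} P"
      using ex_bij_betw_nat_finite[OF finP] by (auto simp: m_def atLeast0LessThan)
    have eP: "e j \<in> P" if "j < m" for j using e that by (auto simp: bij_betw_def)
    have einj: "e i \<noteq> e j" if "i < m" "j < m" "i \<noteq> j" for i j using e that by (auto simp: bij_betw_def inj_on_def)
    define t where "t j = Min (s ` e j)" for j
    have tin: "\<exists>i\<in>e j. t j = s i" if "j < m" for j
    proof -
      have "Min (s ` e j) \<in> s ` e j"
        using pfin(1)[OF eP[OF that]] pne[OF eP[OF that]] by (intro Min_in) auto
      then show ?thesis by (simp add: t_def image_iff)
    qed
    have tle: "t j \<le> s i" if "j < m" "i \<in> e j" for i j
      unfolding t_def by (rule Min_le) (use pfin(1)[OF eP[OF that(1)]] that in auto)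
    define F where "F j \<Lambda> = (\<Prod>i\<in>e j. h (act (diag_flow (real (s i) - real (t j))) \<Lambda>))" for j \<Lambda>
    \<comment> \<open>At most \<open>r\<close> factors, each flowed for a time at most
      \<open>D1\<close>; the \<open>+ 1\<close> ensures \<open>H \<ge> 1\<close>.\<close>
    define H where "H = real r * (H0 * exp (?x * D1)) + 1"
    have H1: "H \<ge> 1" using H0 by (simp add: H_def)
    have F: "regular X H (F j)" if jm: "j < m" for j
    proof -
      have "regular X (real (card (e j)) * (H0 * exp (?x * D1))) (F j)"
        unfolding F_def
      proof (rule regular_mult_act[OF pfin(1)[OF eP[OF jm]]])
        fix i assume i: "i \<in> e j"
        obtain i' where "i' \<in> e j" "t j = s i'" using tin[OF jm] by auto
        then have "\<bar>real (s i) - real (t j)\<bar> \<le> D1" using cl eP[OF jm] i by (auto simp: clustered_def)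
        then show "0 \<le> real (s i) - real (t j) \<and> real (s i) - real (t j) \<le> D1" using tle[OF jm i] by auto
      qed (use h H0 in auto)
      moreover have "card (e j) \<le> r" using card_mono[OF I(1) pfin(2)[OF eP[OF jm]]] I(2) by simp
      then have "real (card (e j)) * (H0 * exp (?x * D1)) \<le> real r * (H0 * exp (?x * D1))"
        using H0 by (intro mult_right_mono) auto
      then have "real (card (e j)) * (H0 * exp (?x * D1)) \<le> H" unfolding H_def by linarith
      ultimately show ?thesis by (rule regular_mono)
    qed
    have sep: "D2 \<le> \<bar>real (t i) - real (t j)\<bar>" if ij: "i < m" "j < m" "i \<noteq> j" for i j
      using tin[OF ij(1)] tin[OF ij(2)] cl eP[OF ij(1)] eP[OF ij(2)] einj[OF ij] by (force simp: clustered_def)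
    have Fact: "F j (act (diag_flow (real (t j))) \<Lambda>) = (\<Prod>i\<in>e j. h (act (diag_flow (s i)) \<Lambda>))" for j \<Lambda>
      unfolding F_def by (simp add: act_diag_flow_add[symmetric])
    have Forb: "F j (orb (real (t j)) \<theta>) = (\<Prod>i\<in>e j. h (orb (s i) \<theta>))" for j \<theta>
      unfolding F_def by (simp add: orb_add)
    have reindex: "(\<Prod>j<m. G (e j)) = (\<Prod>p\<in>P. G p)" for G :: "nat set \<Rightarrow> real"
      by (rule prod.reindex_bij_betw[OF e])
    have intF: "(\<integral>\<Lambda>. F j \<Lambda> \<partial>X) = (\<integral>\<Lambda>. (\<Prod>i\<in>e j. h (act (diag_flow (s i)) \<Lambda>)) \<partial>X)" if "j < m" for j
      using integral_act[OF diag_flow_SL, of "F j" "real (t j)"] F[OF that] by (simp add: Fact regular_def)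
    have prodX: "(\<Prod>j<m. \<integral>\<Lambda>. F j \<Lambda> \<partial>X) = (\<Prod>p\<in>P. \<integral>\<Lambda>. (\<Prod>i\<in>p. h (act (diag_flow (s i)) \<Lambda>)) \<partial>X)"
      using reindex[of "\<lambda>p. \<integral>\<Lambda>. (\<Prod>i\<in>p. h (act (diag_flow (s i)) \<Lambda>)) \<partial>X"] by (simp add: intF)
    have est: "C0 * H * exp (- \<delta>0 * D2) \<le> C * exp (?x * D1 - \<delta> * D2)"
      if "0 \<le> C0" "C0 \<le> max C1 C2" "\<delta> \<le> \<delta>0" for C0 \<delta>0
    proof -
      have x: "?x * D1 \<ge> 0" using D by (simp add: expansion_def)
      then have "1 \<le> exp (?x * D1)" by simp
      then have "H \<le> (real r * H0 + 1) * exp (?x * D1)" by (simp add: H_def algebra_simps)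
      moreover have "exp (- \<delta>0 * D2) \<le> exp (- \<delta> * D2)" using that D by simp
      ultimately have "C0 * H * exp (- \<delta>0 * D2) \<le> max C1 C2 * ((real r * H0 + 1) * exp (?x * D1)) * exp (- \<delta> * D2)"
        using that H1 by (intro mult_mono) auto
      also have "\<dots> = C * exp (?x * D1 - \<delta> * D2)" by (simp add: C_def exp_diff exp_minus field_simps)
      finally show ?thesis .
    qed
    show ?thesis
    proof (intro conjI impI)
      assume sD: "\<forall>i\<in>I. D2 \<le> real (s i)"
      have "\<bar>(\<integral>\<theta>. (\<Prod>j<m. F j (orb (real (t j)) \<theta>)) \<partial>mu) - (\<Prod>j<m. \<integral>\<Lambda>. F j \<Lambda> \<partial>X)\<bar> \<le> C1 * H * exp (- \<delta>1 * D2)"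
      proof (rule C1(3)[OF m1 \<open>m \<le> r\<close>, unfolded Q1_def, rule_format])
        show "D2 \<le> real (t i)" if "i < m" for i
          using tin[OF that] sD pfin(2)[OF eP[OF that]] by auto
      qed (use H1 F D sep in auto)
      also have "\<dots> \<le> C * exp (?x * D1 - \<delta> * D2)" by (rule est) (use C1 in \<open>auto simp: \<delta>_def\<close>)
      finally show "\<bar>(\<integral>\<theta>. (\<Prod>i\<in>I. h (orb (s i) \<theta>)) \<partial>mu) - (\<Prod>p\<in>P. \<integral>\<Lambda>. (\<Prod>i\<in>p. h (act (diag_flow (s i)) \<Lambda>)) \<partial>X)\<bar> \<le> C * exp (?x * D1 - \<delta> * D2)"
        unfolding prodX Forb partition_prod[OF I(1) P] using reindex[of "\<lambda>p. \<Prod>i\<in>p. h (orb (s i) _)"] by simp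
    next
      have "\<bar>(\<integral>\<Lambda>. (\<Prod>j<m. F j (act (diag_flow (real (t j))) \<Lambda>)) \<partial>X) - (\<Prod>j<m. \<integral>\<Lambda>. F j \<Lambda> \<partial>X)\<bar> \<le> C2 * H * exp (- \<delta>2 * D2)"
        by (rule C2(3)[OF m1 \<open>m \<le> r\<close>, unfolded Q2_def, rule_format]) (use H1 F D sep in auto)
      also have "\<dots> \<le> C * exp (?x * D1 - \<delta> * D2)" by (rule est) (use C2 in \<open>auto simp: \<delta>_def\<close>)
      finally show "\<bar>(\<integral>\<Lambda>. (\<Prod>i\<in>I. h (act (diag_flow (s i)) \<Lambda>)) \<partial>X) - (\<Prod>p\<in>P. \<integral>\<Lambda>. (\<Prod>i\<in>p. h (act (diag_flow (s i)) \<Lambda>)) \<partial>X)\<bar> \<le> C * exp (?x * D1 - \<delta> * D2)"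
        unfolding prodX Fact partition_prod[OF I(1) P] using reindex[of "\<lambda>p. \<Prod>i\<in>p. h (act (diag_flow (s i)) _)"] by simp
    qed
  qed
  then show ?thesis using \<open>C \<ge> 0\<close> \<open>\<delta> > 0\<close> by (intro exI[of _ C] exI[of _ \<delta>] conjI allI impI) auto
qed

end

subsection \<open>Partial sums with linear second moments\<close>

text \<open>
  The sum of the squares of the sums of \<open>a\<close> over all proper left halves of dyadic subintervals of
  \<open>[b, b + 2\<^sup>k)\<close>: every initial segment is a disjoint union of at most \<open>k\<close> of these, one per scale.
\<close>

primrec dyadic_energy :: "(nat \<Rightarrow> real) \<Rightarrow> nat \<Rightarrow> nat \<Rightarrow> real" where
  "dyadic_energy a 0 b = 0"
| "dyadic_energy a (Suc k) b = (\<Sum>s\<in>{b..<b + 2^k}. a s)\<^sup>2 + dyadic_energy a k b + dyadic_energy a k (b + 2^k)"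

lemma dyadic_energy_nonneg: "0 \<le> dyadic_energy a k b"
  by (induction k arbitrary: b) auto

text \<open>Cauchy-Schwarz with unequal weights: a bound with factor \<open>k\<close> for a sum of
  \<open>k\<close> pieces becomes one with factor \<open>k + 1\<close> after adding the piece
  \<open>A\<close>.\<close>

lemma square_add_le:
  fixes A B V k :: real
  assumes "k \<ge> 0" "B\<^sup>2 \<le> k * V" "V \<ge> 0"
  shows "(A + B)\<^sup>2 \<le> (k + 1) * (A\<^sup>2 + V)"
proof (cases "k = 0")
  case True
  then show ?thesis using assms by simp
next
  case False
  then have k: "k > 0" using assms by simp
  have "0 \<le> (k * A - B)\<^sup>2" by simp
  then have "2 * A * B * k \<le> k * k * A\<^sup>2 + B\<^sup>2" by (simp add: power2_eq_square algebra_simps)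
  also have "\<dots> \<le> k * (k * A\<^sup>2 + V)" using assms by (simp add: algebra_simps)
  finally have "k * (2 * A * B) \<le> k * (k * A\<^sup>2 + V)" by (simp add: mult_ac)
  then have "2 * A * B \<le> k * A\<^sup>2 + V" using k by simp
  then have "(A + B)\<^sup>2 \<le> A\<^sup>2 + (k * A\<^sup>2 + V) + k * V"
    using assms(2) by (simp add: power2_eq_square algebra_simps)
  then show ?thesis by (simp add: algebra_simps)
qed

text \<open>The leading binary digit of \<open>n\<close> decides whether the first half is taken
  whole; the remainder lies in one of the halves. The factor \<open>k\<close> is the price of
  Cauchy-Schwarz for \<open>k\<close> pieces.\<close>

lemma partial_sum_le_dyadic_energy:
  "n < 2^k \<Longrightarrow> (\<Sum>s\<in>{b..<b + n}. a s)\<^sup>2 \<le> real k * dyadic_energy a k b"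
proof (induction k arbitrary: b n)
  case (Suc k)
  show ?case
  proof (cases "n < 2^k")
    case True
    have "(\<Sum>s\<in>{b..<b + n}. a s)\<^sup>2 \<le> real k * dyadic_energy a k b" by (rule Suc.IH[OF True])
    also have "\<dots> \<le> real (Suc k) * dyadic_energy a (Suc k) b"
      by (intro mult_mono) (auto simp: dyadic_energy_nonneg)
    finally show ?thesis .
  next
    case False
    define n' where "n' = n - 2^k"
    have n': "n' < 2^k" "n = 2^k + n'" using Suc.prems False by (auto simp: n'_def)
    have "(\<Sum>s\<in>{b..<b + n}. a s) = (\<Sum>s\<in>{b..<b + 2^k}. a s) + (\<Sum>s\<in>{b + 2^k..<b + 2^k + n'}. a s)"
      by (subst sum.atLeastLessThan_concat) (auto simp: n'(2) add.assoc)
    also have "\<dots>\<^sup>2 \<le> (real k + 1) * ((\<Sum>s\<in>{b..<b + 2^k}. a s)\<^sup>2 + dyadic_energy a k (b + 2^k))"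
      by (rule square_add_le) (use Suc.IH[OF n'(1)] dyadic_energy_nonneg in auto)
    also have "\<dots> \<le> real (Suc k) * dyadic_energy a (Suc k) b"
      using dyadic_energy_nonneg[of a k b] dyadic_energy_nonneg[of a k "b + 2^k"] by (intro mult_mono) auto
    finally show ?thesis .
  qed
qed simp

context prob_space
begin

text \<open>At each of the \<open>k\<close> scales the intervals are disjoint and of total length at
  most \<open>2^k\<close>, so a linear second moment bounds every scale by
  \<open>C * 2^k\<close>.\<close>

lemma expectation_dyadic_energy:
  fixes Y :: "nat \<Rightarrow> 'a \<Rightarrow> real"
  assumes Y: "\<And>s. Y s \<in> borel_measurable M" "\<And>s x. x \<in> space M \<Longrightarrow> \<bar>Y s x\<bar> \<le> K"
    and C: "\<And>I. finite I \<Longrightarrow> expectation (\<lambda>x. (\<Sum>s\<in>I. Y s x)\<^sup>2) \<le> C * real (card I)"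
  shows "integrable M (\<lambda>x. dyadic_energy (\<lambda>s. Y s x) k b) \<and>
    expectation (\<lambda>x. dyadic_energy (\<lambda>s. Y s x) k b) \<le> C * real k * 2^k"
proof (induction k arbitrary: b)
  case (Suc k)
  have C0: "C \<ge> 0"
  proof -
    have "0 \<le> expectation (\<lambda>x. (\<Sum>s\<in>{0}. Y s x)\<^sup>2)" by (intro integral_nonneg_AE) auto
    also have "\<dots> \<le> C * real (card {0::nat})" by (rule C) simp
    finally show ?thesis by simp
  qed
  have i: "integrable M (\<lambda>x. (\<Sum>s\<in>{b..<b + 2^k}. Y s x)\<^sup>2)"
  proof (rule integrable_const_bound[where B="(2^k * K)\<^sup>2"])
    show "AE x in M. norm ((\<Sum>s\<in>{b..<b + 2^k}. Y s x)\<^sup>2) \<le> (2^k * K)\<^sup>2"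
    proof (rule AE_I2)
      fix x assume x: "x \<in> space M"
      have "\<bar>\<Sum>s\<in>{b..<b + 2^k}. Y s x\<bar> \<le> (\<Sum>s\<in>{b..<b + 2^k}. K)"
        by (rule order_trans[OF sum_abs sum_mono]) (use Y(2)[OF x] in auto)
      then have "\<bar>\<Sum>s\<in>{b..<b + 2^k}. Y s x\<bar> \<le> \<bar>2^k * K\<bar>" by simp
      then show "norm ((\<Sum>s\<in>{b..<b + 2^k}. Y s x)\<^sup>2) \<le> (2^k * K)\<^sup>2"
        by (simp add: abs_le_square_iff)
    qed
  qed (use Y(1) in measurable)
  have "expectation (\<lambda>x. (\<Sum>s\<in>{b..<b + 2^k}. Y s x)\<^sup>2) \<le> C * 2^k"
    using C[of "{b..<b + 2^k}"] by simp
  then have "expectation (\<lambda>x. dyadic_energy (\<lambda>s. Y s x) (Suc k) b) \<le> C * 2^k + C * real k * 2^k + C * real k * 2^k"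
    using Suc.IH[of b] Suc.IH[of "b + 2^k"] i by (simp add: add_mono)
  also have "\<dots> = C * 2^k * (1 + 2 * real k)" by (simp add: algebra_simps)
  also have "\<dots> \<le> C * 2^k * (2 * (1 + real k))" using C0 by (intro mult_left_mono) auto
  also have "\<dots> = C * real (Suc k) * 2^Suc k" by (simp add: algebra_simps)
  finally show ?case using Suc.IH[of b] Suc.IH[of "b + 2^k"] i by simp
qed simp

lemma AE_summable_of_summable_expectation:
  fixes R :: "nat \<Rightarrow> 'a \<Rightarrow> real"
  assumes "\<And>k. integrable M (R k)" "\<And>k x. 0 \<le> R k x" "summable (\<lambda>k. expectation (R k))"
  shows "AE x in M. summable (\<lambda>k. R k x)"
proof -
  have [measurable]: "R k \<in> borel_measurable M" for k using assms(1) by auto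
  have "(\<integral>\<^sup>+x. (\<Sum>k. ennreal (R k x)) \<partial>M) = (\<Sum>k. (\<integral>\<^sup>+x. ennreal (R k x) \<partial>M))"
    by (rule nn_integral_suminf) measurable
  also have "\<dots> = (\<Sum>k. ennreal (expectation (R k)))"
    using assms by (intro arg_cong[where f=suminf] ext nn_integral_eq_integral) auto
  also have "\<dots> = ennreal (\<Sum>k. expectation (R k))"
    using assms by (intro suminf_ennreal2) (auto intro: integral_nonneg_AE)
  finally have "(\<integral>\<^sup>+x. (\<Sum>k. ennreal (R k x)) \<partial>M) \<noteq> \<infinity>" by simp
  then have "AE x in M. (\<Sum>k. ennreal (R k x)) \<noteq> \<infinity>"
    by (intro nn_integral_PInf_AE) auto
  then show ?thesis
    by eventually_elim (rule summable_suminf_not_top, use assms(2) in auto)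
qed

text \<open>The weight \<open>w k\<close> makes the expectation of \<open>R k\<close> a summable
  power of \<open>k\<close>, so \<open>R k\<close> tends to \<open>0\<close> almost surely. A
  squared partial sum is at most \<open>k * w k * R k\<close>: of the three powers of
  \<open>k\<close>, one comes from Cauchy-Schwarz, one from the number of scales, and one, with the
  excess \<open>2 * \<epsilon>\<close>, from summability.\<close>

lemma gal_koksma:
  fixes Y :: "nat \<Rightarrow> 'a \<Rightarrow> real"
  assumes Y: "\<And>s. Y s \<in> borel_measurable M" "\<And>s x. x \<in> space M \<Longrightarrow> \<bar>Y s x\<bar> \<le> K"
    and C: "\<And>I. finite I \<Longrightarrow> expectation (\<lambda>x. (\<Sum>s\<in>I. Y s x)\<^sup>2) \<le> C * real (card I)"
    and \<epsilon>: "\<epsilon> > 0"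
  shows "AE x in M. (\<lambda>N. \<Sum>s<N. Y s x) \<in> o(\<lambda>N. sqrt (real N) * ln (real N) powr (3/2 + \<epsilon>))"
proof -
  define w where "w k = 2^k * real k powr (2 + 2 * \<epsilon>)" for k :: nat
  have w: "w k \<ge> 0" for k by (simp add: w_def)
  define R where "R k x = dyadic_energy (\<lambda>s. Y s x) k 0 / w k" for k x
  have R0: "R k x \<ge> 0" for k x using w[of k] by (simp add: R_def dyadic_energy_nonneg)
  note ex = expectation_dyadic_energy[OF Y C]
  have "AE x in M. summable (\<lambda>k. R k x)"
  proof (rule AE_summable_of_summable_expectation[OF _ R0])
    show "integrable M (R k)" for k unfolding R_def using ex by auto
    have sm: "summable (\<lambda>k. C * real k powr (- 1 - 2 * \<epsilon>))"
      by (intro summable_mult) (use \<epsilon> in \<open>simp add: summable_real_powr_iff\<close>)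
    have bd: "norm (expectation (R k)) \<le> C * real k powr (- 1 - 2 * \<epsilon>)" for k
    proof (cases "k = 0")
      case True
      have "R 0 = (\<lambda>_. 0)" by (simp add: R_def fun_eq_iff)
      then show ?thesis using True by simp
    next
      case False
      then have k: "real k > 0" by simp
      have wk: "w k > 0" using k by (simp add: w_def)
      have "expectation (R k) = expectation (\<lambda>x. dyadic_energy (\<lambda>s. Y s x) k 0) / w k"
        unfolding R_def by simp
      also have "\<dots> \<le> (C * real k * 2^k) / w k"
        using ex[of k 0] wk by (intro divide_right_mono) auto
      also have "\<dots> = C * (real k powr 1 / real k powr (2 + 2 * \<epsilon>))"
        using k by (simp add: w_def)
      also have "real k powr 1 / real k powr (2 + 2 * \<epsilon>) = real k powr (- 1 - 2 * \<epsilon>)"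
        unfolding powr_diff[symmetric] by simp
      finally have "expectation (R k) \<le> C * real k powr (- 1 - 2 * \<epsilon>)" .
      moreover have "0 \<le> expectation (R k)" using R0 by (intro integral_nonneg_AE) auto
      ultimately show ?thesis by simp
    qed
    show "summable (\<lambda>k. expectation (R k))"
      by (rule summable_comparison_test'[OF sm]) (rule bd)
  qed
  then show ?thesis
  proof (rule AE_mp, intro AE_I2 impI)
    fix x assume "x \<in> space M" "summable (\<lambda>k. R k x)"
    then have lim: "(\<lambda>k. R k x) \<longlonglongrightarrow> 0" by (intro summable_LIMSEQ_zero)
    \<comment> \<open>This collects the losses in \<open>2^k \<le> 2 * N\<close> and
      \<open>k \<le> 3 * ln N\<close>, so that the final bound comes out with
      \<open>c\<^sup>2\<close>.\<close>
    define B where "B = 2 * (3::real) powr (3 + 2 * \<epsilon>)"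
    have B: "B > 0" by (simp add: B_def)
    show "(\<lambda>N. \<Sum>s<N. Y s x) \<in> o(\<lambda>N. sqrt (real N) * ln (real N) powr (3/2 + \<epsilon>))"
    proof (rule landau_o.smallI)
      fix c :: real assume c: "c > 0"
      have "\<forall>\<^sub>F k in sequentially. R k x < c\<^sup>2 / B"
        using lim c B by (intro order_tendstoD) auto
      then obtain k0 where k0: "\<And>k. k \<ge> k0 \<Longrightarrow> R k x < c\<^sup>2 / B" by (auto simp: eventually_sequentially)
      show "\<forall>\<^sub>F N in sequentially. norm (\<Sum>s<N. Y s x) \<le> c * norm (sqrt (real N) * ln (real N) powr (3/2 + \<epsilon>))"
        using eventually_ge_at_top[of "2^k0 + 2"]
      proof eventually_elim
        case (elim N)
        define j where "j = floor_log N"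
        define k where "k = Suc j"
        have N2: "N \<ge> 2" using elim by simp
        have jN: "2^j \<le> N" "N < 2^k"
          using N2 floor_log_exp2_le[of N] floor_log_exp2_gt[of N] by (auto simp: j_def k_def)
        have j1: "j \<ge> 1"
        proof (rule ccontr)
          assume "\<not> j \<ge> 1"
          then have "j = 0" by simp
          then show False using jN(2) N2 by (simp add: k_def)
        qed
        have "2^k0 < (2::nat)^k" using elim jN by linarith
        then have kk0: "k \<ge> k0" by (simp add: power_less_imp_less_exp less_imp_le)
        have lnj: "real j * ln 2 \<le> ln (real N)"
        proof -
          have "real j * ln 2 = ln (2^j)" by (simp add: ln_realpow)
          also have "\<dots> \<le> ln (real N)"
          proof -
            have "real (2^j) \<le> real N" using jN(1) by (rule of_nat_mono)
            then show ?thesis using N2 by (subst ln_le_cancel_iff) auto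
          qed
          finally show ?thesis .
        qed
        have "ln (2::real) \<ge> 2/3" by (rule ln2_ge_two_thirds)
        then have "real j * (2/3) \<le> ln (real N)" using lnj mult_left_mono[of "2/3" "ln 2" "real j"] by linarith
        \<comment> \<open>\<open>k = j + 1 \<le> 2 * j\<close> because \<open>j \<ge> 1\<close>, and
          \<open>j \<le> 3/2 * ln N\<close>.\<close>
        then have k3: "real k \<le> 3 * ln (real N)" using j1 by (simp add: k_def)
        have lnpos: "ln (real N) > 0" using N2 by simp
        define S where "S = (\<Sum>s<N. Y s x)"
        have kpos: "real k > 0" by (simp add: k_def)
        have wk: "w k > 0" using kpos by (simp add: w_def)
        have "S\<^sup>2 \<le> real k * dyadic_energy (\<lambda>s. Y s x) k 0"
          using partial_sum_le_dyadic_energy[OF jN(2), where b=0 and a="\<lambda>s. Y s x"] by (simp add: S_def atLeast0LessThan)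
        also have "\<dots> = real k * (R k x * w k)" using wk by (simp add: R_def)
        also have "\<dots> = R k x * (2^k * real k powr (3 + 2 * \<epsilon>))"
        proof -
          have "real k * real k powr (2 + 2 * \<epsilon>) = real k powr (1 + (2 + 2 * \<epsilon>))" using kpos by (subst powr_add) simp
          then show ?thesis by (simp add: w_def mult_ac)
        qed
        also have "\<dots> \<le> (c\<^sup>2 / B) * ((2 * real N) * (3 * ln (real N)) powr (3 + 2 * \<epsilon>))"
        proof (intro mult_mono)
          show "R k x \<le> c\<^sup>2 / B" using k0[OF kk0] by simp
          have "2^k \<le> 2 * N" using jN by (simp add: k_def)
          then have "real (2^k) \<le> real (2 * N)" by (rule of_nat_mono)
          then show "2^k \<le> 2 * real N" by simp
          show "real k powr (3 + 2 * \<epsilon>) \<le> (3 * ln (real N)) powr (3 + 2 * \<epsilon>)"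
            using k3 \<epsilon> by (intro powr_mono2) auto
        qed (use B c in auto)
        also have "(3 * ln (real N)) powr (3 + 2 * \<epsilon>) = 3 powr (3 + 2 * \<epsilon>) * ln (real N) powr (3 + 2 * \<epsilon>)"
          by (rule powr_mult)
        also have "(c\<^sup>2 / B) * ((2 * real N) * (3 powr (3 + 2 * \<epsilon>) * ln (real N) powr (3 + 2 * \<epsilon>))) = c\<^sup>2 * (real N * ln (real N) powr (3 + 2 * \<epsilon>))"
          using B by (simp add: B_def field_simps)
        also have "\<dots> = (c * (sqrt (real N) * ln (real N) powr (3/2 + \<epsilon>)))\<^sup>2"
        proof -
          have "(ln (real N) powr (3/2 + \<epsilon>))\<^sup>2 = ln (real N) powr (3 + 2 * \<epsilon>)"
            using lnpos by (simp add: power2_eq_square powr_add[symmetric])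
          then show ?thesis by (simp add: power_mult_distrib)
        qed
        finally have "\<bar>S\<bar> \<le> \<bar>c * (sqrt (real N) * ln (real N) powr (3/2 + \<epsilon>))\<bar>"
          by (simp add: abs_le_square_iff)
        then show ?case using c by (simp add: S_def abs_mult)
      qed
    qed
  qed
qed

end

section \<open>Linear second moments from geometric decay of correlations\<close>

lemma sum_power_le: "finite I \<Longrightarrow> (\<Sum>s\<in>I. \<rho> ^ s) \<le> 1 / (1 - \<rho>)" if "0 \<le> \<rho>" "\<rho> < 1" for \<rho> :: real
proof -
  assume "finite I"
  then have "(\<Sum>s\<in>I. \<rho> ^ s) \<le> (\<Sum>s. \<rho> ^ s)" using that by (intro sum_le_suminf) auto
  then show ?thesis using that by (simp add: suminf_geometric)
qed

text \<open>With truncated subtraction the product of the two powers is \<rho> to the power of the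
  distance between \<open>s\<close> and \<open>t\<close>.\<close>

lemma sum_power_dist_le:
  fixes \<rho> :: real
  assumes \<rho>: "0 \<le> \<rho>" "\<rho> < 1" and I: "finite I"
  shows "(\<Sum>s\<in>I. \<rho> ^ (s - t) * \<rho> ^ (t - s)) \<le> 2 / (1 - \<rho>)"
proof -
  have "(\<Sum>s\<in>I. \<rho> ^ (s - t) * \<rho> ^ (t - s)) \<le> (\<Sum>s\<in>{s\<in>I. t \<le> s}. \<rho> ^ (s - t)) + (\<Sum>s\<in>{s\<in>I. s < t}. \<rho> ^ (t - s))"
  proof -
    have "I = {s\<in>I. t \<le> s} \<union> {s\<in>I. s < t}" by auto
    then have "(\<Sum>s\<in>I. \<rho> ^ (s - t) * \<rho> ^ (t - s)) = (\<Sum>s\<in>{s\<in>I. t \<le> s}. \<rho> ^ (s - t) * \<rho> ^ (t - s)) + (\<Sum>s\<in>{s\<in>I. s < t}. \<rho> ^ (s - t) * \<rho> ^ (t - s))"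
      by (subst sum.union_disjoint[symmetric]) (use I in auto)
    then show ?thesis by (auto intro!: add_mono sum_mono)
  qed
  also have "(\<Sum>s\<in>{s\<in>I. t \<le> s}. \<rho> ^ (s - t)) = (\<Sum>u\<in>(\<lambda>s. s - t) ` {s\<in>I. t \<le> s}. \<rho> ^ u)"
    by (subst sum.reindex) (auto simp: inj_on_def)
  also have "\<dots> \<le> 1 / (1 - \<rho>)" by (rule sum_power_le[OF \<rho>]) (use I in auto)
  also have "(\<Sum>s\<in>{s\<in>I. s < t}. \<rho> ^ (t - s)) = (\<Sum>u\<in>(\<lambda>s. t - s) ` {s\<in>I. s < t}. \<rho> ^ u)"
    by (subst sum.reindex) (auto simp: inj_on_def)
  also have "\<dots> \<le> 1 / (1 - \<rho>)" by (rule sum_power_le[OF \<rho>]) (use I in auto)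
  finally show ?thesis by simp
qed

text \<open>The term \<open>\<rho> ^ s\<close> allows for correlations that are small only once the
  earlier time is large, as on orbits started at time \<open>0\<close>. The set \<open>I\<close> is
  arbitrary because the estimate is applied also to the times outside the blocks.\<close>

lemma (in prob_space) second_moment_le:
  fixes Y :: "nat \<Rightarrow> 'a \<Rightarrow> real"
  assumes Y: "\<And>s. Y s \<in> borel_measurable M" "\<And>s x. x \<in> space M \<Longrightarrow> \<bar>Y s x\<bar> \<le> K"
    and \<rho>: "0 \<le> \<rho>" "\<rho> < 1" and C: "C \<ge> 0"
    and cor: "\<And>s t. s \<le> t \<Longrightarrow> \<bar>expectation (\<lambda>x. Y s x * Y t x)\<bar> \<le> C * (\<rho> ^ s + \<rho> ^ (t - s))"
    and I: "finite I"
  shows "expectation (\<lambda>x. (\<Sum>s\<in>I. Y s x)\<^sup>2) \<le> (4 * C / (1 - \<rho>)) * real (card I)"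
proof -
  have int: "integrable M (\<lambda>x. Y s x * Y t x)" for s t
  proof (rule integrable_const_bound[where B="K * K"])
    show "AE x in M. norm (Y s x * Y t x) \<le> K * K"
    proof (rule AE_I2)
      fix x assume "x \<in> space M"
      from Y(2)[OF this] have "\<bar>Y s x\<bar> \<le> K" "\<bar>Y t x\<bar> \<le> K" by auto
      then show "norm (Y s x * Y t x) \<le> K * K" by (auto simp: abs_mult intro!: mult_mono)
    qed
  qed (use Y(1) in measurable)
  have cor': "expectation (\<lambda>x. Y s x * Y t x) \<le> C * (\<rho> ^ s + \<rho> ^ t + \<rho> ^ (s - t) * \<rho> ^ (t - s))" for s t
  proof (cases "s \<le> t")
    case True
    have "expectation (\<lambda>x. Y s x * Y t x) \<le> C * (\<rho> ^ s + \<rho> ^ (t - s))" using cor[OF True] by linarith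
    also have "\<dots> \<le> C * (\<rho> ^ s + \<rho> ^ t + \<rho> ^ (s - t) * \<rho> ^ (t - s))"
      using C \<rho> True by (intro mult_left_mono) auto
    finally show ?thesis .
  next
    case False
    then have ts: "t \<le> s" by simp
    have "expectation (\<lambda>x. Y s x * Y t x) = expectation (\<lambda>x. Y t x * Y s x)" by (simp add: mult.commute)
    also have "\<dots> \<le> C * (\<rho> ^ t + \<rho> ^ (s - t))" using cor[OF ts] by linarith
    also have "\<dots> \<le> C * (\<rho> ^ s + \<rho> ^ t + \<rho> ^ (s - t) * \<rho> ^ (t - s))"
      using C \<rho> ts by (intro mult_left_mono) auto
    finally show ?thesis .
  qed
  have "expectation (\<lambda>x. (\<Sum>s\<in>I. Y s x)\<^sup>2) = (\<Sum>s\<in>I. \<Sum>t\<in>I. expectation (\<lambda>x. Y s x * Y t x))"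
    unfolding power2_eq_square sum_product using int by simp
  also have "\<dots> \<le> (\<Sum>s\<in>I. \<Sum>t\<in>I. C * (\<rho> ^ s + \<rho> ^ t + \<rho> ^ (s - t) * \<rho> ^ (t - s)))"
    by (intro sum_mono cor')
  also have "\<dots> = C * (real (card I) * (\<Sum>s\<in>I. \<rho> ^ s) + real (card I) * (\<Sum>t\<in>I. \<rho> ^ t) + (\<Sum>t\<in>I. \<Sum>s\<in>I. \<rho> ^ (s - t) * \<rho> ^ (t - s)))"
    by (simp add: sum_distrib_left[symmetric] sum.distrib sum.swap[of "\<lambda>s t. \<rho> ^ (s - t) * \<rho> ^ (t - s)"])
  also have "\<dots> \<le> C * (real (card I) * (1 / (1 - \<rho>)) + real (card I) * (1 / (1 - \<rho>)) + (\<Sum>t\<in>I. 2 / (1 - \<rho>)))"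
    by (intro mult_left_mono add_mono sum_mono sum_power_dist_le sum_power_le I \<rho> C) auto
  also have "\<dots> = (4 * C / (1 - \<rho>)) * real (card I)" by (simp add: field_simps)
  finally show ?thesis .
qed

subsection \<open>Comparison of characteristic functions through moments\<close>

text \<open>The power is expanded one factor at a time; the induction therefore carries a product
  over the indices already chosen.\<close>

lemma moment_compare:
  fixes y :: "nat \<Rightarrow> 'a \<Rightarrow> real" and z :: "nat \<Rightarrow> 'b \<Rightarrow> real"
  assumes "prob_space M" "prob_space N" and I: "finite I"
    and y: "\<And>s. s \<in> I \<Longrightarrow> y s \<in> borel_measurable M" "\<And>s x. s \<in> I \<Longrightarrow> x \<in> space M \<Longrightarrow> \<bar>y s x\<bar> \<le> 1"
    and z: "\<And>s. s \<in> I \<Longrightarrow> z s \<in> borel_measurable N" "\<And>s x. s \<in> I \<Longrightarrow> x \<in> space N \<Longrightarrow> \<bar>z s x\<bar> \<le> 1"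
    and cmp: "\<And>\<sigma>. (\<forall>i<r. \<sigma> i \<in> I) \<Longrightarrow> \<bar>(\<integral>x. (\<Prod>i<r. y (\<sigma> i) x) \<partial>M) - (\<integral>x. (\<Prod>i<r. z (\<sigma> i) x) \<partial>N)\<bar> \<le> \<eta>"
  shows "\<bar>(\<integral>x. (\<Sum>s\<in>I. y s x) ^ r \<partial>M) - (\<integral>x. (\<Sum>s\<in>I. z s x) ^ r \<partial>N)\<bar> \<le> real (card I) ^ r * \<eta>"
proof -
  have int: "integrable M' (\<lambda>x. (\<Sum>s\<in>I. w s x) ^ k * (\<Prod>i<m. w (\<sigma> i) x))"
    if "prob_space M'" "\<And>s. s \<in> I \<Longrightarrow> w s \<in> borel_measurable M'" "\<And>s x. s \<in> I \<Longrightarrow> x \<in> space M' \<Longrightarrow> \<bar>w s x\<bar> \<le> 1"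
      "\<forall>i<m. \<sigma> i \<in> I" for M' :: "'c measure" and w :: "nat \<Rightarrow> 'c \<Rightarrow> real" and k m and \<sigma> :: "nat \<Rightarrow> nat"
  proof -
    interpret prob_space M' by fact
    show ?thesis
    proof (rule integrable_const_bound[where B="real (card I) ^ k"])
      show "AE x in M'. norm ((\<Sum>s\<in>I. w s x) ^ k * (\<Prod>i<m. w (\<sigma> i) x)) \<le> real (card I) ^ k"
      proof (rule AE_I2)
        fix x assume x: "x \<in> space M'"
        have "\<bar>\<Sum>s\<in>I. w s x\<bar> \<le> (\<Sum>s\<in>I. 1)"
          by (rule order_trans[OF sum_abs sum_mono]) (use that(3)[OF _ x] in auto)
        then have 1: "\<bar>\<Sum>s\<in>I. w s x\<bar> ^ k \<le> real (card I) ^ k" by (intro power_mono) auto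
        have "(\<Prod>i<m. \<bar>w (\<sigma> i) x\<bar>) \<le> 1" by (rule prod_le_1) (use that x in auto)
        then have "\<bar>\<Sum>s\<in>I. w s x\<bar> ^ k * (\<Prod>i<m. \<bar>w (\<sigma> i) x\<bar>) \<le> real (card I) ^ k * 1"
          using 1 by (intro mult_mono) (auto intro!: prod_nonneg)
        then show "norm ((\<Sum>s\<in>I. w s x) ^ k * (\<Prod>i<m. w (\<sigma> i) x)) \<le> real (card I) ^ k"
          by (simp add: abs_mult power_abs abs_prod)
      qed
      show "(\<lambda>x. (\<Sum>s\<in>I. w s x) ^ k * (\<Prod>i<m. w (\<sigma> i) x)) \<in> borel_measurable M'"
        by (intro borel_measurable_times borel_measurable_power borel_measurable_sum borel_measurable_prod that(2)) (use that(4) in auto)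
    qed
  qed
  have expand: "(\<integral>x. (\<Sum>s\<in>I. w s x) ^ Suc k * (\<Prod>i<m. w (\<sigma> i) x) \<partial>M') =
      (\<Sum>s\<in>I. \<integral>x. (\<Sum>s\<in>I. w s x) ^ k * (\<Prod>i<Suc m. w ((\<sigma>(m := s)) i) x) \<partial>M')"
    if "prob_space M'" "\<And>s. s \<in> I \<Longrightarrow> w s \<in> borel_measurable M'" "\<And>s x. s \<in> I \<Longrightarrow> x \<in> space M' \<Longrightarrow> \<bar>w s x\<bar> \<le> 1"
      "\<forall>i<m. \<sigma> i \<in> I" for M' :: "'c measure" and w :: "nat \<Rightarrow> 'c \<Rightarrow> real" and k m and \<sigma> :: "nat \<Rightarrow> nat"
  proof -
    have upd: "(\<Prod>i<Suc m. w ((\<sigma>(m := s)) i) x) = w s x * (\<Prod>i<m. w (\<sigma> i) x)" for s x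
      by (simp add: mult.commute)
    have "(\<Sum>s\<in>I. w s x) ^ Suc k * (\<Prod>i<m. w (\<sigma> i) x) = (\<Sum>s\<in>I. (\<Sum>s\<in>I. w s x) ^ k * (\<Prod>i<Suc m. w ((\<sigma>(m := s)) i) x))" for x
      unfolding upd by (simp add: sum_distrib_left sum_distrib_right mult_ac)
    moreover have "integrable M' (\<lambda>x. (\<Sum>s\<in>I. w s x) ^ k * (\<Prod>i<Suc m. w ((\<sigma>(m := s)) i) x))" if "s \<in> I" for s
      by (rule int) (use \<open>prob_space M'\<close> \<open>\<forall>i<m. \<sigma> i \<in> I\<close> \<open>s \<in> I\<close> \<open>\<And>s. s \<in> I \<Longrightarrow> w s \<in> borel_measurable M'\<close> \<open>\<And>s x. s \<in> I \<Longrightarrow> x \<in> space M' \<Longrightarrow> \<bar>w s x\<bar> \<le> 1\<close> in \<open>auto simp: less_Suc_eq\<close>)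
    ultimately show ?thesis by (simp only: Bochner_Integration.integral_sum)
  qed
  have "\<bar>(\<integral>x. (\<Sum>s\<in>I. y s x) ^ k * (\<Prod>i<m. y (\<sigma> i) x) \<partial>M) - (\<integral>x. (\<Sum>s\<in>I. z s x) ^ k * (\<Prod>i<m. z (\<sigma> i) x) \<partial>N)\<bar> \<le> real (card I) ^ k * \<eta>"
    if "k + m = r" "\<forall>i<m. \<sigma> i \<in> I" for k m \<sigma>
    using that
  proof (induction k arbitrary: m \<sigma>)
    case 0
    then show ?case using cmp[of \<sigma>] by simp
  next
    case (Suc k)
    let ?P = "\<lambda>M' (w :: nat \<Rightarrow> _ \<Rightarrow> real) s. \<integral>x. (\<Sum>s\<in>I. w s x) ^ k * (\<Prod>i<Suc m. w ((\<sigma>(m := s)) i) x) \<partial>M'"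
    have "\<bar>(\<Sum>s\<in>I. ?P M y s) - (\<Sum>s\<in>I. ?P N z s)\<bar> \<le> (\<Sum>s\<in>I. \<bar>?P M y s - ?P N z s\<bar>)"
      unfolding sum_subtractf[symmetric] by (rule sum_abs)
    also have "\<dots> \<le> (\<Sum>s\<in>I. real (card I) ^ k * \<eta>)"
    proof (rule sum_mono)
      fix s assume "s \<in> I"
      then show "\<bar>?P M y s - ?P N z s\<bar> \<le> real (card I) ^ k * \<eta>"
        using Suc.prems by (intro Suc.IH[of "Suc m" "\<sigma>(m := s)"]) (auto simp: less_Suc_eq)
    qed
    also have "\<dots> = real (card I) ^ Suc k * \<eta>" by simp
    finally show ?case
      by (subst (1 2) expand) (use assms(1,2) y z Suc.prems in auto)
  qed
  from this[of r 0] show ?thesis by simp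
qed

text \<open>
  Taylor expansion of both sides.  The remainder on the side of \<open>f\<close> is itself controlled by the
  moment of order \<open>2 * n\<close>, hence by that of \<open>g\<close>; only \<open>g\<close> needs an exponential moment.
\<close>

lemma iexp_moment_compare:
  fixes f :: "'a \<Rightarrow> real" and g :: "'b \<Rightarrow> real"
  assumes "prob_space M" "prob_space N"
    and f: "f \<in> borel_measurable M" "\<And>x. x \<in> space M \<Longrightarrow> \<bar>f x\<bar> \<le> K"
    and g: "g \<in> borel_measurable N" "\<And>x. x \<in> space N \<Longrightarrow> \<bar>g x\<bar> \<le> K"
    and n: "n \<ge> 1"
    and E: "(\<integral>x. exp (2 * \<omega> * g x) \<partial>N) \<le> E" "(\<integral>x. exp (- 2 * \<omega> * g x) \<partial>N) \<le> E"
  shows "cmod ((CLINT x|M. iexp (\<omega> * f x)) - (CLINT x|N. iexp (\<omega> * g x))) \<le>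
    (\<Sum>k\<le>2 * n. \<bar>\<omega>\<bar> ^ k * \<bar>(\<integral>x. f x ^ k \<partial>M) - (\<integral>x. g x ^ k \<partial>N)\<bar>) + 4 * (1/4) ^ n * E"
proof -
  define d where "d k = \<bar>\<omega>\<bar> ^ k * \<bar>(\<integral>x. f x ^ k \<partial>M) - (\<integral>x. g x ^ k \<partial>N)\<bar>" for k
  \<comment> \<open>Taylor polynomials of odd degree leave an even power in the remainder, so its
    absolute value integrates to a moment.\<close>
  define m where "m = 2 * n - 1"
  have Sm: "Suc m = 2 * n" using n by (simp add: m_def)
  have meas_iexp: "(\<lambda>x. iexp (\<omega> * h x)) \<in> borel_measurable M'" if "h \<in> borel_measurable M'" for h :: "'c \<Rightarrow> real" and M'
    using that by measurable
  have pw: "integrable M' (\<lambda>x. h x ^ k)"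
    if "prob_space M'" "h \<in> borel_measurable M'" "\<And>x. x \<in> space M' \<Longrightarrow> \<bar>h x\<bar> \<le> K" for M' :: "'c measure" and h k
  proof -
    interpret prob_space M' by fact
    show ?thesis
    proof (rule integrable_const_bound[where B="K ^ k"])
      show "AE x in M'. norm (h x ^ k) \<le> K ^ k"
      proof (rule AE_I2)
        fix x assume "x \<in> space M'"
        then show "norm (h x ^ k) \<le> K ^ k" using that(3) by (simp add: power_abs power_mono)
      qed
    qed (use that(2) in measurable)
  qed
  have taylor: "cmod ((CLINT x|M'. iexp (\<omega> * h x)) - (\<Sum>k\<le>m. (\<i> * \<omega>) ^ k / fact k * (\<integral>x. h x ^ k \<partial>M'))) \<le> \<bar>\<omega>\<bar> ^ (2 * n) / fact (2 * n) * (\<integral>x. h x ^ (2 * n) \<partial>M')"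
    if *: "prob_space M'" "h \<in> borel_measurable M'" "\<And>x. x \<in> space M' \<Longrightarrow> \<bar>h x\<bar> \<le> K" for M' :: "'c measure" and h
  proof -
    interpret prob_space M' by fact
    note pw' = pw[OF *]
    have i1: "complex_integrable M' (\<lambda>x. iexp (\<omega> * h x))"
      by (rule integrable_const_bound[where B=1]) (use meas_iexp[OF *(2)] in auto)
    have i2: "complex_integrable M' (\<lambda>x. (\<i> * \<omega>) ^ k / fact k * complex_of_real (h x ^ k))" for k
      by (intro integrable_mult_right integrable_of_real pw')
    have "(CLINT x|M'. iexp (\<omega> * h x)) - (\<Sum>k\<le>m. (\<i> * \<omega>) ^ k / fact k * (\<integral>x. h x ^ k \<partial>M'))
      = (CLINT x|M'. iexp (\<omega> * h x) - (\<Sum>k\<le>m. (\<i> * \<omega>) ^ k / fact k * complex_of_real (h x ^ k)))"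
      using i1 i2 by (simp add: Bochner_Integration.integral_diff Bochner_Integration.integral_sum integral_complex_of_real del: of_real_power)
    also have "cmod \<dots> \<le> (\<integral>x. cmod (iexp (\<omega> * h x) - (\<Sum>k\<le>m. (\<i> * \<omega>) ^ k / fact k * complex_of_real (h x ^ k))) \<partial>M')"
      by (rule integral_norm_bound)
    also have "\<dots> \<le> (\<integral>x. \<bar>\<omega>\<bar> ^ (2 * n) / fact (2 * n) * h x ^ (2 * n) \<partial>M')"
    proof (rule integral_mono)
      show "integrable M' (\<lambda>x. cmod (iexp (\<omega> * h x) - (\<Sum>k\<le>m. (\<i> * \<omega>) ^ k / fact k * complex_of_real (h x ^ k))))"
        by (intro integrable_norm Bochner_Integration.integrable_diff Bochner_Integration.integrable_sum i1 i2)
      show "integrable M' (\<lambda>x. \<bar>\<omega>\<bar> ^ (2 * n) / fact (2 * n) * h x ^ (2 * n))"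
        by (intro integrable_mult_right pw')
      fix x
      have "(\<i> * \<omega>) ^ k / fact k * complex_of_real (h x ^ k) = (\<i> * complex_of_real (\<omega> * h x)) ^ k / fact k" for k
        by (simp add: power_mult_distrib)
      then have "cmod (iexp (\<omega> * h x) - (\<Sum>k\<le>m. (\<i> * \<omega>) ^ k / fact k * complex_of_real (h x ^ k))) \<le> \<bar>\<omega> * h x\<bar> ^ (2 * n) / fact (2 * n)"
        using iexp_approx1[of "\<omega> * h x" m] by (simp only: Sm)
      also have "\<dots> = \<bar>\<omega>\<bar> ^ (2 * n) / fact (2 * n) * h x ^ (2 * n)"
        by (simp add: abs_mult power_mult_distrib power_even_abs)
      finally show "cmod (iexp (\<omega> * h x) - (\<Sum>k\<le>m. (\<i> * \<omega>) ^ k / fact k * complex_of_real (h x ^ k))) \<le> \<bar>\<omega>\<bar> ^ (2 * n) / fact (2 * n) * h x ^ (2 * n)" .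
    qed
    finally show ?thesis by simp
  qed
  have mid: "cmod ((\<Sum>k\<le>m. (\<i> * \<omega>) ^ k / fact k * (\<integral>x. f x ^ k \<partial>M)) - (\<Sum>k\<le>m. (\<i> * \<omega>) ^ k / fact k * (\<integral>x. g x ^ k \<partial>N))) \<le> (\<Sum>k\<le>m. d k)"
  proof -
    have "(\<Sum>k\<le>m. (\<i> * \<omega>) ^ k / fact k * (\<integral>x. f x ^ k \<partial>M)) - (\<Sum>k\<le>m. (\<i> * \<omega>) ^ k / fact k * (\<integral>x. g x ^ k \<partial>N))
      = (\<Sum>k\<le>m. (\<i> * \<omega>) ^ k / fact k * complex_of_real ((\<integral>x. f x ^ k \<partial>M) - (\<integral>x. g x ^ k \<partial>N)))"
      by (simp add: sum_subtractf[symmetric] algebra_simps diff_divide_distrib)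
    also have "cmod \<dots> \<le> (\<Sum>k\<le>m. cmod ((\<i> * \<omega>) ^ k / fact k * complex_of_real ((\<integral>x. f x ^ k \<partial>M) - (\<integral>x. g x ^ k \<partial>N))))"
      by (rule norm_sum)
    also have "\<dots> \<le> (\<Sum>k\<le>m. d k)"
    proof (rule sum_mono)
      fix k
      have "cmod ((\<i> * \<omega>) ^ k / fact k * complex_of_real ((\<integral>x. f x ^ k \<partial>M) - (\<integral>x. g x ^ k \<partial>N))) = d k / fact k"
        by (simp add: d_def norm_mult norm_divide norm_power del: of_real_diff)
      also have "\<dots> \<le> d k / 1" by (intro divide_left_mono) (auto simp: d_def fact_ge_1)
      finally show "cmod ((\<i> * \<omega>) ^ k / fact k * complex_of_real ((\<integral>x. f x ^ k \<partial>M) - (\<integral>x. g x ^ k \<partial>N))) \<le> d k" by simp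
    qed
    finally show ?thesis .
  qed
  have tail_g: "\<bar>\<omega>\<bar> ^ (2 * n) / fact (2 * n) * (\<integral>x. g x ^ (2 * n) \<partial>N) \<le> (1/4) ^ n * (2 * E)"
  proof -
    interpret N: prob_space N by fact
    have ie: "integrable N (\<lambda>x. exp (a * g x))" for a
    proof (rule N.integrable_const_bound[where B="exp (\<bar>a\<bar> * K)"])
      show "AE x in N. norm (exp (a * g x)) \<le> exp (\<bar>a\<bar> * K)"
      proof (rule AE_I2)
        fix x assume "x \<in> space N"
        have "a * g x \<le> \<bar>a * g x\<bar>" by simp
        also have "\<dots> \<le> \<bar>a\<bar> * K" unfolding abs_mult using g(2)[OF \<open>x \<in> space N\<close>] by (intro mult_left_mono) auto
        finally show "norm (exp (a * g x)) \<le> exp (\<bar>a\<bar> * K)" by simp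
      qed
    qed (use g(1) in measurable)
    \<comment> \<open>One term of the series of \<open>exp \<bar>2 * \<omega> * u\<bar>\<close> is
      compared with the whole; the doubled exponent is what yields the small factor
      \<open>(1/4) ^ n\<close>.\<close>
    have ineq: "\<bar>\<omega>\<bar> ^ (2 * n) / fact (2 * n) * u ^ (2 * n) \<le> (1/4) ^ n * (exp (2 * \<omega> * u) + exp (- 2 * \<omega> * u))" for u
    proof -
      define y where "y = \<bar>2 * \<omega> * u\<bar>"
      have y: "y \<ge> 0" by (simp add: y_def)
      have "(\<Sum>k\<in>{2 * n}. inverse (fact k) *\<^sub>R y ^ k) \<le> (\<Sum>k. inverse (fact k) *\<^sub>R y ^ k)"
        by (rule sum_le_suminf) (use y summable_exp_generic[of y] in auto)
      then have "y ^ (2 * n) / fact (2 * n) \<le> exp y"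
        by (simp add: exp_def divide_inverse mult.commute)
      also have "\<dots> \<le> exp (2 * \<omega> * u) + exp (- 2 * \<omega> * u)"
        by (cases "2 * \<omega> * u \<ge> 0") (auto simp: y_def abs_if)
      finally have 1: "y ^ (2 * n) / fact (2 * n) \<le> exp (2 * \<omega> * u) + exp (- 2 * \<omega> * u)" .
      have "y ^ (2 * n) = 4 ^ n * (\<bar>\<omega>\<bar> ^ (2 * n) * u ^ (2 * n))"
        unfolding y_def by (simp add: abs_mult power_mult_distrib power_even_abs power_mult[of 2 2 n])
      then have "\<bar>\<omega>\<bar> ^ (2 * n) / fact (2 * n) * u ^ (2 * n) = (1/4) ^ n * (y ^ (2 * n) / fact (2 * n))"
        by (simp add: power_divide)
      also have "\<dots> \<le> (1/4) ^ n * (exp (2 * \<omega> * u) + exp (- 2 * \<omega> * u))" using 1 by (intro mult_left_mono) auto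
      finally show ?thesis .
    qed
    have "\<bar>\<omega>\<bar> ^ (2 * n) / fact (2 * n) * (\<integral>x. g x ^ (2 * n) \<partial>N) = (\<integral>x. \<bar>\<omega>\<bar> ^ (2 * n) / fact (2 * n) * g x ^ (2 * n) \<partial>N)" by simp
    also have "\<dots> \<le> (\<integral>x. (1/4) ^ n * (exp (2 * \<omega> * g x) + exp (- 2 * \<omega> * g x)) \<partial>N)"
    proof (rule integral_mono[OF _ _ ineq])
      show "integrable N (\<lambda>x. \<bar>\<omega>\<bar> ^ (2 * n) / fact (2 * n) * g x ^ (2 * n))"
        by (intro integrable_mult_right pw[OF assms(2) g])
      show "integrable N (\<lambda>x. (1/4) ^ n * (exp (2 * \<omega> * g x) + exp (- 2 * \<omega> * g x)))"
        by (rule integrable_mult_right) (rule Bochner_Integration.integrable_add[OF ie ie])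
    qed
    also have "\<dots> = (1/4) ^ n * ((\<integral>x. exp (2 * \<omega> * g x) \<partial>N) + (\<integral>x. exp (- 2 * \<omega> * g x) \<partial>N))"
      by (simp only: integral_mult_right_zero Bochner_Integration.integral_add[OF ie ie])
    also have "\<dots> \<le> (1/4) ^ n * (2 * E)" using E by (intro mult_left_mono) auto
    finally show ?thesis .
  qed
  have tail_f: "\<bar>\<omega>\<bar> ^ (2 * n) / fact (2 * n) * (\<integral>x. f x ^ (2 * n) \<partial>M) \<le> d (2 * n) + (1/4) ^ n * (2 * E)"
  proof -
    have "(\<integral>x. f x ^ (2 * n) \<partial>M) \<le> \<bar>(\<integral>x. f x ^ (2 * n) \<partial>M) - (\<integral>x. g x ^ (2 * n) \<partial>N)\<bar> + (\<integral>x. g x ^ (2 * n) \<partial>N)" by linarith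
    then have "\<bar>\<omega>\<bar> ^ (2 * n) / fact (2 * n) * (\<integral>x. f x ^ (2 * n) \<partial>M) \<le>
      \<bar>\<omega>\<bar> ^ (2 * n) / fact (2 * n) * (\<bar>(\<integral>x. f x ^ (2 * n) \<partial>M) - (\<integral>x. g x ^ (2 * n) \<partial>N)\<bar> + (\<integral>x. g x ^ (2 * n) \<partial>N))"
      by (intro mult_left_mono) auto
    also have "\<dots> = d (2 * n) / fact (2 * n) + \<bar>\<omega>\<bar> ^ (2 * n) / fact (2 * n) * (\<integral>x. g x ^ (2 * n) \<partial>N)"
      by (simp add: d_def distrib_left)
    also have "d (2 * n) / fact (2 * n) \<le> d (2 * n) / 1" by (intro divide_left_mono) (auto simp: d_def fact_ge_1)
    finally show ?thesis using tail_g by simp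
  qed
  have "cmod ((CLINT x|M. iexp (\<omega> * f x)) - (CLINT x|N. iexp (\<omega> * g x))) \<le> (d (2 * n) + (1/4) ^ n * (2 * E)) + (\<Sum>k\<le>m. d k) + (1/4) ^ n * (2 * E)"
  proof -
    have tri: "cmod (a - b) \<le> cmod (a - a') + cmod (a' - b') + cmod (b - b')" for a b a' b' :: complex
      using norm_triangle_ineq[of "a - a'" "a' - b"] norm_triangle_ineq[of "a' - b'" "b' - b"] by (simp add: norm_minus_commute)
    show ?thesis
      by (rule order_trans[OF tri add_mono[OF add_mono[OF order_trans[OF taylor[OF assms(1) f] tail_f] mid] order_trans[OF taylor[OF assms(2) g] tail_g]]])
  qed
  also have "\<dots> = (\<Sum>k\<le>2 * n. d k) + 4 * (1/4) ^ n * E" by (simp add: Sm[symmetric])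
  finally show ?thesis by (simp add: d_def)
qed

text \<open>
  Pigeonhole: the \<open>r * r\<close> distances, one of which is \<open>0\<close>, cannot meet all of the \<open>r * r\<close> disjoint
  intervals \<open>(R\<^sup>j T0, R\<^sup>j\<^sup>+\<^sup>1 T0]\<close>.
\<close>

lemma good_scale:
  fixes s :: "nat \<Rightarrow> nat" and T0 R :: real
  assumes r: "r \<ge> 1" and R: "R \<ge> 1" and T0: "T0 > 0"
  shows "\<exists>j<r * r. \<forall>i<r. \<forall>k<r. \<bar>real (s i) - real (s k)\<bar> \<le> R ^ j * T0 \<or> R ^ Suc j * T0 < \<bar>real (s i) - real (s k)\<bar>"
proof (rule ccontr)
  let ?d = "\<lambda>p. \<bar>real (s (fst p)) - real (s (snd p))\<bar>"
  assume "\<not> ?thesis"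
  then have neg: "\<exists>i<r. \<exists>k<r. R ^ j * T0 < \<bar>real (s i) - real (s k)\<bar> \<and> \<bar>real (s i) - real (s k)\<bar> \<le> R ^ Suc j * T0"
    if "j < r * r" for j
    using that by (meson not_le not_less)
  have "\<exists>p. j < r * r \<longrightarrow> p \<in> {..<r} \<times> {..<r} \<and> R ^ j * T0 < ?d p \<and> ?d p \<le> R ^ Suc j * T0" for j
  proof (cases "j < r * r")
    case True
    from neg[OF True] obtain i k where "i < r" "k < r" "R ^ j * T0 < \<bar>real (s i) - real (s k)\<bar>"
      "\<bar>real (s i) - real (s k)\<bar> \<le> R ^ Suc j * T0" by blast
    then show ?thesis by (intro exI[of _ "(i, k)"]) simp
  qed simp
  then have "\<forall>j. \<exists>p. j < r * r \<longrightarrow> p \<in> {..<r} \<times> {..<r} \<and> R ^ j * T0 < ?d p \<and> ?d p \<le> R ^ Suc j * T0" ..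
  from choice[OF this] obtain f where f: "\<And>j. j < r * r \<Longrightarrow> f j \<in> {..<r} \<times> {..<r}"
     "\<And>j. j < r * r \<Longrightarrow> R ^ j * T0 < ?d (f j)" "\<And>j. j < r * r \<Longrightarrow> ?d (f j) \<le> R ^ Suc j * T0"
    by blast
  have "f j \<noteq> f j'" if "j < j'" "j < r * r" "j' < r * r" for j j'
  proof -
    have "R ^ Suc j * T0 \<le> R ^ j' * T0" using R T0 that by (intro mult_right_mono power_increasing) auto
    then show ?thesis using f(3)[OF that(2)] f(2)[OF that(3)] by auto
  qed
  then have "inj_on f {..<r * r}"
    unfolding inj_on_def by (metis lessThan_iff linorder_neqE_nat)
  moreover have "f ` {..<r * r} \<subseteq> {..<r} \<times> {..<r} - {(0, 0)}"
  proof (intro image_subsetI DiffI)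
    fix j assume "j \<in> {..<r * r}"
    then show "f j \<in> {..<r} \<times> {..<r}" using f(1) by simp
    have "0 < ?d (f j)" using f(2)[of j] \<open>j \<in> _\<close> R T0 by (smt (verit) lessThan_iff mult_nonneg_nonneg zero_le_power)
    then show "f j \<notin> {(0, 0)}" by auto
  qed
  ultimately have "card {..<r * r} \<le> card ({..<r} \<times> {..<r} - {(0, 0)})"
    by (intro card_inj_on_le[of f]) auto
  also have "\<dots> = r * r - 1" using r by (subst card_Diff_singleton) auto
  finally have "r * r \<le> r * r - 1" by (simp only: card_lessThan)
  moreover have "r * r > 0" using r by simp
  ultimately show False by linarith
qed

subsection \<open>Decorrelated sequences\<close>

lemma (in prob_space) norm_expectation_le:
  fixes f :: "'a \<Rightarrow> 'c::{banach, second_countable_topology}"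
  assumes "\<And>x. x \<in> space M \<Longrightarrow> norm (f x) \<le> B" "0 \<le> B"
  shows "norm (integral\<^sup>L M f) \<le> B"
proof -
  have "norm (integral\<^sup>L M f) \<le> (\<integral>x. norm (f x) \<partial>M)" by (rule integral_norm_bound)
  also have "\<dots> \<le> (\<integral>x. B \<partial>M)" by (rule integral_mono') (use assms in auto)
  finally show ?thesis by (simp add: prob_space)
qed

lemma exp_le_quadratic:
  fixes x :: real
  assumes "\<bar>x\<bar> \<le> 1"
  shows "exp x \<le> 1 + x + x\<^sup>2"
proof (cases "x \<ge> 0")
  case True
  then show ?thesis using exp_bound[of x] assms by simp
next
  case False
  define y where "y = - x"
  have y: "y > 0" using False by (simp add: y_def)
  \<comment> \<open>For negative arguments the claim reduces to the identity
    \<open>(1 + y) * (1 - y + y\<^sup>2) = 1 + y ^ 3\<close> together with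
    \<open>1 + y \<le> exp y\<close>.\<close>
  have "1 \<le> 1 + y ^ 3" using y by simp
  also have "\<dots> = (1 + y) * (1 - y + y\<^sup>2)" by (simp add: power2_eq_square power3_eq_cube algebra_simps)
  also have "\<dots> \<le> exp y * (1 - y + y\<^sup>2)"
  proof (rule mult_right_mono)
    have "0 \<le> (1 - y / 2)\<^sup>2 + 3 / 4 * y\<^sup>2" by simp
    then show "0 \<le> 1 - y + y\<^sup>2" by (simp add: power2_eq_square algebra_simps)
  qed simp
  finally have "1 * exp (- y) \<le> exp y * (1 - y + y\<^sup>2) * exp (- y)" by (intro mult_right_mono) auto
  also have "\<dots> = 1 - y + y\<^sup>2" by (simp add: exp_minus)
  finally show ?thesis by (simp add: y_def)
qed

lemma exp_minus_linear_bound: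
  fixes y :: real
  assumes "0 \<le> y"
  shows "\<bar>(1 - y) - exp (- y)\<bar> \<le> y\<^sup>2"
proof -
  have "1 - y \<le> exp (- y)" using exp_ge_add_one_self[of "- y"] by simp
  moreover have "exp (- y) \<le> 1 - y + y\<^sup>2"
  proof (cases "y \<le> 1")
    case True
    then show ?thesis using exp_le_quadratic[of "- y"] assms by simp
  next
    case False
    then have "y * 1 \<le> y * y" by (intro mult_left_mono) auto
    moreover have "exp (- y) \<le> 1" using assms by simp
    ultimately show ?thesis unfolding power2_eq_square by linarith
  qed
  ultimately show ?thesis by linarith
qed

context prob_space
begin

lemma integrable_bounded_power2:
  fixes S :: "'a \<Rightarrow> real"
  assumes "S \<in> borel_measurable M" "\<And>x. x \<in> space M \<Longrightarrow> \<bar>S x\<bar> \<le> l"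
  shows "integrable M (\<lambda>x. (S x)\<^sup>2)"
proof (rule integrable_const_bound[where B="l\<^sup>2"])
  show "AE x in M. norm ((S x)\<^sup>2) \<le> l\<^sup>2"
  proof (rule AE_I2)
    fix x assume "x \<in> space M"
    then have "\<bar>S x\<bar> \<le> \<bar>l\<bar>" using assms(2)[of x] by linarith
    then show "norm ((S x)\<^sup>2) \<le> l\<^sup>2" by (simp add: abs_le_square_iff)
  qed
qed (use assms(1) in measurable)

text \<open>The quadratic bound on \<open>exp\<close> is available because \<open>a * S\<close>
  stays within \<open>[-1, 1]\<close>; the linear term has mean zero.\<close>

lemma expectation_exp_le:
  fixes S :: "'a \<Rightarrow> real"
  assumes S: "S \<in> borel_measurable M" "\<And>x. x \<in> space M \<Longrightarrow> \<bar>S x\<bar> \<le> l"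
    and 0: "expectation S = 0" and al: "\<bar>a\<bar> * l \<le> 1"
  shows "expectation (\<lambda>x. exp (a * S x)) \<le> exp (a\<^sup>2 * expectation (\<lambda>x. (S x)\<^sup>2))"
proof -
  have i1: "integrable M S" by (rule integrable_const_bound[where B=l]) (use S in auto)
  have i2: "integrable M (\<lambda>x. (S x)\<^sup>2)" using S by (rule integrable_bounded_power2)
  have "expectation (\<lambda>x. exp (a * S x)) \<le> expectation (\<lambda>x. 1 + a * S x + a\<^sup>2 * (S x)\<^sup>2)"
  proof (rule integral_mono')
    show "integrable M (\<lambda>x. 1 + a * S x + a\<^sup>2 * (S x)\<^sup>2)" using i1 i2 by auto
    fix x assume x: "x \<in> space M"
    have "\<bar>a * S x\<bar> \<le> \<bar>a\<bar> * l" unfolding abs_mult using S(2)[OF x] by (intro mult_left_mono) auto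
    then have "\<bar>a * S x\<bar> \<le> 1" using al by linarith
    from exp_le_quadratic[OF this] show "exp (a * S x) \<le> 1 + a * S x + a\<^sup>2 * (S x)\<^sup>2"
      by (simp add: power_mult_distrib)
    moreover have "0 \<le> exp (a * S x)" by simp
    ultimately show "0 \<le> 1 + a * S x + a\<^sup>2 * (S x)\<^sup>2" by linarith
  qed
  also have "\<dots> = 1 + a\<^sup>2 * expectation (\<lambda>x. (S x)\<^sup>2)" using i1 i2 0 by (simp add: prob_space)
  also have "\<dots> \<le> exp (a\<^sup>2 * expectation (\<lambda>x. (S x)\<^sup>2))" by (rule exp_ge_add_one_self)
  finally show ?thesis .
qed

text \<open>Second order Taylor expansion. The cubic remainder is at most \<open>l\<close> times a
  square, so that both error terms involve only the variance and the bound \<open>l\<close>.\<close>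

lemma expectation_iexp_approx:
  fixes S :: "'a \<Rightarrow> real"
  assumes S: "S \<in> borel_measurable M" "\<And>x. x \<in> space M \<Longrightarrow> \<bar>S x\<bar> \<le> l"
    and 0: "expectation S = 0" and v: "v = expectation (\<lambda>x. (S x)\<^sup>2)"
  shows "cmod ((CLINT x|M. iexp (a * S x)) - exp (- (a\<^sup>2 * v / 2))) \<le> \<bar>a\<bar> ^ 3 * l * v + a ^ 4 * v\<^sup>2"
proof -
  have i1: "integrable M S" by (rule integrable_const_bound[where B=l]) (use S in auto)
  have i2: "integrable M (\<lambda>x. (S x)\<^sup>2)" using S by (rule integrable_bounded_power2)
  have v0: "v \<ge> 0" unfolding v by (intro integral_nonneg_AE) auto
  have ie: "complex_integrable M (\<lambda>x. iexp (a * S x))"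
    by (rule integrable_const_bound[where B=1]) (use S(1) in auto)
  define T where "T x = 1 + \<i> * complex_of_real (a * S x) - complex_of_real (a\<^sup>2 / 2 * (S x)\<^sup>2)" for x
  have iT: "complex_integrable M T"
    unfolding T_def using i1 i2 by (intro Bochner_Integration.integrable_diff Bochner_Integration.integrable_add integrable_mult_right integrable_of_real) auto
  have ET: "(CLINT x|M. T x) = complex_of_real (1 - a\<^sup>2 * v / 2)"
  proof -
    have "(CLINT x|M. T x) = (CLINT x|M. 1 + \<i> * complex_of_real (a * S x)) - (CLINT x|M. complex_of_real (a\<^sup>2 / 2 * (S x)\<^sup>2))"
      unfolding T_def using i1 i2 by (intro Bochner_Integration.integral_diff Bochner_Integration.integrable_add integrable_mult_right integrable_of_real) auto
    also have "(CLINT x|M. 1 + \<i> * complex_of_real (a * S x)) = (CLINT x|M. 1) + (CLINT x|M. \<i> * complex_of_real (a * S x))"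
      using i1 by (intro Bochner_Integration.integral_add integrable_mult_right integrable_of_real) auto
    also have "(CLINT x|M. \<i> * complex_of_real (a * S x)) = \<i> * complex_of_real (expectation (\<lambda>x. a * S x))"
      by (simp only: integral_mult_right_zero integral_complex_of_real)
    also have "(CLINT x|M. complex_of_real (a\<^sup>2 / 2 * (S x)\<^sup>2)) = complex_of_real (a\<^sup>2 / 2 * v)"
      unfolding integral_complex_of_real v by simp
    finally show ?thesis by (simp add: 0 prob_space)
  qed
  have "cmod ((CLINT x|M. iexp (a * S x)) - (CLINT x|M. T x)) \<le> \<bar>a\<bar> ^ 3 * l * v"
  proof -
    have "(CLINT x|M. iexp (a * S x)) - (CLINT x|M. T x) = (CLINT x|M. iexp (a * S x) - T x)"
      using ie iT by (rule Bochner_Integration.integral_diff[symmetric])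
    also have "cmod \<dots> \<le> (\<integral>x. cmod (iexp (a * S x) - T x) \<partial>M)" by (rule integral_norm_bound)
    also have "\<dots> \<le> (\<integral>x. \<bar>a\<bar> ^ 3 * l * (S x)\<^sup>2 \<partial>M)"
    proof (rule integral_mono')
      show "integrable M (\<lambda>x. \<bar>a\<bar> ^ 3 * l * (S x)\<^sup>2)" using i2 by (rule integrable_mult_right)
      fix x assume x: "x \<in> space M"
      have "l \<ge> 0" using S(2)[OF x] by linarith
      then show "0 \<le> \<bar>a\<bar> ^ 3 * l * (S x)\<^sup>2" by simp
      have "(\<Sum>k\<le>2. (\<i> * complex_of_real (a * S x)) ^ k / fact k) = T x"
        unfolding T_def by (simp add: eval_nat_numeral power_mult_distrib)
      then have "cmod (iexp (a * S x) - T x) \<le> \<bar>a * S x\<bar> ^ 3 / fact 3"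
        using iexp_approx1[of "a * S x" 2] by (simp add: eval_nat_numeral)
      also have "\<dots> \<le> \<bar>a * S x\<bar> ^ 3 / 1" by (intro divide_left_mono) (auto simp: fact_ge_1)
      also have "\<dots> = \<bar>a\<bar> ^ 3 * (\<bar>S x\<bar> * (S x)\<^sup>2)"
        unfolding power2_abs[of "S x", symmetric] by (simp only: abs_mult power3_eq_cube power2_eq_square mult_ac div_by_1)
      also have "\<dots> \<le> \<bar>a\<bar> ^ 3 * (l * (S x)\<^sup>2)"
        using S(2)[OF x] by (intro mult_left_mono mult_right_mono) auto
      finally show "cmod (iexp (a * S x) - T x) \<le> \<bar>a\<bar> ^ 3 * l * (S x)\<^sup>2" by (simp add: mult.assoc)
    qed
    finally show ?thesis by (simp add: v)
  qed
  moreover have "cmod ((CLINT x|M. T x) - exp (- (a\<^sup>2 * v / 2))) \<le> a ^ 4 * v\<^sup>2"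
  proof -
    have "(CLINT x|M. T x) - exp (- (a\<^sup>2 * v / 2)) = complex_of_real ((1 - a\<^sup>2 * v / 2) - exp (- (a\<^sup>2 * v / 2)))"
      by (simp add: ET exp_of_real)
    then have "cmod ((CLINT x|M. T x) - exp (- (a\<^sup>2 * v / 2))) = \<bar>(1 - a\<^sup>2 * v / 2) - exp (- (a\<^sup>2 * v / 2))\<bar>"
      by (simp only: norm_of_real)
    also have "\<dots> \<le> (a\<^sup>2 * v / 2)\<^sup>2" using v0 by (intro exp_minus_linear_bound) auto
    also have "\<dots> = a ^ 4 * v\<^sup>2 / 4" by (simp add: power_divide power_mult_distrib power_mult[symmetric])
    also have "\<dots> \<le> a ^ 4 * v\<^sup>2" by simp
    finally show ?thesis .
  qed
  ultimately show ?thesis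
    using norm_triangle_ineq[of "(CLINT x|M. iexp (a * S x)) - (CLINT x|M. T x)" "(CLINT x|M. T x) - exp (- (a\<^sup>2 * v / 2))"] by simp
qed

lemma product_integral_prod_const:
  fixes f :: "'i \<Rightarrow> 'a \<Rightarrow> 'c::{real_normed_field, banach, second_countable_topology}"
  assumes "finite B" "\<And>b. b \<in> B \<Longrightarrow> integrable M (f b)"
  shows "(\<integral>\<omega>. (\<Prod>b\<in>B. f b (\<omega> b)) \<partial>(\<Pi>\<^sub>M b\<in>B. M)) = (\<Prod>b\<in>B. integral\<^sup>L M (f b))"
proof -
  interpret product_sigma_finite "\<lambda>_ :: 'i. M" by standard
  show ?thesis using assms by (rule product_integral_prod)
qed

lemma prob_space_PiM_const: "prob_space (\<Pi>\<^sub>M b\<in>B. M)"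
  by (intro prob_space_PiM) unfold_locales

end

text \<open>
  On orbits, \<open>Y s \<theta> = h (a\<^sub>s u(\<theta>) \<Gamma>)\<close> and \<open>W s \<Lambda> = h (a\<^sub>s \<Lambda>)\<close>.  Expectations of products factor along the
  parts of a clustered family of times; \<open>D1\<close> bounds the diameters of the parts, \<open>D2\<close> their distances.
\<close>

locale decorrelation = M: prob_space M + X: prob_space X
  for M :: "'a measure" and X :: "'b measure" +
  fixes Y :: "nat \<Rightarrow> 'a \<Rightarrow> real" and W :: "nat \<Rightarrow> 'b \<Rightarrow> real" and c :: "nat \<Rightarrow> real" and \<xi> :: real
  assumes Y: "\<And>s. Y s \<in> borel_measurable M" "\<And>s x. x \<in> space M \<Longrightarrow> \<bar>Y s x\<bar> \<le> 1"
    and W: "\<And>s. W s \<in> borel_measurable X" "\<And>s x. x \<in> space X \<Longrightarrow> \<bar>W s x\<bar> \<le> 1"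
    and W0: "\<And>s. X.expectation (W s) = 0"
    and cov: "\<And>s t. s \<le> t \<Longrightarrow> X.expectation (\<lambda>x. W s x * W t x) = c (t - s)"
    and \<xi>: "\<xi> \<ge> 0"
    and decay: "\<And>r::nat. \<exists>C\<ge>0. \<exists>\<delta>>0. \<forall>(I :: nat set) s P D1 D2. finite I \<longrightarrow> card I \<le> r \<longrightarrow> partition_on I P \<longrightarrow> 0 \<le> D1 \<longrightarrow> 0 < D2 \<longrightarrow> clustered s P D1 D2 \<longrightarrow>
     ((\<forall>i\<in>I. D2 \<le> real (s i)) \<longrightarrow>
       \<bar>(\<integral>x. (\<Prod>i\<in>I. Y (s i) x) \<partial>M) - (\<Prod>p\<in>P. \<integral>x. (\<Prod>i\<in>p. W (s i) x) \<partial>X)\<bar> \<le> C * exp (\<xi> * D1 - \<delta> * D2)) \<and>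
     \<bar>(\<integral>x. (\<Prod>i\<in>I. W (s i) x) \<partial>X) - (\<Prod>p\<in>P. \<integral>x. (\<Prod>i\<in>p. W (s i) x) \<partial>X)\<bar> \<le> C * exp (\<xi> * D1 - \<delta> * D2)"
begin

lemma integrable_W_prod: "integrable X (\<lambda>x. W s x * W t x)"
proof (rule X.integrable_const_bound[where B=1])
  show "AE x in X. norm (W s x * W t x) \<le> 1"
    by (intro AE_I2) (auto simp: abs_mult W intro!: mult_le_one)
qed (use W in measurable)

text \<open>The case of two singleton clusters: their diameter is \<open>0\<close>, so the loss
  \<open>exp (\<xi> * D1)\<close> is \<open>1\<close>, and the factorised expectation vanishes
  because the means do. On orbits the distance from time \<open>0\<close> counts as well, hence the
  term \<open>\<rho> ^ s\<close>.\<close>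

lemma pair_decay:
  "\<exists>C\<ge>1. \<exists>\<rho>. 0 \<le> \<rho> \<and> \<rho> < 1 \<and> (\<forall>s t. s \<le> t \<longrightarrow> \<bar>M.expectation (\<lambda>x. Y s x * Y t x)\<bar> \<le> C * (\<rho> ^ s + \<rho> ^ (t - s))) \<and>
     (\<forall>n. \<bar>c n\<bar> \<le> C * \<rho> ^ n)"
proof -
  obtain C \<delta> where C: "C \<ge> 0" "\<delta> > 0" and dec: "\<forall>(I :: nat set) s P D1 D2. finite I \<longrightarrow> card I \<le> 2 \<longrightarrow> partition_on I P \<longrightarrow> 0 \<le> D1 \<longrightarrow> 0 < D2 \<longrightarrow> clustered s P D1 D2 \<longrightarrow>
     ((\<forall>i\<in>I. D2 \<le> real (s i)) \<longrightarrow>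
       \<bar>(\<integral>x. (\<Prod>i\<in>I. Y (s i) x) \<partial>M) - (\<Prod>p\<in>P. \<integral>x. (\<Prod>i\<in>p. W (s i) x) \<partial>X)\<bar> \<le> C * exp (\<xi> * D1 - \<delta> * D2)) \<and>
     \<bar>(\<integral>x. (\<Prod>i\<in>I. W (s i) x) \<partial>X) - (\<Prod>p\<in>P. \<integral>x. (\<Prod>i\<in>p. W (s i) x) \<partial>X)\<bar> \<le> C * exp (\<xi> * D1 - \<delta> * D2)"
    using decay[of 2] by (elim exE conjE) (rule that)
  define \<rho> where "\<rho> = exp (- \<delta>)"
  have \<rho>: "0 \<le> \<rho>" "\<rho> < 1" using C by (auto simp: \<rho>_def)
  have \<rho>p: "exp (- \<delta> * real n) = \<rho> ^ n" for n
    by (simp add: \<rho>_def exp_of_nat_mult[symmetric] mult.commute)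
  define P where "P = {{0}, {Suc 0}}"
  have P: "partition_on {0, Suc 0} P" by (auto simp: P_def partition_on_def disjoint_def)
  have two: "((0 < D \<and> D \<le> real s \<and> D \<le> real t) \<longrightarrow> \<bar>M.expectation (\<lambda>x. Y s x * Y t x)\<bar> \<le> C * exp (- \<delta> * D)) \<and>
     (0 < D \<longrightarrow> \<bar>X.expectation (\<lambda>x. W s x * W t x)\<bar> \<le> C * exp (- \<delta> * D))"
    if "s < t" "D \<le> real t - real s" for s t D
  proof -
    define \<sigma> where "\<sigma> i = (if i = 0 then s else t)" for i :: nat
    have "clustered \<sigma> P 0 D" using that by (auto simp: clustered_def P_def \<sigma>_def)
    then show ?thesis
      using dec[rule_format, of "{0, Suc 0}" P 0 D \<sigma>] P by (simp add: \<sigma>_def P_def W0)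
  qed
  define K where "K = max C 1"
  \<comment> \<open>If \<open>s = 0\<close> or \<open>s = t\<close>, no positive \<open>D2\<close>
    is available, but one of the two powers of \<rho> is \<open>1\<close> and the trivial bound
    suffices.\<close>
  have "\<bar>M.expectation (\<lambda>x. Y s x * Y t x)\<bar> \<le> K * (\<rho> ^ s + \<rho> ^ (t - s))" if st: "s \<le> t" for s t
  proof (cases "s = 0 \<or> s = t")
    case True
    have "norm (M.expectation (\<lambda>x. Y s x * Y t x)) \<le> 1"
      by (rule M.norm_expectation_le) (auto simp: abs_mult Y intro!: mult_le_one)
    also have "1 \<le> \<rho> ^ s + \<rho> ^ (t - s)" using True \<rho> by auto
    also have "1 * (\<rho> ^ s + \<rho> ^ (t - s)) \<le> K * (\<rho> ^ s + \<rho> ^ (t - s))"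
      using \<rho> by (intro mult_right_mono) (auto simp: K_def)
    finally show ?thesis by simp
  next
    case False
    define D where "D = min s (t - s)"
    have D: "0 < D" "D \<le> s" "D \<le> t - s" using False st by (auto simp: D_def)
    have "\<bar>M.expectation (\<lambda>x. Y s x * Y t x)\<bar> \<le> C * exp (- \<delta> * real D)"
      using two[of s t "real D"] False st D by auto
    also have "\<dots> \<le> K * \<rho> ^ D" unfolding \<rho>p using \<rho> by (intro mult_right_mono) (auto simp: K_def)
    also have "\<dots> \<le> K * (\<rho> ^ s + \<rho> ^ (t - s))"
      using \<rho> by (intro mult_left_mono) (auto simp: D_def min_def K_def)
    finally show ?thesis .
  qed
  moreover have "\<bar>c n\<bar> \<le> K * \<rho> ^ n" for n
  proof (cases "n = 0")
    case True
    have "norm (W 0 x * W 0 x) \<le> 1" if "x \<in> space X" for x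
      unfolding real_norm_def abs_mult using W(2)[OF that] by (intro mult_le_one) auto
    then have "norm (X.expectation (\<lambda>x. W 0 x * W 0 x)) \<le> 1"
      by (intro X.norm_expectation_le) auto
    then show ?thesis using cov[of 0 0] True by (simp add: K_def)
  next
    case False
    then have "\<bar>X.expectation (\<lambda>x. W 0 x * W n x)\<bar> \<le> C * exp (- \<delta> * real n)"
      using two[of 0 n "real n"] by auto
    also have "\<dots> \<le> K * \<rho> ^ n" unfolding \<rho>p using \<rho> by (intro mult_right_mono) (auto simp: K_def)
    finally show ?thesis using cov[of 0 n] by simp
  qed
  moreover have "K \<ge> 1" by (simp add: K_def)
  ultimately show ?thesis using \<rho> by blast
qed

lemma second_moment_Y:
  "\<exists>C\<ge>0. \<forall>I. finite I \<longrightarrow> M.expectation (\<lambda>x. (\<Sum>s\<in>I. Y s x)\<^sup>2) \<le> C * real (card I)"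
proof -
  obtain C \<rho> where C: "C \<ge> 1" "0 \<le> \<rho>" "\<rho> < 1" "\<And>s t. s \<le> t \<Longrightarrow> \<bar>M.expectation (\<lambda>x. Y s x * Y t x)\<bar> \<le> C * (\<rho> ^ s + \<rho> ^ (t - s))"
    using pair_decay by blast
  have "M.expectation (\<lambda>x. (\<Sum>s\<in>I. Y s x)\<^sup>2) \<le> (4 * C / (1 - \<rho>)) * real (card I)" if "finite I" for I
    using C that by (intro M.second_moment_le[where K=1] Y) auto
  moreover have "4 * C / (1 - \<rho>) \<ge> 0" using C by simp
  ultimately show ?thesis by blast
qed

text \<open>The Green-Kubo variance: the sum of the correlations over all integer times, folded by
  symmetry.\<close>

definition \<sigma>2 :: real where "\<sigma>2 = c 0 + 2 * (\<Sum>n. c (Suc n))"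

lemma summable_c: "summable (\<lambda>n. \<bar>c n\<bar>)" "summable (\<lambda>n. c (Suc n))"
proof -
  obtain C \<rho> where C: "C \<ge> 1" "0 \<le> \<rho>" "\<rho> < 1" "\<And>n. \<bar>c n\<bar> \<le> C * \<rho> ^ n"
    using pair_decay by blast
  have g: "summable (\<lambda>n. C * \<rho> ^ n)" using C by (intro summable_mult summable_geometric) auto
  show 1: "summable (\<lambda>n. \<bar>c n\<bar>)"
    by (rule summable_comparison_test'[OF g, where N=0]) (use C in auto)
  then have "summable c" by (rule summable_rabs_cancel)
  then show "summable (\<lambda>n. c (Suc n))" by (simp add: summable_Suc_iff)
qed

text \<open>Appending one time adds its own variance and twice its covariances with the earlier
  times; these depend only on time differences, whence the value is the same for every starting
  point \<open>a\<close>.\<close>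

lemma block_variance:
  "X.expectation (\<lambda>x. (\<Sum>s\<in>{a..<a + l}. W s x)\<^sup>2) = (\<Sum>i<l. c 0 + 2 * (\<Sum>n<i. c (Suc n)))"
proof (induction l)
  case (Suc l)
  let ?S = "\<lambda>x. \<Sum>s\<in>{a..<a + l}. W s x"
  have eq: "(\<Sum>s\<in>{a..<a + Suc l}. W s x)\<^sup>2 = (?S x)\<^sup>2 + (2 * (\<Sum>s\<in>{a..<a + l}. W s x * W (a + l) x) + W (a + l) x * W (a + l) x)" for x
    by (simp add: power2_eq_square algebra_simps sum_distrib_left sum_distrib_right)
  have i2: "integrable X (\<lambda>x. (?S x)\<^sup>2)"
    unfolding power2_eq_square sum_product by (intro Bochner_Integration.integrable_sum integrable_W_prod)
  have ic: "integrable X (\<lambda>x. \<Sum>s\<in>{a..<a + l}. W s x * W (a + l) x)"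
    by (intro Bochner_Integration.integrable_sum integrable_W_prod)
  have "X.expectation (\<lambda>x. \<Sum>s\<in>{a..<a + l}. W s x * W (a + l) x) = (\<Sum>s\<in>{a..<a + l}. c (a + l - s))"
    unfolding Bochner_Integration.integral_sum[OF integrable_W_prod]
  proof (rule sum.cong)
    fix s assume "s \<in> {a..<a + l}"
    then have "s \<le> a + l" by simp
    then show "X.expectation (\<lambda>x. W s x * W (a + l) x) = c (a + l - s)" by (rule cov)
  qed simp
  also have "\<dots> = (\<Sum>i<l. c (l - i))"
    by (rule sum.reindex_bij_witness[of _ "\<lambda>i. a + i" "\<lambda>s. s - a"]) (auto simp: add.commute)
  also have "\<dots> = (\<Sum>i<l. c (Suc (l - Suc i)))"
    by (intro sum.cong) (auto simp: Suc_diff_Suc)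
  also have "\<dots> = (\<Sum>n<l. c (Suc n))"
    by (rule sum.nat_diff_reindex[where g="\<lambda>n. c (Suc n)"])
  finally have cross: "X.expectation (\<lambda>x. \<Sum>s\<in>{a..<a + l}. W s x * W (a + l) x) = (\<Sum>n<l. c (Suc n))" .
  have "X.expectation (\<lambda>x. (\<Sum>s\<in>{a..<a + Suc l}. W s x)\<^sup>2) = X.expectation (\<lambda>x. (?S x)\<^sup>2) + (2 * (\<Sum>n<l. c (Suc n)) + c 0)"
    unfolding eq using i2 ic integrable_W_prod cov[of "a + l" "a + l"] cross by simp
  then show ?case using Suc.IH by simp
qed simp

text \<open>The variance of a block is a sum of partial sums of the series for
  \<open>\<sigma>2\<close>, whose tails decay geometrically; hence the total error stays bounded in
  \<open>l\<close>. An error bounded per block is negligible as soon as the blocks grow.\<close>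

lemma block_variance_asymp:
  "\<exists>K\<ge>0. \<forall>a l. \<bar>X.expectation (\<lambda>x. (\<Sum>s\<in>{a..<a + l}. W s x)\<^sup>2) - real l * \<sigma>2\<bar> \<le> K"
proof -
  obtain C \<rho> where C: "C \<ge> 1" "0 \<le> \<rho>" "\<rho> < 1" "\<And>n. \<bar>c n\<bar> \<le> C * \<rho> ^ n"
    using pair_decay by blast
  have tail: "\<bar>(\<Sum>n. c (Suc n)) - (\<Sum>n<i. c (Suc n))\<bar> \<le> (C / (1 - \<rho>)) * \<rho> ^ i" for i
  proof -
    have "(\<Sum>n. c (Suc n)) - (\<Sum>n<i. c (Suc n)) = (\<Sum>n. c (Suc (n + i)))"
      using suminf_split_initial_segment[OF summable_c(2), of i] by simp
    also have "norm \<dots> \<le> (\<Sum>n. C * \<rho> ^ i * \<rho> ^ n)"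
    proof (rule norm_suminf_le)
      show "summable (\<lambda>n. C * \<rho> ^ i * \<rho> ^ n)" using C by (intro summable_mult summable_geometric) auto
      fix n
      have "\<bar>c (Suc (n + i))\<bar> \<le> C * \<rho> ^ Suc (n + i)" by (rule C(4))
      also have "\<dots> \<le> C * \<rho> ^ (n + i)" using C by (intro mult_left_mono power_decreasing) auto
      finally show "norm (c (Suc (n + i))) \<le> C * \<rho> ^ i * \<rho> ^ n" by (simp add: power_add mult_ac)
    qed
    also have "(\<Sum>n. C * \<rho> ^ i * \<rho> ^ n) = C * \<rho> ^ i * (1 / (1 - \<rho>))"
      using C by (subst suminf_mult) (auto simp: suminf_geometric)
    finally show ?thesis by simp
  qed
  have "\<bar>X.expectation (\<lambda>x. (\<Sum>s\<in>{a..<a + l}. W s x)\<^sup>2) - real l * \<sigma>2\<bar> \<le> 2 * (C / (1 - \<rho>)) * (1 / (1 - \<rho>))" for a l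
  proof -
    have "X.expectation (\<lambda>x. (\<Sum>s\<in>{a..<a + l}. W s x)\<^sup>2) - real l * \<sigma>2 = (\<Sum>i<l. 2 * ((\<Sum>n<i. c (Suc n)) - (\<Sum>n. c (Suc n))))"
      unfolding block_variance \<sigma>2_def by (simp add: sum_subtractf sum.distrib sum_distrib_left algebra_simps)
    also have "\<bar>\<dots>\<bar> \<le> (\<Sum>i<l. 2 * ((C / (1 - \<rho>)) * \<rho> ^ i))"
    proof (rule order_trans[OF sum_abs sum_mono])
      fix i
      show "\<bar>2 * ((\<Sum>n<i. c (Suc n)) - (\<Sum>n. c (Suc n)))\<bar> \<le> 2 * ((C / (1 - \<rho>)) * \<rho> ^ i)"
      proof -
        have "\<bar>2 * (u - w)\<bar> = 2 * \<bar>w - u\<bar>" for u w :: real by (simp add: abs_if)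
        then show ?thesis using tail[of i] by (simp only: mult_le_cancel_left_pos zero_less_numeral)
      qed
    qed
    also have "\<dots> = 2 * (C / (1 - \<rho>)) * (\<Sum>i<l. \<rho> ^ i)" by (simp only: sum_distrib_left mult.assoc)
    also have "\<dots> \<le> 2 * (C / (1 - \<rho>)) * (1 / (1 - \<rho>))"
      using C by (intro mult_left_mono sum_power_le) auto
    finally show ?thesis .
  qed
  moreover have "2 * (C / (1 - \<rho>)) * (1 / (1 - \<rho>)) \<ge> 0" using C by simp
  ultimately show ?thesis by blast
qed

text \<open>Block variances are nonnegative and equal \<open>l * \<sigma>2\<close> up to a bounded
  error.\<close>

lemma \<sigma>2_nonneg: "\<sigma>2 \<ge> 0"
proof (rule ccontr)
  assume "\<not> \<sigma>2 \<ge> 0"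
  then have neg: "\<sigma>2 < 0" by simp
  obtain K where K: "\<And>a l. \<bar>X.expectation (\<lambda>x. (\<Sum>s\<in>{a..<a + l}. W s x)\<^sup>2) - real l * \<sigma>2\<bar> \<le> K"
    using block_variance_asymp by blast
  obtain l :: nat where "K / (- \<sigma>2) < real l" using reals_Archimedean2 by blast
  then have "K < real l * (- \<sigma>2)" using pos_divide_less_eq[of "- \<sigma>2" K "real l"] neg by linarith
  moreover have "0 \<le> X.expectation (\<lambda>x. (\<Sum>s\<in>{0..<0 + l}. W s x)\<^sup>2)" by (intro integral_nonneg_AE) auto
  ultimately show False using K[of 0 l] by linarith
qed

text \<open>At a good scale the indices fall into clusters that respect the blocks, so both sides
  can be compared with the product over clusters: the expectation along orbits by the first half of
  \<open>decay\<close>, each block by the second. Errors arise only in blocks that are met, at most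
  \<open>r\<close> of them however large \<open>B\<close> is.\<close>

lemma tuple_compare:
  assumes r: "r \<ge> (1 :: nat)"
  shows "\<exists>C\<ge>0. \<exists>R\<ge>1. \<forall>(\<sigma> :: nat \<Rightarrow> nat) (\<beta> :: nat \<Rightarrow> nat) B T0 q. T0 > 0 \<longrightarrow> R ^ (r * r) * T0 \<le> q \<longrightarrow> (\<forall>i<r. q \<le> real (\<sigma> i)) \<longrightarrow>
     (\<forall>i<r. \<forall>k<r. \<beta> (\<sigma> i) \<noteq> \<beta> (\<sigma> k) \<longrightarrow> q < \<bar>real (\<sigma> i) - real (\<sigma> k)\<bar>) \<longrightarrow> finite B \<longrightarrow> (\<forall>i<r. \<beta> (\<sigma> i) \<in> B) \<longrightarrow>
     \<bar>M.expectation (\<lambda>x. \<Prod>i<r. Y (\<sigma> i) x) - (\<Prod>b\<in>B. X.expectation (\<lambda>x. \<Prod>i\<in>{i\<in>{..<r}. \<beta> (\<sigma> i) = b}. W (\<sigma> i) x))\<bar> \<le> C * exp (- T0)"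
proof -
  obtain C \<delta> where C: "C \<ge> 0" "\<delta> > 0" and dec: "\<forall>(I :: nat set) s P D1 D2. finite I \<longrightarrow> card I \<le> r \<longrightarrow> partition_on I P \<longrightarrow> 0 \<le> D1 \<longrightarrow> 0 < D2 \<longrightarrow> clustered s P D1 D2 \<longrightarrow>
     ((\<forall>i\<in>I. D2 \<le> real (s i)) \<longrightarrow>
       \<bar>(\<integral>x. (\<Prod>i\<in>I. Y (s i) x) \<partial>M) - (\<Prod>p\<in>P. \<integral>x. (\<Prod>i\<in>p. W (s i) x) \<partial>X)\<bar> \<le> C * exp (\<xi> * D1 - \<delta> * D2)) \<and>
     \<bar>(\<integral>x. (\<Prod>i\<in>I. W (s i) x) \<partial>X) - (\<Prod>p\<in>P. \<integral>x. (\<Prod>i\<in>p. W (s i) x) \<partial>X)\<bar> \<le> C * exp (\<xi> * D1 - \<delta> * D2)"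
    using decay[of r] by (elim exE conjE) (rule that)
  \<comment> \<open>\<open>R\<close> is the ratio of separation to diameter:
    \<open>(\<xi> + 1) / \<delta>\<close> brings the exponent
    \<open>\<xi> * T - \<delta> * R * T\<close> down to at most \<open>- T\<close>, and
    \<open>2\<close> makes nearness transitive.\<close>
  define R where "R = max 2 ((\<xi> + 1) / \<delta>)"
  have R2: "R \<ge> 2" by (simp add: R_def)
  have R: "R \<ge> 1" "\<xi> + 1 \<le> \<delta> * R"
  proof -
    have "(\<xi> + 1) / \<delta> \<le> R" by (simp add: R_def)
    then show "\<xi> + 1 \<le> \<delta> * R" using C by (simp add: pos_divide_le_eq mult.commute)
  qed (simp add: R_def)
  have "\<bar>M.expectation (\<lambda>x. \<Prod>i<r. Y (\<sigma> i) x) - (\<Prod>b\<in>B. X.expectation (\<lambda>x. \<Prod>i\<in>{i\<in>{..<r}. \<beta> (\<sigma> i) = b}. W (\<sigma> i) x))\<bar> \<le> (C + real r * C) * exp (- T0)"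
    if T0: "T0 > 0" and Rq: "R ^ (r * r) * T0 \<le> q" and q\<sigma>: "\<forall>i<r. q \<le> real (\<sigma> i)"
      and sep: "\<forall>i<r. \<forall>k<r. \<beta> (\<sigma> i) \<noteq> \<beta> (\<sigma> k) \<longrightarrow> q < \<bar>real (\<sigma> i) - real (\<sigma> k)\<bar>"
      and B: "finite B" and \<beta>B: "\<forall>i<r. \<beta> (\<sigma> i) \<in> B" for \<sigma> :: "nat \<Rightarrow> nat" and \<beta> :: "nat \<Rightarrow> nat" and B T0 q
  proof -
    obtain j where j: "j < r * r" and good: "\<And>i k. i < r \<Longrightarrow> k < r \<Longrightarrow> \<bar>real (\<sigma> i) - real (\<sigma> k)\<bar> \<le> R ^ j * T0 \<or> R ^ Suc j * T0 < \<bar>real (\<sigma> i) - real (\<sigma> k)\<bar>"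
      using good_scale[OF r R(1) T0, of \<sigma>] by blast
    define T where "T = R ^ j * T0"
    define T' where "T' = R ^ Suc j * T0"
    note good = good[folded T_def T'_def]
    have T: "T > 0" "T' = R * T" "T0 \<le> T" using R T0 by (auto simp: T_def T'_def)
    \<comment> \<open>Whichever scale the pigeonhole selects, its separation is at most
      \<open>R ^ (r * r) * T0\<close>; thus clusters stay shorter than the gaps between
      blocks.\<close>
    have T'q: "T' \<le> q"
    proof -
      have "R ^ Suc j \<le> R ^ (r * r)" using R j by (intro power_increasing) auto
      then have "T' \<le> R ^ (r * r) * T0" unfolding T'_def using T0 by (intro mult_right_mono) auto
      then show ?thesis using Rq by linarith
    qed
    have TT': "2 * T \<le> T'" using R2 T by (simp add: mult_right_mono)
    define E where "E = {(i, k). i < r \<and> k < r \<and> \<bar>real (\<sigma> i) - real (\<sigma> k)\<bar> \<le> T}"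
    have "equiv {..<r} E"
    proof (rule equivI)
      show "E \<subseteq> {..<r} \<times> {..<r}" by (auto simp: E_def)
      show "refl_on {..<r} E" using T by (auto simp: E_def refl_on_def)
      show "sym E" by (auto simp: E_def sym_def abs_minus_commute)
      \<comment> \<open>Two steps of length at most \<open>T\<close> give a distance of at most
        \<open>2 * T \<le> T'\<close>, and no distance lies in \<open>(T, T']\<close>.\<close>
      show "trans E"
      proof (rule transI)
        fix i k l assume *: "(i, k) \<in> E" "(k, l) \<in> E"
        then have "\<bar>real (\<sigma> i) - real (\<sigma> l)\<bar> \<le> 2 * T" by (auto simp: E_def)
        then show "(i, l) \<in> E" using * good[of i l] TT' by (auto simp: E_def)
      qed
    qed
    define P where "P = {..<r} // E"
    have P: "partition_on {..<r} P" unfolding P_def by (rule partition_on_quotient) fact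
    have finP: "finite P" using finite_elements[OF _ P] by simp
    have PU: "\<Union>P = {..<r}" using P by (auto dest: partition_onD1)
    have same: "(i, k) \<in> E" if "p \<in> P" "i \<in> p" "k \<in> p" for p i k
      using in_quotient_imp_in_rel[OF \<open>equiv {..<r} E\<close>, of p i k] that by (auto simp: P_def)
    have diff: "(i, k) \<notin> E" if "p \<in> P" "p' \<in> P" "p \<noteq> p'" "i \<in> p" "k \<in> p'" for p p' i k
      using quotient_eq_iff[OF \<open>equiv {..<r} E\<close>, of p p' i k] that by (auto simp: P_def)
    have lt: "i < r" if "p \<in> P" "i \<in> p" for p i using PU that by auto
    have cl: "clustered \<sigma> Q T T'" if "Q \<subseteq> P" for Q
      unfolding clustered_def
    proof (intro conjI ballI impI)
      fix p i k assume "p \<in> Q" "i \<in> p" "k \<in> p"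
      then show "\<bar>real (\<sigma> i) - real (\<sigma> k)\<bar> \<le> T" using same[of p i k] that by (auto simp: E_def)
    next
      fix p p' i k assume *: "p \<in> Q" "p' \<in> Q" "p \<noteq> p'" "i \<in> p" "k \<in> p'"
      then have "(i, k) \<notin> E" using diff that by blast
      moreover have "i < r" "k < r" using lt * that by auto
      ultimately show "T' \<le> \<bar>real (\<sigma> i) - real (\<sigma> k)\<bar>"
        using good[of i k] by (auto simp: E_def)
    qed
    define \<eta> where "\<eta> = C * exp (- T0)"
    have "\<xi> * T - \<delta> * T' \<le> - T0"
    proof -
      have "(\<xi> + 1) * T \<le> \<delta> * R * T" using R(2) T by (intro mult_right_mono) auto
      then show ?thesis using T by (simp add: algebra_simps)
    qed
    then have \<eta>: "C * exp (\<xi> * T - \<delta> * T') \<le> \<eta>" unfolding \<eta>_def using C by (intro mult_left_mono) auto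
    have T'0: "T' > 0" using T TT' by linarith
    define G where "G p = X.expectation (\<lambda>x. \<Prod>i\<in>p. W (\<sigma> i) x)" for p
    have first: "\<bar>M.expectation (\<lambda>x. \<Prod>i<r. Y (\<sigma> i) x) - (\<Prod>p\<in>P. G p)\<bar> \<le> \<eta>"
    proof -
      have "\<forall>i\<in>{..<r}. T' \<le> real (\<sigma> i)" using q\<sigma> T'q by force
      then show ?thesis
        using dec[rule_format, of "{..<r}" P T T' \<sigma>] P T T'0 cl[of P] \<eta> unfolding G_def by force
    qed
    define Ib where "Ib b = {i\<in>{..<r}. \<beta> (\<sigma> i) = b}" for b
    define Pb where "Pb b = {p\<in>P. p \<subseteq> Ib b}" for b
    have inblock: "p \<subseteq> Ib (\<beta> (\<sigma> i))" if "p \<in> P" "i \<in> p" for p i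
    proof
      fix k assume k: "k \<in> p"
      have "\<bar>real (\<sigma> k) - real (\<sigma> i)\<bar> \<le> T" using same[OF that(1) k that(2)] by (simp add: E_def)
      then have "\<not> q < \<bar>real (\<sigma> k) - real (\<sigma> i)\<bar>" using TT' T T'q by linarith
      then have "\<beta> (\<sigma> k) = \<beta> (\<sigma> i)" using sep lt[OF that(1) k] lt[OF that] by blast
      then show "k \<in> Ib (\<beta> (\<sigma> i))" using lt[OF that(1) k] by (simp add: Ib_def)
    qed
    have pne: "p \<noteq> {}" if "p \<in> P" for p using P that by (auto dest: partition_onD3)
    have Pb: "partition_on (Ib b) (Pb b)" for b
    proof (rule partition_onI)
      show "\<Union>(Pb b) = Ib b"
      proof
        show "\<Union>(Pb b) \<subseteq> Ib b" by (auto simp: Pb_def)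
        show "Ib b \<subseteq> \<Union>(Pb b)"
        proof
          fix i assume i: "i \<in> Ib b"
          then have "i \<in> \<Union>P" unfolding PU by (simp add: Ib_def)
          then obtain p where p: "p \<in> P" "i \<in> p" by blast
          then have "p \<in> Pb b" using inblock[OF p] i by (simp add: Pb_def Ib_def)
          then show "i \<in> \<Union>(Pb b)" using p by blast
        qed
      qed
      show "disjnt p p'" if "p \<in> Pb b" "p' \<in> Pb b" "p \<noteq> p'" for p p'
        using partition_onD2[OF P] that by (auto simp: Pb_def disjoint_def disjnt_def)
      show "{} \<notin> Pb b" using pne by (auto simp: Pb_def)
    qed
    have second: "\<bar>G (Ib b) - (\<Prod>p\<in>Pb b. G p)\<bar> \<le> \<eta>" for b
    proof -
      have "card (Ib b) \<le> card {..<r}" by (rule card_mono) (auto simp: Ib_def)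
      then show ?thesis
        using dec[rule_format, of "Ib b" "Pb b" T T' \<sigma>] Pb[of b] T T'0 cl[of "Pb b"] \<eta>
        unfolding G_def by (force simp: Ib_def Pb_def)
    qed
    have split: "(\<Prod>p\<in>P. G p) = (\<Prod>b\<in>B. \<Prod>p\<in>Pb b. G p)"
    proof -
      have "P = (\<Union>b\<in>B. Pb b)"
      proof
        show "P \<subseteq> (\<Union>b\<in>B. Pb b)"
        proof
          fix p assume p: "p \<in> P"
          then obtain i where i: "i \<in> p" using pne by blast
          then have "\<beta> (\<sigma> i) \<in> B" using \<beta>B lt[OF p] by simp
          then show "p \<in> (\<Union>b\<in>B. Pb b)" using inblock[OF p i] p by (auto simp: Pb_def)
        qed
      qed (auto simp: Pb_def)
      moreover have "Pb b \<inter> Pb b' = {}" if "b \<noteq> b'" for b b'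
      proof (rule ccontr)
        assume "Pb b \<inter> Pb b' \<noteq> {}"
        then obtain p where "p \<in> P" "p \<subseteq> Ib b" "p \<subseteq> Ib b'" by (auto simp: Pb_def)
        then show False using pne[of p] that by (auto simp: Ib_def)
      qed
      moreover have "finite (Pb b)" for b using finP by (simp add: Pb_def)
      ultimately show ?thesis using B by (simp add: prod.UNION_disjoint)
    qed
    have Gle: "\<bar>G p\<bar> \<le> 1" for p
    proof -
      have "norm (G p) \<le> 1"
        unfolding G_def by (rule X.norm_expectation_le) (auto simp: abs_prod W intro!: prod_le_1)
      then show ?thesis by simp
    qed
    have third: "\<bar>(\<Prod>b\<in>B. G (Ib b)) - (\<Prod>b\<in>B. \<Prod>p\<in>Pb b. G p)\<bar> \<le> real r * \<eta>"
    proof -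
      \<comment> \<open>Blocks without an index contribute the factor \<open>1\<close> on both
        sides; only the others carry an error.\<close>
      define B' where "B' = (\<lambda>i. \<beta> (\<sigma> i)) ` {..<r}"
      have "norm ((\<Prod>b\<in>B. G (Ib b)) - (\<Prod>b\<in>B. \<Prod>p\<in>Pb b. G p)) \<le> (\<Sum>b\<in>B. norm (G (Ib b) - (\<Prod>p\<in>Pb b. G p)))"
        by (rule norm_prod_diff) (auto simp: Gle abs_prod intro!: prod_le_1)
      also have "\<dots> = (\<Sum>b\<in>B'. norm (G (Ib b) - (\<Prod>p\<in>Pb b. G p)))"
      proof (rule sum.mono_neutral_right[OF B])
        show "B' \<subseteq> B" using \<beta>B by (auto simp: B'_def)
        show "\<forall>b\<in>B - B'. norm (G (Ib b) - (\<Prod>p\<in>Pb b. G p)) = 0"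
        proof
          fix b assume "b \<in> B - B'"
          then have "Ib b = {}" by (auto simp: Ib_def B'_def)
          moreover from this have "Pb b = {}" using pne by (auto simp: Pb_def)
          ultimately show "norm (G (Ib b) - (\<Prod>p\<in>Pb b. G p)) = 0" by (simp add: G_def X.prob_space)
        qed
      qed
      also have "\<dots> \<le> (\<Sum>b\<in>B'. \<eta>)" by (intro sum_mono) (use second in simp)
      also have "\<dots> = real (card B') * \<eta>" by simp
      also have "\<dots> \<le> real r * \<eta>"
        using card_image_le[of "{..<r}" "\<lambda>i. \<beta> (\<sigma> i)"] C by (intro mult_right_mono) (auto simp: B'_def \<eta>_def)
      finally show ?thesis by simp
    qed
    have "\<bar>M.expectation (\<lambda>x. \<Prod>i<r. Y (\<sigma> i) x) - (\<Prod>b\<in>B. G (Ib b))\<bar> \<le> \<eta> + real r * \<eta>"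
      using first third unfolding split by linarith
    then show ?thesis by (simp add: G_def Ib_def \<eta>_def algebra_simps)
  qed
  moreover have "C + real r * C \<ge> 0" using C by simp
  ultimately show ?thesis using R(1) by (intro exI[of _ "C + real r * C"] exI[of _ R] conjI allI impI)
qed

text \<open>\<open>\<beta>\<close> assigns a time to its block. Reading \<open>W s\<close> at
  \<open>\<omega> (\<beta> s)\<close> makes different blocks independent, while times within one
  block keep their joint law under \<open>X\<close>.\<close>

lemma surrogate_moment:
  "\<exists>C\<ge>0. \<exists>R\<ge>1. \<forall>(I :: nat set) (\<beta> :: nat \<Rightarrow> nat) B T0 q. T0 > 0 \<longrightarrow> R ^ (r * r) * T0 \<le> q \<longrightarrow> finite I \<longrightarrow> (\<forall>s\<in>I. q \<le> real s) \<longrightarrow>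
     (\<forall>s\<in>I. \<forall>t\<in>I. \<beta> s \<noteq> \<beta> t \<longrightarrow> q < \<bar>real s - real t\<bar>) \<longrightarrow> finite B \<longrightarrow> (\<forall>s\<in>I. \<beta> s \<in> B) \<longrightarrow>
     \<bar>M.expectation (\<lambda>x. (\<Sum>s\<in>I. Y s x) ^ r) - (\<integral>\<omega>. (\<Sum>s\<in>I. W s (\<omega> (\<beta> s))) ^ r \<partial>(\<Pi>\<^sub>M b\<in>B. X))\<bar> \<le> real (card I) ^ r * (C * exp (- T0))"
proof (cases "r \<ge> 1")
  case False
  then have r: "r = 0" by simp
  have p1: "measure (\<Pi>\<^sub>M b\<in>B. X) (space (\<Pi>\<^sub>M b\<in>B. X)) = 1" for B :: "nat set"
    using X.prob_space_PiM_const by (rule prob_space.prob_space)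
  show ?thesis
    by (intro exI[of _ 0] conjI exI[of _ 1]) (auto simp: r M.prob_space p1)
next
  case True
  obtain C R where C: "C \<ge> 0" "R \<ge> 1" and tc: "\<forall>(\<sigma> :: nat \<Rightarrow> nat) (\<beta> :: nat \<Rightarrow> nat) B T0 q. T0 > 0 \<longrightarrow> R ^ (r * r) * T0 \<le> q \<longrightarrow> (\<forall>i<r. q \<le> real (\<sigma> i)) \<longrightarrow>
     (\<forall>i<r. \<forall>k<r. \<beta> (\<sigma> i) \<noteq> \<beta> (\<sigma> k) \<longrightarrow> q < \<bar>real (\<sigma> i) - real (\<sigma> k)\<bar>) \<longrightarrow> finite B \<longrightarrow> (\<forall>i<r. \<beta> (\<sigma> i) \<in> B) \<longrightarrow>
     \<bar>M.expectation (\<lambda>x. \<Prod>i<r. Y (\<sigma> i) x) - (\<Prod>b\<in>B. X.expectation (\<lambda>x. \<Prod>i\<in>{i\<in>{..<r}. \<beta> (\<sigma> i) = b}. W (\<sigma> i) x))\<bar> \<le> C * exp (- T0)"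
    using tuple_compare[OF True] by (elim exE conjE) (rule that)
  have "\<bar>M.expectation (\<lambda>x. (\<Sum>s\<in>I. Y s x) ^ r) - (\<integral>\<omega>. (\<Sum>s\<in>I. W s (\<omega> (\<beta> s))) ^ r \<partial>(\<Pi>\<^sub>M b\<in>B. X))\<bar> \<le> real (card I) ^ r * (C * exp (- T0))"
    if T0: "T0 > 0" "R ^ (r * r) * T0 \<le> q" and I: "finite I" "\<forall>s\<in>I. q \<le> real s" "\<forall>s\<in>I. \<forall>t\<in>I. \<beta> s \<noteq> \<beta> t \<longrightarrow> q < \<bar>real s - real t\<bar>"
      and B: "finite B" "\<forall>s\<in>I. \<beta> s \<in> B" for I and \<beta> :: "nat \<Rightarrow> nat" and B T0 q
  proof (rule moment_compare[OF M.prob_space_axioms X.prob_space_PiM_const I(1) Y])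
    show "(\<lambda>\<omega>. W s (\<omega> (\<beta> s))) \<in> borel_measurable (\<Pi>\<^sub>M b\<in>B. X)" if "s \<in> I" for s
      by (rule measurable_compose[OF measurable_component_singleton[of "\<beta> s" B "\<lambda>_. X"] W(1)]) (use B that in auto)
    show "\<bar>W s (\<omega> (\<beta> s))\<bar> \<le> 1" if "s \<in> I" "\<omega> \<in> space (\<Pi>\<^sub>M b\<in>B. X)" for s \<omega>
      by (rule W(2)) (use B that in \<open>auto simp: space_PiM PiE_iff\<close>)
    fix \<sigma> :: "nat \<Rightarrow> nat" assume \<sigma>: "\<forall>i<r. \<sigma> i \<in> I"
    have "(\<integral>\<omega>. (\<Prod>i<r. W (\<sigma> i) (\<omega> (\<beta> (\<sigma> i)))) \<partial>(\<Pi>\<^sub>M b\<in>B. X)) = (\<integral>\<omega>. (\<Prod>b\<in>B. \<Prod>i\<in>{i\<in>{..<r}. \<beta> (\<sigma> i) = b}. W (\<sigma> i) (\<omega> b)) \<partial>(\<Pi>\<^sub>M b\<in>B. X))"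
    proof (intro Bochner_Integration.integral_cong refl)
      fix \<omega>
      have "(\<Prod>i<r. W (\<sigma> i) (\<omega> (\<beta> (\<sigma> i)))) = (\<Prod>b\<in>B. \<Prod>i\<in>{i\<in>{..<r}. \<beta> (\<sigma> i) = b}. W (\<sigma> i) (\<omega> (\<beta> (\<sigma> i))))"
        by (rule prod.group[symmetric]) (use B \<sigma> in auto)
      also have "\<dots> = (\<Prod>b\<in>B. \<Prod>i\<in>{i\<in>{..<r}. \<beta> (\<sigma> i) = b}. W (\<sigma> i) (\<omega> b))"
        by (intro prod.cong) auto
      finally show "(\<Prod>i<r. W (\<sigma> i) (\<omega> (\<beta> (\<sigma> i)))) = (\<Prod>b\<in>B. \<Prod>i\<in>{i\<in>{..<r}. \<beta> (\<sigma> i) = b}. W (\<sigma> i) (\<omega> b))" .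
    qed
    also have "\<dots> = (\<Prod>b\<in>B. X.expectation (\<lambda>x. \<Prod>i\<in>{i\<in>{..<r}. \<beta> (\<sigma> i) = b}. W (\<sigma> i) x))"
    proof (rule X.product_integral_prod_const[OF B(1)])
      fix b
      show "integrable X (\<lambda>x. \<Prod>i\<in>{i\<in>{..<r}. \<beta> (\<sigma> i) = b}. W (\<sigma> i) x)"
      proof (rule X.integrable_const_bound[where B=1])
        show "AE x in X. norm (\<Prod>i\<in>{i\<in>{..<r}. \<beta> (\<sigma> i) = b}. W (\<sigma> i) x) \<le> 1"
          by (intro AE_I2) (auto simp: abs_prod W intro!: prod_le_1)
      qed (intro borel_measurable_prod W(1))
    qed
    finally show "\<bar>M.expectation (\<lambda>x. \<Prod>i<r. Y (\<sigma> i) x) - (\<integral>\<omega>. (\<Prod>i<r. W (\<sigma> i) (\<omega> (\<beta> (\<sigma> i)))) \<partial>(\<Pi>\<^sub>M b\<in>B. X))\<bar> \<le> C * exp (- T0)"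
      using tc[rule_format, of T0 q \<sigma> \<beta> B] T0 I B \<sigma> by simp
  qed
  then show ?thesis using C by (intro exI[of _ C] exI[of _ R] conjI allI impI)
qed

end

subsection \<open>Blocks and the limiting characteristic function\<close>

text \<open>
  Blocks of length \<open>p - q\<close> separated by gaps of length \<open>q\<close>.  The block at \<open>0\<close> is left out, since decay
  along orbits needs all times to be large.
\<close>

definition block_set :: "nat \<Rightarrow> nat \<Rightarrow> nat \<Rightarrow> nat set" where
  "block_set p q n = {s. s div p \<in> {1..<n} \<and> s mod p < p - q}"

lemma block_set_fibre:
  assumes "0 < p" "b \<in> {1..<n}"
  shows "{s \<in> block_set p q n. s div p = b} = {b * p..<b * p + (p - q)}"
proof (intro set_eqI iffI)
  fix s assume "s \<in> {s \<in> block_set p q n. s div p = b}"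
  then have "s div p = b" "s mod p < p - q" by (auto simp: block_set_def)
  then show "s \<in> {b * p..<b * p + (p - q)}" using div_mult_mod_eq[of s p] by auto
next
  fix s assume s: "s \<in> {b * p..<b * p + (p - q)}"
  define j where "j = s - b * p"
  have "s = j + b * p" "j < p - q" using s by (auto simp: j_def)
  then show "s \<in> {s \<in> block_set p q n. s div p = b}" using assms by (auto simp: block_set_def)
qed

lemma block_set_subset: "block_set p q n \<subseteq> {..<n * p}"
proof
  fix s assume s: "s \<in> block_set p q n"
  then have "p > 0" by (auto simp: block_set_def intro!: gr0I)
  moreover have "s div p < n" using s by (auto simp: block_set_def)
  ultimately show "s \<in> {..<n * p}" by (simp add: div_less_iff_less_mult)
qed

lemma finite_block_set: "finite (block_set p q n)"
  using block_set_subset by (rule finite_subset) simp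

lemma block_set_ge:
  assumes "s \<in> block_set p q n"
  shows "p \<le> s"
proof (rule ccontr)
  assume "\<not> p \<le> s"
  then show False using assms by (auto simp: block_set_def)
qed

text \<open>Every block stops \<open>q\<close> short of the next multiple of \<open>p\<close>, where
  the following one may begin.\<close>

lemma block_set_separated:
  assumes s: "s \<in> block_set p q n" and t: "t \<in> block_set p q n" and ne: "s div p \<noteq> t div p" and q: "q < p"
  shows "real q < \<bar>real s - real t\<bar>"
proof -
  have *: "real q < real t - real s" if s: "s \<in> block_set p q n" and "s div p < t div p" for s t
  proof -
    have "s mod p < p - q" using s by (simp add: block_set_def)
    then have "s < s div p * p + (p - q)" using div_mult_mod_eq[of s p] by linarith
    moreover have "(s div p + 1) * p \<le> t div p * p" using that by (intro mult_right_mono) auto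
    moreover have "t div p * p \<le> t" by simp
    ultimately have "s + q < t" using q unfolding distrib_right by linarith
    then show ?thesis by linarith
  qed
  show ?thesis using *[OF s, of t] *[OF t, of s] ne by linarith
qed

lemma sum_block_set:
  fixes f :: "nat \<Rightarrow> 'a::comm_monoid_add"
  assumes "0 < p"
  shows "(\<Sum>s\<in>block_set p q n. f s) = (\<Sum>b\<in>{1..<n}. \<Sum>s\<in>{b * p..<b * p + (p - q)}. f s)"
proof -
  have "(\<Sum>b\<in>{1..<n}. \<Sum>s\<in>{s \<in> block_set p q n. s div p = b}. f s) = (\<Sum>s\<in>block_set p q n. f s)"
    by (rule sum.group[OF finite_block_set]) (auto simp: block_set_def)
  then show ?thesis using block_set_fibre[OF assms] by simp
qed

lemma card_block_set: "0 < p \<Longrightarrow> card (block_set p q n) = (n - 1) * (p - q)"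
  using sum_block_set[of p "\<lambda>_. 1 :: nat" q n] by simp

section \<open>The independent blocks and their comparison with orbits\<close>

context decorrelation
begin

definition block_var :: "nat \<Rightarrow> real" where
  "block_var l = (\<Sum>i<l. c 0 + 2 * (\<Sum>n<i. c (Suc n)))"

lemma expectation_block: "X.expectation (\<lambda>x. (\<Sum>s\<in>{a..<a + l}. W s x)\<^sup>2) = block_var l"
  unfolding block_var_def by (rule block_variance)

lemma block_var_nonneg: "0 \<le> block_var l"
  unfolding expectation_block[of 0, symmetric] by (intro integral_nonneg_AE) auto

lemma block_sum_bound: "x \<in> space X \<Longrightarrow> \<bar>\<Sum>s\<in>{a..<a + l}. W s x\<bar> \<le> real l"
  using order_trans[OF sum_abs sum_mono, of "{a..<a + l}" "\<lambda>s. W s x" "\<lambda>_. 1"] W(2)[of x] by simp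

lemma block_sum_measurable: "(\<lambda>x. \<Sum>s\<in>{a..<a + l}. W s x) \<in> borel_measurable X"
  using W(1) by measurable

lemma block_sum_mean: "X.expectation (\<lambda>x. \<Sum>s\<in>{a..<a + l}. W s x) = 0"
proof -
  have "integrable X (W s)" for s
    by (rule X.integrable_const_bound[where B=1]) (use W in auto)
  then show ?thesis by (simp add: W0)
qed

text \<open>
  In the surrogate, block \<open>b\<close> is driven by its own coordinate \<open>\<omega> b\<close> of the product space.
\<close>

lemma surrogate_factor:
  fixes \<phi> :: "real \<Rightarrow> 'c::{real_normed_field, banach, second_countable_topology}"
  assumes p: "0 < p" and \<phi>: "\<phi> \<in> borel_measurable borel"
    and hom: "\<And>(A :: nat set) f. finite A \<Longrightarrow> \<phi> (sum f A) = (\<Prod>a\<in>A. \<phi> (f a))"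
    and bd: "\<And>y. \<bar>y\<bar> \<le> real (p - q) \<Longrightarrow> norm (\<phi> y) \<le> D"
  shows "(\<integral>\<omega>. \<phi> (\<Sum>s\<in>block_set p q n. W s (\<omega> (s div p))) \<partial>(\<Pi>\<^sub>M b\<in>{1..<n}. X)) =
    (\<Prod>b\<in>{1..<n}. \<integral>x. \<phi> (\<Sum>s\<in>{b * p..<b * p + (p - q)}. W s x) \<partial>X)"
proof -
  have "(\<Sum>s\<in>block_set p q n. W s (\<omega> (s div p))) = (\<Sum>b\<in>{1..<n}. \<Sum>s\<in>{b * p..<b * p + (p - q)}. W s (\<omega> b))" for \<omega>
  proof -
    have "s div p = b" if "s \<in> {b * p..<b * p + (p - q)}" "b \<in> {1..<n}" for s b
      using block_set_fibre[OF p that(2), of q] that by blast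
    then show ?thesis unfolding sum_block_set[OF p] by (intro sum.cong) auto
  qed
  then have "(\<integral>\<omega>. \<phi> (\<Sum>s\<in>block_set p q n. W s (\<omega> (s div p))) \<partial>(\<Pi>\<^sub>M b\<in>{1..<n}. X)) =
    (\<integral>\<omega>. (\<Prod>b\<in>{1..<n}. \<phi> (\<Sum>s\<in>{b * p..<b * p + (p - q)}. W s (\<omega> b))) \<partial>(\<Pi>\<^sub>M b\<in>{1..<n}. X))"
    by (simp add: hom)
  also have "\<dots> = (\<Prod>b\<in>{1..<n}. \<integral>x. \<phi> (\<Sum>s\<in>{b * p..<b * p + (p - q)}. W s x) \<partial>X)"
  proof (rule X.product_integral_prod_const)
    fix b
    show "integrable X (\<lambda>x. \<phi> (\<Sum>s\<in>{b * p..<b * p + (p - q)}. W s x))"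
    proof (rule X.integrable_const_bound[where B=D])
      show "AE x in X. norm (\<phi> (\<Sum>s\<in>{b * p..<b * p + (p - q)}. W s x)) \<le> D"
        using block_sum_bound by (intro AE_I2 bd) auto
      show "(\<lambda>x. \<phi> (\<Sum>s\<in>{b * p..<b * p + (p - q)}. W s x)) \<in> borel_measurable X"
        by (rule measurable_compose[OF block_sum_measurable \<phi>])
    qed
  qed simp
  finally show ?thesis .
qed

text \<open>Independence turns the exponential moment into a product, and each block is short enough
  for the quadratic bound on \<open>exp\<close>.\<close>

lemma surrogate_exp_le:
  assumes p: "0 < p" and a: "\<bar>a\<bar> * real (p - q) \<le> 1"
  shows "(\<integral>\<omega>. exp (a * (\<Sum>s\<in>block_set p q n. W s (\<omega> (s div p)))) \<partial>(\<Pi>\<^sub>M b\<in>{1..<n}. X)) \<le>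
    exp (a\<^sup>2 * (real (n - 1) * block_var (p - q)))"
proof -
  have "(\<integral>\<omega>. exp (a * (\<Sum>s\<in>block_set p q n. W s (\<omega> (s div p)))) \<partial>(\<Pi>\<^sub>M b\<in>{1..<n}. X)) =
    (\<Prod>b\<in>{1..<n}. \<integral>x. exp (a * (\<Sum>s\<in>{b * p..<b * p + (p - q)}. W s x)) \<partial>X)"
  proof (rule surrogate_factor[OF p])
    show "exp (a * sum f A) = (\<Prod>k\<in>A. exp (a * f k))" if "finite A" for A :: "nat set" and f
      using that by (simp add: sum_distrib_left exp_sum)
    show "norm (exp (a * y)) \<le> exp 1" if "\<bar>y\<bar> \<le> real (p - q)" for y
    proof -
      have "a * y \<le> \<bar>a\<bar> * \<bar>y\<bar>" unfolding abs_mult[symmetric] by simp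
      also have "\<dots> \<le> \<bar>a\<bar> * real (p - q)" using that by (intro mult_left_mono) auto
      finally show ?thesis using a by simp
    qed
  qed simp
  also have "\<dots> \<le> (\<Prod>b\<in>{1..<n}. exp (a\<^sup>2 * block_var (p - q)))"
  proof (rule prod_mono, intro conjI)
    fix b
    show "0 \<le> (\<integral>x. exp (a * (\<Sum>s\<in>{b * p..<b * p + (p - q)}. W s x)) \<partial>X)"
      by (intro integral_nonneg_AE) auto
    show "(\<integral>x. exp (a * (\<Sum>s\<in>{b * p..<b * p + (p - q)}. W s x)) \<partial>X) \<le> exp (a\<^sup>2 * block_var (p - q))"
      unfolding expectation_block[of "b * p", symmetric]
      by (rule X.expectation_exp_le[OF block_sum_measurable block_sum_bound block_sum_mean a])
  qed
  also have "\<dots> = exp (a\<^sup>2 * (real (n - 1) * block_var (p - q)))"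
    by (simp add: exp_of_nat_mult[symmetric] mult_ac)
  finally show ?thesis .
qed

text \<open>The expectation and the Gaussian value are both products of \<open>n - 1\<close> numbers
  in the unit disc, so the errors of the single blocks add up.\<close>

lemma surrogate_iexp_approx:
  assumes p: "0 < p"
  shows "cmod ((CLINT \<omega>|(\<Pi>\<^sub>M b\<in>{1..<n}. X). iexp (a * (\<Sum>s\<in>block_set p q n. W s (\<omega> (s div p))))) -
      exp (- (a\<^sup>2 * (real (n - 1) * block_var (p - q)) / 2))) \<le>
    real (n - 1) * (\<bar>a\<bar> ^ 3 * real (p - q) * block_var (p - q) + a ^ 4 * (block_var (p - q))\<^sup>2)"
proof -
  define v where "v = block_var (p - q)"
  have v: "v \<ge> 0" unfolding v_def by (rule block_var_nonneg)
  define z where "z b = (CLINT x|X. iexp (a * (\<Sum>s\<in>{b * p..<b * p + (p - q)}. W s x)))" for b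
  have "(CLINT \<omega>|(\<Pi>\<^sub>M b\<in>{1..<n}. X). iexp (a * (\<Sum>s\<in>block_set p q n. W s (\<omega> (s div p))))) = (\<Prod>b\<in>{1..<n}. z b)"
    unfolding z_def
  proof (rule surrogate_factor[OF p])
    show "iexp (a * sum f A) = (\<Prod>k\<in>A. iexp (a * f k))" if "finite A" for A :: "nat set" and f
      using that by (simp add: sum_distrib_left exp_sum)
    show "norm (iexp (a * y)) \<le> 1" for y by simp
  qed measurable
  moreover have "complex_of_real (exp (- (a\<^sup>2 * (real (n - 1) * v) / 2))) = (\<Prod>b\<in>{1..<n}. complex_of_real (exp (- (a\<^sup>2 * v / 2))))"
  proof -
    have "(exp (- (a\<^sup>2 * v / 2))) ^ (n - 1) = exp (- (a\<^sup>2 * (real (n - 1) * v) / 2))"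
      unfolding exp_of_nat_mult[symmetric] by (simp add: mult_ac)
    then show ?thesis by (simp del: of_nat_diff_real exp_of_real add: of_real_power[symmetric])
  qed
  moreover have "cmod ((\<Prod>b\<in>{1..<n}. z b) - (\<Prod>b\<in>{1..<n}. complex_of_real (exp (- (a\<^sup>2 * v / 2))))) \<le>
      (\<Sum>b\<in>{1..<n}. cmod (z b - complex_of_real (exp (- (a\<^sup>2 * v / 2)))))"
  proof (rule norm_prod_diff)
    show "norm (z b) \<le> 1" for b unfolding z_def by (rule X.norm_expectation_le) auto
    show "norm (complex_of_real (exp (- (a\<^sup>2 * v / 2)))) \<le> 1" for b :: nat
      unfolding norm_of_real using v by simp
  qed
  moreover have "cmod (z b - complex_of_real (exp (- (a\<^sup>2 * v / 2)))) \<le> \<bar>a\<bar> ^ 3 * real (p - q) * v + a ^ 4 * v\<^sup>2" for b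
    using X.expectation_iexp_approx[OF block_sum_measurable block_sum_bound block_sum_mean refl, of a "b * p" "p - q"]
    unfolding expectation_block v_def[symmetric] z_def exp_of_real[symmetric] by simp
  then have "(\<Sum>b\<in>{1..<n}. cmod (z b - complex_of_real (exp (- (a\<^sup>2 * v / 2))))) \<le> (\<Sum>b\<in>{1..<n}. \<bar>a\<bar> ^ 3 * real (p - q) * v + a ^ 4 * v\<^sup>2)"
    by (intro sum_mono) 
  ultimately show ?thesis unfolding v_def[symmetric] exp_of_real[symmetric] by (simp del: of_nat_diff_real)
qed

text \<open>Discarding the times outside \<open>I\<close> costs at most the mean of
  \<open>\<bar>a * D\<bar>\<close>, which Cauchy-Schwarz, in the form of a nonnegative variance,
  bounds by the second moment.\<close>

lemma iexp_second_moment: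
  assumes C: "\<And>I. finite I \<Longrightarrow> M.expectation (\<lambda>x. (\<Sum>s\<in>I. Y s x)\<^sup>2) \<le> C * real (card I)"
    and I: "I \<subseteq> {..<N}"
  shows "cmod ((CLINT x|M. iexp (a * (\<Sum>s<N. Y s x))) - (CLINT x|M. iexp (a * (\<Sum>s\<in>I. Y s x)))) \<le>
    \<bar>a\<bar> * sqrt (C * (real N - real (card I)))"
proof -
  define D where "D x = (\<Sum>s\<in>{..<N} - I. Y s x)" for x
  have finI: "finite I" using I by (rule finite_subset) simp
  have split: "(\<Sum>s<N. Y s x) = (\<Sum>s\<in>I. Y s x) + D x" for x
    unfolding D_def using I sum.subset_diff[of I "{..<N}" "\<lambda>s. Y s x"] by simp
  have Dm: "D \<in> borel_measurable M" unfolding D_def using Y(1) by measurable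
  have Db: "\<bar>D x\<bar> \<le> real N" if "x \<in> space M" for x
  proof -
    have "\<bar>D x\<bar> \<le> (\<Sum>s\<in>{..<N} - I. 1)" unfolding D_def
      by (rule order_trans[OF sum_abs sum_mono]) (use Y(2)[OF that] in auto)
    also have "\<dots> \<le> (\<Sum>s\<in>{..<N}. 1)" by (rule sum_mono2) auto
    finally show ?thesis by simp
  qed
  have i1: "integrable M D" by (rule M.integrable_const_bound[where B="real N"]) (use Dm Db in auto)
  have i2: "integrable M (\<lambda>x. (D x)\<^sup>2)" using Dm Db by (rule M.integrable_bounded_power2)
  have ie: "complex_integrable M (\<lambda>x. iexp (a * (\<Sum>s\<in>J. Y s x)))" for J
    by (rule M.integrable_const_bound[where B=1]) (use Y(1) in auto)
  have "(CLINT x|M. iexp (a * (\<Sum>s<N. Y s x))) - (CLINT x|M. iexp (a * (\<Sum>s\<in>I. Y s x))) =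
      (CLINT x|M. iexp (a * (\<Sum>s<N. Y s x)) - iexp (a * (\<Sum>s\<in>I. Y s x)))"
    by (rule Bochner_Integration.integral_diff[symmetric, OF ie ie])
  also have "cmod \<dots> \<le> (\<integral>x. cmod (iexp (a * (\<Sum>s<N. Y s x)) - iexp (a * (\<Sum>s\<in>I. Y s x))) \<partial>M)"
    by (rule integral_norm_bound)
  also have "\<dots> \<le> (\<integral>x. \<bar>a\<bar> * \<bar>D x\<bar> \<partial>M)"
  proof (rule integral_mono')
    show "integrable M (\<lambda>x. \<bar>a\<bar> * \<bar>D x\<bar>)" using i1 by (intro integrable_mult_right integrable_abs)
    fix x
    have "iexp (a * (\<Sum>s<N. Y s x)) - iexp (a * (\<Sum>s\<in>I. Y s x)) = iexp (a * (\<Sum>s\<in>I. Y s x)) * (iexp (a * D x) - 1)"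
      by (simp add: split algebra_simps exp_add[symmetric])
    then have "cmod (iexp (a * (\<Sum>s<N. Y s x)) - iexp (a * (\<Sum>s\<in>I. Y s x))) = cmod (iexp (a * D x) - 1)"
      by (simp add: norm_mult)
    also have "\<dots> \<le> \<bar>a * D x\<bar>" using iexp_approx1[of "a * D x" 0] by simp
    finally show "cmod (iexp (a * (\<Sum>s<N. Y s x)) - iexp (a * (\<Sum>s\<in>I. Y s x))) \<le> \<bar>a\<bar> * \<bar>D x\<bar>" by (simp add: abs_mult)
  qed simp
  also have "\<dots> = \<bar>a\<bar> * M.expectation (\<lambda>x. \<bar>D x\<bar>)" by simp
  also have "M.expectation (\<lambda>x. \<bar>D x\<bar>) \<le> sqrt (M.expectation (\<lambda>x. (D x)\<^sup>2))"
  proof (rule real_le_rsqrt)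
    have i3: "integrable M (\<lambda>x. \<bar>D x\<bar>)" using i1 by (rule integrable_abs)
    have i4: "integrable M (\<lambda>x. \<bar>D x\<bar>\<^sup>2)" using i2 by simp
    have "0 \<le> M.variance (\<lambda>x. \<bar>D x\<bar>)" by (intro integral_nonneg_AE) auto
    also have "\<dots> = M.expectation (\<lambda>x. \<bar>D x\<bar>\<^sup>2) - (M.expectation (\<lambda>x. \<bar>D x\<bar>))\<^sup>2"
      by (rule M.variance_eq[OF i3 i4])
    finally show "(M.expectation (\<lambda>x. \<bar>D x\<bar>))\<^sup>2 \<le> M.expectation (\<lambda>x. (D x)\<^sup>2)" by simp
  qed
  also have "M.expectation (\<lambda>x. (D x)\<^sup>2) \<le> C * real (card ({..<N} - I))"
    unfolding D_def by (rule C) simp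
  also have "real (card ({..<N} - I)) = real N - real (card I)"
    using card_Diff_subset[OF finI I] card_mono[OF _ I] by simp
  finally show ?thesis by (simp add: mult_left_mono)
qed


text \<open>The four error terms come from the discarded times, the comparison of moments up to
  order \<open>2 * j\<close>, the Taylor tail, and the Gaussian approximation of the independent
  blocks. The factor \<open>2\<close> in the condition on \<open>a\<close> is there because the
  Taylor tail uses exponential moments at \<open>2 * a\<close>.\<close>

lemma char_estimate:
  assumes C: "\<And>I. finite I \<Longrightarrow> M.expectation (\<lambda>x. (\<Sum>s\<in>I. Y s x)\<^sup>2) \<le> C * real (card I)"
    and cmp: "\<And>k. k \<le> 2 * j \<Longrightarrow> \<bar>M.expectation (\<lambda>x. (\<Sum>s\<in>block_set p q n. Y s x) ^ k) -
        (\<integral>\<omega>. (\<Sum>s\<in>block_set p q n. W s (\<omega> (s div p))) ^ k \<partial>(\<Pi>\<^sub>M b\<in>{1..<n}. X))\<bar> \<le> real (card (block_set p q n)) ^ k * \<eta> k"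
    and \<eta>: "\<And>k. 0 \<le> \<eta> k"
    and p: "0 < p" "n * p \<le> N" and j: "1 \<le> j" and a: "2 * \<bar>a\<bar> * real (p - q) \<le> 1"
  shows "cmod ((CLINT x|M. iexp (a * (\<Sum>s<N. Y s x))) - exp (- (a\<^sup>2 * (real (n - 1) * block_var (p - q)) / 2))) \<le>
    \<bar>a\<bar> * sqrt (C * (real N - real (n - 1) * real (p - q))) + (\<Sum>k\<le>2 * j. (\<bar>a\<bar> * real N) ^ k * \<eta> k) +
    4 * (1/4) ^ j * exp (4 * a\<^sup>2 * (real (n - 1) * block_var (p - q))) +
    real (n - 1) * (\<bar>a\<bar> ^ 3 * real (p - q) * block_var (p - q) + a ^ 4 * (block_var (p - q))\<^sup>2)"
proof -
  define I where "I = block_set p q n"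
  define v where "v = block_var (p - q)"
  have finI: "finite I" unfolding I_def by (rule finite_block_set)
  have IN: "I \<subseteq> {..<N}" using block_set_subset[of p q n] p(2) by (auto simp: I_def)
  have cardI: "real (card I) = real (n - 1) * real (p - q)"
    unfolding I_def card_block_set[OF p(1)] by (rule of_nat_mult)
  have cardN: "card I \<le> N" using card_mono[OF _ IN] by simp
  define P where "P = (\<Pi>\<^sub>M b\<in>{1..<n}. X)"
  interpret P: prob_space P unfolding P_def by (rule X.prob_space_PiM_const)
  define g where "g \<omega> = (\<Sum>s\<in>I. W s (\<omega> (s div p)))" for \<omega>
  define f where "f x = (\<Sum>s\<in>I. Y s x)" for x
  have inB: "s div p \<in> {1..<n}" if "s \<in> I" for s using that by (auto simp: I_def block_set_def)
  have gm: "g \<in> borel_measurable P"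
    unfolding g_def P_def
    by (intro borel_measurable_sum measurable_compose[OF measurable_component_singleton[OF inB] W(1)])
  have gb: "\<bar>g \<omega>\<bar> \<le> real (card I)" if "\<omega> \<in> space P" for \<omega>
  proof -
    have "\<bar>g \<omega>\<bar> \<le> (\<Sum>s\<in>I. 1)" unfolding g_def
    proof (rule order_trans[OF sum_abs sum_mono])
      fix s assume "s \<in> I"
      then have "\<omega> (s div p) \<in> space X" using inB[of s] that by (auto simp: P_def space_PiM PiE_iff)
      then show "\<bar>W s (\<omega> (s div p))\<bar> \<le> 1" by (rule W(2))
    qed
    then show ?thesis by simp
  qed
  have fm: "f \<in> borel_measurable M" unfolding f_def using Y(1) by measurable
  have fb: "\<bar>f x\<bar> \<le> real (card I)" if "x \<in> space M" for x
  proof -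
    have "\<bar>f x\<bar> \<le> (\<Sum>s\<in>I. 1)" unfolding f_def
      by (rule order_trans[OF sum_abs sum_mono]) (use Y(2)[OF that] in auto)
    then show ?thesis by simp
  qed
  have e1: "(\<integral>\<omega>. exp (2 * a * g \<omega>) \<partial>P) \<le> exp (4 * a\<^sup>2 * (real (n - 1) * v))"
    using surrogate_exp_le[OF p(1), of "2 * a" q n] a
    by (simp add: g_def P_def I_def v_def abs_mult power_mult_distrib)
  have e2: "(\<integral>\<omega>. exp (- 2 * a * g \<omega>) \<partial>P) \<le> exp (4 * a\<^sup>2 * (real (n - 1) * v))"
    using surrogate_exp_le[OF p(1), of "- 2 * a" q n] a
    by (simp add: g_def P_def I_def v_def abs_mult power_mult_distrib)
  have "cmod ((CLINT x|M. iexp (a * f x)) - (CLINT \<omega>|P. iexp (a * g \<omega>))) \<le>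
      (\<Sum>k\<le>2 * j. \<bar>a\<bar> ^ k * \<bar>(\<integral>x. f x ^ k \<partial>M) - (\<integral>\<omega>. g \<omega> ^ k \<partial>P)\<bar>) + 4 * (1/4) ^ j * exp (4 * a\<^sup>2 * (real (n - 1) * v))"
    by (rule iexp_moment_compare[OF M.prob_space_axioms P.prob_space_axioms fm fb gm gb j e1 e2])
  also have "(\<Sum>k\<le>2 * j. \<bar>a\<bar> ^ k * \<bar>(\<integral>x. f x ^ k \<partial>M) - (\<integral>\<omega>. g \<omega> ^ k \<partial>P)\<bar>) \<le> (\<Sum>k\<le>2 * j. (\<bar>a\<bar> * real N) ^ k * \<eta> k)"
  proof (rule sum_mono)
    fix k assume "k \<in> {..2 * j}"
    then have "\<bar>a\<bar> ^ k * \<bar>(\<integral>x. f x ^ k \<partial>M) - (\<integral>\<omega>. g \<omega> ^ k \<partial>P)\<bar> \<le> \<bar>a\<bar> ^ k * (real (card I) ^ k * \<eta> k)"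
      unfolding f_def g_def P_def I_def by (intro mult_left_mono cmp) auto
    also have "\<dots> \<le> \<bar>a\<bar> ^ k * (real N ^ k * \<eta> k)"
      using cardN \<eta> by (intro mult_left_mono mult_right_mono power_mono) auto
    finally show "\<bar>a\<bar> ^ k * \<bar>(\<integral>x. f x ^ k \<partial>M) - (\<integral>\<omega>. g \<omega> ^ k \<partial>P)\<bar> \<le> (\<bar>a\<bar> * real N) ^ k * \<eta> k"
      by (simp add: power_mult_distrib mult.assoc)
  qed
  finally have 2: "cmod ((CLINT x|M. iexp (a * f x)) - (CLINT \<omega>|P. iexp (a * g \<omega>))) \<le>
    (\<Sum>k\<le>2 * j. (\<bar>a\<bar> * real N) ^ k * \<eta> k) + 4 * (1/4) ^ j * exp (4 * a\<^sup>2 * (real (n - 1) * v))" by simp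
  have 1: "cmod ((CLINT x|M. iexp (a * (\<Sum>s<N. Y s x))) - (CLINT x|M. iexp (a * f x))) \<le> \<bar>a\<bar> * sqrt (C * (real N - real (n - 1) * real (p - q)))"
    using iexp_second_moment[OF C IN] unfolding f_def cardI .
  have 3: "cmod ((CLINT \<omega>|P. iexp (a * g \<omega>)) - exp (- (a\<^sup>2 * (real (n - 1) * v) / 2))) \<le>
    real (n - 1) * (\<bar>a\<bar> ^ 3 * real (p - q) * v + a ^ 4 * v\<^sup>2)"
    using surrogate_iexp_approx[OF p(1)] unfolding g_def P_def I_def v_def .
  define z1 where "z1 = (CLINT x|M. iexp (a * (\<Sum>s<N. Y s x)))"
  define z2 where "z2 = (CLINT x|M. iexp (a * f x))"
  define z3 where "z3 = (CLINT \<omega>|P. iexp (a * g \<omega>))"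
  define z4 where "z4 = complex_of_real (exp (- (a\<^sup>2 * (real (n - 1) * v) / 2)))"
  have "cmod (z1 - z4) \<le> cmod (z1 - z2) + cmod (z2 - z3) + cmod (z3 - z4)"
    using norm_triangle_ineq[of "z1 - z2" "z2 - z3"] norm_triangle_ineq[of "z1 - z3" "z3 - z4"] by simp
  then show ?thesis
    using 1 2 3 unfolding v_def[symmetric] z1_def[symmetric] z2_def[symmetric] z3_def[symmetric] z4_def[symmetric] by linarith
qed

lemma char_limit:
  "(\<lambda>N. CLINT x|M. iexp (\<omega> * ((\<Sum>s<N. Y s x) / sqrt (real N)))) \<longlonglongrightarrow> complex_of_real (exp (- (\<sigma>2 * \<omega>\<^sup>2 / 2)))"
proof -
  obtain C where C: "C \<ge> 0" "\<And>I. finite I \<Longrightarrow> M.expectation (\<lambda>x. (\<Sum>s\<in>I. Y s x)\<^sup>2) \<le> C * real (card I)"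
    using second_moment_Y by blast
  obtain K where K: "K \<ge> 0" "\<And>l. \<bar>block_var l - real l * \<sigma>2\<bar> \<le> K"
    using block_variance_asymp unfolding expectation_block by blast
  define Q where "Q r C R \<longleftrightarrow> (\<forall>(I :: nat set) (\<beta> :: nat \<Rightarrow> nat) B T0 q. T0 > 0 \<longrightarrow> R ^ (r * r) * T0 \<le> q \<longrightarrow> finite I \<longrightarrow> (\<forall>s\<in>I. q \<le> real s) \<longrightarrow>
     (\<forall>s\<in>I. \<forall>t\<in>I. \<beta> s \<noteq> \<beta> t \<longrightarrow> q < \<bar>real s - real t\<bar>) \<longrightarrow> finite B \<longrightarrow> (\<forall>s\<in>I. \<beta> s \<in> B) \<longrightarrow>
     \<bar>M.expectation (\<lambda>x. (\<Sum>s\<in>I. Y s x) ^ r) - (\<integral>\<omega>. (\<Sum>s\<in>I. W s (\<omega> (\<beta> s))) ^ r \<partial>(\<Pi>\<^sub>M b\<in>B. X))\<bar> \<le> real (card I) ^ r * (C * exp (- T0)))"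
    for r and C R :: real
  have "\<forall>r. \<exists>C. \<exists>R. C \<ge> 0 \<and> Q r C R"
    using surrogate_moment unfolding Q_def[symmetric] by blast
  then obtain Ck Rk where Ck: "\<And>r. Ck r \<ge> 0" and Rk: "\<And>r. Q r (Ck r) (Rk r)" by metis
  \<comment> \<open>The gaps outgrow every fixed power of \<open>ln N\<close> and fill only a proportion \<open>1 / q\<close>, while blocks are
    short enough, \<open>p \<le> N\<^sup>1\<^sup>/\<^sup>4\<close>, for the Lindeberg terms to vanish.\<close>
  define q where "q N = nat \<lfloor>real N powr (1/8)\<rfloor>" for N :: nat
  define p where "p N = q N * q N" for N
  define n where "n N = N div p N" for N
  define l where "l N = p N - q N" for N
  define m where "m N = n N - 1" for N
  define v where "v N = block_var (l N)" for N
  \<comment> \<open>\<open>exp (- T N)\<close> beats every power of \<open>N\<close>, hence the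
    number of tuples in any fixed moment, while every constant multiple of \<open>T N\<close> is
    eventually below \<open>q N\<close>.\<close>
  define T where "T N = (ln (real N))\<^sup>2" for N :: nat
  have q_hi: "real (q N) \<le> real N powr (1/8)" for N by (simp add: q_def)
  have q_lo: "real N powr (1/8) - 1 \<le> real (q N)" for N unfolding q_def by linarith
  have q_top: "filterlim (\<lambda>N. real (q N)) at_top sequentially"
  proof (rule filterlim_at_top_mono)
    show "filterlim (\<lambda>N. real N powr (1/8) - 1) at_top sequentially" by real_asymp
  qed (simp add: q_lo)
  then have ev_q: "\<forall>\<^sub>F N in sequentially. 2 \<le> real (q N)" unfolding filterlim_at_top by blast
  have p_hi: "real (p N) \<le> real N powr (1/4)" for N
  proof -
    have "real (q N) * real (q N) \<le> real N powr (1/8) * real N powr (1/8)" using q_hi by (intro mult_mono) auto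
    then show ?thesis by (simp add: p_def powr_add[symmetric])
  qed
  have p_le: "\<forall>\<^sub>F N in sequentially. p N \<le> N"
  proof -
    have "\<forall>\<^sub>F N in sequentially. real N powr (1/4) \<le> real N" by real_asymp
    then show ?thesis
    proof eventually_elim
      case (elim N)
      then have "real (p N) \<le> real N" using p_hi[of N] by linarith
      then show ?case by simp
    qed
  qed
  have Lp: "(\<lambda>N. real (p N) / sqrt (real N)) \<longlonglongrightarrow> 0"
  proof (rule tendsto_sandwich[OF _ _ tendsto_const])
    show "(\<lambda>N. real N powr (1/4) / sqrt (real N)) \<longlonglongrightarrow> 0" by real_asymp
  qed (auto intro!: always_eventually divide_right_mono p_hi)
  have LpN: "(\<lambda>N. real (p N) / real N) \<longlonglongrightarrow> 0"
  proof (rule tendsto_sandwich[OF _ _ tendsto_const])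
    show "(\<lambda>N. real N powr (1/4) / real N) \<longlonglongrightarrow> 0" by real_asymp
  qed (auto intro!: always_eventually divide_right_mono p_hi)
  have Lq: "(\<lambda>N. 1 / real (q N)) \<longlonglongrightarrow> 0"
    using tendsto_inverse_0_at_top[OF q_top] by (simp add: inverse_eq_divide)
  have LmN: "(\<lambda>N. real (m N) / real N) \<longlonglongrightarrow> 0"
  proof (rule tendsto_sandwich[OF _ _ tendsto_const Lq])
    show "\<forall>\<^sub>F N in sequentially. real (m N) / real N \<le> 1 / real (q N)"
      using ev_q eventually_gt_at_top[of 0]
    proof eventually_elim
      case (elim N)
      have "m N * q N \<le> n N * p N" unfolding m_def p_def by (intro mult_mono) auto
      also have "\<dots> \<le> N" by (simp add: n_def)
      finally have "real (m N) * real (q N) \<le> real N" by (metis of_nat_le_iff of_nat_mult)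
      then show ?case using elim by (simp add: field_simps)
    qed
  qed auto
  \<comment> \<open>Lost are the gaps, a proportion of about \<open>1 / q N\<close>, and the omitted
    first block together with the incomplete last one, at most \<open>2 * p N\<close> times.\<close>
  have LmlN: "(\<lambda>N. real (m N) * real (l N) / real N) \<longlonglongrightarrow> 1"
  proof (rule tendsto_sandwich)
    have "(\<lambda>N. 1 - 1 / real (q N) - 2 * (real (p N) / real N)) \<longlonglongrightarrow> 1 - 0 - 2 * 0"
      by (intro tendsto_intros Lq LpN)
    then show "(\<lambda>N. 1 - 1 / real (q N) - 2 * (real (p N) / real N)) \<longlonglongrightarrow> 1" by simp
    show "\<forall>\<^sub>F N in sequentially. real (m N) * real (l N) / real N \<le> 1"
    proof (rule always_eventually, rule allI)
      fix N
      have "m N * l N \<le> n N * p N" unfolding m_def l_def by (intro mult_mono) auto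
      also have "\<dots> \<le> N" by (simp add: n_def)
      finally have "real (m N) * real (l N) \<le> real N" by (metis of_nat_le_iff of_nat_mult)
      then show "real (m N) * real (l N) / real N \<le> 1" by (simp add: divide_le_eq)
    qed
    show "\<forall>\<^sub>F N in sequentially. 1 - 1 / real (q N) - 2 * (real (p N) / real N) \<le> real (m N) * real (l N) / real N"
      using ev_q eventually_gt_at_top[of 0]
    proof eventually_elim
      case (elim N)
      have q0: "real (q N) > 0" using elim by simp
      have "N mod p N < p N" using q0 by (simp add: p_def)
      then have "real N \<le> real (n N) * real (p N) + real (p N)"
        using div_mult_mod_eq[of N "p N"] unfolding n_def of_nat_mult[symmetric] of_nat_add[symmetric] of_nat_le_iff by linarith
      moreover have "real (n N) \<le> real (m N) + 1" by (simp add: m_def)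
      then have "real (n N) * real (p N) \<le> (real (m N) + 1) * real (p N)" by (intro mult_right_mono) auto
      ultimately have 1: "real N - 2 * real (p N) \<le> real (m N) * real (p N)" by (simp add: algebra_simps)
      have mq: "real (m N) * real (q N) \<le> real N / real (q N)"
      proof -
        have "m N * p N \<le> n N * p N" unfolding m_def by (intro mult_mono) auto
        also have "\<dots> \<le> N" by (simp add: n_def)
        finally have "real (m N) * real (p N) \<le> real N" by (metis of_nat_le_iff of_nat_mult)
        then show ?thesis using q0 by (simp add: p_def field_simps)
      qed
      have "q N \<le> p N" using q0 by (simp add: p_def)
      then have "real (m N) * real (l N) = real (m N) * real (p N) - real (m N) * real (q N)"
        by (simp add: l_def algebra_simps)
      then have "real N - 2 * real (p N) - real N / real (q N) \<le> real (m N) * real (l N)" using 1 mq by linarith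
      then have "(real N - 2 * real (p N) - real N / real (q N)) / real N \<le> real (m N) * real (l N) / real N"
        by (rule divide_right_mono) simp
      then show ?case using elim by (simp add: diff_divide_distrib)
    qed
  qed simp
  \<comment> \<open>Replacing each block variance by \<open>l N * \<sigma>2\<close> costs at most
    \<open>K\<close> per block, and the number of blocks is negligible against
    \<open>N\<close>.\<close>
  have LmvN: "(\<lambda>N. real (m N) * v N / real N) \<longlonglongrightarrow> \<sigma>2"
  proof -
    have "(\<lambda>N. real (m N) * v N / real N - \<sigma>2 * (real (m N) * real (l N) / real N)) \<longlonglongrightarrow> 0"
    proof (rule Lim_null_comparison)
      have "(\<lambda>N. K * (real (m N) / real N)) \<longlonglongrightarrow> K * 0" by (intro tendsto_intros LmN)
      then show "(\<lambda>N. K * (real (m N) / real N)) \<longlonglongrightarrow> 0" by simp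
      show "\<forall>\<^sub>F N in sequentially. norm (real (m N) * v N / real N - \<sigma>2 * (real (m N) * real (l N) / real N)) \<le> K * (real (m N) / real N)"
      proof (rule always_eventually, rule allI)
        fix N
        have "real (m N) * v N / real N - \<sigma>2 * (real (m N) * real (l N) / real N) = (v N - real (l N) * \<sigma>2) * (real (m N) / real N)"
          by (simp add: algebra_simps diff_divide_distrib)
        also have "norm \<dots> = \<bar>v N - real (l N) * \<sigma>2\<bar> * (real (m N) / real N)" by (simp add: abs_mult)
        also have "\<dots> \<le> K * (real (m N) / real N)" using K(2) by (intro mult_right_mono) (auto simp: v_def)
        finally show "norm (real (m N) * v N / real N - \<sigma>2 * (real (m N) * real (l N) / real N)) \<le> K * (real (m N) / real N)" .
      qed
    qed
    from tendsto_add[OF this tendsto_mult[OF tendsto_const[of \<sigma>2] LmlN]] show ?thesis by simp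
  qed
  have Ll: "(\<lambda>N. real (l N) / sqrt (real N)) \<longlonglongrightarrow> 0"
    by (rule tendsto_sandwich[OF _ _ tendsto_const Lp]) (auto intro!: always_eventually divide_right_mono simp: l_def)
  have LvN: "(\<lambda>N. v N / real N) \<longlonglongrightarrow> 0"
  proof (rule tendsto_sandwich[OF _ _ tendsto_const])
    have K': "(\<lambda>N. K / real N) \<longlonglongrightarrow> 0" by real_asymp
    have "(\<lambda>N. \<sigma>2 * (real (p N) / real N) + K / real N) \<longlonglongrightarrow> \<sigma>2 * 0 + 0" by (intro tendsto_intros LpN K')
    then show "(\<lambda>N. \<sigma>2 * (real (p N) / real N) + K / real N) \<longlonglongrightarrow> 0" by simp
    show "\<forall>\<^sub>F N in sequentially. v N / real N \<le> \<sigma>2 * (real (p N) / real N) + K / real N"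
    proof (rule always_eventually, rule allI)
      fix N
      have "v N \<le> real (l N) * \<sigma>2 + K" using K(2)[of "l N"] by (simp add: v_def)
      also have "real (l N) * \<sigma>2 \<le> real (p N) * \<sigma>2" using \<sigma>2_nonneg by (intro mult_right_mono) (auto simp: l_def)
      finally have "v N / real N \<le> (real (p N) * \<sigma>2 + K) / real N" by (intro divide_right_mono) auto
      then show "v N / real N \<le> \<sigma>2 * (real (p N) / real N) + K / real N" by (simp add: add_divide_distrib mult.commute)
    qed
  qed (auto simp: v_def block_var_nonneg)
  \<comment> \<open>At \<open>a = \<omega> / sqrt N\<close> the terms of
    \<open>char_estimate\<close> become \<open>e1\<close>, the sum of the \<open>e2 k\<close>, a
    multiple of \<open>e3\<close>, and \<open>e4\<close>; \<open>e5\<close> is the distance between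
    the Gaussian values for the block variances and for \<open>\<sigma>2\<close>.\<close>
  define e1 where "e1 N = \<bar>\<omega>\<bar> * sqrt (C * (1 - real (m N) * real (l N) / real N))" for N
  define e2 where "e2 k N = (\<bar>\<omega>\<bar> * sqrt (real N)) ^ k * (Ck k * exp (- T N))" for k N
  define e3 where "e3 N = exp (4 * \<omega>\<^sup>2 * (real (m N) * v N / real N))" for N
  define e4 where "e4 N = \<bar>\<omega>\<bar> ^ 3 * (real (m N) * v N / real N) * (real (l N) / sqrt (real N)) + \<omega> ^ 4 * (real (m N) * v N / real N) * (v N / real N)" for N
  define e5 where "e5 N = \<bar>exp (- (\<omega>\<^sup>2 * (real (m N) * v N / real N) / 2)) - exp (- (\<omega>\<^sup>2 * \<sigma>2 / 2))\<bar>" for N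
  have L1: "e1 \<longlonglongrightarrow> 0"
  proof -
    have "e1 \<longlonglongrightarrow> \<bar>\<omega>\<bar> * sqrt (C * (1 - 1))" unfolding e1_def by (intro tendsto_intros LmlN)
    then show ?thesis by simp
  qed
  have L2: "e2 k \<longlonglongrightarrow> 0" for k
  proof -
    have "(\<lambda>N. sqrt (real N) ^ k * exp (- (ln (real N))\<^sup>2)) \<longlonglongrightarrow> 0" by real_asymp
    then have "(\<lambda>N. \<bar>\<omega>\<bar> ^ k * Ck k * (sqrt (real N) ^ k * exp (- (ln (real N))\<^sup>2))) \<longlonglongrightarrow> \<bar>\<omega>\<bar> ^ k * Ck k * 0"
      by (intro tendsto_intros)
    then show ?thesis by (simp add: e2_def[abs_def] T_def power_mult_distrib mult_ac)
  qed
  have L3: "e3 \<longlonglongrightarrow> exp (4 * \<omega>\<^sup>2 * \<sigma>2)" unfolding e3_def by (intro tendsto_intros LmvN)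
  have L4: "e4 \<longlonglongrightarrow> 0"
  proof -
    have "e4 \<longlonglongrightarrow> \<bar>\<omega>\<bar> ^ 3 * \<sigma>2 * 0 + \<omega> ^ 4 * \<sigma>2 * 0" unfolding e4_def by (intro tendsto_intros LmvN Ll LvN)
    then show ?thesis by simp
  qed
  have L5: "e5 \<longlonglongrightarrow> 0"
  proof -
    have "e5 \<longlonglongrightarrow> \<bar>exp (- (\<omega>\<^sup>2 * \<sigma>2 / 2)) - exp (- (\<omega>\<^sup>2 * \<sigma>2 / 2))\<bar>" unfolding e5_def by (intro tendsto_intros LmvN) auto
    then show ?thesis by simp
  qed
  define chi where "chi N = (CLINT x|M. iexp (\<omega> * ((\<Sum>s<N. Y s x) / sqrt (real N))))" for N
  define G where "G = complex_of_real (exp (- (\<sigma>2 * \<omega>\<^sup>2 / 2)))"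
  have bound: "\<forall>\<^sub>F N in sequentially. cmod (chi N - G) \<le> e1 N + (\<Sum>k\<le>2 * j. e2 k N) + 4 * (1/4) ^ j * e3 N + e4 N + e5 N"
    if j: "j \<ge> 1" for j
  proof -
    have "\<forall>\<^sub>F N in sequentially. Rk k ^ (k * k) * T N \<le> real (q N)" for k
    proof -
      have "\<forall>\<^sub>F N in sequentially. Rk k ^ (k * k) * (ln (real N))\<^sup>2 \<le> real N powr (1/8) - 1" by real_asymp
      then show ?thesis 
      proof eventually_elim
        case (elim N)
        then show ?case using q_lo[of N] unfolding T_def by linarith
      qed
    qed
    then have evR: "\<forall>\<^sub>F N in sequentially. \<forall>k\<in>{..2 * j}. Rk k ^ (k * k) * T N \<le> real (q N)"
      by (intro eventually_ball_finite) auto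
    have "(\<lambda>N. 2 * \<bar>\<omega>\<bar> * (real (l N) / sqrt (real N))) \<longlonglongrightarrow> 2 * \<bar>\<omega>\<bar> * 0" by (intro tendsto_intros Ll)
    then have ev_l: "\<forall>\<^sub>F N in sequentially. 2 * \<bar>\<omega>\<bar> * (real (l N) / sqrt (real N)) < 1"
      by (rule order_tendstoD) simp
    show ?thesis
      using evR ev_l ev_q eventually_ge_at_top[of 2]
    proof eventually_elim
      case (elim N)
      define a where "a = \<omega> / sqrt (real N)"
      have N: "real N > 0" using elim by simp
      have a: "\<bar>a\<bar> = \<bar>\<omega>\<bar> / sqrt (real N)" "a\<^sup>2 = \<omega>\<^sup>2 / real N" using N by (auto simp: a_def power_divide)
      have q2: "2 \<le> q N" using elim(3) by simp
      have qp: "q N < p N"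
      proof -
        have "q N * 1 < q N * q N" using q2 by (intro mult_strict_left_mono) auto
        then show ?thesis by (simp add: p_def)
      qed
      have T0: "T N > 0" unfolding T_def using elim(4) by simp
      have "cmod ((CLINT x|M. iexp (a * (\<Sum>s<N. Y s x))) - exp (- (a\<^sup>2 * (real (n N - 1) * block_var (p N - q N)) / 2))) \<le>
          \<bar>a\<bar> * sqrt (C * (real N - real (n N - 1) * real (p N - q N))) + (\<Sum>k\<le>2 * j. (\<bar>a\<bar> * real N) ^ k * (Ck k * exp (- T N))) +
          4 * (1/4) ^ j * exp (4 * a\<^sup>2 * (real (n N - 1) * block_var (p N - q N))) +
          real (n N - 1) * (\<bar>a\<bar> ^ 3 * real (p N - q N) * block_var (p N - q N) + a ^ 4 * (block_var (p N - q N))\<^sup>2)"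
      proof (rule char_estimate[OF C(2)])
        fix k assume k: "k \<le> 2 * j"
        show "\<bar>M.expectation (\<lambda>x. (\<Sum>s\<in>block_set (p N) (q N) (n N). Y s x) ^ k) -
          (\<integral>\<omega>. (\<Sum>s\<in>block_set (p N) (q N) (n N). W s (\<omega> (s div p N))) ^ k \<partial>(\<Pi>\<^sub>M b\<in>{1..<n N}. X))\<bar>
          \<le> real (card (block_set (p N) (q N) (n N))) ^ k * (Ck k * exp (- T N))"
        proof (rule Rk[unfolded Q_def, rule_format])
          show "T N > 0" by fact
          show "Rk k ^ (k * k) * T N \<le> real (q N)" using elim(1) k by simp
          show "finite (block_set (p N) (q N) (n N))" by (rule finite_block_set)
          show "real (q N) \<le> real s" if "s \<in> block_set (p N) (q N) (n N)" for s
            using block_set_ge[OF that] qp by simp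
          show "real (q N) < \<bar>real s - real t\<bar>" if "s \<in> block_set (p N) (q N) (n N)" "t \<in> block_set (p N) (q N) (n N)" "s div p N \<noteq> t div p N" for s t
            using that qp by (rule block_set_separated)
          show "s div p N \<in> {1..<n N}" if "s \<in> block_set (p N) (q N) (n N)" for s
            using that by (simp add: block_set_def)
        qed simp
      next
        show "2 * \<bar>a\<bar> * real (p N - q N) \<le> 1" using elim(2) by (simp add: a l_def)
      qed (use qp j Ck in \<open>auto simp: n_def\<close>)
      then have main: "cmod (chi N - exp (- (a\<^sup>2 * (real (m N) * v N) / 2))) \<le>
          \<bar>a\<bar> * sqrt (C * (real N - real (m N) * real (l N))) + (\<Sum>k\<le>2 * j. (\<bar>a\<bar> * real N) ^ k * (Ck k * exp (- T N))) +
          4 * (1/4) ^ j * exp (4 * a\<^sup>2 * (real (m N) * v N)) +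
          real (m N) * (\<bar>a\<bar> ^ 3 * real (l N) * v N + a ^ 4 * (v N)\<^sup>2)"
        by (simp only: chi_def m_def v_def l_def a_def times_divide_eq_left times_divide_eq_right)
      have "\<bar>a\<bar> * sqrt (C * (real N - real (m N) * real (l N))) = \<bar>\<omega>\<bar> * sqrt ((C * (real N - real (m N) * real (l N))) / real N)"
        unfolding a real_sqrt_divide by simp
      also have "(C * (real N - real (m N) * real (l N))) / real N = C * (1 - real (m N) * real (l N) / real N)"
        using N by (simp add: field_simps)
      finally have t1: "\<bar>a\<bar> * sqrt (C * (real N - real (m N) * real (l N))) = e1 N" by (simp add: e1_def)
      have "\<bar>a\<bar> * real N = \<bar>\<omega>\<bar> * sqrt (real N)" 
        using real_div_sqrt[of "real N"] N unfolding a by (metis less_imp_le times_divide_eq_left times_divide_eq_right)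
      then have t2: "(\<Sum>k\<le>2 * j. (\<bar>a\<bar> * real N) ^ k * (Ck k * exp (- T N))) = (\<Sum>k\<le>2 * j. e2 k N)" by (simp add: e2_def)
      have t3: "exp (4 * a\<^sup>2 * (real (m N) * v N)) = e3 N" unfolding e3_def a by simp
      have a3: "\<bar>a\<bar> ^ 3 = \<bar>\<omega>\<bar> ^ 3 / (real N * sqrt (real N))" unfolding a power_divide using N by (simp add: power3_eq_cube)
      have a4: "a ^ 4 = \<omega> ^ 4 / (real N * real N)"
      proof -
        have "a ^ 4 = (a\<^sup>2)\<^sup>2" by (simp flip: power_mult)
        also have "\<dots> = \<omega> ^ 4 / (real N * real N)" unfolding a power_divide by (simp add: power2_eq_square flip: power_mult power_add) (simp add: eval_nat_numeral)
        finally show ?thesis .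
      qed
      have t4: "real (m N) * (\<bar>a\<bar> ^ 3 * real (l N) * v N + a ^ 4 * (v N)\<^sup>2) = e4 N"
        unfolding a3 a4 e4_def by (simp add: algebra_simps power2_eq_square)
      have "complex_of_real (exp (- (a\<^sup>2 * (real (m N) * v N) / 2))) - G = complex_of_real (exp (- (\<omega>\<^sup>2 * (real (m N) * v N / real N) / 2)) - exp (- (\<omega>\<^sup>2 * \<sigma>2 / 2)))"
        unfolding G_def a by (simp add: mult.commute)
      then have t5: "cmod (complex_of_real (exp (- (a\<^sup>2 * (real (m N) * v N) / 2))) - G) = e5 N"
        unfolding e5_def by (simp only: norm_of_real)
      show ?case
        using main norm_triangle_ineq[of "chi N - complex_of_real (exp (- (a\<^sup>2 * (real (m N) * v N) / 2)))" "complex_of_real (exp (- (a\<^sup>2 * (real (m N) * v N) / 2))) - G"]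
        unfolding t1 t2 t3 t4 t5 add_diff_eq diff_add_cancel by linarith
    qed
  qed
  have "chi \<longlonglongrightarrow> G"
  proof (rule tendstoI)
    fix e :: real assume e: "e > 0"
    \<comment> \<open>The Taylor tail does not vanish with \<open>N\<close>: its limit is
      \<open>(1/4) ^ j * E\<close>. Therefore \<open>j\<close>, and with it the number of moments,
      is chosen first.\<close>
    define E where "E = 4 * exp (4 * \<omega>\<^sup>2 * \<sigma>2)"
    have E: "E > 0" by (simp add: E_def)
    obtain i where i: "(1/4) ^ i < e / E" using real_arch_pow_inv[of "e / E" "1/4 :: real"] e E by auto
    define j where "j = Suc i"
    have "(1/4 :: real) ^ j \<le> (1/4) ^ i" unfolding j_def by (intro power_decreasing) auto
    then have "(1/4) ^ j < e / E" using i by linarith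
    then have jE: "(1/4) ^ j * E < e" using E by (simp add: pos_less_divide_eq)
    have "(\<lambda>N. e1 N + (\<Sum>k\<le>2 * j. e2 k N) + 4 * (1/4) ^ j * e3 N + e4 N + e5 N) \<longlonglongrightarrow>
        0 + (\<Sum>k\<le>2 * j. 0) + 4 * (1/4) ^ j * exp (4 * \<omega>\<^sup>2 * \<sigma>2) + 0 + 0"
      by (intro tendsto_add tendsto_sum tendsto_mult tendsto_const L1 L2 L3 L4 L5)
    then have "\<forall>\<^sub>F N in sequentially. e1 N + (\<Sum>k\<le>2 * j. e2 k N) + 4 * (1/4) ^ j * e3 N + e4 N + e5 N < e"
      by (rule order_tendstoD) (use jE in \<open>simp add: E_def mult_ac\<close>)
    moreover have "1 \<le> j" by (simp add: j_def)
    note bound[OF this]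
    ultimately show "\<forall>\<^sub>F N in sequentially. dist (chi N) G < e"
      unfolding dist_norm by eventually_elim linarith
  qed
  then show ?thesis unfolding chi_def G_def .
qed

end

subsection \<open>The strong law and the central limit theorem on orbits\<close>

text \<open>The integers split into \<open>n\<close> and \<open>- (n + 1)\<close> for natural
  \<open>n\<close>; each half contributes the sum over \<open>Suc n\<close>, and the first one
  \<open>a 0\<close> in addition.\<close>

lemma has_sum_int_even:
  fixes a :: "nat \<Rightarrow> real"
  assumes "summable (\<lambda>n. \<bar>a n\<bar>)"
  shows "((\<lambda>s::int. a (nat \<bar>s\<bar>)) has_sum (a 0 + 2 * (\<Sum>n. a (Suc n)))) UNIV"
proof -
  have sa: "summable a" using assms by (rule summable_rabs_cancel)
  have "summable (\<lambda>n. norm (a n))" "summable (\<lambda>n. norm (a (Suc n)))"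
    using assms by (simp_all add: summable_Suc_iff[of "\<lambda>n. \<bar>a n\<bar>"])
  moreover have "summable (\<lambda>n. a (Suc n))" using sa by (simp add: summable_Suc_iff)
  ultimately have 1: "(a has_sum (\<Sum>n. a n)) UNIV" and 2: "((\<lambda>n. a (Suc n)) has_sum (\<Sum>n. a (Suc n))) UNIV"
    using sa by (auto intro!: norm_summable_imp_has_sum summable_sums)
  have "((\<lambda>s::int. a (nat \<bar>s\<bar>)) has_sum (\<Sum>n. a n)) (range int)"
    using 1 by (subst has_sum_reindex) (auto simp: inj_on_def o_def)
  moreover have "((\<lambda>s::int. a (nat \<bar>s\<bar>)) has_sum (\<Sum>n. a (Suc n))) (range (\<lambda>n. - int (Suc n)))"
    using 2 by (subst has_sum_reindex) (auto simp: inj_on_def o_def nat_add_distrib)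
  moreover have "range int \<inter> range (\<lambda>n. - int (Suc n)) = {}" by auto
  ultimately have "((\<lambda>s::int. a (nat \<bar>s\<bar>)) has_sum ((\<Sum>n. a n) + (\<Sum>n. a (Suc n)))) (range int \<union> range (\<lambda>n. - int (Suc n)))"
    by (rule has_sum_Un_disjoint)
  moreover have "range int \<union> range (\<lambda>n. - int (Suc n)) = UNIV"
  proof (intro equalityI subsetI)
    fix s :: int
    show "s \<in> range int \<union> range (\<lambda>n. - int (Suc n))"
      by (cases s rule: int_cases) auto
  qed auto
  moreover have "(\<Sum>n. a n) = a 0 + (\<Sum>n. a (Suc n))"
    using suminf_split_head[OF sa] by simp
  ultimately show ?thesis by (simp add: add_ac)
qed

text \<open>Substitution \<open>y = \<sigma> * z\<close>. The half-lines, open here and closed in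
  \<open>Norm\<close>, differ by a point of measure zero.\<close>

lemma measure_std_normal:
  assumes "\<sigma> > 0"
  shows "measure std_normal_distribution {..<x / \<sigma>} = Norm \<sigma> x"
proof -
  interpret real_distribution std_normal_distribution by (rule real_dist_normal_dist)
  have "measure std_normal_distribution {..<x / \<sigma>} = (\<integral>z. indicator {..<x / \<sigma>} z \<partial>std_normal_distribution)"
    by simp
  also have "\<dots> = (\<integral>z. std_normal_density z *\<^sub>R indicator {..<x / \<sigma>} z \<partial>lborel)"
    by (rule integral_density) auto
  also have "\<dots> = (\<integral>z. 1 / sqrt (2 * pi) * (indicator {..x} (0 + \<sigma> * z) *\<^sub>R exp (- (1/2) * ((0 + \<sigma> * z) / \<sigma>)\<^sup>2)) \<partial>lborel)"
  proof (rule integral_cong_AE)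
    show "AE z in lborel. std_normal_density z *\<^sub>R indicator {..<x / \<sigma>} z =
        1 / sqrt (2 * pi) * (indicator {..x} (0 + \<sigma> * z) *\<^sub>R exp (- (1/2) * ((0 + \<sigma> * z) / \<sigma>)\<^sup>2))"
      using AE_lborel_singleton[of "x / \<sigma>"]
    proof eventually_elim
      case (elim z)
      have "z < x / \<sigma> \<longleftrightarrow> \<sigma> * z \<le> x"
        using elim assms by (auto simp: field_simps)
      then show ?case using assms by (simp add: std_normal_density_def indicator_def)
    qed
  qed auto
  also have "\<dots> = 1 / sqrt (2 * pi) * (\<integral>z. indicator {..x} (0 + \<sigma> * z) *\<^sub>R exp (- (1/2) * ((0 + \<sigma> * z) / \<sigma>)\<^sup>2) \<partial>lborel)"
    by (rule integral_mult_right_zero)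
  also have "\<dots> = 1 / (\<sigma> * sqrt (2 * pi)) * (\<bar>\<sigma>\<bar> *\<^sub>R (\<integral>z. indicator {..x} (0 + \<sigma> * z) *\<^sub>R exp (- (1/2) * ((0 + \<sigma> * z) / \<sigma>)\<^sup>2) \<partial>lborel))"
    using assms by simp
  also have "\<bar>\<sigma>\<bar> *\<^sub>R (\<integral>z. indicator {..x} (0 + \<sigma> * z) *\<^sub>R exp (- (1/2) * ((0 + \<sigma> * z) / \<sigma>)\<^sup>2) \<partial>lborel) =
      (\<integral>y. indicator {..x} y *\<^sub>R exp (- (1/2) * (y / \<sigma>)\<^sup>2) \<partial>lborel)"
    using assms by (intro lborel_integral_real_affine[symmetric]) simp
  finally show ?thesis using assms by (simp add: Norm_def set_lebesgue_integral_def)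
qed

text \<open>
  The law \<open>N(0, \<sigma>\<^sup>2)\<close> is taken as the image of the standard normal law under \<open>z \<mapsto> \<sigma> z\<close>, which
  covers the point mass \<open>\<sigma> = 0\<close> as well.
\<close>

lemma (in prob_space) normal_convergence:
  fixes S :: "nat \<Rightarrow> 'a \<Rightarrow> real"
  assumes S: "\<And>n. S n \<in> borel_measurable M" and \<sigma>: "\<sigma> \<ge> 0" "\<sigma> \<noteq> 0 \<or> x \<noteq> 0"
    and chi: "\<And>t. (\<lambda>n. CLINT y|M. iexp (t * S n y)) \<longlonglongrightarrow> complex_of_real (exp (- (\<sigma>\<^sup>2 * t\<^sup>2 / 2)))"
  shows "(\<lambda>n. measure M {y \<in> space M. S n y < x}) \<longlonglongrightarrow> Norm \<sigma> x"
proof -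
  interpret Z: real_distribution std_normal_distribution by (rule real_dist_normal_dist)
  define L where "L = distr std_normal_distribution borel (\<lambda>z. \<sigma> * z)"
  interpret L: real_distribution L
    unfolding L_def by (rule Z.real_distribution_distr) simp
  interpret D: real_distribution "distr M borel (S n)" for n
    by (rule real_distribution_distr) (rule S)
  have Lval: "measure L A = measure std_normal_distribution ((\<lambda>z. \<sigma> * z) -` A)" if "A \<in> sets borel" for A
    unfolding L_def using that by (subst measure_distr) auto
  have wc: "weak_conv_m (\<lambda>n. distr M borel (S n)) L"
  proof (rule levy_continuity)
    fix t
    have "char (distr M borel (S n)) t = (CLINT y|M. iexp (t * S n y))" for n
      unfolding char_def by (rule integral_distr) (use S in auto)
    moreover have "char L t = complex_of_real (exp (- (\<sigma>\<^sup>2 * t\<^sup>2 / 2)))"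
    proof -
      have "char L t = (CLINT z|std_normal_distribution. iexp (t * (\<sigma> * z)))"
        unfolding char_def L_def by (rule integral_distr) auto
      also have "\<dots> = char std_normal_distribution (t * \<sigma>)" by (simp add: char_def mult.assoc)
      finally show ?thesis by (simp add: char_std_normal_distribution power_mult_distrib mult.commute)
    qed
    ultimately show "(\<lambda>n. char (distr M borel (S n)) t) \<longlonglongrightarrow> char L t" using chi by simp
  qed unfold_locales
  have "(\<lambda>n. measure (distr M borel (S n)) {..<x}) \<longlonglongrightarrow> measure L {..<x}"
  proof (rule weak_conv_imp_continuity_set_conv[OF D.real_distribution_axioms L.real_distribution_axioms wc])
    \<comment> \<open>Convergence at \<open>x\<close> requires that \<open>x\<close> be no atom of
      the limit. For \<open>\<sigma> = 0\<close> the only atom is \<open>0\<close>, which the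
      assumption on \<open>x\<close> excludes.\<close>
    have "measure L {x} = 0"
    proof (cases "\<sigma> = 0")
      case True
      then have "(\<lambda>z. \<sigma> * z) -` {x} = {}" using \<sigma> by auto
      then show ?thesis by (simp add: Lval)
    next
      case False
      then have "(\<lambda>z. \<sigma> * z) -` {x} = {x / \<sigma>}" by (auto simp: field_simps)
      moreover have "emeasure std_normal_distribution {x / \<sigma>} = 0"
        by (subst emeasure_density) (auto simp: nn_integral_0_iff_AE intro: AE_mp[OF AE_lborel_singleton[of "x / \<sigma>"]])
      then have "measure std_normal_distribution {x / \<sigma>} = 0" by (simp only: measure_def enn2real_0)
      ultimately show ?thesis by (simp only: Lval borel_closed closed_singleton)
    qed
    moreover have "frontier {..<x} = {x}" by (auto simp: frontier_def interior_open)
    ultimately show "emeasure L (frontier {..<x}) = 0" by (simp only: L.emeasure_eq_measure ennreal_0)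
  qed simp
  moreover have "measure (distr M borel (S n)) {..<x} = measure M {y \<in> space M. S n y < x}" for n
    by (subst measure_distr) (use S in \<open>auto intro!: arg_cong[where f="measure M"]\<close>)
  moreover have "measure L {..<x} = Norm \<sigma> x"
  proof (cases "\<sigma> = 0")
    case True
    then have "(\<lambda>z. \<sigma> * z) -` {..<x} = (if 0 < x then UNIV else {})" by auto
    then show ?thesis using True Z.prob_space by (simp add: Lval Norm_def)
  next
    case False
    then have "(\<lambda>z. \<sigma> * z) -` {..<x} = {..<x / \<sigma>}" using \<sigma> by (auto simp: field_simps)
    then show ?thesis using measure_std_normal[of \<sigma> x] False \<sigma> by (simp add: Lval)
  qed
  ultimately show ?thesis by simp
qed

text \<open>For small \<epsilon> the distance to the identity is at most \<open>K1\<close> times the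
  norm, so the given modulus at scale \<open>K1 * \<epsilon>\<close> works. For larger \<epsilon>
  the constant \<open>2\<close> is a modulus, and \<open>H\<close> is taken large enough for its
  mean to be at most \<open>H * \<epsilon>\<close>.\<close>

lemma (in lattice_prob) regular_normalised:
  fixes f :: "(real^'a^'a) set \<Rightarrow> real"
  assumes d: "right_invariant_distance d" and f: "f \<in> borel_measurable X" "bounded (f ` lattices)"
    and \<tau>: "\<And>\<epsilon>. \<epsilon> > 0 \<Longrightarrow> \<tau> \<epsilon> \<in> borel_measurable X" "\<And>\<epsilon> \<Lambda>. \<epsilon> > 0 \<Longrightarrow> \<Lambda> \<in> lattices \<Longrightarrow> 0 \<le> \<tau> \<epsilon> \<Lambda>"
      "\<And>\<epsilon>. \<epsilon> > 0 \<Longrightarrow> (\<integral>\<^sup>+\<Lambda>. ennreal (\<tau> \<epsilon> \<Lambda>) \<partial>X) \<le> ennreal (C * \<epsilon>)"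
    and ev: "\<forall>\<^sub>F \<epsilon> in at_right 0. \<forall>g\<in>SL. d g (mat 1) < \<epsilon> \<longrightarrow> (\<forall>\<Lambda>\<in>lattices. \<bar>f (act g \<Lambda>) - f \<Lambda>\<bar> \<le> \<tau> \<epsilon> \<Lambda>)"
  shows "\<exists>K\<ge>1. \<exists>H\<ge>1. regular X H (\<lambda>\<Lambda>. (f \<Lambda> - expectation f) / K)"
proof -
  obtain M0 where M0: "\<And>\<Lambda>. \<Lambda> \<in> lattices \<Longrightarrow> \<bar>f \<Lambda>\<bar> \<le> M0" "M0 > 0"
    using f(2) unfolding bounded_pos by auto
  have iM: "norm (expectation f) \<le> M0"
  proof -
    have "norm (expectation f) \<le> (\<integral>\<Lambda>. norm (f \<Lambda>) \<partial>X)" by (rule integral_norm_bound)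
    also have "\<dots> \<le> (\<integral>\<Lambda>. M0 \<partial>X)" by (rule integral_mono') (use M0 in auto)
    finally show ?thesis by (simp add: prob_space)
  qed
  \<comment> \<open>Both \<open>f\<close> and its mean are bounded by \<open>M0\<close>. The
    \<open>1\<close> gives \<open>K \<ge> 1\<close>, so that division by \<open>K\<close> shrinks
    oscillations and the given \<tau> can be kept.\<close>
  define K where "K = 2 * M0 + 1"
  have K: "K \<ge> 1" using M0 by (simp add: K_def)
  define h where "h \<Lambda> = (f \<Lambda> - expectation f) / K" for \<Lambda>
  have h1: "\<bar>h \<Lambda>\<bar> \<le> 1" if "\<Lambda> \<in> lattices" for \<Lambda>
  proof -
    have "\<bar>f \<Lambda> - expectation f\<bar> \<le> K" using M0(1)[OF that] iM by (simp add: K_def)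
    then show ?thesis using K by (simp add: h_def)
  qed
  obtain K1 r where K1: "K1 > 0" "r > 0" "\<And>g. g \<in> SL \<Longrightarrow> norm (g - mat 1) < r \<Longrightarrow> d g (mat 1) \<le> K1 * norm (g - mat 1)"
    using d unfolding right_invariant_distance_def by blast
  obtain e where e: "e > 0" "\<And>\<epsilon> g \<Lambda>. 0 < \<epsilon> \<Longrightarrow> \<epsilon> < e \<Longrightarrow> g \<in> SL \<Longrightarrow> d g (mat 1) < \<epsilon> \<Longrightarrow> \<Lambda> \<in> lattices \<Longrightarrow> \<bar>f (act g \<Lambda>) - f \<Lambda>\<bar> \<le> \<tau> \<epsilon> \<Lambda>"
    using ev unfolding eventually_at_right_field by blast
  define e1 where "e1 = min r (e / K1)"
  have e1: "e1 > 0" using K1 e by (simp add: e1_def)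
  define H where "H = max 1 (max (C * K1) (2 / e1))"
  have "regular X H h"
    unfolding regular_def
  proof (intro conjI ballI allI impI)
    show "h \<in> borel_measurable X" unfolding h_def[abs_def] using f(1) by measurable
    show "\<bar>h \<Lambda>\<bar> \<le> 1" if "\<Lambda> \<in> lattices" for \<Lambda> using that by (rule h1)
    fix \<epsilon> :: real assume \<epsilon>: "0 < \<epsilon>"
    show "\<exists>\<tau>\<in>borel_measurable X. (\<forall>\<Lambda>\<in>lattices. 0 \<le> \<tau> \<Lambda>) \<and> (\<integral>\<^sup>+\<Lambda>. ennreal (\<tau> \<Lambda>) \<partial>X) \<le> ennreal (H * \<epsilon>) \<and>
        (\<forall>g\<in>SL. norm (g - mat 1) < \<epsilon> \<longrightarrow> (\<forall>\<Lambda>\<in>lattices. \<bar>h (act g \<Lambda>) - h \<Lambda>\<bar> \<le> \<tau> \<Lambda>))"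
    proof (cases "\<epsilon> < e1")
      case True
      have K\<epsilon>: "0 < K1 * \<epsilon>" "K1 * \<epsilon> < e"
        using K1 \<epsilon> True by (auto simp: e1_def pos_less_divide_eq mult.commute)
      show ?thesis
      proof (intro bexI conjI ballI impI)
        show "\<tau> (K1 * \<epsilon>) \<in> borel_measurable X" using K\<epsilon> by (intro \<tau>)
        show "0 \<le> \<tau> (K1 * \<epsilon>) \<Lambda>" if "\<Lambda> \<in> lattices" for \<Lambda> using K\<epsilon> that by (intro \<tau>)
        have "(\<integral>\<^sup>+\<Lambda>. ennreal (\<tau> (K1 * \<epsilon>) \<Lambda>) \<partial>X) \<le> ennreal (C * (K1 * \<epsilon>))" using K\<epsilon> by (intro \<tau>)
        also have "\<dots> \<le> ennreal (H * \<epsilon>)"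
          using \<epsilon> unfolding mult.assoc[symmetric] by (intro ennreal_leI mult_right_mono) (auto simp: H_def)
        finally show "(\<integral>\<^sup>+\<Lambda>. ennreal (\<tau> (K1 * \<epsilon>) \<Lambda>) \<partial>X) \<le> ennreal (H * \<epsilon>)" .
        fix g :: "real^'a^'a" and \<Lambda> :: "(real^'a^'a) set" assume g: "g \<in> SL" "norm (g - mat 1) < \<epsilon>" and \<Lambda>: "\<Lambda> \<in> lattices"
        have "d g (mat 1) \<le> K1 * norm (g - mat 1)" using g True by (intro K1) (auto simp: e1_def)
        also have "\<dots> < K1 * \<epsilon>" using g K1 by simp
        finally have "\<bar>f (act g \<Lambda>) - f \<Lambda>\<bar> \<le> \<tau> (K1 * \<epsilon>) \<Lambda>" using e(2)[OF K\<epsilon> g(1) _ \<Lambda>] by simp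
        moreover have "h (act g \<Lambda>) - h \<Lambda> = (f (act g \<Lambda>) - f \<Lambda>) / K" by (simp add: h_def diff_divide_distrib)
        then have "\<bar>h (act g \<Lambda>) - h \<Lambda>\<bar> \<le> \<bar>f (act g \<Lambda>) - f \<Lambda>\<bar> / 1"
          using K by (simp add: abs_divide divide_le_eq mult_le_cancel_left1)
        ultimately show "\<bar>h (act g \<Lambda>) - h \<Lambda>\<bar> \<le> \<tau> (K1 * \<epsilon>) \<Lambda>" by simp
      qed
    next
      case False
      show ?thesis
      proof (intro bexI[of _ "\<lambda>_. 2"] conjI ballI impI)
        have "2 = 2 / e1 * e1" using e1 by simp
        also have "\<dots> \<le> H * \<epsilon>" using False e1 \<epsilon> by (intro mult_mono) (auto simp: H_def)
        finally have "ennreal 2 \<le> ennreal (H * \<epsilon>)" by (rule ennreal_leI)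
        then show "(\<integral>\<^sup>+\<Lambda>. ennreal 2 \<partial>X) \<le> ennreal (H * \<epsilon>)" by (simp add: emeasure_space_1[unfolded space_X])
        fix g :: "real^'a^'a" and \<Lambda> :: "(real^'a^'a) set" assume "g \<in> SL" "norm (g - mat 1) < \<epsilon>" "\<Lambda> \<in> lattices"
        then show "\<bar>h (act g \<Lambda>) - h \<Lambda>\<bar> \<le> 2" using h1[of "act g \<Lambda>"] h1[of \<Lambda>] act_lattices by fastforce
      qed auto
    qed
  qed
  then show ?thesis using K unfolding h_def[abs_def] by (intro exI[of _ K] conjI exI[of _ H]) (auto simp: H_def)
qed

section \<open>Orbits as a decorrelated sequence\<close>

context emei
begin

definition corr :: "((real^('m + 'n)^('m + 'n)) set \<Rightarrow> real) \<Rightarrow> real \<Rightarrow> real" where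
  "corr h s = (\<integral>\<Lambda>. h (act (diag_flow s) \<Lambda>) * h \<Lambda> \<partial>X)"

lemma act_flow_measurable: "act (diag_flow s) \<in> measurable X X"
  by (intro measurable_act') (auto simp: diag_flow_SL)

lemma measurable_flow:
  "h \<in> borel_measurable X \<Longrightarrow> (\<lambda>\<Lambda>. h (act (diag_flow s) \<Lambda>)) \<in> borel_measurable X"
  by (rule measurable_compose[OF act_flow_measurable])

lemma corr_shift:
  assumes "h \<in> borel_measurable X"
  shows "(\<integral>\<Lambda>. h (act (diag_flow (s + t)) \<Lambda>) * h (act (diag_flow t) \<Lambda>) \<partial>X) = corr h s"
  using integral_act[OF diag_flow_SL[of t], of "\<lambda>\<Lambda>. h (act (diag_flow s) \<Lambda>) * h \<Lambda>"] assms
  by (simp add: corr_def act_diag_flow_add measurable_flow borel_measurable_times)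

text \<open>By invariance, flowing for a time \<open>s\<close> turns the pair of times
  \<open>- s\<close>, \<open>0\<close> into the pair \<open>0\<close>, \<open>s\<close>.\<close>

lemma corr_minus:
  assumes "h \<in> borel_measurable X"
  shows "corr h (- s) = corr h s"
  using corr_shift[OF assms, of "- s" s] by (simp add: corr_def mult.commute)

lemma decorrelation_orbit:
  assumes h: "regular X H0 h" "H0 \<ge> 1" and h0: "expectation h = 0"
  shows "decorrelation mu X (\<lambda>s \<theta>. h (orb (real s) \<theta>)) (\<lambda>s \<Lambda>. h (act (diag_flow (real s)) \<Lambda>))
    (\<lambda>n. corr h (real n)) (expansion TYPE('m) TYPE('n))"
proof -
  have hm: "h \<in> borel_measurable X" and h1: "\<And>\<Lambda>. \<Lambda> \<in> lattices \<Longrightarrow> \<bar>h \<Lambda>\<bar> \<le> 1"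
    using h(1) by (auto simp: regular_def)
  show ?thesis
  proof (unfold_locales, goal_cases)
    case (1 s)
    show ?case using hm by (rule measurable_orb')
  next
    case (2 x s)
    show ?case by (rule h1[OF orb_lattices])
  next
    case (3 s)
    show ?case using hm by (rule measurable_flow)
  next
    case (4 x s)
    then show ?case by (intro h1 act_lattices) (auto simp: diag_flow_SL)
  next
    case (5 s)
    show ?case using integral_act[OF diag_flow_SL hm] h0 by simp
  next
    case (6 s t)
    show ?case using corr_shift[OF hm, of "real (t - s)" "real s"] 6 by (simp add: mult.commute of_nat_diff)
  next
    case 7
    show ?case by (simp add: expansion_def)
  next
    case (8 r)
    show ?case by (rule cluster_decay[OF h])
  qed
qed

end

theorem theorem5p1:
  fixes d :: "real^('m::finite + 'n::finite)^('m + 'n) \<Rightarrow> real^('m + 'n)^('m + 'n) \<Rightarrow> real"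
    and B :: "(real^('m + 'n)^('m + 'n)) set"
    and muX :: "(real^('m + 'n)^('m + 'n)) set measure"
    and f :: "(real^('m + 'n)^('m + 'n)) set \<Rightarrow> real"
    and \<tau> :: "real \<Rightarrow> (real^('m + 'n)^('m + 'n)) set \<Rightarrow> real"
    and C :: real
    and mu :: "(real^'n^'m) measure"
  assumes "right_invariant_distance d"
    and "basis_of_sl B"
    and "invariant_probability muX"
    and "f \<in> borel_measurable muX"
    and "bounded (f ` lattices)"
    and "\<And>\<epsilon>. \<epsilon> > 0 \<Longrightarrow> \<tau> \<epsilon> \<in> borel_measurable muX"
    and "\<And>\<epsilon> \<Lambda>. \<epsilon> > 0 \<Longrightarrow> \<Lambda> \<in> lattices \<Longrightarrow> 0 \<le> \<tau> \<epsilon> \<Lambda>"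
    and "\<And>\<epsilon>. \<epsilon> > 0 \<Longrightarrow> (\<integral>\<^sup>+\<Lambda>. ennreal (\<tau> \<epsilon> \<Lambda>) \<partial>muX) \<le> ennreal (C * \<epsilon>)"
    and "\<forall>\<^sub>F \<epsilon> in at_right 0. \<forall>g\<in>SL. d g (mat 1) < \<epsilon> \<longrightarrow>
           (\<forall>\<Lambda>\<in>lattices. \<bar>f (act g \<Lambda>) - f \<Lambda>\<bar> \<le> \<tau> \<epsilon> \<Lambda>)"
    and "prob_space mu" and "sets mu = sets borel"
    and "EMEI B muX mu"
  shows "let \<gamma> = (\<integral>\<Lambda>. f \<Lambda> \<partial>muX);
             c = (\<lambda>s::int. (\<integral>\<Lambda>. f (act (diag_flow (of_int s)) \<Lambda>) * f \<Lambda> \<partial>muX) - \<gamma>\<^sup>2);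
             F = (\<lambda>N \<Lambda>. 1 / sqrt (real N) * (\<Sum>i<N. f (act (diag_flow (real i)) \<Lambda>) - \<gamma>))
         in (\<forall>\<epsilon>>0. AE \<theta> in mu.
               (\<lambda>N. (\<Sum>s<N. f (act (diag_flow (real s)) (lcoset (unip \<theta>)))) - real N * \<gamma>)
                 \<in> o(\<lambda>N. sqrt (real N) * ln (real N) powr (3/2 + \<epsilon>)))
          \<and> c summable_on UNIV
          \<and> (\<exists>\<sigma>\<ge>0. \<sigma>\<^sup>2 = (\<Sum>\<^sub>\<infinity>s\<in>UNIV. c s)
               \<and> (\<forall>x. \<sigma> \<noteq> 0 \<or> x \<noteq> 0 \<longrightarrow>
                    (\<lambda>N. measure mu {\<theta>. F N (lcoset (unip \<theta>)) < x}) \<longlonglongrightarrow> Norm \<sigma> x))"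
proof -
  interpret emei muX mu B
    by (intro emei.intro lattice_prob.intro emei_axioms.intro) fact+
  define \<gamma> where "\<gamma> = expectation f"
  obtain K H where K: "K \<ge> 1" and H: "H \<ge> 1" "regular muX H (\<lambda>\<Lambda>. (f \<Lambda> - \<gamma>) / K)"
    using regular_normalised[OF assms(1,4-9)] unfolding \<gamma>_def by blast
  \<comment> \<open>The decorrelation estimates are stated for functions bounded by \<open>1\<close>
    and of mean zero; \<open>K\<close> and \<gamma> are restored at the end.\<close>
  define h where "h \<Lambda> = (f \<Lambda> - \<gamma>) / K" for \<Lambda>
  have h: "regular muX H h" using H(2) unfolding h_def[abs_def] .
  have hm: "h \<in> borel_measurable muX" and h1: "\<And>\<Lambda>. \<Lambda> \<in> lattices \<Longrightarrow> \<bar>h \<Lambda>\<bar> \<le> 1"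
    using h by (auto simp: regular_def)
  have fh: "f \<Lambda> = K * h \<Lambda> + \<gamma>" for \<Lambda> using K by (simp add: h_def)
  have intf: "integrable muX f"
  proof -
    obtain M0 where "\<And>\<Lambda>. \<Lambda> \<in> lattices \<Longrightarrow> norm (f \<Lambda>) \<le> M0" using assms(5) by (auto simp: bounded_iff)
    then show ?thesis using assms(4) by (intro integrable_const_bound[where B=M0]) auto
  qed
  have inth: "integrable muX h" using hm h1 by (intro integrable_const_bound[where B=1]) auto
  have h0: "expectation h = 0"
    using intf prob_space unfolding h_def[abs_def] by (simp add: \<gamma>_def)
  interpret dec: decorrelation mu muX "\<lambda>s \<theta>. h (orb (real s) \<theta>)" "\<lambda>s \<Lambda>. h (act (diag_flow (real s)) \<Lambda>)"
    "\<lambda>n. corr h (real n)" "expansion TYPE('m) TYPE('n)"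
    using h H(1) h0 by (rule decorrelation_orbit)
  have sum_h: "(\<Sum>s<N. f (orb (real s) \<theta>)) - real N * \<gamma> = K * (\<Sum>s<N. h (orb (real s) \<theta>))" for N \<theta>
    by (simp add: fh sum.distrib sum_distrib_left)
  have slln: "AE \<theta> in mu. (\<lambda>N. (\<Sum>s<N. f (orb (real s) \<theta>)) - real N * \<gamma>) \<in> o(\<lambda>N. sqrt (real N) * ln (real N) powr (3/2 + \<epsilon>))"
    if \<epsilon>: "\<epsilon> > 0" for \<epsilon>
  proof -
    obtain C' where C': "\<And>I. finite I \<Longrightarrow> mu.expectation (\<lambda>\<theta>. (\<Sum>s\<in>I. h (orb (real s) \<theta>))\<^sup>2) \<le> C' * real (card I)"
      using dec.second_moment_Y by blast
    have "AE \<theta> in mu. (\<lambda>N. \<Sum>s<N. h (orb (real s) \<theta>)) \<in> o(\<lambda>N. sqrt (real N) * ln (real N) powr (3/2 + \<epsilon>))"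
      by (rule mu.gal_koksma[OF dec.Y C' \<epsilon>])
    then show ?thesis unfolding sum_h using K by simp
  qed
  define c where "c s = (\<integral>\<Lambda>. f (act (diag_flow (of_int s)) \<Lambda>) * f \<Lambda> \<partial>muX) - \<gamma>\<^sup>2" for s :: int
  have c: "c s = K\<^sup>2 * corr h (real (nat \<bar>s\<bar>))" for s
  proof -
    let ?h = "\<lambda>\<Lambda>. h (act (diag_flow (of_int s)) \<Lambda>)"
    have i1: "integrable muX ?h"
      using h1 by (intro integrable_const_bound[where B=1] measurable_flow hm) (auto simp: act_lattices diag_flow_SL)
    have i2: "integrable muX (\<lambda>\<Lambda>. ?h \<Lambda> * h \<Lambda>)"
    proof (rule integrable_const_bound[where B=1])
      have "\<bar>?h \<Lambda>\<bar> * \<bar>h \<Lambda>\<bar> \<le> 1" if "\<Lambda> \<in> lattices" for \<Lambda>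
        using that h1 by (intro mult_le_one) (auto simp: act_lattices diag_flow_SL)
      then show "AE \<Lambda> in muX. norm (?h \<Lambda> * h \<Lambda>) \<le> 1" by (intro AE_I2) (auto simp: abs_mult)
    qed (intro borel_measurable_times measurable_flow hm)
    \<comment> \<open>With \<open>f = K * h + \<gamma>\<close> the mixed terms integrate to
      \<open>0\<close>, and the constant one cancels the \<open>\<gamma>\<^sup>2\<close> in
      \<open>c\<close>.\<close>
    have "(\<integral>\<Lambda>. f (act (diag_flow (of_int s)) \<Lambda>) * f \<Lambda> \<partial>muX) =
        (\<integral>\<Lambda>. K\<^sup>2 * (?h \<Lambda> * h \<Lambda>) + (\<gamma> * K * ?h \<Lambda> + (\<gamma> * K * h \<Lambda> + \<gamma>\<^sup>2)) \<partial>muX)"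
      unfolding fh by (intro Bochner_Integration.integral_cong refl) (simp add: algebra_simps power2_eq_square)
    also have "\<dots> = K\<^sup>2 * corr h (of_int s) + \<gamma>\<^sup>2"
      using i1 i2 inth h0 integral_act[OF diag_flow_SL hm, of "of_int s"] prob_space by (simp add: corr_def)
    finally have "c s = K\<^sup>2 * corr h (of_int s)" by (simp add: c_def)
    moreover have "corr h (of_int s) = corr h (real (nat \<bar>s\<bar>))"
      using corr_minus[OF hm, of "of_int s"] by (cases "s \<ge> 0") auto
    ultimately show ?thesis by simp
  qed
  have "((\<lambda>s::int. corr h (real (nat \<bar>s\<bar>))) has_sum dec.\<sigma>2) UNIV"
    unfolding dec.\<sigma>2_def by (rule has_sum_int_even[OF dec.summable_c(1)])
  then have c_sum: "(c has_sum (K\<^sup>2 * dec.\<sigma>2)) UNIV"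
    unfolding c[abs_def] by (rule has_sum_cmult_right)
  define \<sigma> where "\<sigma> = K * sqrt dec.\<sigma>2"
  have \<sigma>: "\<sigma> \<ge> 0" "\<sigma>\<^sup>2 = K\<^sup>2 * dec.\<sigma>2" using K dec.\<sigma>2_nonneg by (auto simp: \<sigma>_def power_mult_distrib)
  define F where "F N \<Lambda> = 1 / sqrt (real N) * (\<Sum>i<N. f (act (diag_flow (real i)) \<Lambda>) - \<gamma>)" for N \<Lambda>
  have F: "F N (lcoset (unip \<theta>)) = K * ((\<Sum>s<N. h (orb (real s) \<theta>)) / sqrt (real N))" for N \<theta>
    by (simp add: F_def fh orb_def sum_distrib_left[symmetric])
  have clt: "(\<lambda>N. measure mu {\<theta>. F N (lcoset (unip \<theta>)) < x}) \<longlonglongrightarrow> Norm \<sigma> x" if x: "\<sigma> \<noteq> 0 \<or> x \<noteq> 0" for x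
  proof -
    have "space mu = UNIV" using sets_eq_imp_space_eq[OF assms(11)] by simp
    moreover have "(\<lambda>N. measure mu {\<theta> \<in> space mu. F N (lcoset (unip \<theta>)) < x}) \<longlonglongrightarrow> Norm \<sigma> x"
    proof (rule mu.normal_convergence[OF _ \<sigma>(1) x])
      show "(\<lambda>\<theta>. F n (lcoset (unip \<theta>))) \<in> borel_measurable mu" for n
        unfolding F using dec.Y(1) by measurable
      fix t
      \<comment> \<open>\<open>char_limit\<close> at the frequency \<open>t * K\<close>, which
        absorbs the normalisation of \<open>f\<close>.\<close>
      have "(\<lambda>N. CLINT \<theta>|mu. iexp (t * K * ((\<Sum>s<N. h (orb (real s) \<theta>)) / sqrt (real N)))) \<longlonglongrightarrow>
          complex_of_real (exp (- (dec.\<sigma>2 * (t * K)\<^sup>2 / 2)))"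
        by (rule dec.char_limit)
      moreover have "dec.\<sigma>2 * (t * K)\<^sup>2 = K\<^sup>2 * dec.\<sigma>2 * t\<^sup>2" by (simp add: power_mult_distrib mult_ac)
      ultimately show "(\<lambda>N. CLINT \<theta>|mu. iexp (t * F N (lcoset (unip \<theta>)))) \<longlonglongrightarrow> complex_of_real (exp (- (\<sigma>\<^sup>2 * t\<^sup>2 / 2)))"
        unfolding F \<sigma>(2) by (simp only: mult.assoc[of t K])
    qed
    ultimately show ?thesis by simp
  qed
  show ?thesis
    unfolding Let_def \<gamma>_def[symmetric] unfolding c_def[symmetric] F_def[symmetric] unfolding orb_def[symmetric]
  proof (intro conjI allI impI exI[of _ \<sigma>])
    show "c summable_on UNIV" using c_sum by (rule has_sum_imp_summable)
    show "\<sigma>\<^sup>2 = (\<Sum>\<^sub>\<infinity>s\<in>UNIV. c s)" using infsumI[OF c_sum] \<sigma>(2) by simp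
  qed (fact slln \<sigma>(1) clt)+
qed

end
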